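(* Let $V(x)=iW(x)^2$, where $W:\mathbb{R}^2\to\mathbb{C}^{2\times2}$ is a matrix-valued function with $W(x)^*=W(x)$, as in the context. Assume that $$ \frac14\int_{\mathbb{R}^2}\operatorname{tr}|V|\,dx<1 . $$ Then the operator $D=D_0+V$ does not have eigenvalues outside of the real line $\mathbb{R}$, i.e. the spectrum of $D$ is real.
   Context: $D_0$ is the operator in $L^2(\mathbb{R}^2;\mathbb{C}^2)$ with domain the Sobolev space $\mathcal{H}^2(\mathbb{R}^2;\mathbb{C}^2)$ given by $$ D_0=\begin{pmatrix} 0 & 4\partial_{\bar z}^2\\ 4\partial_z^2 & 0\end{pmatrix},\qquad \partial_{\bar z}=\tfrac12\Bigl(\tfrac{\partial}{\partial x_1}+\tfrac1i\tfrac{\partial}{\partial x_2}\Bigr),\qquad \partial_z=\tfrac12\Bigl(\tfrac{\partial}{\partial x_1}-\tfrac1i\tfrac{\partial}{\partial x_2}\Bigr). $$ Its spectrum is $\mathbb{R}$. $W$ is a measurable function with values in the Hermitian $2\times 2$ complex matrices. In $\operatorname{tr}|V|$, $|V|$ denotes the matrix absolute value $(V^*V)^{1/2}$, so here $\operatorname{tr}|V(x)|=\operatorname{tr}W(x)^2$. The operator $D=D_0+V$ acts in $L^2(\mathbb{R}^2;\mathbb{C}^2)$ with domain $\mathcal{H}^2(\mathbb{R}^2;\mathbb{C}^2)$ (so $V$ is such that $Vu\in L^2$ for all $u\in\mathcal{H}^2$). A number $k\in\mathbb{C}$ is an eigenvalue of $D$ if $Du=ku$ for some nonzero $u\in\mathcal{H}^2(\mathbb{R}^2;\mathbb{C}^2)$.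 *)

theory Defs
  imports "HOL-Analysis.Analysis"
begin

section \<open>Matrices\<close>

definition mat_adj :: "complex^'n^'n \<Rightarrow> complex^'n^'n" where
  "mat_adj A = (\<chi> i j. cnj (A $ j $ i))"

definition hermitian :: "complex^'n^'n \<Rightarrow> bool" where
  "hermitian A \<longleftrightarrow> mat_adj A = A"

definition pos_semidef :: "complex^'n^'n \<Rightarrow> bool" where
  "pos_semidef A \<longleftrightarrow> hermitian A \<and> (\<forall>v. 0 \<le> Re (\<Sum>i\<in>UNIV. cnj (v $ i) * (A *v v) $ i))"

text \<open>The matrix absolute value \<open>(A\<^sup>* A)\<^sup>1\<^sup>/\<^sup>2\<close>.\<close>
definition mat_abs :: "complex^'n^'n \<Rightarrow> complex^'n^'n" where
  "mat_abs A = (THE P. pos_semidef P \<and> P ** P = mat_adj A ** A)"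

section \<open>Weak derivatives and Sobolev spaces\<close>

text \<open>Elements of \<open>L\<^sup>2\<close> are represented by functions rather than by equivalence classes;
  hence equalities in \<open>L\<^sup>2\<close> are written below as equalities almost everywhere.\<close>

definition L2 :: "(real^'d \<Rightarrow> 'b::euclidean_space) set" where
  "L2 = {f \<in> borel_measurable lebesgue. integrable lebesgue (\<lambda>x. (norm (f x))\<^sup>2)}"

definition L2_norm :: "(real^'d \<Rightarrow> 'b::euclidean_space) \<Rightarrow> real" where
  "L2_norm f = sqrt (LINT x|lebesgue. (norm (f x))\<^sup>2)"

definition pderivative :: "'d \<Rightarrow> (real^'d \<Rightarrow> real) \<Rightarrow> real^'d \<Rightarrow> real" where
  "pderivative j f = (\<lambda>x. frechet_derivative f (at x) (axis j 1))"

abbreviation pderivatives :: "'d list \<Rightarrow> (real^'d \<Rightarrow> real) \<Rightarrow> real^'d \<Rightarrow> real" where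
  "pderivatives js f \<equiv> foldr pderivative js f"

text \<open>Differentiability of all iterated partial derivatives is equivalent to being \<open>C\<^sup>\<infinity>\<close>.\<close>
definition test_function :: "(real^'d \<Rightarrow> real) \<Rightarrow> bool" where
  "test_function \<phi> \<longleftrightarrow>
     (\<forall>js. pderivatives js \<phi> differentiable_on UNIV) \<and> compact (closure {x. \<phi> x \<noteq> 0})"

definition locally_integrable :: "(real^'d \<Rightarrow> 'b::euclidean_space) \<Rightarrow> bool" where
  "locally_integrable f \<longleftrightarrow> (\<forall>K. compact K \<longrightarrow> set_integrable lebesgue K f)"

definition has_weak_derivative ::
  "'d list \<Rightarrow> (real^'d \<Rightarrow> 'b::euclidean_space) \<Rightarrow> (real^'d \<Rightarrow> 'b) \<Rightarrow> bool" where
  "has_weak_derivative js u g \<longleftrightarrow> locally_integrable u \<and> locally_integrable g \<and>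
     (\<forall>\<phi>. test_function \<phi> \<longrightarrow>
        (LINT x|lebesgue. pderivatives js \<phi> x *\<^sub>R u x) =
        (- 1) ^ length js *\<^sub>R (LINT x|lebesgue. \<phi> x *\<^sub>R g x))"

text \<open>A representative of the weak partial derivative in direction \<open>j\<close>; it is determined
  up to a null set, and arbitrary if no weak derivative exists.\<close>
definition weak_partial :: "'d \<Rightarrow> (real^'d \<Rightarrow> 'b::euclidean_space) \<Rightarrow> real^'d \<Rightarrow> 'b" where
  "weak_partial j u = (SOME g. has_weak_derivative [j] u g)"

definition sobolev :: "nat \<Rightarrow> (real^'d \<Rightarrow> 'b::euclidean_space) set" where
  "sobolev m = {u \<in> L2. \<forall>js. length js \<le> m \<longrightarrow> (\<exists>g\<in>L2. has_weak_derivative js u g)}"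

section \<open>Eigenvalues and spectrum of unbounded operators in \<open>L\<^sup>2\<close>\<close>

definition is_eigenvalue ::
  "(real^'d \<Rightarrow> complex^'n) set \<Rightarrow> ((real^'d \<Rightarrow> complex^'n) \<Rightarrow> real^'d \<Rightarrow> complex^'n) \<Rightarrow> complex \<Rightarrow> bool"
  where
  "is_eigenvalue S T k \<longleftrightarrow>
     (\<exists>u\<in>S. \<not> (AE x in lebesgue. u x = 0) \<and> (AE x in lebesgue. T u x = k *s u x))"

text \<open>\<open>T - k\<close> maps its domain \<open>S\<close> bijectively onto \<open>L\<^sup>2\<close>, with bounded inverse.\<close>
definition resolvent_set ::
  "(real^'d \<Rightarrow> complex^'n) set \<Rightarrow> ((real^'d \<Rightarrow> complex^'n) \<Rightarrow> real^'d \<Rightarrow> complex^'n) \<Rightarrow> complex set"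
  where
  "resolvent_set S T = {k.
     (\<forall>u\<in>S. (AE x in lebesgue. T u x = k *s u x) \<longrightarrow> (AE x in lebesgue. u x = 0)) \<and>
     (\<forall>f\<in>L2. \<exists>u\<in>S. AE x in lebesgue. T u x - k *s u x = f x) \<and>
     (\<exists>C. \<forall>u\<in>S. L2_norm u \<le> C * L2_norm (\<lambda>x. T u x - k *s u x))}"

definition spectrum ::
  "(real^'d \<Rightarrow> complex^'n) set \<Rightarrow> ((real^'d \<Rightarrow> complex^'n) \<Rightarrow> real^'d \<Rightarrow> complex^'n) \<Rightarrow> complex set"
  where
  "spectrum S T = - resolvent_set S T"

section \<open>The operator \<open>D\<^sub>0 + V\<close>\<close>

text \<open>The signs here are opposite to the usual Wirtinger convention: \<open>d_zbar\<close> is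
  \<open>(\<partial>\<^sub>1 - i \<partial>\<^sub>2) / 2\<close> and \<open>d_z\<close> is \<open>(\<partial>\<^sub>1 + i \<partial>\<^sub>2) / 2\<close>.\<close>

definition d_zbar :: "(real^2 \<Rightarrow> complex) \<Rightarrow> real^2 \<Rightarrow> complex" where
  "d_zbar f = (\<lambda>x. 1 / 2 * (weak_partial 1 f x + 1 / \<i> * weak_partial 2 f x))"

definition d_z :: "(real^2 \<Rightarrow> complex) \<Rightarrow> real^2 \<Rightarrow> complex" where
  "d_z f = (\<lambda>x. 1 / 2 * (weak_partial 1 f x - 1 / \<i> * weak_partial 2 f x))"

definition D0 :: "(real^2 \<Rightarrow> complex^2) \<Rightarrow> real^2 \<Rightarrow> complex^2" where
  "D0 u = (\<lambda>x. vector [4 * d_zbar (d_zbar (\<lambda>y. u y $ 2)) x, 4 * d_z (d_z (\<lambda>y. u y $ 1)) x])"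

definition perturbed_D :: "(real^2 \<Rightarrow> complex^2^2) \<Rightarrow> (real^2 \<Rightarrow> complex^2) \<Rightarrow> real^2 \<Rightarrow> complex^2" where
  "perturbed_D V u = (\<lambda>x. D0 u x + V x *v u x)"

abbreviation H2 :: "(real^2 \<Rightarrow> complex^2) set" where
  "H2 \<equiv> sobolev 2"

end

theory Submission
  imports Defs "HOL-Probability.Probability"
begin

text \<open>
  Let \<open>k = \<alpha> + i \<eta>\<close> with \<open>\<eta> \<noteq> 0\<close>. It is to be shown that \<open>D - k\<close> maps the Sobolev space bijectively onto
  \<open>L\<^sup>2\<close>, with a bounded inverse.

  The heart of the matter is a pointwise estimate for the free operator: for \<open>u\<close> in the Sobolev space,
  \<open>|u(x)|\<^sup>2 \<le> \<parallel>(D\<^sub>0 - k) u\<parallel>\<^sup>2 / (4 |\<eta>|)\<close> for almost every \<open>x\<close> (\<open>AE_norm_le_shifted\<close>). The symbol of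
  \<open>D\<^sub>0\<close> is a Hermitian matrix with eigenvalues \<open>\<plusminus>|\<xi>|\<^sup>2\<close>, so that the symbol of the resolvent has norm at most
  \<open>((|\<xi>|\<^sup>2 - |\<alpha>|)\<^sup>2 + \<eta>\<^sup>2)\<^sup>-\<^sup>1\<^sup>/\<^sup>2\<close>. In the plane, area is \<open>\<pi>\<close> times the length measured by \<open>t = |\<xi>|\<^sup>2\<close>, and
  in the variable \<open>t\<close> the square of this bound is a Cauchy density; hence its integral is at most
  \<open>\<pi>\<^sup>2/|\<eta>|\<close> whatever \<open>\<alpha>\<close> is. Together with the Cauchy-Schwarz inequality and the factor \<open>1/(2\<pi>)\<close> of Fourier
  inversion this gives the estimate.

  Integrating it against \<open>|W|\<^sup>2\<close> gives \<open>\<parallel>W u\<parallel>\<^sup>2 \<le> q \<parallel>(D\<^sub>0 - k) u\<parallel>\<^sup>2 / |\<eta>|\<close>, where \<open>q\<close> is a quarter of the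
  integral of \<open>tr W\<^sup>2\<close>, a number less than \<open>1\<close> (\<open>norm_Wf_le\<close>). Now let \<open>f = (D\<^sub>0 + t i W\<^sup>2 - k) u\<close> with
  \<open>0 \<le> t \<le> 1\<close>. As \<open>D\<^sub>0\<close> is symmetric, the imaginary part of \<open>\<langle>f, u\<rangle>\<close> is
  \<open>t \<parallel>W u\<parallel>\<^sup>2 - \<eta> \<parallel>u\<parallel>\<^sup>2\<close>. For \<open>\<eta> < 0\<close> this bounds \<open>u\<close> by \<open>f\<close> at once. For \<open>\<eta> > 0\<close>
  write \<open>u = (D\<^sub>0 - k\<^sup>*) v\<close>, with \<open>k\<^sup>*\<close> the complex conjugate of \<open>k\<close>; then
  \<open>\<parallel>u\<parallel>\<^sup>2 = \<langle>(D\<^sub>0 - k) u, v\<rangle>\<close>, and the estimate of \<open>W v\<close> shows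
  \<open>\<parallel>u\<parallel> \<le> \<parallel>f\<parallel>/\<eta> + t (q/\<eta>)\<^sup>1\<^sup>/\<^sup>2 \<parallel>W u\<parallel>\<close> (\<open>dual_estimate\<close>). As \<open>q < 1\<close>, the two relations
  together bound \<open>\<parallel>u\<parallel>\<close> by a multiple of \<open>\<parallel>f\<parallel>\<close>, uniformly in \<open>t\<close> (\<open>norm_le_T\<close>). In particular there are no
  nonreal eigenvalues.

  Surjectivity is carried from \<open>t = 0\<close> to \<open>t = 1\<close> by the method of continuity (\<open>T_surj\<close>). This
  needs \<open>V\<close> to be bounded relative to \<open>D\<^sub>0\<close> with relative bound less than \<open>1\<close>. The hypothesis that \<open>V\<close> maps
  the Sobolev space into \<open>L\<^sup>2\<close> implies, by a gliding hump argument, that the \<open>L\<^sup>2\<close> norms of \<open>V\<close> over unit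
  cells are uniformly bounded (\<open>local_bound_direction\<close>); localising the pointwise estimate with
  a large \<open>\<eta>\<close> then makes the relative bound as small as desired (\<open>Q_relative_bound\<close>).

  The estimates are carried out in a real Hilbert space of classes of functions, on which the
  imaginary unit acts as a skew-symmetric operator; the Fourier transform appears through its real
  and imaginary parts, and Plancherel's identity in a form smoothed by Gaussians. For the
  potential itself, \<open>V\<^sup>* V = W\<^sup>4\<close>, so that \<open>|V| = W\<^sup>2\<close> because positive semidefinite square roots are
  unique (\<open>mat_abs_i_square\<close>).
\<close>

section \<open>The Hilbert space of square integrable functions\<close>

definition sqi :: "('a::euclidean_space \<Rightarrow> 'b::euclidean_space) \<Rightarrow> bool" where
  "sqi f \<longleftrightarrow> f \<in> borel_measurable borel \<and> integrable lborel (\<lambda>x. (norm (f x))\<^sup>2)"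

lemma sqi_inner_integrable:
  assumes "sqi f" "sqi g"
  shows "integrable lborel (\<lambda>x. f x \<bullet> g x)"
proof (rule Bochner_Integration.integrable_bound)
  show "integrable lborel (\<lambda>x. (norm (f x))\<^sup>2 + (norm (g x))\<^sup>2)"
    using assms by (auto simp: sqi_def)
  show "(\<lambda>x. f x \<bullet> g x) \<in> borel_measurable lborel"
    using assms by (auto simp: sqi_def)
  have "\<bar>f x \<bullet> g x\<bar> \<le> (norm (f x))\<^sup>2 + (norm (g x))\<^sup>2" for x
  proof -
    have "\<bar>f x \<bullet> g x\<bar> \<le> norm (f x) * norm (g x)" by (rule Cauchy_Schwarz_ineq2)
    also have "\<dots> \<le> (norm (f x))\<^sup>2 + (norm (g x))\<^sup>2"
      using sum_squares_bound[of "norm (f x)" "norm (g x)"] mult_nonneg_nonneg[OF norm_ge_zero[of "f x"] norm_ge_zero[of "g x"]]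
      by linarith
    finally show ?thesis .
  qed
  then show "AE x in lborel. norm (f x \<bullet> g x) \<le> norm ((norm (f x))\<^sup>2 + (norm (g x))\<^sup>2)"
    by auto
qed

lemma sqi_bound:
  assumes "sqi g" "f \<in> borel_measurable borel" "\<And>x. norm (f x) \<le> C * norm (g x)"
  shows "sqi f"
  unfolding sqi_def
proof
  show "integrable lborel (\<lambda>x. (norm (f x))\<^sup>2)"
  proof (rule Bochner_Integration.integrable_bound)
    show "integrable lborel (\<lambda>x. C\<^sup>2 * (norm (g x))\<^sup>2)" using assms by (simp add: sqi_def)
    have "(norm (f x))\<^sup>2 \<le> C\<^sup>2 * (norm (g x))\<^sup>2" for x
      using power_mono[OF assms(3)[of x], of 2] by (simp add: power_mult_distrib)
    then show "AE x in lborel. norm ((norm (f x))\<^sup>2) \<le> norm (C\<^sup>2 * (norm (g x))\<^sup>2)" by auto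
  qed (use assms in simp)
qed (rule assms)

lemma sqi_add:
  assumes "sqi f" "sqi g" shows "sqi (\<lambda>x. f x + g x)"
  unfolding sqi_def
proof
  show "(\<lambda>x. f x + g x) \<in> borel_measurable borel" using assms by (auto simp: sqi_def)
  have "(norm (f x + g x))\<^sup>2 = (norm (f x))\<^sup>2 + 2 * (f x \<bullet> g x) + (norm (g x))\<^sup>2" for x
    by (simp add: power2_norm_eq_inner inner_simps inner_commute)
  then show "integrable lborel (\<lambda>x. (norm (f x + g x))\<^sup>2)"
    using assms sqi_inner_integrable[OF assms] by (simp add: sqi_def)
qed

lemma sqi_scaleR: "sqi f \<Longrightarrow> sqi (\<lambda>x. c *\<^sub>R f x)"
  by (auto simp: sqi_def power_mult_distrib)

lemma sqi_zero: "sqi (\<lambda>x. 0)"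
  by (auto simp: sqi_def)

lemma sqi_linear:
  assumes "sqi f" "bounded_linear A"
  shows "sqi (\<lambda>x. A (f x))"
proof -
  from assms(2) obtain C where "\<And>x. norm (A x) \<le> norm x * C"
    using bounded_linear.bounded by blast
  moreover have "A \<in> borel_measurable borel"
    using assms(2) by (intro borel_measurable_continuous_onI linear_continuous_on)
  ultimately show ?thesis
    using assms(1) by (intro sqi_bound[OF assms(1), of _ C]) (auto simp: sqi_def mult.commute)
qed

text \<open>Each class of functions that agree almost everywhere is represented by one of its members,
  so that elements of the type below are honest Borel functions.\<close>

definition canonical_rep :: "('a::euclidean_space \<Rightarrow> 'b::euclidean_space) \<Rightarrow> 'a \<Rightarrow> 'b" where
  "canonical_rep f = (SOME g. sqi g \<and> (AE x in lborel. g x = f x))"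

lemma canonical_rep:
  assumes "sqi f"
  shows "sqi (canonical_rep f)" "AE x in lborel. canonical_rep f x = f x"
proof -
  have "\<exists>g. sqi g \<and> (AE x in lborel. g x = f x)" using assms by auto
  then have "sqi (canonical_rep f) \<and> (AE x in lborel. canonical_rep f x = f x)"
    unfolding canonical_rep_def by (rule someI_ex)
  then show "sqi (canonical_rep f)" "AE x in lborel. canonical_rep f x = f x" by auto
qed

lemma canonical_rep_cong:
  assumes "AE x in lborel. f x = g x"
  shows "canonical_rep f = canonical_rep g"
proof -
  have "(AE x in lborel. h x = f x) \<longleftrightarrow> (AE x in lborel. h x = g x)" for h :: "'a \<Rightarrow> 'b"
    using assms by (auto elim: eventually_elim2)
  then show ?thesis by (simp add: canonical_rep_def)
qed

typedef (overloaded) ('a, 'b) l2 = "canonical_rep ` {f :: 'a::euclidean_space \<Rightarrow> 'b::euclidean_space. sqi f}"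
  morphisms fn abs_l2
  using sqi_zero by auto

definition cls :: "('a::euclidean_space \<Rightarrow> 'b::euclidean_space) \<Rightarrow> ('a, 'b) l2" where
  "cls f = abs_l2 (canonical_rep f)"

lemma sqi_fn [simp]: "sqi (fn a)"
  using fn[of a] canonical_rep(1) by auto

lemma fn_measurable [measurable]: "fn a \<in> borel_measurable borel"
  using sqi_fn[of a] by (simp add: sqi_def)

lemma fn_sq_integrable [simp]: "integrable lborel (\<lambda>x. (norm (fn a x))\<^sup>2)"
  using sqi_fn[of a] by (simp add: sqi_def)

lemma fn_cls: "sqi f \<Longrightarrow> AE x in lborel. fn (cls f) x = f x"
  unfolding cls_def by (subst abs_l2_inverse) (auto intro: canonical_rep)

lemma cls_fn [simp]: "cls (fn a) = a"
proof -
  obtain f where "sqi f" "fn a = canonical_rep f" using fn[of a] by auto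
  then have "canonical_rep (fn a) = fn a"
    using canonical_rep_cong[OF canonical_rep(2)[of f]] by simp
  then show ?thesis by (simp add: cls_def fn_inverse)
qed

lemma cls_cong: "AE x in lborel. f x = g x \<Longrightarrow> cls f = cls g"
  by (simp add: cls_def canonical_rep_cong)

lemma l2_eqI: "AE x in lborel. fn a x = fn b x \<Longrightarrow> a = b"
  using cls_cong[of "fn a" "fn b"] by simp

lemma cls_eqI: "AE x in lborel. f x = fn b x \<Longrightarrow> cls f = b"
  using cls_cong[of f "fn b"] by simp

instantiation l2 :: (euclidean_space, euclidean_space) real_inner
begin

definition zero_l2 :: "('a, 'b) l2" where "zero_l2 = cls (\<lambda>x. 0)"
definition plus_l2 :: "('a, 'b) l2 \<Rightarrow> ('a, 'b) l2 \<Rightarrow> ('a, 'b) l2" where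
  "plus_l2 a b = cls (\<lambda>x. fn a x + fn b x)"
definition scaleR_l2 :: "real \<Rightarrow> ('a, 'b) l2 \<Rightarrow> ('a, 'b) l2" where
  "scaleR_l2 c a = cls (\<lambda>x. c *\<^sub>R fn a x)"
definition uminus_l2 :: "('a, 'b) l2 \<Rightarrow> ('a, 'b) l2" where
  "uminus_l2 a = cls (\<lambda>x. - fn a x)"
definition minus_l2 :: "('a, 'b) l2 \<Rightarrow> ('a, 'b) l2 \<Rightarrow> ('a, 'b) l2" where
  "minus_l2 a b = cls (\<lambda>x. fn a x - fn b x)"
definition inner_l2 :: "('a, 'b) l2 \<Rightarrow> ('a, 'b) l2 \<Rightarrow> real" where
  "inner_l2 a b = (LINT x|lborel. fn a x \<bullet> fn b x)"
definition norm_l2 :: "('a, 'b) l2 \<Rightarrow> real" where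
  "norm_l2 a = sqrt (inner a a)"
definition sgn_l2 :: "('a, 'b) l2 \<Rightarrow> ('a, 'b) l2" where
  "sgn_l2 a = inverse (norm a) *\<^sub>R a"
definition dist_l2 :: "('a, 'b) l2 \<Rightarrow> ('a, 'b) l2 \<Rightarrow> real" where
  "dist_l2 a b = norm (a - b)"
definition uniformity_l2 :: "(('a, 'b) l2 \<times> ('a, 'b) l2) filter" where
  "uniformity_l2 = (INF e\<in>{0 <..}. principal {(x, y). dist x y < e})"
definition open_l2 :: "('a, 'b) l2 set \<Rightarrow> bool" where
  "open_l2 S = (\<forall>x\<in>S. \<forall>\<^sub>F (x', y) in uniformity. x' = x \<longrightarrow> y \<in> S)"

lemma fn_zero: "AE x in lborel. fn (0 :: ('a, 'b) l2) x = 0"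
  unfolding zero_l2_def by (rule fn_cls) (rule sqi_zero)

lemma fn_add: "AE x in lborel. fn (a + b) x = fn a x + fn b x" for a b :: "('a, 'b) l2"
  unfolding plus_l2_def by (rule fn_cls) (simp add: sqi_add)

lemma fn_scaleR: "AE x in lborel. fn (c *\<^sub>R a) x = c *\<^sub>R fn a x" for a :: "('a, 'b) l2"
  unfolding scaleR_l2_def by (rule fn_cls) (simp add: sqi_scaleR)

lemma fn_uminus: "AE x in lborel. fn (- a) x = - fn a x" for a :: "('a, 'b) l2"
  unfolding uminus_l2_def using fn_cls[OF sqi_scaleR[of "fn a" "-1"]] by simp

lemma fn_diff: "AE x in lborel. fn (a - b) x = fn a x - fn b x" for a b :: "('a, 'b) l2"
  unfolding minus_l2_def using fn_cls[OF sqi_add[OF sqi_fn[of a] sqi_scaleR[of "fn b" "-1"]]] by simp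

instance
proof
  fix a b c :: "('a, 'b) l2" and r s :: real
  show "a + b + c = a + (b + c)"
    by (rule l2_eqI) (use fn_add[of "a + b" c] fn_add[of a b] fn_add[of a "b + c"] fn_add[of b c] in \<open>eventually_elim, simp\<close>)
  show "a + b = b + a"
    by (rule l2_eqI) (use fn_add[of a b] fn_add[of b a] in \<open>eventually_elim, simp\<close>)
  show "0 + a = a"
    by (rule l2_eqI) (use fn_add[of 0 a] fn_zero in \<open>eventually_elim, simp\<close>)
  show "- a + a = 0"
    by (rule l2_eqI) (use fn_add[of "- a" a] fn_uminus[of a] fn_zero in \<open>eventually_elim, simp\<close>)
  show "a - b = a + - b"
    by (rule l2_eqI) (use fn_add[of a "- b"] fn_uminus[of b] fn_diff[of a b] in \<open>eventually_elim, simp\<close>)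
  show "r *\<^sub>R (a + b) = r *\<^sub>R a + r *\<^sub>R b"
    by (rule l2_eqI) (use fn_scaleR[of r "a + b"] fn_add[of a b] fn_add[of "r *\<^sub>R a" "r *\<^sub>R b"] fn_scaleR[of r a] fn_scaleR[of r b] in \<open>eventually_elim, simp add: scaleR_add_right\<close>)
  show "(r + s) *\<^sub>R a = r *\<^sub>R a + s *\<^sub>R a"
    by (rule l2_eqI) (use fn_scaleR[of "r + s" a] fn_add[of "r *\<^sub>R a" "s *\<^sub>R a"] fn_scaleR[of r a] fn_scaleR[of s a] in \<open>eventually_elim, simp add: scaleR_add_left\<close>)
  show "r *\<^sub>R s *\<^sub>R a = (r * s) *\<^sub>R a"
    by (rule l2_eqI) (use fn_scaleR[of r "s *\<^sub>R a"] fn_scaleR[of s a] fn_scaleR[of "r * s" a] in \<open>eventually_elim, simp\<close>)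
  show "1 *\<^sub>R a = a"
    by (rule l2_eqI) (use fn_scaleR[of 1 a] in \<open>eventually_elim, simp\<close>)
  show "dist a b = norm (a - b)" by (rule dist_l2_def)
  show "sgn a = inverse (norm a) *\<^sub>R a" by (rule sgn_l2_def)
  show "(uniformity :: (('a, 'b) l2 \<times> ('a, 'b) l2) filter) = (INF e\<in>{0 <..}. principal {(x, y). dist x y < e})"
    by (rule uniformity_l2_def)
  show "open S = (\<forall>x\<in>S. \<forall>\<^sub>F (x', y) in uniformity. x' = x \<longrightarrow> y \<in> S)" for S :: "('a, 'b) l2 set"
    by (rule open_l2_def)
  show "inner a b = inner b a" by (simp add: inner_l2_def inner_commute)
  have "inner (a + b) c = (LINT x|lborel. fn a x \<bullet> fn c x + fn b x \<bullet> fn c x)"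
    unfolding inner_l2_def using fn_add[of a b]
    by (intro integral_cong_AE) (auto simp: inner_add_left)
  then show "inner (a + b) c = inner a c + inner b c"
    by (simp add: inner_l2_def sqi_inner_integrable)
  have "inner (r *\<^sub>R a) b = (LINT x|lborel. r * (fn a x \<bullet> fn b x))"
    unfolding inner_l2_def using fn_scaleR[of r a]
    by (intro integral_cong_AE) auto
  then show "inner (r *\<^sub>R a) b = r * inner a b"
    by (simp add: inner_l2_def)
  show "0 \<le> inner a a" by (simp add: inner_l2_def)
  show "norm a = sqrt (inner a a)" by (rule norm_l2_def)
  show "(inner a a = 0) = (a = 0)"
  proof
    assume "inner a a = 0"
    then have *: "AE x in lborel. fn a x \<bullet> fn a x = 0"
      unfolding inner_l2_def
      by (subst (asm) integral_nonneg_eq_0_iff_AE) (auto simp: sqi_inner_integrable)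
    show "a = 0"
      by (rule l2_eqI) (use * fn_zero in \<open>eventually_elim, simp\<close>)
  next
    assume "a = 0"
    have "inner (0 :: ('a, 'b) l2) 0 = (LINT x::'a|lborel. 0)"
      unfolding inner_l2_def using fn_zero by (intro integral_cong_AE) auto
    then show "inner a a = 0" using \<open>a = 0\<close> by simp
  qed
qed

end

lemma norm_l2_sq: "(norm a)\<^sup>2 = (LINT x|lborel. (norm (fn a x))\<^sup>2)"
  by (simp add: power2_norm_eq_inner inner_l2_def)

lemma inner_cls:
  assumes "sqi f" "sqi g"
  shows "inner (cls f) (cls g) = (LINT x|lborel. f x \<bullet> g x)"
  unfolding inner_l2_def using fn_cls[OF assms(1)] fn_cls[OF assms(2)] assms
  by (intro integral_cong_AE) (auto simp: sqi_def)

lemma inner_cls_right: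
  assumes "sqi g"
  shows "inner a (cls g) = (LINT x|lborel. fn a x \<bullet> g x)"
  using inner_cls[OF sqi_fn[of a] assms] by simp

lemma norm_cls_sq:
  assumes "sqi f"
  shows "(norm (cls f))\<^sup>2 = (LINT x|lborel. (norm (f x))\<^sup>2)"
  using inner_cls[OF assms assms] by (simp add: power2_norm_eq_inner)

lemma nn_integral_fn_sq: "(\<integral>\<^sup>+ x. ennreal ((norm (fn a x))\<^sup>2) \<partial>lborel) = ennreal ((norm a)\<^sup>2)"
  unfolding norm_l2_sq by (intro nn_integral_eq_integral) auto

lemma cls_add: "sqi f \<Longrightarrow> sqi g \<Longrightarrow> cls (\<lambda>x. f x + g x) = cls f + cls g"
  using fn_cls[of f] fn_cls[of g] fn_add[of "cls f" "cls g"] by (intro cls_eqI) (auto elim: eventually_elim2)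

lemma cls_scaleR: "sqi f \<Longrightarrow> cls (\<lambda>x. c *\<^sub>R f x) = c *\<^sub>R cls f"
  using fn_cls[of f] fn_scaleR[of c "cls f"] by (intro cls_eqI) (auto elim: eventually_elim2)

lemma integral_Cauchy_Schwarz:
  fixes f g :: "'a::euclidean_space \<Rightarrow> real"
  assumes "sqi f" "sqi g"
  shows "\<bar>LINT x|lborel. f x * g x\<bar> \<le> sqrt (LINT x|lborel. (f x)\<^sup>2) * sqrt (LINT x|lborel. (g x)\<^sup>2)"
proof -
  have "norm (cls f) = sqrt (LINT x|lborel. (f x)\<^sup>2)" if "sqi f" for f :: "'a \<Rightarrow> real"
    using norm_cls_sq[OF that] by (intro real_sqrt_unique[symmetric]) auto
  then show ?thesis
    using Cauchy_Schwarz_ineq2[of "cls f" "cls g"] inner_cls[OF assms] assms by simp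
qed

text \<open>Riesz-Fischer: along a subsequence whose increments \<open>d n\<close> have norm at most \<open>(1/4)^n\<close> the sum
  of \<open>4^n |d n|\<^sup>2\<close> is integrable, hence finite almost everywhere, which forces the increments to be
  summable there; Fatou's lemma turns the pointwise limit into a limit in norm.\<close>

instance l2 :: (euclidean_space, euclidean_space) complete_space
proof
  fix X :: "nat \<Rightarrow> ('a, 'b) l2"
  assume X: "Cauchy X"
  have "\<exists>N. \<forall>m\<ge>N. \<forall>n\<ge>N. norm (X m - X n) < (1 / 4) ^ k" for k :: nat
    using X unfolding Cauchy_iff by simp
  then obtain M where M: "\<And>k m n. m \<ge> M k \<Longrightarrow> n \<ge> M k \<Longrightarrow> norm (X m - X n) < (1 / 4) ^ k"
    by metis
  define r where "r = (\<lambda>k. \<Sum>i\<le>k. M i)"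
  have rM: "r k \<ge> M k" for k unfolding r_def by (rule member_le_sum) auto
  have r_mono: "r k \<le> r l" if "k \<le> l" for k l
    unfolding r_def using that by (intro sum_mono2) auto
  have rr: "norm (X (r l) - X (r k)) < (1 / 4) ^ k" if "k \<le> l" for k l
    using M[of k "r l" "r k"] rM[of k] r_mono[OF that] by linarith
  define d where "d = (\<lambda>k. X (r (Suc k)) - X (r k))"
  have dn: "norm (d k) < (1 / 4) ^ k" for k unfolding d_def by (rule rr) simp
  have "(\<integral>\<^sup>+ x. (\<Sum>k. ennreal (4 ^ k * (norm (fn (d k) x))\<^sup>2)) \<partial>lborel)
      = (\<Sum>k. ennreal (4 ^ k * (norm (d k))\<^sup>2))"
    by (subst nn_integral_suminf) (auto simp: ennreal_mult nn_integral_cmult nn_integral_fn_sq)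
  also have "\<dots> \<le> (\<Sum>k. ennreal ((1 / 4) ^ k))"
  proof (intro suminf_le ennreal_leI)
    fix k
    have "(norm (d k))\<^sup>2 \<le> ((1 / 4) ^ k)\<^sup>2" using dn[of k] by (intro power_mono) auto
    then have "4 ^ k * (norm (d k))\<^sup>2 \<le> 4 ^ k * ((1 / 4) ^ k)\<^sup>2" by (rule mult_left_mono) simp
    also have "\<dots> = (1 / 4) ^ k" by (simp add: power2_eq_square power_one_over)
    finally show "4 ^ k * (norm (d k))\<^sup>2 \<le> (1 / 4) ^ k" .
  qed auto
  also have "\<dots> < \<infinity>"
    by (subst suminf_ennreal_eq[OF _ summable_sums]) (auto intro!: summable_geometric)
  finally have "AE x in lborel. (\<Sum>k. ennreal (4 ^ k * (norm (fn (d k) x))\<^sup>2)) \<noteq> \<infinity>"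
    by (intro nn_integral_PInf_AE) auto
  then have summ: "AE x in lborel. summable (\<lambda>k. fn (d k) x)"
  proof eventually_elim
    case (elim x)
    then have "summable (\<lambda>k. 4 ^ k * (norm (fn (d k) x))\<^sup>2)"
      by (intro summable_suminf_not_top) auto
    then have "Bseq (\<lambda>k. 4 ^ k * (norm (fn (d k) x))\<^sup>2)"
      by (rule convergent_imp_Bseq[OF convergentI[OF summable_LIMSEQ_zero]])
    then obtain K where K: "K > 0" "\<And>k. 4 ^ k * (norm (fn (d k) x))\<^sup>2 \<le> K"
      by (auto simp: Bseq_def)
    have "norm (fn (d k) x) \<le> sqrt K * (1 / 2) ^ k" for k
    proof (rule power2_le_imp_le)
      have "(norm (fn (d k) x))\<^sup>2 \<le> K / 4 ^ k" using K(2)[of k] by (simp add: field_simps)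
      also have "\<dots> = (sqrt K)\<^sup>2 * ((1 / 2 * (1 / 2)) ^ k)" using K(1) by (simp add: power_one_over)
      also have "\<dots> = (sqrt K * (1 / 2) ^ k)\<^sup>2"
        unfolding power_mult_distrib by (simp only: power2_eq_square mult.assoc)
      finally show "(norm (fn (d k) x))\<^sup>2 \<le> (sqrt K * (1 / 2) ^ k)\<^sup>2" .
    qed (use K(1) in simp)
    then show ?case
      using summable_comparison_test'[where N = 0 and f = "\<lambda>k. fn (d k) x", OF summable_mult[OF summable_geometric[of "1 / 2 :: real"], of "sqrt K"]]
      by simp
  qed
  have "AE x in lborel. \<forall>k. fn (d k) x = fn (X (r (Suc k))) x - fn (X (r k)) x"
    unfolding AE_all_countable d_def by (intro allI fn_diff)
  with summ have conv: "AE x in lborel. convergent (\<lambda>k. fn (X (r k)) x)"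
  proof eventually_elim
    case (elim x)
    have sums: "(\<Sum>i<k. fn (d i) x) = fn (X (r k)) x - fn (X (r 0)) x" for k
      using elim(2) by (induction k) auto
    have eq: "(\<lambda>k. fn (X (r k)) x) = (\<lambda>k. (\<Sum>i<k. fn (d i) x) + fn (X (r 0)) x)"
      unfolding sums by (rule ext) (rule diff_add_cancel[symmetric])
    have "(\<lambda>k. (\<Sum>i<k. fn (d i) x) + fn (X (r 0)) x) \<longlonglongrightarrow> (\<Sum>i. fn (d i) x) + fn (X (r 0)) x"
      using elim(1) by (intro tendsto_add summable_LIMSEQ tendsto_const)
    then show ?case by (subst eq) (rule convergentI)
  qed
  define f where "f = (\<lambda>x. lim (\<lambda>k. fn (X (r k)) x))"
  have f_meas [measurable]: "f \<in> borel_measurable borel"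
    unfolding f_def by measurable
  from conv have f_lim: "AE x in lborel. (\<lambda>k. fn (X (r k)) x) \<longlonglongrightarrow> f x"
    unfolding f_def by (simp add: convergent_LIMSEQ_iff)
  have fatou: "(\<integral>\<^sup>+ x. ennreal ((norm (f x - fn (X (r k)) x))\<^sup>2) \<partial>lborel) \<le> ennreal (((1 / 4) ^ k)\<^sup>2)" for k
  proof -
    have "(\<integral>\<^sup>+ x. ennreal ((norm (f x - fn (X (r k)) x))\<^sup>2) \<partial>lborel)
      = (\<integral>\<^sup>+ x. liminf (\<lambda>l. ennreal ((norm (fn (X (r l)) x - fn (X (r k)) x))\<^sup>2)) \<partial>lborel)"
      using f_lim
    proof (intro nn_integral_cong_AE, eventually_elim)
      case (elim x)
      then have "(\<lambda>l. ennreal ((norm (fn (X (r l)) x - fn (X (r k)) x))\<^sup>2)) \<longlonglongrightarrow> ennreal ((norm (f x - fn (X (r k)) x))\<^sup>2)"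
        by (intro tendsto_intros)
      from lim_imp_Liminf[OF trivial_limit_sequentially this] show ?case by (rule sym)
    qed
    also have "\<dots> \<le> liminf (\<lambda>l. \<integral>\<^sup>+ x. ennreal ((norm (fn (X (r l)) x - fn (X (r k)) x))\<^sup>2) \<partial>lborel)"
      by (rule nn_integral_liminf) auto
    also have "(\<lambda>l. \<integral>\<^sup>+ x. ennreal ((norm (fn (X (r l)) x - fn (X (r k)) x))\<^sup>2) \<partial>lborel) = (\<lambda>l. ennreal ((norm (X (r l) - X (r k)))\<^sup>2))"
    proof
      fix l
      show "(\<integral>\<^sup>+ x. ennreal ((norm (fn (X (r l)) x - fn (X (r k)) x))\<^sup>2) \<partial>lborel) = ennreal ((norm (X (r l) - X (r k)))\<^sup>2)"
        unfolding nn_integral_fn_sq[symmetric] using fn_diff[of "X (r l)" "X (r k)"]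
        by (intro nn_integral_cong_AE) auto
    qed
    also have "liminf (\<lambda>l. ennreal ((norm (X (r l) - X (r k)))\<^sup>2)) \<le> ennreal (((1 / 4) ^ k)\<^sup>2)"
    proof (rule Liminf_le)
      show "\<forall>\<^sub>F l in sequentially. ennreal ((norm (X (r l) - X (r k)))\<^sup>2) \<le> ennreal (((1 / 4) ^ k)\<^sup>2)"
        using eventually_ge_at_top[of k]
      proof eventually_elim
        case (elim l)
        then show ?case using rr[OF elim] by (intro ennreal_leI power_mono) auto
      qed
    qed simp
    finally show ?thesis .
  qed
  have diff_sqi: "sqi (\<lambda>x. f x - fn (X (r k)) x)" for k
    unfolding sqi_def
  proof
    show "integrable lborel (\<lambda>x. (norm (f x - fn (X (r k)) x))\<^sup>2)"
      using fatou[of k] by (intro integrableI_bounded) (auto simp: top_unique less_top[symmetric])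
  qed simp
  have f_sqi: "sqi f"
    using sqi_add[OF diff_sqi[of 0] sqi_fn[of "X (r 0)"]] by simp
  have close: "norm (cls f - X (r k)) \<le> (1 / 4) ^ k" for k
  proof (rule power2_le_imp_le)
    have "ennreal ((norm (cls f - X (r k)))\<^sup>2) = (\<integral>\<^sup>+ x. ennreal ((norm (f x - fn (X (r k)) x))\<^sup>2) \<partial>lborel)"
      unfolding nn_integral_fn_sq[symmetric] using fn_diff[of "cls f" "X (r k)"] fn_cls[OF f_sqi]
      by (intro nn_integral_cong_AE) (auto elim: eventually_elim2)
    also note fatou[of k]
    finally show "(norm (cls f - X (r k)))\<^sup>2 \<le> ((1 / 4) ^ k)\<^sup>2" by simp
  qed simp
  have "X \<longlonglongrightarrow> cls f"
  proof (rule LIMSEQ_I)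
    fix e :: real assume "e > 0"
    then obtain k where k: "(1 / 4 :: real) ^ k < e / 2"
      using real_arch_pow_inv[of "e / 2" "1 / 4"] by auto
    have "norm (X n - cls f) < e" if "n \<ge> M k" for n
    proof -
      have "norm (X n - cls f) = norm ((X n - X (r k)) - (cls f - X (r k)))" by simp
      also have "\<dots> \<le> norm (X n - X (r k)) + norm (cls f - X (r k))" by (rule norm_triangle_ineq4)
      also have "norm (X n - X (r k)) < (1 / 4) ^ k" using M[OF that rM[of k]] .
      finally show ?thesis using close[of k] k by linarith
    qed
    then show "\<exists>N. \<forall>n\<ge>N. norm (X n - cls f) < e" by blast
  qed
  then show "convergent X" by (auto simp: convergent_def)
qed

section \<open>Projections in a Hilbert space\<close>

text \<open>By the parallelogram identity a sequence in \<open>M\<close> whose distances to \<open>x\<close> approach the infimum is Cauchy;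
  its limit is the foot of the perpendicular, as moving along \<open>M\<close> cannot decrease the distance further.\<close>

lemma closed_subspace_projection:
  fixes M :: "'h::{real_inner, complete_space} set"
  assumes "closed M" "subspace M"
  shows "\<exists>m\<in>M. \<forall>y\<in>M. inner (x - m) y = 0"
proof -
  define d where "d = Inf ((\<lambda>y. norm (x - y)) ` M)"
  have ne: "M \<noteq> {}" using subspace_0[OF assms(2)] by auto
  have bdd: "bdd_below ((\<lambda>y. norm (x - y)) ` M)" by (intro bdd_belowI[of _ 0]) auto
  have d_le: "d \<le> norm (x - y)" if "y \<in> M" for y
    unfolding d_def using that bdd by (intro cInf_lower) auto
  have d0: "d \<ge> 0" unfolding d_def using ne by (intro cInf_greatest) auto
  have "\<exists>y\<in>M. norm (x - y) < d + 1 / Suc n" for n :: nat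
  proof -
    have "Inf ((\<lambda>y. norm (x - y)) ` M) < d + 1 / Suc n" unfolding d_def by simp
    then show ?thesis using ne bdd by (subst (asm) cInf_less_iff) auto
  qed
  then obtain Y where Y: "\<And>n. Y n \<in> M" "\<And>n. norm (x - Y n) < d + 1 / Suc n" by metis
  have lim: "(\<lambda>n. norm (x - Y n)) \<longlonglongrightarrow> d"
  proof (rule tendsto_sandwich[of "\<lambda>_. d" _ _ "\<lambda>n. d + 1 / Suc n"])
    show "(\<lambda>n. d + 1 / Suc n) \<longlonglongrightarrow> d"
      using LIMSEQ_Suc[OF lim_const_over_n[of 1]] by (auto intro: tendsto_eq_intros)
    show "\<forall>\<^sub>F n in sequentially. norm (x - Y n) \<le> d + 1 / Suc n"
      using Y(2) by (auto intro: always_eventually less_imp_le)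
  qed (use d_le Y in \<open>auto intro: always_eventually\<close>)
  have par: "(norm (Y m - Y n))\<^sup>2 \<le> 2 * (norm (x - Y m))\<^sup>2 + 2 * (norm (x - Y n))\<^sup>2 - 4 * d\<^sup>2" for m n
  proof -
    have "(1 / 2) *\<^sub>R (Y m + Y n) \<in> M"
      using Y(1) assms(2) by (intro subspace_scale subspace_add) auto
    then have "d\<^sup>2 \<le> (norm (x - (1 / 2) *\<^sub>R (Y m + Y n)))\<^sup>2"
      using d_le d0 by (intro power_mono) auto
    moreover have "(norm (Y m - Y n))\<^sup>2 + 4 * (norm (x - (1 / 2) *\<^sub>R (Y m + Y n)))\<^sup>2
       = 2 * (norm (x - Y m))\<^sup>2 + 2 * (norm (x - Y n))\<^sup>2"
      by (simp add: power2_norm_eq_inner inner_simps inner_commute algebra_simps)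
    ultimately show ?thesis by linarith
  qed
  have "Cauchy Y"
  proof (rule CauchyI)
    fix e :: real assume e: "e > 0"
    have "(\<lambda>n. (norm (x - Y n))\<^sup>2) \<longlonglongrightarrow> d\<^sup>2" using lim by (intro tendsto_intros)
    from LIMSEQ_D[OF this, of "e\<^sup>2 / 8"] e obtain N
      where N: "\<And>n. n \<ge> N \<Longrightarrow> \<bar>(norm (x - Y n))\<^sup>2 - d\<^sup>2\<bar> < e\<^sup>2 / 8" by auto
    have "norm (Y m - Y n) < e" if "m \<ge> N" "n \<ge> N" for m n
    proof -
      have "(norm (Y m - Y n))\<^sup>2 \<le> 2 * (norm (x - Y m))\<^sup>2 + 2 * (norm (x - Y n))\<^sup>2 - 4 * d\<^sup>2" by (rule par)
      also have "\<dots> < e\<^sup>2" using N[OF that(1)] N[OF that(2)] zero_less_power[OF e, of 2] unfolding abs_less_iff by linarith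
      finally show ?thesis using e by (simp add: power_less_imp_less_base)
    qed
    then show "\<exists>N. \<forall>m\<ge>N. \<forall>n\<ge>N. norm (Y m - Y n) < e" by blast
  qed
  then obtain m where m: "Y \<longlonglongrightarrow> m" using Cauchy_convergent convergent_def by blast
  have mM: "m \<in> M" using closed_sequentially[OF assms(1)] Y(1) m by blast
  have nm: "norm (x - m) = d"
  proof (rule LIMSEQ_unique[OF _ lim])
    show "(\<lambda>n. norm (x - Y n)) \<longlonglongrightarrow> norm (x - m)" using m by (intro tendsto_intros)
  qed
  have "inner (x - m) y = 0" if "y \<in> M" for y
  proof (rule ccontr)
    assume ne: "inner (x - m) y \<noteq> 0"
    then have y0: "inner y y > 0" by (metis inner_zero_right inner_gt_zero_iff)
    define t where "t = inner (x - m) y / inner y y"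
    have "m + t *\<^sub>R y \<in> M" using mM that assms(2) by (intro subspace_scale subspace_add) auto
    then have "(norm (x - m))\<^sup>2 \<le> (norm (x - (m + t *\<^sub>R y)))\<^sup>2"
      using d_le nm by (intro power_mono) auto
    also have "\<dots> = (norm (x - m))\<^sup>2 - 2 * t * inner (x - m) y + t\<^sup>2 * inner y y"
      unfolding power2_norm_eq_inner
      by (simp add: inner_simps inner_commute algebra_simps power2_eq_square)
    also have "\<dots> = (norm (x - m))\<^sup>2 - (inner (x - m) y)\<^sup>2 / inner y y"
      using y0 unfolding t_def by (simp add: power2_eq_square)
    finally have "(inner (x - m) y)\<^sup>2 / inner y y \<le> 0" by simp
    then show False using ne y0 by (simp add: divide_le_0_iff)
  qed
  then show ?thesis using mM by blast
qed

lemma closed_subspace_eq_UNIV: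
  fixes M :: "'h::{real_inner, complete_space} set"
  assumes "closed M" "subspace M" "\<And>z. (\<And>y. y \<in> M \<Longrightarrow> inner z y = 0) \<Longrightarrow> z = 0"
  shows "M = UNIV"
proof -
  have "x \<in> M" for x
  proof -
    obtain m where "m \<in> M" "\<forall>y\<in>M. inner (x - m) y = 0"
      using closed_subspace_projection[OF assms(1,2)] by blast
    then have "x - m = 0" using assms(3) by blast
    then show ?thesis using \<open>m \<in> M\<close> by simp
  qed
  then show ?thesis by auto
qed

text \<open>A vector perpendicular to the kernel represents the functional up to a scalar.\<close>

lemma Riesz_representation:
  fixes f :: "'h::{real_inner, complete_space} \<Rightarrow> real"
  assumes "bounded_linear f"
  shows "\<exists>c. \<forall>x. f x = inner c x"
proof (cases "\<forall>x. f x = 0")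
  case True
  then show ?thesis by (intro exI[of _ 0]) simp
next
  case False
  then obtain x where x: "f x \<noteq> 0" by auto
  interpret f: bounded_linear f by fact
  have "closed {x. f x = 0}"
    by (intro closed_Collect_eq continuous_intros linear_continuous_on assms)
  moreover have "subspace {x. f x = 0}"
    by (auto simp: subspace_def f.add f.scaleR f.zero)
  ultimately obtain m where m: "f m = 0" "\<And>y. f y = 0 \<Longrightarrow> inner (x - m) y = 0"
    using closed_subspace_projection[of "{x. f x = 0}" x] by auto
  define z where "z = x - m"
  have fz: "f z \<noteq> 0" using x m(1) by (simp add: z_def f.diff)
  then have z0: "inner z z > 0" by (metis f.zero inner_gt_zero_iff)
  have "f y = inner ((f z / inner z z) *\<^sub>R z) y" for y
  proof -
    have "f (y - (f y / f z) *\<^sub>R z) = 0" using fz by (simp add: f.diff f.scaleR)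
    then have "inner z (y - (f y / f z) *\<^sub>R z) = 0" using m(2) by (simp add: z_def)
    then have "inner z y = f y / f z * inner z z" by (simp add: inner_diff_right)
    then show ?thesis using fz z0 by simp
  qed
  then show ?thesis by blast
qed

section \<open>Smooth functions and test functions\<close>

text \<open>Coinductive, so that every member of a set of differentiable functions closed under \<open>pderivative\<close> is
  smooth; that is how products and the bump functions below are treated.\<close>

coinductive smooth :: "(real^'d \<Rightarrow> real) \<Rightarrow> bool" where
  "(\<And>x. f differentiable (at x)) \<Longrightarrow> (\<And>j. smooth (pderivative j f)) \<Longrightarrow> smooth f"

lemma smooth_differentiable: "smooth f \<Longrightarrow> f differentiable (at x)"
  by (auto elim: smooth.cases)

lemma smooth_pderivative: "smooth f \<Longrightarrow> smooth (pderivative j f)"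
  by (auto elim: smooth.cases)

lemma smooth_pderivatives: "smooth f \<Longrightarrow> smooth (pderivatives js f)"
  by (induction js) (auto intro: smooth_pderivative)

lemma smooth_iff: "smooth f \<longleftrightarrow> (\<forall>js. pderivatives js f differentiable_on UNIV)"
proof
  assume "smooth f"
  then show "\<forall>js. pderivatives js f differentiable_on UNIV"
    using smooth_differentiable[OF smooth_pderivatives] by (auto simp: differentiable_on_def)
next
  assume "\<forall>js. pderivatives js f differentiable_on UNIV"
  then show "smooth f"
  proof (coinduction arbitrary: f)
    case smooth
    have "pderivatives [] f differentiable_on UNIV" using smooth by blast
    moreover have "pderivatives js (pderivative j f) differentiable_on UNIV" for js j
      using smooth[rule_format, of "js @ [j]"] by simp
    ultimately show ?case by (auto simp: differentiable_on_def)
  qed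
qed

lemma test_function_iff: "test_function \<phi> \<longleftrightarrow> smooth \<phi> \<and> compact (closure {x. \<phi> x \<noteq> 0})"
  by (simp add: test_function_def smooth_iff)

lemma pderivative_eqI: "(f has_derivative f') (at x) \<Longrightarrow> pderivative j f x = f' (axis j 1)"
  by (simp add: pderivative_def frechet_derivative_at[symmetric])

lemma smooth_has_derivative: "smooth f \<Longrightarrow> (f has_derivative frechet_derivative f (at x)) (at x)"
  using smooth_differentiable frechet_derivative_works by blast

text \<open>The algebra generated by the smooth functions. By the product rule it is closed under differentiation,
  hence consists of smooth functions.\<close>

inductive smooth_polynomial :: "(real^'d \<Rightarrow> real) \<Rightarrow> bool" where
  base: "smooth f \<Longrightarrow> smooth_polynomial f"
| add: "smooth_polynomial f \<Longrightarrow> smooth_polynomial g \<Longrightarrow> smooth_polynomial (\<lambda>x. f x + g x)"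
| mult: "smooth_polynomial f \<Longrightarrow> smooth_polynomial g \<Longrightarrow> smooth_polynomial (\<lambda>x. f x * g x)"

lemma pderivative_add:
  assumes "\<And>x. f differentiable (at x)" "\<And>x. g differentiable (at x)"
  shows "pderivative j (\<lambda>x. f x + g x) = (\<lambda>x. pderivative j f x + pderivative j g x)"
proof
  fix x
  have "(f has_derivative frechet_derivative f (at x)) (at x)" "(g has_derivative frechet_derivative g (at x)) (at x)"
    using assms frechet_derivative_works by blast+
  from has_derivative_add[OF this] show "pderivative j (\<lambda>x. f x + g x) x = pderivative j f x + pderivative j g x"
    by (subst pderivative_eqI) (auto simp: pderivative_def)
qed

lemma pderivative_mult:
  assumes "\<And>x. f differentiable (at x)" "\<And>x. g differentiable (at x)"
  shows "pderivative j (\<lambda>x. f x * g x) = (\<lambda>x. f x * pderivative j g x + pderivative j f x * g x)"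
proof
  fix x
  have "(f has_derivative frechet_derivative f (at x)) (at x)" "(g has_derivative frechet_derivative g (at x)) (at x)"
    using assms frechet_derivative_works by blast+
  from has_derivative_mult[OF this] show "pderivative j (\<lambda>x. f x * g x) x = f x * pderivative j g x + pderivative j f x * g x"
    by (subst pderivative_eqI) (auto simp: pderivative_def)
qed

lemma smooth_polynomial_closed:
  assumes "smooth_polynomial f"
  shows "(\<forall>x. f differentiable (at x)) \<and> (\<forall>j. smooth_polynomial (pderivative j f))"
  using assms
proof induction
  case (base f)
  then show ?case by (auto intro: smooth_differentiable smooth_pderivative smooth_polynomial.base)
next
  case (add f g)
  then show ?case by (auto simp: pderivative_add intro: smooth_polynomial.add differentiable_add)
next
  case (mult f g)
  then show ?case
    by (auto simp: pderivative_mult intro!: smooth_polynomial.add smooth_polynomial.mult differentiable_mult)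
qed

lemma smooth_polynomial_smooth: "smooth_polynomial f \<Longrightarrow> smooth f"
  using smooth_polynomial_closed by (coinduction arbitrary: f) blast

lemma smooth_mult: "smooth f \<Longrightarrow> smooth g \<Longrightarrow> smooth (\<lambda>x. f x * g x)"
  by (rule smooth_polynomial_smooth) (intro smooth_polynomial.mult smooth_polynomial.base)

lemma smooth_const: "smooth (\<lambda>x. c)"
proof (coinduction arbitrary: c)
  case smooth
  have "pderivative j (\<lambda>x. c) = (\<lambda>x. 0)" for j :: 'a
    by (rule ext) (simp add: pderivative_eqI[OF has_derivative_const])
  then show ?case by auto
qed

lemma smooth_prod: "(\<And>i. i \<in> I \<Longrightarrow> smooth (f i)) \<Longrightarrow> smooth (\<lambda>x. \<Prod>i\<in>I. f i x)"
  by (induction I rule: infinite_finite_induct) (auto intro: smooth_const smooth_mult)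

lemma pderivative_affine:
  assumes "\<And>x. f differentiable (at x)"
  shows "pderivative j (\<lambda>x. s * f (c + r *\<^sub>R x)) = (\<lambda>x. (s * r) * pderivative j f (c + r *\<^sub>R x))"
    and "(\<lambda>x. s * f (c + r *\<^sub>R x)) differentiable (at x)"
proof -
  have *: "((\<lambda>x. s * f (c + r *\<^sub>R x)) has_derivative (\<lambda>h. s * frechet_derivative f (at (c + r *\<^sub>R x)) (r *\<^sub>R h))) (at x)" for x
  proof -
    have "(f has_derivative frechet_derivative f (at (c + r *\<^sub>R x))) (at (c + r *\<^sub>R x))"
      using assms frechet_derivative_works by blast
    moreover have "((\<lambda>x. c + r *\<^sub>R x) has_derivative (\<lambda>h. r *\<^sub>R h)) (at x)"
      by (auto intro!: derivative_eq_intros)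
    ultimately show ?thesis
      using has_derivative_compose[of "\<lambda>x. c + r *\<^sub>R x" _ x UNIV f] by (auto intro!: derivative_eq_intros)
  qed
  from * show "(\<lambda>x. s * f (c + r *\<^sub>R x)) differentiable (at x)" by (auto simp: differentiable_def)
  have "linear (frechet_derivative f (at y))" for y
    using assms frechet_derivative_works has_derivative_linear by blast
  then show "pderivative j (\<lambda>x. s * f (c + r *\<^sub>R x)) = (\<lambda>x. (s * r) * pderivative j f (c + r *\<^sub>R x))"
    by (intro ext) (simp add: pderivative_eqI[OF *] linear_scale, simp add: pderivative_def)
qed

lemma smooth_affine:
  assumes "smooth f" shows "smooth (\<lambda>x. f (c + r *\<^sub>R x))"
proof -
  have "smooth (\<lambda>x. s * f (c + r *\<^sub>R x))" for s
    using assms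
  proof (coinduction arbitrary: f s)
    case (smooth f s)
    then show ?case
      using pderivative_affine[OF smooth_differentiable[OF smooth]] smooth_pderivative[OF smooth] by blast
  qed
  from this[of 1] show ?thesis by simp
qed

text \<open>The one-dimensional analogue, for functions that vary in a single direction of space.\<close>

coinductive smooth_real :: "(real \<Rightarrow> real) \<Rightarrow> bool" where
  "(\<And>t. (h has_real_derivative h' t) (at t)) \<Longrightarrow> smooth_real h' \<Longrightarrow> smooth_real h"

lemma smooth_real_ridge:
  assumes "smooth_real h"
  shows "smooth (\<lambda>x. h (x \<bullet> v + c))"
proof -
  have "smooth (\<lambda>x. s * h (x \<bullet> v + c))" for s
    using assms
  proof (coinduction arbitrary: h s)
    case (smooth h s)
    then obtain h' where h': "\<And>t. (h has_real_derivative h' t) (at t)" "smooth_real h'"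
      by (rule smooth_real.cases) blast
    have d: "((\<lambda>x. s * h (x \<bullet> v + c)) has_derivative (\<lambda>y. s * (h' (x \<bullet> v + c) * (y \<bullet> v)))) (at x)" for x
    proof -
      have "((\<lambda>x. x \<bullet> v + c) has_derivative (\<lambda>y. y \<bullet> v)) (at x)"
        by (auto intro!: derivative_eq_intros)
      moreover have "(h has_derivative (\<lambda>y. h' (x \<bullet> v + c) * y)) (at (x \<bullet> v + c))"
        using h'(1) by (simp add: has_field_derivative_def)
      ultimately have "((\<lambda>x. h (x \<bullet> v + c)) has_derivative (\<lambda>y. h' (x \<bullet> v + c) * (y \<bullet> v))) (at x)"
        by (rule has_derivative_compose)
      then show ?thesis by (rule has_derivative_mult_right)
    qed
    have "pderivative j (\<lambda>x. s * h (x \<bullet> v + c)) = (\<lambda>x. (s * (axis j 1 \<bullet> v)) * h' (x \<bullet> v + c))" for j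
      by (rule ext) (simp add: pderivative_eqI[OF d])
    then show ?case using d h'(2) unfolding differentiable_def by blast
  qed
  from this[of 1] show ?thesis by simp
qed

lemma smooth_real_trig: "smooth_real (\<lambda>t. a * cos t + b * sin t)"
proof (coinduction arbitrary: a b)
  case smooth_real
  have "\<forall>t. ((\<lambda>t. a * cos t + b * sin t) has_real_derivative (b * cos t + (- a) * sin t)) (at t)"
    by (auto intro!: derivative_eq_intros)
  moreover have "\<exists>c d. (\<lambda>t. b * cos t + (- a) * sin t) = (\<lambda>t. c * cos t + d * sin t)"
    by (intro exI) (rule refl)
  ultimately show ?case
    by (intro exI[of _ "\<lambda>t. a * cos t + b * sin t"] exI[of _ "\<lambda>t. b * cos t + (- a) * sin t"] conjI refl disjI1)
qed

text \<open>The functions \<open>t\<^sup>-\<^sup>m e\<^sup>-\<^sup>1\<^sup>/\<^sup>t\<close>, extended by \<open>0\<close> to the left, span a space closed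
  under differentiation; this is why \<open>e\<^sup>-\<^sup>1\<^sup>/\<^sup>t\<close> is smooth.\<close>

definition flat :: "nat \<Rightarrow> real \<Rightarrow> real" where
  "flat m t = (if t > 0 then (1 / t) ^ m * exp (- (1 / t)) else 0)"

lemma flat_derivative:
  "(flat m has_real_derivative (- real m * flat (m + 1) t + flat (m + 2) t)) (at t)"
proof -
  consider "t > 0" | "t < 0" | "t = 0" by linarith
  then show ?thesis
  proof cases
    case 1
    have "((\<lambda>t. (1 / t) ^ m * exp (- (1 / t))) has_real_derivative (- real m * flat (m + 1) t + flat (m + 2) t)) (at t)"
    proof -
      have d: "((\<lambda>t. (1 / t) ^ m * exp (- (1 / t))) has_real_derivative
          (real m * ((1 / t) ^ (m - 1) * (- (1 / t\<^sup>2))) * exp (- (1 / t)) + (1 / t) ^ m * (exp (- (1 / t)) * (1 / t\<^sup>2)))) (at t)"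
        using 1 by (auto intro!: derivative_eq_intros simp: power2_eq_square)
      have A: "real m * ((1 / t) ^ (m - 1) * (- (1 / t\<^sup>2))) = - real m * (1 / t) ^ (m + 1)"
        using 1 by (cases m) (auto simp: power_one_over power2_eq_square field_simps)
      have B: "(1 / t) ^ m * (exp (- (1 / t)) * (1 / t\<^sup>2)) = (1 / t) ^ (m + 2) * exp (- (1 / t))"
        by (simp add: power_one_over power_add power2_eq_square)
      from d[unfolded A B] 1 show ?thesis by (simp only: flat_def if_True mult.assoc)
    qed
    then show ?thesis
      by (rule DERIV_cong_ev[THEN iffD1, rotated -1])
        (use 1 eventually_nhds_in_open[of "{0<..}" t] in \<open>auto simp: flat_def elim!: eventually_mono\<close>)
  next
    case 2
    have "((\<lambda>t. 0) has_real_derivative (- real m * flat (m + 1) t + flat (m + 2) t)) (at t)"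
      using 2 by (auto simp: flat_def)
    then show ?thesis
      by (rule DERIV_cong_ev[THEN iffD1, rotated -1])
        (use 2 eventually_nhds_in_open[of "{..<0}" t] in \<open>auto simp: flat_def elim!: eventually_mono\<close>)
  next
    case 3
    have "((\<lambda>h. flat m h / h) \<longlongrightarrow> 0) (at_right 0)"
    proof -
      have "((\<lambda>s::real. s ^ (m + 1) / exp s) \<longlongrightarrow> 0) at_top" by (rule tendsto_power_div_exp_0)
      then have "((\<lambda>h::real. (inverse h) ^ (m + 1) / exp (inverse h)) \<longlongrightarrow> 0) (at_right 0)"
        by (rule filterlim_compose) (rule filterlim_inverse_at_top_right)
      moreover have "\<forall>\<^sub>F h::real in at_right 0. (inverse h) ^ (m + 1) / exp (inverse h) = flat m h / h"
        using eventually_at_right_less[of 0]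
        by eventually_elim (simp add: flat_def field_simps exp_minus)
      ultimately show ?thesis by (rule Lim_transform_eventually)
    qed
    moreover have "((\<lambda>h. flat m h / h) \<longlongrightarrow> 0) (at_left 0)"
    proof -
      have "\<forall>\<^sub>F h::real in at_left 0. 0 = flat m h / h"
        by (auto simp: flat_def eventually_at_filter)
      then show ?thesis by (rule Lim_transform_eventually[OF tendsto_const])
    qed
    ultimately have "((\<lambda>h. flat m h / h) \<longlongrightarrow> 0) (at 0)" by (simp add: filterlim_split_at)
    then show ?thesis using 3 by (simp add: DERIV_def flat_def)
  qed
qed

inductive flat_span :: "(real \<Rightarrow> real) \<Rightarrow> bool" where
  flat: "flat_span (\<lambda>t. c * flat m t)"
| add: "flat_span f \<Longrightarrow> flat_span g \<Longrightarrow> flat_span (\<lambda>t. f t + g t)"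

lemma flat_span_smooth: "flat_span f \<Longrightarrow> smooth_real f"
proof (coinduction arbitrary: f)
  case (smooth_real f)
  then have "\<exists>f'. (\<forall>t. (f has_real_derivative f' t) (at t)) \<and> flat_span f'"
  proof induction
    case (flat c m)
    have "((\<lambda>t. c * flat m t) has_real_derivative (c * - real m) * flat (m + 1) t + c * flat (m + 2) t) (at t)" for t
      using DERIV_cmult[OF flat_derivative[of m t], of c] by (simp add: algebra_simps)
    then show ?case
      using flat_span.add[OF flat_span.flat[of "c * - real m" "m + 1"] flat_span.flat[of c "m + 2"]]
      by (intro exI[of _ "\<lambda>t. (c * - real m) * flat (m + 1) t + c * flat (m + 2) t"]) simp
  next
    case (add f g)
    then obtain f' g' where "\<And>t. (f has_real_derivative f' t) (at t)" "flat_span f'"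
      "\<And>t. (g has_real_derivative g' t) (at t)" "flat_span g'" by blast
    then show ?case
      by (intro exI[of _ "\<lambda>t. f' t + g' t"] conjI allI DERIV_add flat_span.add)
  qed
  then obtain f' where "\<forall>t. (f has_real_derivative f' t) (at t)" "flat_span f'" by blast
  then show ?case by (intro exI[of _ f] exI[of _ f'] conjI refl disjI1)
qed

lemma smooth_flat: "smooth_real (flat 0)"
  using flat_span_smooth[OF flat_span.flat[of 1 0]] by simp

lemma flat_0: "flat 0 t = (if t > 0 then exp (- (1 / t)) else 0)"
  by (simp add: flat_def)

text \<open>Increasing \<open>n\<close> sharpens this bump: it tends to the indicator function of the box.\<close>

definition bump :: "real \<Rightarrow> real^'d \<Rightarrow> real^'d \<Rightarrow> real^'d \<Rightarrow> real" where
  "bump n a b x = (\<Prod>i\<in>UNIV. flat 0 (n * (x $ i - a $ i)) * flat 0 (n * (b $ i - x $ i)))"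

lemma bump_nonneg: "bump n a b x \<ge> 0"
  by (auto simp: bump_def flat_0 intro!: prod_nonneg)

lemma flat_0_le_1: "flat 0 t \<le> 1"
  by (simp add: flat_0)

lemma flat_0_nonneg: "flat 0 t \<ge> 0"
  by (simp add: flat_0)

lemma bump_le_1: "bump n a b x \<le> 1"
  unfolding bump_def by (intro prod_le_1 conjI mult_nonneg_nonneg mult_le_one flat_0_le_1 flat_0_nonneg)

lemma bump_nonzero_iff:
  assumes "n > 0" shows "bump n a b x \<noteq> 0 \<longleftrightarrow> x \<in> box a b"
  using assms by (auto simp: bump_def flat_0 mem_box_cart zero_less_mult_iff split: if_splits)

lemma test_function_bump:
  assumes "n > 0" shows "test_function (bump n a b :: real^'d \<Rightarrow> real)"
  unfolding test_function_iff
proof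
  have l: "smooth (\<lambda>x :: real^'d. flat 0 (n * (x $ i - a $ i)))" for i
    using smooth_real_ridge[OF smooth_flat, of "n *\<^sub>R axis i 1" "- n * a $ i"]
    by (simp add: inner_axis algebra_simps)
  have r: "smooth (\<lambda>x :: real^'d. flat 0 (n * (b $ i - x $ i)))" for i
    using smooth_real_ridge[OF smooth_flat, of "- n *\<^sub>R axis i 1" "n * b $ i"]
    by (simp add: inner_axis algebra_simps)
  show "smooth (bump n a b :: real^'d \<Rightarrow> real)"
    unfolding bump_def[abs_def] by (intro smooth_prod smooth_mult l r)
  have "{x. bump n a b x \<noteq> 0} = box a b" using bump_nonzero_iff[OF assms] by blast
  then show "compact (closure {x. bump n a b x \<noteq> 0})" by (simp add: bounded_box compact_closure)
qed

lemma bump_tendsto: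
  "(\<lambda>n. bump (real (Suc n)) a b x) \<longlonglongrightarrow> indicator (box a b) x"
proof (cases "x \<in> box a b")
  case True
  have f: "(\<lambda>n. flat 0 (real (Suc n) * t)) \<longlonglongrightarrow> 1" if "t > 0" for t
  proof -
    have "(\<lambda>n. exp (- (inverse (real (Suc n)) * (1 / t)))) \<longlonglongrightarrow> exp (- (0 * (1 / t)))"
      by (intro tendsto_intros LIMSEQ_inverse_real_of_nat)
    then show ?thesis using that by (simp add: flat_0 divide_inverse)
  qed
  have "(\<lambda>n. bump (real (Suc n)) a b x) \<longlonglongrightarrow> (\<Prod>i\<in>(UNIV::'a set). 1 * 1)"
    unfolding bump_def using True by (intro tendsto_prod tendsto_mult f) (auto simp: mem_box_cart)
  then show ?thesis using True by simp
next
  case False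
  have "bump (real (Suc n)) a b x = 0" for n using bump_nonzero_iff[of "real (Suc n)" a b x] False by auto
  then show ?thesis using False by simp
qed

lemma test_function_smooth: "test_function \<phi> \<Longrightarrow> smooth \<phi>"
  by (simp add: test_function_iff)

lemma smooth_continuous: "smooth \<phi> \<Longrightarrow> continuous_on S \<phi>"
  using smooth_differentiable differentiable_imp_continuous_within
  by (metis continuous_at_imp_continuous_on)

lemma smooth_measurable: "smooth \<phi> \<Longrightarrow> \<phi> \<in> borel_measurable borel"
  by (intro borel_measurable_continuous_onI smooth_continuous)

lemma test_function_measurable [measurable_dest]: "test_function \<phi> \<Longrightarrow> \<phi> \<in> borel_measurable borel"
  by (intro smooth_measurable test_function_smooth)

lemma test_function_support:
  fixes \<phi> :: "real^'d \<Rightarrow> real"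
  assumes "test_function \<phi>"
  obtains R where "R > 0" "\<And>x. norm x > R \<Longrightarrow> \<phi> x = 0"
proof -
  have "bounded (closure {x. \<phi> x \<noteq> 0})" using assms compact_imp_bounded by (auto simp: test_function_iff)
  then obtain R where R: "R > 0" "\<And>x. x \<in> closure {x. \<phi> x \<noteq> 0} \<Longrightarrow> norm x \<le> R"
    unfolding bounded_pos by auto
  show ?thesis
  proof (rule that[of R])
    fix x :: "real^'d" assume "norm x > R"
    then have "x \<notin> closure {x. \<phi> x \<noteq> 0}" using R(2) linorder_not_less by blast
    moreover have "{x. \<phi> x \<noteq> 0} \<subseteq> closure {x. \<phi> x \<noteq> 0}" by (rule closure_subset)
    ultimately show "\<phi> x = 0" by auto
  qed (rule R)
qed

lemma test_functionI:
  fixes \<phi> :: "real^'d \<Rightarrow> real"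
  assumes "smooth \<phi>" "\<And>x. norm x > R \<Longrightarrow> \<phi> x = 0"
  shows "test_function \<phi>"
proof -
  have "{x. \<phi> x \<noteq> 0} \<subseteq> cball 0 R" using assms(2) by (force simp: not_less[symmetric])
  then have "bounded {x. \<phi> x \<noteq> 0}" using bounded_cball bounded_subset by blast
  then show ?thesis using assms(1) by (simp add: test_function_iff compact_closure)
qed

lemma test_function_pderivative:
  assumes "test_function \<phi>" shows "test_function (pderivative j \<phi>)"
proof -
  obtain R where R: "R > 0" "\<And>x. norm x > R \<Longrightarrow> \<phi> x = 0" using test_function_support[OF assms] by blast
  have "pderivative j \<phi> x = 0" if "norm x > R" for x
  proof -
    have "open {x::real^'a. norm x > R}" by (intro open_Collect_less continuous_intros)
    then have "(\<phi> has_derivative (\<lambda>h. 0)) (at x)"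
      by (rule has_derivative_transform_within_open[OF has_derivative_const]) (use that R(2) in auto)
    then show ?thesis by (simp add: pderivative_eqI)
  qed
  then show ?thesis
    using assms by (intro test_functionI[of _ R]) (auto intro: smooth_pderivative test_function_smooth)
qed

lemma test_function_pderivatives: "test_function \<phi> \<Longrightarrow> test_function (pderivatives js \<phi>)"
  by (induction js) (auto intro: test_function_pderivative)

lemma test_function_mult:
  assumes "test_function \<phi>" "smooth \<psi>" shows "test_function (\<lambda>x. \<phi> x * \<psi> x)"
proof -
  obtain R where "R > 0" "\<And>x. norm x > R \<Longrightarrow> \<phi> x = 0" using test_function_support[OF assms(1)] by blast
  then show ?thesis
    using assms by (intro test_functionI[of _ R]) (auto intro: smooth_mult test_function_smooth)
qed

lemma test_function_affine:
  assumes "test_function \<phi>" "r \<noteq> 0" shows "test_function (\<lambda>x. \<phi> (c + r *\<^sub>R x))"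
proof -
  obtain R where R: "R > 0" "\<And>x. norm x > R \<Longrightarrow> \<phi> x = 0" using test_function_support[OF assms(1)] by blast
  have "\<phi> (c + r *\<^sub>R x) = 0" if "norm x > (R + norm c) / \<bar>r\<bar>" for x
  proof (rule R(2))
    have "R + norm c < \<bar>r\<bar> * norm x" using that assms(2) by (simp add: field_simps)
    moreover have "norm (r *\<^sub>R x) \<le> norm (c + r *\<^sub>R x) + norm c"
      using norm_triangle_ineq4[of "c + r *\<^sub>R x" c] by simp
    ultimately show "R < norm (c + r *\<^sub>R x)" by simp
  qed
  then show ?thesis
    using assms by (intro test_functionI) (auto intro: smooth_affine test_function_smooth)
qed

lemma test_function_cmult: "test_function \<phi> \<Longrightarrow> test_function (\<lambda>x. c * \<phi> x)"
  using test_function_mult[OF _ smooth_const[of c]] by (simp add: mult.commute)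

lemma test_function_bounded:
  assumes "test_function \<phi>"
  obtains B where "B > 0" "\<And>x. \<bar>\<phi> x\<bar> \<le> B"
proof -
  have "compact (\<phi> ` closure {x. \<phi> x \<noteq> 0})"
    using assms by (intro compact_continuous_image smooth_continuous) (auto simp: test_function_iff)
  then have "bounded (\<phi> ` closure {x. \<phi> x \<noteq> 0})" by (rule compact_imp_bounded)
  then obtain B where B: "B > 0" "\<And>x. x \<in> closure {x. \<phi> x \<noteq> 0} \<Longrightarrow> \<bar>\<phi> x\<bar> \<le> B"
    unfolding bounded_pos by (metis imageI real_norm_def)
  have "\<bar>\<phi> x\<bar> \<le> B" for x
  proof (cases "\<phi> x = 0")
    case False
    then show ?thesis using closure_subset[of "{x. \<phi> x \<noteq> 0}"] by (intro B(2)) auto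
  qed (use B(1) in simp)
  then show ?thesis using that B by blast
qed

lemma integrable_compact_support:
  fixes f :: "'a::euclidean_space \<Rightarrow> 'b::euclidean_space"
  assumes "f \<in> borel_measurable borel" "\<And>x. norm (f x) \<le> B" "\<And>x. norm x > R \<Longrightarrow> f x = 0"
  shows "integrable lborel f"
proof (rule Bochner_Integration.integrable_bound)
  have "emeasure lborel (cball (0::'a) R) < \<infinity>" by (rule emeasure_bounded_finite) simp
  then show "integrable lborel (\<lambda>x. B * indicator (cball (0::'a) R) x :: real)" by auto
  show "AE x in lborel. norm (f x) \<le> norm (B * indicator (cball 0 R) x :: real)"
    using assms(2,3) abs_ge_self order_trans by (intro AE_I2) (fastforce simp: indicator_def)
qed (use assms in simp)

lemma test_function_integrable:
  fixes c :: "'b::euclidean_space"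
  assumes "test_function \<phi>" shows "integrable lborel \<phi>" "sqi (\<lambda>x. \<phi> x *\<^sub>R c)"
proof -
  obtain R where R: "\<And>x. norm x > R \<Longrightarrow> \<phi> x = 0" using test_function_support[OF assms] by metis
  obtain B where B: "\<And>x. \<bar>\<phi> x\<bar> \<le> B" "B > 0" using test_function_bounded[OF assms] by metis
  show "integrable lborel \<phi>"
    using assms B R by (intro integrable_compact_support[of _ B R]) (auto intro: test_function_measurable)
  have "integrable lborel (\<lambda>x. (norm (\<phi> x *\<^sub>R c))\<^sup>2)"
  proof (rule integrable_compact_support[of _ "(B * norm c)\<^sup>2" R])
    show "norm ((norm (\<phi> x *\<^sub>R c))\<^sup>2) \<le> (B * norm c)\<^sup>2" for x
      using B(1)[of x] by (auto intro!: power_mono mult_right_mono)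
  qed (use assms R in \<open>auto intro!: test_function_measurable\<close>)
  then show "sqi (\<lambda>x. \<phi> x *\<^sub>R c)"
    using test_function_measurable[OF assms] by (simp add: sqi_def)
qed

lemma lborel_integral_translation:
  fixes f :: "'a::euclidean_space \<Rightarrow> 'b::{banach, second_countable_topology}"
  assumes [measurable]: "f \<in> borel_measurable borel"
  shows "(LINT x|lborel. f (c + x)) = (LINT x|lborel. f x)"
  by (subst (2) lborel_distr_plus[of c, symmetric], subst integral_distr) auto

lemma lborel_integrable_translation:
  fixes f :: "'a::euclidean_space \<Rightarrow> 'b::{banach, second_countable_topology}"
  assumes "integrable lborel f"
  shows "integrable lborel (\<lambda>x. f (c + x))"
proof -
  have [measurable]: "f \<in> borel_measurable borel" using assms by auto
  have "integrable (distr lborel borel ((+) c)) f" using assms by (simp add: lborel_distr_plus)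
  then show ?thesis by (subst (asm) integrable_distr_eq) auto
qed

lemma smooth_line_derivative:
  assumes "smooth \<phi>"
  shows "((\<lambda>s. \<phi> (x + s *\<^sub>R axis j 1)) has_real_derivative pderivative j \<phi> (x + s *\<^sub>R axis j 1)) (at s)"
proof -
  have "((\<lambda>s. x + s *\<^sub>R axis j 1) has_derivative (\<lambda>h. h *\<^sub>R axis j 1)) (at s)"
    by (auto intro!: derivative_eq_intros)
  from has_derivative_compose[OF this smooth_has_derivative[OF assms]]
  have "((\<lambda>s. \<phi> (x + s *\<^sub>R axis j 1)) has_derivative (\<lambda>h. frechet_derivative \<phi> (at (x + s *\<^sub>R axis j 1)) (h *\<^sub>R axis j 1))) (at s)" .
  moreover have "linear (frechet_derivative \<phi> (at (x + s *\<^sub>R axis j 1)))"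
    using smooth_has_derivative[OF assms] has_derivative_linear by blast
  ultimately show ?thesis
    by (simp add: has_field_derivative_def pderivative_def linear_scale mult.commute[of _ "frechet_derivative _ _ _"])
qed

text \<open>The derivative is the limit of difference quotients, and each of these has integral zero
  because Lebesgue measure is invariant under translations.\<close>

lemma integral_pderivative_eq_0:
  fixes \<phi> :: "real^'d \<Rightarrow> real"
  assumes "test_function \<phi>"
  shows "(LINT x|lborel. pderivative j \<phi> x) = 0"
proof -
  define e where "e = (axis j 1 :: real^'d)"
  define h where "h = (\<lambda>n::nat. inverse (real (Suc n)))"
  have h: "h n > 0" "h n \<le> 1" for n by (auto simp: h_def field_simps)
  obtain R where R: "R > 0" "\<And>x. norm x > R \<Longrightarrow> \<phi> x = 0" using test_function_support[OF assms] by blast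
  obtain B where B: "B > 0" "\<And>x. \<bar>pderivative j \<phi> x\<bar> \<le> B"
    using test_function_bounded[OF test_function_pderivative[OF assms]] by blast
  have [measurable]: "\<phi> \<in> borel_measurable borel" "pderivative j \<phi> \<in> borel_measurable borel"
    using assms by (auto intro: test_function_measurable test_function_pderivative)
  have \<phi>: "integrable lborel \<phi>" by (rule test_function_integrable[OF assms])
  have bound: "\<bar>(\<phi> (h n *\<^sub>R e + x) - \<phi> x) / h n\<bar> \<le> B * indicator (cball 0 (R + 1)) x" for n x
  proof (cases "norm x > R + 1")
    case True
    have "norm (h n *\<^sub>R e) \<le> 1" using h[of n] by (simp add: e_def norm_axis_1)
    then have "norm (h n *\<^sub>R e + x) > R" using True norm_triangle_ineq4[of "h n *\<^sub>R e + x" "h n *\<^sub>R e"] by simp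
    then show ?thesis using True R by (auto simp: indicator_def)
  next
    case False
    obtain z where "\<phi> (x + h n *\<^sub>R e) - \<phi> (x + 0 *\<^sub>R e) = (h n - 0) * pderivative j \<phi> (x + z *\<^sub>R e)"
      using MVT2[of 0 "h n" "\<lambda>s. \<phi> (x + s *\<^sub>R e)" "\<lambda>s. pderivative j \<phi> (x + s *\<^sub>R e)"]
        smooth_line_derivative[OF test_function_smooth[OF assms]] h[of n] unfolding e_def by blast
    then have "(\<phi> (h n *\<^sub>R e + x) - \<phi> x) / h n = pderivative j \<phi> (x + z *\<^sub>R e)"
      using h[of n] by (simp add: add.commute)
    then show ?thesis using False B by (auto simp: indicator_def)
  qed
  have lim: "(\<lambda>n. (\<phi> (h n *\<^sub>R e + x) - \<phi> x) / h n) \<longlonglongrightarrow> pderivative j \<phi> x" for x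
  proof -
    have "((\<lambda>s. (\<phi> (x + s *\<^sub>R e) - \<phi> x) / s) \<longlongrightarrow> pderivative j \<phi> x) (at 0)"
      using smooth_line_derivative[OF test_function_smooth[OF assms], of x j 0] by (simp add: DERIV_def e_def)
    moreover have "filterlim h (at 0) sequentially"
      unfolding filterlim_at h_def using LIMSEQ_inverse_real_of_nat by auto
    ultimately show ?thesis
      using filterlim_compose[of _ _ "at 0" h] by (fastforce simp: add.commute)
  qed
  have "(\<lambda>n. LINT x|lborel. (\<phi> (h n *\<^sub>R e + x) - \<phi> x) / h n) \<longlonglongrightarrow> (LINT x|lborel. pderivative j \<phi> x)"
  proof (rule integral_dominated_convergence[where w = "\<lambda>x. B * indicator (cball 0 (R + 1)) x"])
    have "emeasure lborel (cball (0::real^'d) (R + 1)) < \<infinity>" by (rule emeasure_bounded_finite) simp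
    then show "integrable lborel (\<lambda>x. B * indicator (cball (0::real^'d) (R + 1)) x)" by auto
  qed (use bound lim in auto)
  moreover have "(LINT x|lborel. (\<phi> (h n *\<^sub>R e + x) - \<phi> x) / h n) = 0" for n
    using \<phi> lborel_integrable_translation[OF \<phi>, of "h n *\<^sub>R e"] lborel_integral_translation[of \<phi> "h n *\<^sub>R e"]
    by simp
  ultimately have "(\<lambda>n::nat. 0) \<longlonglongrightarrow> (LINT x|lborel. pderivative j \<phi> x)" by (simp only:)
  then show ?thesis by (simp add: LIMSEQ_const_iff)
qed

lemma integral_by_parts:
  assumes "test_function \<phi>" "smooth \<psi>"
  shows "(LINT x|lborel. pderivative j \<phi> x * \<psi> x) = - (LINT x|lborel. \<phi> x * pderivative j \<psi> x)"
proof -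
  have "(LINT x|lborel. \<phi> x * pderivative j \<psi> x + pderivative j \<phi> x * \<psi> x) = 0"
    using integral_pderivative_eq_0[OF test_function_mult[OF assms], of j]
    by (simp add: pderivative_mult smooth_differentiable test_function_smooth assms)
  moreover have "integrable lborel (\<lambda>x. \<phi> x * pderivative j \<psi> x)"
    by (intro test_function_integrable test_function_mult assms smooth_pderivative)
  moreover have "integrable lborel (\<lambda>x. pderivative j \<phi> x * \<psi> x)"
    by (intro test_function_integrable test_function_mult test_function_pderivative assms)
  ultimately show ?thesis by simp
qed

text \<open>The hypothesis tests against smooth bumps only; these increase to indicator functions of boxes,
  and the boxes generate the Borel sets.\<close>

lemma AE_eq_0_if_test_functions:
  fixes f :: "real^'d \<Rightarrow> 'b::euclidean_space"
  assumes loc: "\<And>R. integrable lborel (\<lambda>x. indicator (cball 0 R) x *\<^sub>R f x)"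
    and orth: "\<And>\<phi>. test_function \<phi> \<Longrightarrow> (LINT x|lborel. \<phi> x *\<^sub>R f x) = 0"
  shows "AE x in lborel. f x = 0"
proof -
  have box: "(LINT x|lborel. indicator (box a b) x *\<^sub>R f x) = 0" and box_int: "integrable lborel (\<lambda>x. indicator (box a b) x *\<^sub>R f x)" for a b
  proof -
    obtain R where "\<forall>x\<in>box a b. norm x \<le> R"
      using bounded_box[of a b] unfolding bounded_iff by blast
    then have R: "box a b \<subseteq> cball 0 R" by auto
    define F where "F = (\<lambda>x. indicator (cball 0 R) x *\<^sub>R f x)"
    have F: "integrable lborel F" unfolding F_def by (rule loc)
    have [measurable]: "F \<in> borel_measurable borel" using F by auto
    have m [measurable]: "bump n a b \<in> borel_measurable borel" if "n > 0" for n
      using test_function_bump[OF that] by (rule test_function_measurable)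
    have eqF: "indicator (box a b) x *\<^sub>R f x = indicator (box a b) x *\<^sub>R F x" for x
      using R by (auto simp: F_def indicator_def)
    have "(\<lambda>n. LINT x|lborel. bump (real (Suc n)) a b x *\<^sub>R F x) \<longlonglongrightarrow> (LINT x|lborel. indicator (box a b) x *\<^sub>R F x)"
    proof (rule integral_dominated_convergence[where w = "\<lambda>x. norm (F x)"])
      show "AE x in lborel. (\<lambda>n. bump (real (Suc n)) a b x *\<^sub>R F x) \<longlonglongrightarrow> indicator (box a b) x *\<^sub>R F x"
        by (intro AE_I2 tendsto_scaleR bump_tendsto tendsto_const)
      show "AE x in lborel. norm (bump (real (Suc n)) a b x *\<^sub>R F x) \<le> norm (F x)" for n
        using bump_le_1[of "real (Suc n)" a b] bump_nonneg[of "real (Suc n)" a b]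
        by (intro AE_I2) (auto simp: mult_left_le_one_le)
    qed (use F m in auto)
    moreover have "(LINT x|lborel. bump (real (Suc n)) a b x *\<^sub>R F x) = 0" for n
    proof -
      have "bump (real (Suc n)) a b x *\<^sub>R F x = bump (real (Suc n)) a b x *\<^sub>R f x" for x
        using bump_nonzero_iff[of "real (Suc n)" a b x] R by (auto simp: F_def indicator_def)
      then show ?thesis using orth[OF test_function_bump[of "real (Suc n)" a b]] by (simp only: of_nat_0_less_iff zero_less_Suc)
    qed
    ultimately have "(\<lambda>n::nat. 0) \<longlonglongrightarrow> (LINT x|lborel. indicator (box a b) x *\<^sub>R F x)" by (simp only:)
    then show "(LINT x|lborel. indicator (box a b) x *\<^sub>R f x) = 0"
      unfolding eqF by (simp add: LIMSEQ_const_iff)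
    show "integrable lborel (\<lambda>x. indicator (box a b) x *\<^sub>R f x)"
      unfolding eqF using F by (intro integrable_mult_indicator) auto
  qed
  have "AE x in lborel. indicator (box (- c) c) x *\<^sub>R f x = 0" for c :: "real^'d"
  proof (rule sigma_finite_measure.density_zero[OF sigma_finite_lborel box_int])
    define G where "G = (\<lambda>x. indicator (box (- c) c) x *\<^sub>R f x)"
    have G: "integrable lborel G" unfolding G_def by (rule box_int)
    have Gi: "set_integrable lborel A G" if "A \<in> sets borel" for A
      unfolding set_integrable_def using G that by (intro integrable_mult_indicator) auto
    have sb: "sets (borel :: (real^'d) measure) = sigma_sets UNIV (range (\<lambda>(a, b). box a b))"
      by (subst borel_eq_box) (simp add: sets_measure_of)
    fix A :: "(real^'d) set" assume "A \<in> sets lborel"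
    then have A: "A \<in> sigma_sets UNIV (range (\<lambda>(a, b). box a b))" by (simp add: sb)
    have stable: "Int_stable (range (\<lambda>(a :: real^'d, b). box a b))"
      by (auto simp: Int_stable_def box_Int_box)
    have sub: "range (\<lambda>(a :: real^'d, b). box a b) \<subseteq> Pow UNIV" by simp
    from stable sub A show "set_lebesgue_integral lborel A (\<lambda>x. indicator (box (- c) c) x *\<^sub>R f x) = 0"
      unfolding G_def[symmetric]
    proof (induction rule: sigma_sets_induct_disjoint)
      case (basic A)
      then obtain a b where A: "A = box a b" by auto
      obtain p q where pq: "box a b \<inter> box (- c) c = box p q" using box_Int_box by blast
      have "indicator A x *\<^sub>R G x = indicator (box p q) x *\<^sub>R f x" for x
        unfolding A G_def pq[symmetric] by (auto simp: indicator_def)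
      then show ?case using box by (simp add: set_lebesgue_integral_def)
    next
      case empty
      show ?case by (simp add: set_lebesgue_integral_def)
    next
      case (compl A)
      then have A: "A \<in> sets borel" by (simp add: sb)
      have "indicator (UNIV - A) x *\<^sub>R G x = G x - indicator A x *\<^sub>R G x" for x
        by (auto simp: indicator_def)
      then have "set_lebesgue_integral lborel (UNIV - A) G = (LINT x|lborel. G x) - set_lebesgue_integral lborel A G"
        using G Gi[OF A] by (simp add: set_lebesgue_integral_def set_integrable_def)
      then show ?case using compl box[of "- c" c] by (simp add: G_def)
    next
      case (union A)
      then have A: "A i \<in> sets borel" for i by (auto simp: sb)
      have "set_lebesgue_integral lborel (\<Union>i. A i) G = (\<Sum>i. set_lebesgue_integral lborel (A i) G)"
        using union(1) A Gi by (intro lebesgue_integral_countable_add) (auto simp: disjoint_family_on_def)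
      then show ?case using union by simp
    qed
  qed
  then have "AE x in lborel. \<forall>n::nat. indicator (box (- (\<chi> i. real n)) (\<chi> i. real n)) x *\<^sub>R f x = 0"
    unfolding AE_all_countable by blast
  then show ?thesis
  proof eventually_elim
    case (elim x)
    obtain n :: nat where n: "norm x < real n" using reals_Archimedean2 by blast
    have "\<bar>x $ i\<bar> < real n" for i using component_le_norm_cart[of x i] n by linarith
    then have "x \<in> box (- (\<chi> i. real n)) (\<chi> i. real n)" by (auto simp: mem_box_cart abs_less_iff) (metis minus_less_iff)
    then show ?case using elim[rule_format, of n] by simp
  qed
qed

section \<open>Translations and convolutions\<close>

lemma lborel_AE_translation:
  fixes z :: "'a::euclidean_space"
  assumes "AE x in lborel. P x"
  shows "AE x in lborel. P (x - z)"
proof -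
  obtain N where N: "N \<in> null_sets lborel" "{x. \<not> P x} \<subseteq> N"
    using assms by (auto elim!: AE_E simp: null_sets_def)
  have "AE x in distr lborel borel ((+) (- z)). x \<notin> N"
    unfolding lborel_distr_plus by (rule AE_not_in[OF N(1)])
  then have "AE x in lborel. (- z + x) \<notin> N"
    using N(1) by (subst (asm) AE_distr_iff) (auto simp: null_sets_def)
  then show ?thesis
    using N(2) by (auto elim!: eventually_mono)
qed

lemma lborel_integral_diff:
  fixes f :: "'a::euclidean_space \<Rightarrow> 'b::{banach, second_countable_topology}"
  assumes "f \<in> borel_measurable borel"
  shows "(LINT x|lborel. f (x - z)) = (LINT x|lborel. f x)"
  using lborel_integral_translation[OF assms, of "- z"] by simp

lemma sqi_shift:
  assumes "sqi f" shows "sqi (\<lambda>x. f (x - z))"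
proof -
  have "integrable lborel (\<lambda>x. (norm (f (- z + x)))\<^sup>2)"
    using assms by (intro lborel_integrable_translation) (simp add: sqi_def)
  moreover have [measurable]: "f \<in> borel_measurable borel" using assms by (simp add: sqi_def)
  ultimately show ?thesis by (simp add: sqi_def)
qed

definition shift :: "'a::euclidean_space \<Rightarrow> ('a, 'b::euclidean_space) l2 \<Rightarrow> ('a, 'b) l2" where
  "shift z a = cls (\<lambda>x. fn a (x - z))"

lemma fn_shift: "AE x in lborel. fn (shift z a) x = fn a (x - z)"
  unfolding shift_def by (rule fn_cls[OF sqi_shift[OF sqi_fn]])

lemma shift_cls:
  assumes "sqi f" shows "shift z (cls f) = cls (\<lambda>x. f (x - z))"
  unfolding shift_def by (rule cls_cong) (rule lborel_AE_translation[OF fn_cls[OF assms]])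

lemma shift_add: "shift z (a + b) = shift z a + shift z b"
  by (rule l2_eqI) (use fn_shift[of z "a + b"] fn_shift[of z a] fn_shift[of z b]
    lborel_AE_translation[OF fn_add[of a b], of z] fn_add[of "shift z a" "shift z b"] in \<open>eventually_elim, simp\<close>)

lemma shift_scaleR: "shift z (c *\<^sub>R a) = c *\<^sub>R shift z a"
  by (rule l2_eqI) (use fn_shift[of z "c *\<^sub>R a"] fn_shift[of z a]
    lborel_AE_translation[OF fn_scaleR[of c a], of z] fn_scaleR[of c "shift z a"] in \<open>eventually_elim, simp\<close>)

lemma inner_shift: "inner (shift z a) (shift z b) = inner a b"
proof -
  have "inner (shift z a) (shift z b) = (LINT x|lborel. fn a (x - z) \<bullet> fn b (x - z))"
    unfolding shift_def by (intro inner_cls sqi_shift sqi_fn)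
  also have "\<dots> = inner a b"
    unfolding inner_l2_def by (rule lborel_integral_diff[of "\<lambda>x. fn a x \<bullet> fn b x" z]) simp
  finally show ?thesis .
qed

lemma norm_shift [simp]: "norm (shift z a) = norm a"
  by (simp add: norm_eq_sqrt_inner inner_shift)

lemma shift_shift: "shift y (shift z a) = shift (y + z) a"
proof -
  have "shift y (shift z a) = cls (\<lambda>x. fn a (x - y - z))"
    unfolding shift_def[of z a] by (rule shift_cls[OF sqi_shift[OF sqi_fn]])
  then show ?thesis by (simp add: shift_def[of "y + z"] diff_diff_eq)
qed

lemma shift_0 [simp]: "shift 0 a = a"
  by (simp add: shift_def)

lemma inner_shift_left: "inner (shift z a) b = inner a (shift (- z) b)"
  using inner_shift[of "- z" "shift z a" b] by (simp add: shift_shift)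

lemma shift_diff: "shift z (a - b) = shift z a - shift z b"
  using shift_add[of z a "- 1 *\<^sub>R b"] shift_scaleR[of z "- 1" b] by simp

text \<open>The fields with values in a line against which weak derivatives are tested.\<close>

definition tf :: "(real^'d \<Rightarrow> real) \<Rightarrow> 'b::euclidean_space \<Rightarrow> (real^'d, 'b) l2" where
  "tf \<phi> c = cls (\<lambda>x. \<phi> x *\<^sub>R c)"

lemma inner_tf:
  assumes "test_function \<phi>"
  shows "inner a (tf \<phi> c) = (LINT x|lborel. \<phi> x * (fn a x \<bullet> c))"
  unfolding tf_def by (subst inner_cls_right) (auto simp: test_function_integrable assms)

lemma sqi_scaleR_integrable:
  fixes f :: "'a::euclidean_space \<Rightarrow> real" and g :: "'a \<Rightarrow> 'b::euclidean_space"
  assumes "sqi f" "sqi g"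
  shows "integrable lborel (\<lambda>x. f x *\<^sub>R g x)"
proof (rule Bochner_Integration.integrable_bound)
  have "sqi (\<lambda>x. norm (f x))" "sqi (\<lambda>x. norm (g x))" using assms by (auto simp: sqi_def)
  from sqi_inner_integrable[OF this] show "integrable lborel (\<lambda>x. norm (f x) * norm (g x))" by simp
  show "(\<lambda>x. f x *\<^sub>R g x) \<in> borel_measurable lborel" using assms by (auto simp: sqi_def)
qed auto

lemma sqi_indicator_cball: "sqi (indicator (cball 0 R) :: 'a::euclidean_space \<Rightarrow> real)"
  unfolding sqi_def
proof
  have "emeasure lborel (cball (0::'a) R) < \<infinity>" by (rule emeasure_bounded_finite) simp
  then have "integrable lborel (indicator (cball (0::'a) R) :: 'a \<Rightarrow> real)" by auto
  moreover have "(\<lambda>x. (norm (indicator (cball (0::'a) R) x :: real))\<^sup>2) = indicator (cball (0::'a) R)"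
    by (auto simp: indicator_def)
  ultimately show "integrable lborel (\<lambda>x. (norm (indicator (cball (0::'a) R) x :: real))\<^sup>2)" by simp
qed (rule borel_measurable_indicator, simp)

lemma test_functions_total:
  fixes a :: "(real^'d, 'b::euclidean_space) l2"
  assumes "\<And>\<phi> c. test_function \<phi> \<Longrightarrow> inner a (tf \<phi> c) = 0"
  shows "a = 0"
proof -
  have "AE x in lborel. fn a x = 0"
  proof (rule AE_eq_0_if_test_functions)
    show "integrable lborel (\<lambda>x. indicator (cball 0 R) x *\<^sub>R fn a x)" for R
      by (intro sqi_scaleR_integrable sqi_indicator_cball sqi_fn)
    fix \<phi> :: "real^'d \<Rightarrow> real" assume \<phi>: "test_function \<phi>"
    have i: "integrable lborel (\<lambda>x. \<phi> x *\<^sub>R fn a x)"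
      using test_function_integrable(2)[OF \<phi>, of "1::real"] by (intro sqi_scaleR_integrable) auto
    show "(LINT x|lborel. \<phi> x *\<^sub>R fn a x) = 0"
    proof (rule euclidean_eqI)
      fix c :: 'b assume "c \<in> Basis"
      have "(LINT x|lborel. \<phi> x *\<^sub>R fn a x) \<bullet> c = (LINT x|lborel. \<phi> x *\<^sub>R fn a x \<bullet> c)"
        by (rule integral_inner_left[symmetric]) (rule i)
      also have "\<dots> = inner a (tf \<phi> c)" by (simp add: inner_tf[OF \<phi>])
      finally show "(LINT x|lborel. \<phi> x *\<^sub>R fn a x) \<bullet> c = 0 \<bullet> c" using assms[OF \<phi>] by simp
    qed
  qed
  then show ?thesis
    by (intro l2_eqI) (use fn_zero in \<open>auto elim: eventually_elim2\<close>)
qed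

lemma shift_tf_tendsto:
  fixes c :: "'b::euclidean_space" and z :: "nat \<Rightarrow> real^'d"
  assumes \<phi>: "test_function \<phi>" and z: "z \<longlonglongrightarrow> 0"
  shows "(\<lambda>n. shift (z n) (tf \<phi> c)) \<longlonglongrightarrow> tf \<phi> c"
proof -
  have [measurable]: "\<phi> \<in> borel_measurable borel" by (rule test_function_measurable[OF \<phi>])
  obtain B where B: "B > 0" "\<And>x. \<bar>\<phi> x\<bar> \<le> B" using test_function_bounded[OF \<phi>] by blast
  have "(\<lambda>n. LINT x|lborel. (\<phi> (x - z n) * \<phi> x) * (c \<bullet> c)) \<longlonglongrightarrow> (LINT x|lborel. (\<phi> x * \<phi> x) * (c \<bullet> c))"
  proof (rule integral_dominated_convergence[where w = "\<lambda>x. (B * \<bar>\<phi> x\<bar>) * (c \<bullet> c)"])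
    show "integrable lborel (\<lambda>x. (B * \<bar>\<phi> x\<bar>) * (c \<bullet> c))"
      using test_function_integrable(1)[OF \<phi>] by auto
    show "AE x in lborel. (\<lambda>n. (\<phi> (x - z n) * \<phi> x) * (c \<bullet> c)) \<longlonglongrightarrow> (\<phi> x * \<phi> x) * (c \<bullet> c)"
    proof (rule AE_I2)
      fix x
      have "isCont \<phi> x" using smooth_differentiable[OF test_function_smooth[OF \<phi>]] differentiable_imp_continuous_within by blast
      moreover have "(\<lambda>n. x - z n) \<longlonglongrightarrow> x" using tendsto_diff[OF tendsto_const z, of x] by simp
      ultimately have "(\<lambda>n. \<phi> (x - z n)) \<longlonglongrightarrow> \<phi> x" by (rule isCont_tendsto_compose)
      then show "(\<lambda>n. (\<phi> (x - z n) * \<phi> x) * (c \<bullet> c)) \<longlonglongrightarrow> (\<phi> x * \<phi> x) * (c \<bullet> c)" by (intro tendsto_intros)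
    qed
    show "AE x in lborel. norm ((\<phi> (x - z n) * \<phi> x) * (c \<bullet> c)) \<le> (B * \<bar>\<phi> x\<bar>) * (c \<bullet> c)" for n
      using B by (intro AE_I2) (auto simp: abs_mult intro!: mult_right_mono)
  qed auto
  moreover have "inner (shift (z n) (tf \<phi> c)) (tf \<phi> c) = (LINT x|lborel. (\<phi> (x - z n) * \<phi> x) * (c \<bullet> c))" for n
    unfolding tf_def by (subst shift_cls, simp add: test_function_integrable \<phi>, subst inner_cls)
      (auto simp: test_function_integrable \<phi> sqi_shift[where f = "\<lambda>x. \<phi> x *\<^sub>R c"] mult_ac)
  moreover have "inner (tf \<phi> c) (tf \<phi> c) = (LINT x|lborel. (\<phi> x * \<phi> x) * (c \<bullet> c))"
    unfolding tf_def by (subst inner_cls) (auto simp: test_function_integrable \<phi> mult.assoc)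
  ultimately have lim: "(\<lambda>n. inner (shift (z n) (tf \<phi> c)) (tf \<phi> c)) \<longlonglongrightarrow> inner (tf \<phi> c) (tf \<phi> c)" by simp
  have "(\<lambda>n. (norm (shift (z n) (tf \<phi> c) - tf \<phi> c))\<^sup>2) \<longlonglongrightarrow> 0"
  proof -
    have "(norm (shift (z n) (tf \<phi> c) - tf \<phi> c))\<^sup>2 = 2 * inner (tf \<phi> c) (tf \<phi> c) - 2 * inner (shift (z n) (tf \<phi> c)) (tf \<phi> c)" for n
      by (simp add: power2_norm_eq_inner inner_diff_left inner_diff_right inner_shift inner_commute)
    moreover have "(\<lambda>n. 2 * inner (tf \<phi> c) (tf \<phi> c) - 2 * inner (shift (z n) (tf \<phi> c)) (tf \<phi> c)) \<longlonglongrightarrow> 2 * inner (tf \<phi> c) (tf \<phi> c) - 2 * inner (tf \<phi> c) (tf \<phi> c)"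
      by (intro tendsto_intros lim)
    ultimately show ?thesis by simp
  qed
  then have "(\<lambda>n. norm (shift (z n) (tf \<phi> c) - tf \<phi> c)) \<longlonglongrightarrow> 0"
    using tendsto_real_sqrt by fastforce
  then show ?thesis by (simp add: tendsto_norm_zero_iff LIM_zero_cancel)
qed

text \<open>The vectors on which translation is strongly continuous form a closed subspace.\<close>

lemma shift_tendsto:
  fixes a :: "(real^'d, 'b::euclidean_space) l2"
  assumes z: "z \<longlonglongrightarrow> (0 :: real^'d)"
  shows "(\<lambda>n. shift (z n) a) \<longlonglongrightarrow> a"
proof -
  define M where "M = {a :: (real^'d, 'b) l2. (\<lambda>n. shift (z n) a) \<longlonglongrightarrow> a}"
  have "M = UNIV"
  proof (rule closed_subspace_eq_UNIV)
    show "subspace M"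
      unfolding subspace_def
    proof (intro conjI ballI allI)
      have "shift w (0 :: (real^'d, 'b) l2) = 0" for w using shift_scaleR[of w 0 0] by simp
      then show "0 \<in> M" by (simp add: M_def)
    qed (auto simp: M_def shift_add shift_scaleR intro: tendsto_intros)
    show "closed M"
      unfolding closed_sequential_limits
    proof (intro allI impI, elim conjE)
      fix x l assume x: "\<forall>n. x n \<in> M" and l: "x \<longlonglongrightarrow> l"
      have "(\<lambda>n. shift (z n) l) \<longlonglongrightarrow> l"
      proof (rule LIMSEQ_I)
        fix e :: real assume e: "e > 0"
        obtain k where k: "norm (x k - l) < e / 3" using LIMSEQ_D[OF l, of "e / 3"] e by auto
        have "(\<lambda>n. shift (z n) (x k)) \<longlonglongrightarrow> x k" using x by (simp add: M_def)
        from LIMSEQ_D[OF this, of "e / 3"] e obtain N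
          where N: "\<And>n. n \<ge> N \<Longrightarrow> norm (shift (z n) (x k) - x k) < e / 3" by auto
        have "norm (shift (z n) l - l) < e" if "n \<ge> N" for n
        proof -
          have "shift (z n) l - l = shift (z n) (l - x k) + (shift (z n) (x k) - x k) + (x k - l)"
            by (simp add: shift_diff)
          then have "norm (shift (z n) l - l) \<le> norm (shift (z n) (l - x k)) + norm (shift (z n) (x k) - x k) + norm (x k - l)"
            by (metis norm_triangle_mono norm_triangle_ineq order_refl)
          also have "norm (shift (z n) (l - x k)) = norm (x k - l)" by (simp add: norm_minus_commute)
          finally show ?thesis using N[OF that] k by simp
        qed
        then show "\<exists>N. \<forall>n\<ge>N. norm (shift (z n) l - l) < e" by blast
      qed
      then show "l \<in> M" by (simp add: M_def)
    qed
    show "b = 0" if "\<And>y. y \<in> M \<Longrightarrow> inner b y = 0" for b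
      using that shift_tf_tendsto[OF _ z] by (intro test_functions_total) (auto simp: M_def)
  qed
  then show ?thesis by (auto simp: M_def)
qed

lemma continuous_shift:
  fixes a :: "(real^'d, 'b::euclidean_space) l2"
  shows "continuous_on UNIV (\<lambda>z. shift z a)"
proof (rule continuous_on_sequentiallyI)
  fix u :: "nat \<Rightarrow> real^'d" and w assume u: "u \<longlonglongrightarrow> w"
  have "(\<lambda>n. u n - w) \<longlonglongrightarrow> 0" using u by (simp add: LIM_zero)
  from shift_tendsto[OF this, of "shift w a"] show "(\<lambda>n. shift (u n) a) \<longlonglongrightarrow> shift w a"
    by (simp add: shift_shift)
qed

lemma inner_shift_measurable [measurable]:
  "(\<lambda>z. inner (shift (s *\<^sub>R z) a) b) \<in> borel_measurable borel" for a :: "(real^'d, 'b::euclidean_space) l2"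
proof (rule borel_measurable_continuous_onI)
  have "continuous_on UNIV (\<lambda>z. shift (s *\<^sub>R z) a)"
    by (rule continuous_on_compose2[OF continuous_shift]) (auto intro: continuous_intros)
  then show "continuous_on UNIV (\<lambda>z. inner (shift (s *\<^sub>R z) a) b)" by (intro continuous_intros)
qed

lemma kernel_shift_integrable:
  fixes a :: "(real^'d, 'b::euclidean_space) l2"
  assumes "integrable lborel k"
  shows "integrable lborel (\<lambda>z. k z * inner (shift (s *\<^sub>R z) a) b)"
proof (rule Bochner_Integration.integrable_bound)
  show "integrable lborel (\<lambda>z. k z * (norm a * norm b))" using assms by simp
  have [measurable]: "k \<in> borel_measurable borel" using assms by auto
  show "(\<lambda>z. k z * inner (shift (s *\<^sub>R z) a) b) \<in> borel_measurable lborel" by simp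
  have "\<bar>k z * inner (shift (s *\<^sub>R z) a) b\<bar> \<le> \<bar>k z * (norm a * norm b)\<bar>" for z
    using Cauchy_Schwarz_ineq2[of "shift (s *\<^sub>R z) a" b] by (simp add: abs_mult mult_left_mono)
  then show "AE z in lborel. norm (k z * inner (shift (s *\<^sub>R z) a) b) \<le> norm (k z * (norm a * norm b))" by simp
qed

text \<open>Convolution with the kernel \<open>k\<close> rescaled to width \<open>s\<close>, as the weak average of translates.\<close>

definition conv :: "real \<Rightarrow> (real^'d \<Rightarrow> real) \<Rightarrow> (real^'d, 'b::euclidean_space) l2 \<Rightarrow> (real^'d, 'b) l2" where
  "conv s k a = (SOME c. \<forall>b. inner c b = (LINT z|lborel. k z * inner (shift (s *\<^sub>R z) a) b))"

text \<open>The weak integral exists by the Riesz representation theorem.\<close>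

lemma inner_conv:
  fixes a :: "(real^'d, 'b::euclidean_space) l2"
  assumes "integrable lborel k"
  shows "inner (conv s k a) b = (LINT z|lborel. k z * inner (shift (s *\<^sub>R z) a) b)"
proof -
  have ki: "integrable lborel (\<lambda>z. k z * inner (shift (s *\<^sub>R z) a) b)" for b
    by (rule kernel_shift_integrable[OF assms])
  have "bounded_linear (\<lambda>b. LINT z|lborel. k z * inner (shift (s *\<^sub>R z) a) b)"
  proof (rule bounded_linear_intro)
    fix b c r
    show "(LINT z|lborel. k z * inner (shift (s *\<^sub>R z) a) (b + c)) = (LINT z|lborel. k z * inner (shift (s *\<^sub>R z) a) b) + (LINT z|lborel. k z * inner (shift (s *\<^sub>R z) a) c)"
      using ki by (simp add: inner_add_right distrib_left)
    show "(LINT z|lborel. k z * inner (shift (s *\<^sub>R z) a) (r *\<^sub>R b)) = r *\<^sub>R (LINT z|lborel. k z * inner (shift (s *\<^sub>R z) a) b)"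
      by (simp add: mult.left_commute)
    have "norm (LINT z|lborel. k z * inner (shift (s *\<^sub>R z) a) b) \<le> (LINT z|lborel. \<bar>k z\<bar> * (norm a * norm b))"
    proof (rule order_trans[OF integral_norm_bound integral_mono])
      show "norm (k z * inner (shift (s *\<^sub>R z) a) b) \<le> \<bar>k z\<bar> * (norm a * norm b)" for z
        using Cauchy_Schwarz_ineq2[of "shift (s *\<^sub>R z) a" b] by (simp add: abs_mult mult_left_mono)
    qed (use assms ki in auto)
    then show "norm (LINT z|lborel. k z * inner (shift (s *\<^sub>R z) a) b) \<le> norm b * ((LINT z|lborel. \<bar>k z\<bar>) * norm a)"
      by (simp add: mult_ac)
  qed
  from Riesz_representation[OF this] have "\<exists>c. \<forall>b. inner c b = (LINT z|lborel. k z * inner (shift (s *\<^sub>R z) a) b)"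
    by metis
  then show ?thesis unfolding conv_def by (rule someI2_ex) simp
qed

lemma l2_inner_eqI: "(\<And>b. inner a b = inner c b) \<Longrightarrow> a = c" for a c :: "'h::real_inner"
  using vector_eq_rdot[of a c] by (metis inner_commute vector_eq_ldot)

lemma lborel_integral_uminus:
  fixes f :: "'a::euclidean_space \<Rightarrow> 'b::{banach, second_countable_topology}"
  assumes [measurable]: "f \<in> borel_measurable borel"
  shows "(LINT x|lborel. f (- x)) = (LINT x|lborel. f x)"
proof -
  have "(lborel :: 'a measure) = distr lborel borel uminus"
    using lborel_affine[of "-1" "0::'a"] by (simp add: density_1)
  then show ?thesis by (subst (2) \<open>lborel = _\<close>, subst integral_distr) auto
qed

lemma inner_conv_adjoint:
  fixes a :: "(real^'d, 'b::euclidean_space) l2"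
  assumes "integrable lborel k" "\<And>z. k (- z) = \<sigma> * k z"
  shows "inner (conv s k a) b = \<sigma> * inner a (conv s k b)"
proof -
  have [measurable]: "k \<in> borel_measurable borel" using assms by auto
  have "inner (conv s k a) b = (LINT z|lborel. k (- z) * inner (shift (s *\<^sub>R (- z)) a) b)"
    unfolding inner_conv[OF assms(1)] by (rule lborel_integral_uminus[symmetric]) simp
  also have "\<dots> = (LINT z|lborel. \<sigma> * (k z * inner (shift (s *\<^sub>R z) b) a))"
  proof -
    have "inner (shift (s *\<^sub>R (- z)) a) b = inner (shift (s *\<^sub>R z) b) a" for z
      using inner_shift_left[of "s *\<^sub>R (- z)" a b] by (simp add: inner_commute)
    then show ?thesis unfolding assms(2) by (simp only: mult.assoc)
  qed
  also have "\<dots> = \<sigma> * inner a (conv s k b)"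
    using inner_conv[OF assms(1), of s b a] by (simp add: inner_commute)
  finally show ?thesis .
qed

lemma conv_tendsto:
  fixes a :: "(real^'d, 'b::euclidean_space) l2"
  assumes k: "integrable lborel k" "\<And>z. k z \<ge> 0" "(LINT z|lborel. k z) = 1" and s: "s \<longlonglongrightarrow> 0"
  shows "(\<lambda>n. conv (s n) k a) \<longlonglongrightarrow> a"
proof -
  have [measurable]: "k \<in> borel_measurable borel" using k by auto
  have [measurable]: "(\<lambda>z. norm (shift (r *\<^sub>R z) a - a)) \<in> borel_measurable borel" for r
  proof (rule borel_measurable_continuous_onI)
    have "continuous_on UNIV (\<lambda>z. shift (r *\<^sub>R z) a)"
      by (rule continuous_on_compose2[OF continuous_shift]) (auto intro: continuous_intros)
    then show "continuous_on UNIV (\<lambda>z. norm (shift (r *\<^sub>R z) a - a))" by (intro continuous_intros)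
  qed
  have le: "norm (shift w a - a) \<le> 2 * norm a" for w :: "real^'d"
    using norm_triangle_ineq4[of "shift w a" a] by simp
  have int: "integrable lborel (\<lambda>z. k z * norm (shift (r *\<^sub>R z) a - a))" for r
  proof (rule Bochner_Integration.integrable_bound)
    show "integrable lborel (\<lambda>z. k z * (2 * norm a))" using k by simp
    show "AE z in lborel. norm (k z * norm (shift (r *\<^sub>R z) a - a)) \<le> norm (k z * (2 * norm a))"
      using k(2) le by (intro AE_I2) (auto simp: abs_mult intro!: mult_left_mono)
  qed simp
  have ki: "integrable lborel (\<lambda>z. k z * inner (shift (r *\<^sub>R z) a) b)" for r b
    by (rule kernel_shift_integrable[OF k(1)])
  have bound: "norm (conv r k a - a) \<le> (LINT z|lborel. k z * norm (shift (r *\<^sub>R z) a - a))" for r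
  proof -
    define b where "b = conv r k a - a"
    have "inner b b = inner (conv r k a) b - inner a b" by (simp add: b_def inner_diff_left)
    also have "\<dots> = (LINT z|lborel. k z * inner (shift (r *\<^sub>R z) a) b) - (LINT z|lborel. k z * inner a b)"
      using k by (simp add: inner_conv)
    also have "\<dots> = (LINT z|lborel. k z * inner (shift (r *\<^sub>R z) a - a) b)"
      using k ki by (simp add: inner_diff_left right_diff_distrib)
    also have "\<dots> \<le> (LINT z|lborel. k z * norm (shift (r *\<^sub>R z) a - a) * norm b)"
    proof (rule integral_mono)
      show "integrable lborel (\<lambda>z. k z * inner (shift (r *\<^sub>R z) a - a) b)"
        using k ki by (simp add: inner_diff_left right_diff_distrib)
      show "integrable lborel (\<lambda>z. k z * norm (shift (r *\<^sub>R z) a - a) * norm b)" using int by simp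
      show "k z * inner (shift (r *\<^sub>R z) a - a) b \<le> k z * norm (shift (r *\<^sub>R z) a - a) * norm b" for z
        unfolding mult.assoc using k(2) norm_cauchy_schwarz by (intro mult_left_mono) auto
    qed
    also have "\<dots> = (LINT z|lborel. k z * norm (shift (r *\<^sub>R z) a - a)) * norm b" by simp
    finally have "norm b * norm b \<le> (LINT z|lborel. k z * norm (shift (r *\<^sub>R z) a - a)) * norm b"
      by (simp add: power2_norm_eq_inner[symmetric] power2_eq_square)
    moreover have "(LINT z|lborel. k z * norm (shift (r *\<^sub>R z) a - a)) \<ge> 0"
      using k(2) by (intro integral_nonneg_AE) auto
    ultimately show ?thesis unfolding b_def[symmetric] by (cases "b = 0") auto
  qed
  have "(\<lambda>n. LINT z|lborel. k z * norm (shift (s n *\<^sub>R z) a - a)) \<longlonglongrightarrow> (LINT z::real^'d|lborel. (0::real))"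
  proof (rule integral_dominated_convergence[where w = "\<lambda>z::real^'d. k z * (2 * norm a)"])
    show "AE z in lborel. (\<lambda>n. k z * norm (shift (s n *\<^sub>R z) a - a)) \<longlonglongrightarrow> 0"
    proof (rule AE_I2)
      fix z :: "real^'d"
      have "(\<lambda>n. s n *\<^sub>R z) \<longlonglongrightarrow> 0" using tendsto_scaleR[OF s tendsto_const, of z] by simp
      from shift_tendsto[OF this, of a] have "(\<lambda>n. norm (shift (s n *\<^sub>R z) a - a)) \<longlonglongrightarrow> 0"
        by (simp add: LIM_zero tendsto_norm_zero)
      from tendsto_mult[OF tendsto_const this] show "(\<lambda>n. k z * norm (shift (s n *\<^sub>R z) a - a)) \<longlonglongrightarrow> 0" by simp
    qed
    show "AE z in lborel. norm (k z * norm (shift (s n *\<^sub>R z) a - a)) \<le> k z * (2 * norm a)" for n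
      using k(2) le by (intro AE_I2) (auto simp: abs_mult intro!: mult_left_mono)
  qed (use k in auto)
  then have lim0: "(\<lambda>n. LINT z|lborel. k z * norm (shift (s n *\<^sub>R z) a - a)) \<longlonglongrightarrow> 0" by simp
  have "(\<lambda>n. conv (s n) k a - a) \<longlonglongrightarrow> 0"
    by (rule Lim_null_comparison[OF _ lim0]) (simp add: bound)
  then show ?thesis by (rule LIM_zero_cancel)
qed

section \<open>Weak derivatives\<close>

definition wder :: "'d list \<Rightarrow> (real^'d, 'b::euclidean_space) l2 \<Rightarrow> (real^'d, 'b) l2 \<Rightarrow> bool" where
  "wder js a b \<longleftrightarrow> (\<forall>\<phi> c. test_function \<phi> \<longrightarrow>
     inner a (tf (pderivatives js \<phi>) c) = (- 1) ^ length js * inner b (tf \<phi> c))"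

lemma wder_Nil: "wder [] a a"
  by (simp add: wder_def)

lemma wder_unique:
  assumes "wder js a b" "wder js a c" shows "b = c"
proof -
  have "inner (b - c) (tf \<phi> e) = 0" if "test_function \<phi>" for \<phi> e
    using assms that by (simp add: wder_def inner_diff_left)
  then have "b - c = 0" by (rule test_functions_total)
  then show ?thesis by simp
qed

lemma wder_add: "wder js a b \<Longrightarrow> wder js a' b' \<Longrightarrow> wder js (a + a') (b + b')"
  by (simp add: wder_def inner_add_left distrib_left)

lemma wder_scaleR: "wder js a b \<Longrightarrow> wder js (r *\<^sub>R a) (r *\<^sub>R b)"
  by (simp add: wder_def)

lemma wder_tendsto:
  fixes a :: "(real^'d, 'b::euclidean_space) l2"
  assumes "\<And>n. wder js (X n) (Y n)" "X \<longlonglongrightarrow> a" "Y \<longlonglongrightarrow> b"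
  shows "wder js a b"
  unfolding wder_def
proof (intro allI impI)
  fix \<phi> :: "real^'d \<Rightarrow> real" and c :: 'b assume \<phi>: "test_function \<phi>"
  have "(\<lambda>n. inner (X n) (tf (pderivatives js \<phi>) c)) \<longlonglongrightarrow> inner a (tf (pderivatives js \<phi>) c)"
    using assms by (intro tendsto_intros)
  moreover have "(\<lambda>n. (- 1) ^ length js * inner (Y n) (tf \<phi> c)) \<longlonglongrightarrow> (- 1) ^ length js * inner b (tf \<phi> c)"
    using assms by (intro tendsto_intros)
  moreover have "(\<lambda>n. inner (X n) (tf (pderivatives js \<phi>) c)) = (\<lambda>n. (- 1) ^ length js * inner (Y n) (tf \<phi> c))"
    using assms(1) \<phi> by (auto simp: wder_def)
  ultimately show "inner a (tf (pderivatives js \<phi>) c) = (- 1) ^ length js * inner b (tf \<phi> c)"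
    using LIMSEQ_unique by metis
qed

lemma wder_Cons_iff:
  assumes "wder [i] a b"
  shows "wder (i # js) a c \<longleftrightarrow> wder js b c"
proof -
  have "inner a (tf (pderivatives (i # js) \<phi>) e) = - inner b (tf (pderivatives js \<phi>) e)" if "test_function \<phi>" for \<phi> e
    using assms test_function_pderivatives[OF that, of js] by (simp add: wder_def)
  then show ?thesis by (auto simp: wder_def)
qed

lemma shift_tf:
  fixes c :: "'b::euclidean_space"
  assumes "test_function \<phi>"
  shows "shift z (tf \<phi> c) = tf (\<lambda>x. \<phi> (x - z)) c"
  unfolding tf_def by (rule shift_cls) (rule test_function_integrable[OF assms])

lemma test_function_shift:
  assumes "test_function \<phi>" shows "test_function (\<lambda>x. \<phi> (x - z))"
  using test_function_affine[OF assms, of 1 "- z"] by simp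

lemma pderivative_shift:
  assumes "smooth \<phi>" shows "pderivative j (\<lambda>x. \<phi> (x - z)) = (\<lambda>x. pderivative j \<phi> (x - z))"
  using pderivative_affine(1)[OF smooth_differentiable[OF assms], of j 1 "- z" 1] by simp

lemma pderivatives_shift:
  assumes "smooth \<phi>" shows "pderivatives js (\<lambda>x. \<phi> (x - z)) = (\<lambda>x. pderivatives js \<phi> (x - z))"
  by (induction js) (auto simp: pderivative_shift smooth_pderivatives assms)

lemma wder_shift:
  fixes a :: "(real^'d, 'b::euclidean_space) l2"
  assumes "wder js a b" shows "wder js (shift z a) (shift z b)"
  unfolding wder_def
proof (intro allI impI)
  fix \<phi> :: "real^'d \<Rightarrow> real" and c :: 'b assume \<phi>: "test_function \<phi>"
  have "inner (shift z a) (tf (pderivatives js \<phi>) c) = inner a (tf (pderivatives js (\<lambda>x. \<phi> (x - (- z)))) c)"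
    unfolding inner_shift_left using pderivatives_shift[OF test_function_smooth[OF \<phi>], of js "- z"]
    by (simp add: shift_tf[OF test_function_pderivatives[OF \<phi>]])
  also have "\<dots> = (- 1) ^ length js * inner b (tf (\<lambda>x. \<phi> (x - (- z))) c)"
    using assms test_function_shift[OF \<phi>, of "- z"] unfolding wder_def by blast
  also have "\<dots> = (- 1) ^ length js * inner (shift z b) (tf \<phi> c)"
    by (simp add: inner_shift_left shift_tf[OF \<phi>])
  finally show "inner (shift z a) (tf (pderivatives js \<phi>) c) = (- 1) ^ length js * inner (shift z b) (tf \<phi> c)" .
qed

lemma wder_conv:
  fixes a :: "(real^'d, 'b::euclidean_space) l2"
  assumes "wder js a b" "integrable lborel k"
  shows "wder js (conv s k a) (conv s k b)"
  unfolding wder_def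
proof (intro allI impI)
  fix \<phi> :: "real^'d \<Rightarrow> real" and c :: 'b assume \<phi>: "test_function \<phi>"
  have "inner (shift (s *\<^sub>R z) a) (tf (pderivatives js \<phi>) c) = (- 1) ^ length js * inner (shift (s *\<^sub>R z) b) (tf \<phi> c)" for z
    using wder_shift[OF assms(1)] \<phi> by (simp add: wder_def)
  then show "inner (conv s k a) (tf (pderivatives js \<phi>) c) = (- 1) ^ length js * inner (conv s k b) (tf \<phi> c)"
    unfolding inner_conv[OF assms(2)] by (subst integral_mult_right_zero[symmetric]) (simp only: mult.left_commute)
qed

lemma integrable_product_bounded:
  fixes f :: "'a::euclidean_space \<Rightarrow> real" and g :: "'b::euclidean_space \<Rightarrow> real"
  assumes f: "integrable lborel f" and g: "integrable lborel g"
    and K [measurable]: "case_prod K \<in> borel_measurable (borel \<Otimes>\<^sub>M borel)" and B: "\<And>x y. \<bar>K x y\<bar> \<le> B"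
  shows "integrable (lborel \<Otimes>\<^sub>M lborel) (\<lambda>(x, y). f x * g y * K x y)"
proof (rule lborel_pair.Fubini_integrable)
  have [measurable]: "f \<in> borel_measurable borel" "g \<in> borel_measurable borel" using f g by auto
  have B0: "B \<ge> 0" using B[of undefined undefined] by linarith
  show m: "(\<lambda>(x, y). f x * g y * K x y) \<in> borel_measurable (lborel \<Otimes>\<^sub>M lborel)"
    unfolding measurable_lborel1 by measurable
  have bd: "\<bar>f x * g y * K x y\<bar> \<le> \<bar>f x\<bar> * (\<bar>g y\<bar> * B)" for x y
    using B[of x y] by (simp add: abs_mult mult.assoc mult_left_mono)
  have gi: "integrable lborel (\<lambda>y. f x * g y * K x y)" for x
  proof (rule Bochner_Integration.integrable_bound)
    show "integrable lborel (\<lambda>y. \<bar>f x\<bar> * (\<bar>g y\<bar> * B))" using g by auto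
    show "AE y in lborel. norm (f x * g y * K x y) \<le> norm (\<bar>f x\<bar> * (\<bar>g y\<bar> * B))"
      using bd B0 by (intro AE_I2) (auto simp: abs_mult)
  qed measurable
  then show "AE x in lborel. integrable lborel (\<lambda>y. case (x, y) of (x, y) \<Rightarrow> f x * g y * K x y)" by simp
  show "integrable lborel (\<lambda>x. LINT y|lborel. norm (case (x, y) of (x, y) \<Rightarrow> f x * g y * K x y))"
  proof (rule Bochner_Integration.integrable_bound)
    show "integrable lborel (\<lambda>x. \<bar>f x\<bar> * ((LINT y|lborel. \<bar>g y\<bar>) * B))" using f by auto
    show "(\<lambda>x. LINT y|lborel. norm (case (x, y) of (x, y) \<Rightarrow> f x * g y * K x y)) \<in> borel_measurable lborel"
      by measurable
    have "(LINT y|lborel. \<bar>f x * g y * K x y\<bar>) \<le> \<bar>f x\<bar> * ((LINT y|lborel. \<bar>g y\<bar>) * B)" for x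
    proof -
      have "(LINT y|lborel. \<bar>f x * g y * K x y\<bar>) \<le> (LINT y|lborel. \<bar>f x\<bar> * (\<bar>g y\<bar> * B))"
        using gi[of x] g bd by (intro integral_mono) auto
      then show ?thesis by simp
    qed
    then show "AE x in lborel. norm (LINT y|lborel. norm (case (x, y) of (x, y) \<Rightarrow> f x * g y * K x y)) \<le> norm (\<bar>f x\<bar> * ((LINT y|lborel. \<bar>g y\<bar>) * B))"
      using B0 by (intro AE_I2) (auto simp: abs_mult)
  qed
qed

text \<open>Smoothing: a derivative of a convolution may be moved onto the kernel.\<close>

lemma wder_conv_kernel:
  fixes a :: "(real^'d, 'b::euclidean_space) l2"
  assumes \<kappa>: "test_function \<kappa>" and s: "s > 0"
  shows "wder [j] (conv s \<kappa> a) ((1 / s) *\<^sub>R conv s (pderivative j \<kappa>) a)"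
  unfolding wder_def
proof (intro allI impI)
  fix \<phi> :: "real^'d \<Rightarrow> real" and c :: 'b assume \<phi>: "test_function \<phi>"
  have shift_inner: "inner (shift (s *\<^sub>R z) a) (tf \<psi> c) = (LINT x|lborel. \<psi> (x + s *\<^sub>R z) * (fn a x \<bullet> c))" if "test_function \<psi>" for \<psi> z
    unfolding inner_shift_left shift_tf[OF that] using inner_tf[OF test_function_shift[OF that, of "- (s *\<^sub>R z)"]] by simp
  obtain R where R: "R > 0" "\<And>x. norm x > R \<Longrightarrow> \<kappa> x = 0" using test_function_support[OF \<kappa>] by blast
  obtain R1 where R1: "R1 > 0" "\<And>x. norm x > R1 \<Longrightarrow> pderivative j \<kappa> x = 0" using test_function_support[OF test_function_pderivative[OF \<kappa>]] by blast
  define S where "S = max R R1"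
  have swap: "inner (conv s \<mu> a) (tf \<psi> c) = (LINT x|lborel. (fn a x \<bullet> c) * (LINT z|lborel. \<mu> z * \<psi> (x + s *\<^sub>R z)))"
    if \<mu>: "test_function \<mu>" and \<mu>S: "\<And>x. norm x > S \<Longrightarrow> \<mu> x = 0" and \<psi>: "test_function \<psi>" for \<mu> \<psi>
  proof -
    obtain Q where Q: "Q > 0" "\<And>x. norm x > Q \<Longrightarrow> \<psi> x = 0" using test_function_support[OF \<psi>] by blast
    obtain B where B: "B > 0" "\<And>x. \<bar>\<psi> x\<bar> \<le> B" using test_function_bounded[OF \<psi>] by blast
    define f where "f = (\<lambda>x. indicator (cball 0 (Q + s * S)) x * (fn a x \<bullet> c))"
    have [measurable]: "\<psi> \<in> borel_measurable borel" "\<mu> \<in> borel_measurable borel"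
      using \<psi> \<mu> by (auto intro: test_function_measurable)
    have fi: "integrable lborel f"
    proof -
      have "integrable lborel (\<lambda>x. (indicator (cball 0 (Q + s * S)) x *\<^sub>R fn a x) \<bullet> c)"
        by (intro integrable_inner_left sqi_scaleR_integrable sqi_indicator_cball sqi_fn)
      then show ?thesis by (simp add: f_def)
    qed
    have eq: "\<mu> z * \<psi> (x + s *\<^sub>R z) * (fn a x \<bullet> c) = f x * \<mu> z * \<psi> (x + s *\<^sub>R z)" for x z
    proof (cases "norm z > S \<or> norm (x + s *\<^sub>R z) > Q")
      case True then show ?thesis using \<mu>S Q(2) by auto
    next
      case False
      then have "norm (s *\<^sub>R z) \<le> s * S" using s by (simp add: mult_left_mono)
      moreover have "norm x \<le> norm (x + s *\<^sub>R z) + norm (s *\<^sub>R z)" using norm_triangle_ineq4[of "x + s *\<^sub>R z" "s *\<^sub>R z"] by simp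
      ultimately have "norm x \<le> Q + s * S" using False by linarith
      then show ?thesis by (simp add: f_def)
    qed
    have prod: "integrable (lborel \<Otimes>\<^sub>M lborel) (\<lambda>(x, z). f x * \<mu> z * \<psi> (x + s *\<^sub>R z))"
    proof (rule integrable_product_bounded[OF fi test_function_integrable(1)[OF \<mu>] _ B(2)])
      show "(\<lambda>(x, z). \<psi> (x + s *\<^sub>R z)) \<in> borel_measurable (borel \<Otimes>\<^sub>M borel)" by measurable
    qed
    have "inner (conv s \<mu> a) (tf \<psi> c) = (LINT z|lborel. LINT x|lborel. \<mu> z * \<psi> (x + s *\<^sub>R z) * (fn a x \<bullet> c))"
      unfolding inner_conv[OF test_function_integrable(1)[OF \<mu>]] shift_inner[OF \<psi>] by (simp add: mult.assoc)
    also have "\<dots> = (LINT z|lborel. LINT x|lborel. f x * \<mu> z * \<psi> (x + s *\<^sub>R z))" by (simp only: eq)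
    also have "\<dots> = (LINT x|lborel. LINT z|lborel. f x * \<mu> z * \<psi> (x + s *\<^sub>R z))"
      by (rule lborel_pair.Fubini_integral[OF prod])
    also have "\<dots> = (LINT x|lborel. LINT z|lborel. (fn a x \<bullet> c) * (\<mu> z * \<psi> (x + s *\<^sub>R z)))"
      unfolding eq[symmetric] by (simp only: mult.commute)
    finally show ?thesis by simp
  qed
  have parts: "(LINT z|lborel. \<kappa> z * pderivative j \<phi> (x + s *\<^sub>R z)) = - (1 / s) * (LINT z|lborel. pderivative j \<kappa> z * \<phi> (x + s *\<^sub>R z))" for x
  proof -
    have "pderivative j (\<lambda>z. \<phi> (x + s *\<^sub>R z)) = (\<lambda>z. s * pderivative j \<phi> (x + s *\<^sub>R z))"
      using pderivative_affine(1)[OF smooth_differentiable[OF test_function_smooth[OF \<phi>]], of j 1 x s] by simp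
    then have "(LINT z|lborel. pderivative j \<kappa> z * \<phi> (x + s *\<^sub>R z)) = - (LINT z|lborel. s * (\<kappa> z * pderivative j \<phi> (x + s *\<^sub>R z)))"
      using integral_by_parts[OF \<kappa> smooth_affine[OF test_function_smooth[OF \<phi>], of x s], of j] by (simp add: mult.left_commute)
    then show ?thesis using s by simp
  qed
  have "inner (conv s \<kappa> a) (tf (pderivative j \<phi>) c) = (LINT x|lborel. (fn a x \<bullet> c) * (- (1 / s) * (LINT z|lborel. pderivative j \<kappa> z * \<phi> (x + s *\<^sub>R z))))"
    by (subst swap) (auto simp: \<kappa> \<phi> test_function_pderivative R S_def parts)
  also have "\<dots> = (LINT x|lborel. - (1 / s) * ((fn a x \<bullet> c) * (LINT z|lborel. pderivative j \<kappa> z * \<phi> (x + s *\<^sub>R z))))"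
    by (simp only: mult.left_commute)
  also have "\<dots> = - (1 / s) * inner (conv s (pderivative j \<kappa>) a) (tf \<phi> c)"
    by (subst swap) (auto simp: \<kappa> \<phi> test_function_pderivative R1 S_def)
  finally show "inner (conv s \<kappa> a) (tf (pderivatives [j] \<phi>) c) = (- 1) ^ length [j] * inner ((1 / s) *\<^sub>R conv s (pderivative j \<kappa>) a) (tf \<phi> c)"
    by simp
qed

definition mollifier :: "real^'d \<Rightarrow> real" where
  "mollifier x = bump 1 (\<chi> i. - 1) (\<chi> i. 1) x / (LINT x|lborel. bump 1 (\<chi> i. - 1) (\<chi> i. 1) (x :: real^'d))"

lemma test_function_mollifier: "test_function (mollifier :: real^'d \<Rightarrow> real)"
  using test_function_cmult[OF test_function_bump[of 1 "\<chi> i. - 1" "\<chi> i. 1"], of "1 / (LINT x|lborel. bump 1 (\<chi> i. - 1) (\<chi> i. 1) (x :: real^'d))"]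
  by (simp add: mollifier_def[abs_def])

lemma mollifier_even: "mollifier (- x) = mollifier x"
  by (simp add: mollifier_def bump_def mult.commute add.commute)

lemma bump_integral_pos: "(LINT x|lborel. bump 1 (\<chi> i. - 1) (\<chi> i. 1) (x :: real^'d)) > 0"
proof -
  let ?b = "bump 1 (\<chi> i. - 1) (\<chi> i. 1) :: real^'d \<Rightarrow> real"
  have i: "integrable lborel ?b" by (intro test_function_integrable test_function_bump) simp
  have "(LINT x|lborel. ?b x) \<noteq> 0"
  proof
    assume "(LINT x|lborel. ?b x) = 0"
    then have "AE x in lborel. ?b x = 0"
      using i by (subst (asm) integral_nonneg_eq_0_iff_AE) (auto simp: bump_nonneg)
    then have "AE x in lborel. x \<notin> box (\<chi> i. - 1) ((\<chi> i. 1) :: real^'d)"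
      using bump_nonzero_iff[of 1] by (auto elim!: eventually_mono)
    then have "emeasure lborel (box (\<chi> i. - 1) ((\<chi> i. 1) :: real^'d)) = 0"
      by (subst (asm) AE_iff_measurable[OF _ refl]) auto
    moreover define p where "p = (\<Prod>b\<in>Basis. ((\<chi> i. 1) - (\<chi> i. - 1) :: real^'d) \<bullet> b)"
    moreover have "emeasure lborel (box (\<chi> i. - 1) ((\<chi> i. 1) :: real^'d)) = ennreal p"
      unfolding p_def by (rule emeasure_lborel_box) (auto simp: Basis_vec_def inner_axis)
    moreover have "p > 0"
      unfolding p_def by (rule prod_pos) (auto simp: Basis_vec_def inner_axis)
    ultimately show False by (metis ennreal_eq_0_iff not_less)
  qed
  moreover have "(LINT x|lborel. ?b x) \<ge> 0" by (intro integral_nonneg_AE) (auto simp: bump_nonneg)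
  ultimately show ?thesis by linarith
qed

lemma mollifier_nonneg: "mollifier x \<ge> 0"
  using bump_integral_pos by (simp add: mollifier_def bump_nonneg)

lemma mollifier_integral:
  "integrable lborel (mollifier :: real^'d \<Rightarrow> real)" "(LINT x|lborel. mollifier (x :: real^'d)) = 1"
  using bump_integral_pos[where 'd = 'd] test_function_integrable(1)[OF test_function_mollifier]
  by (auto simp: mollifier_def less_imp_neq[symmetric])

abbreviation moll :: "real \<Rightarrow> (real^'d, 'b::euclidean_space) l2 \<Rightarrow> (real^'d, 'b) l2" where
  "moll s a \<equiv> conv s mollifier a"

lemma inner_moll: "inner (moll s a) b = inner a (moll s b)"
  using inner_conv_adjoint[OF mollifier_integral(1), of 1] by (simp add: mollifier_even)

lemma moll_tendsto: "(\<lambda>n. moll (inverse (real (Suc n))) a) \<longlonglongrightarrow> a"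
  by (intro conv_tendsto mollifier_integral mollifier_nonneg LIMSEQ_inverse_real_of_nat)

text \<open>Each derivative in turn is moved onto the kernel, whose derivatives are again test functions.\<close>

lemma conv_wder_ex:
  assumes "test_function \<kappa>" "s > 0"
  shows "\<exists>b. wder js (conv s \<kappa> a) b"
  using assms(1)
proof (induction js arbitrary: \<kappa>)
  case Nil
  then show ?case using wder_Nil by blast
next
  case (Cons j js)
  obtain b where "wder js (conv s (pderivative j \<kappa>) a) b"
    using Cons test_function_pderivative by blast
  then show ?case
    using wder_Cons_iff[OF wder_conv_kernel[OF Cons.prems assms(2)]] wder_scaleR by blast
qed

lemma wder_moll: "wder js a b \<Longrightarrow> wder js (moll s a) (moll s b)"
  by (rule wder_conv[OF _ mollifier_integral(1)])

lemma pderivative_mollifier_odd: "pderivative j mollifier (- x) = - 1 * pderivative j mollifier x"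
proof -
  have "pderivative j (\<lambda>x. mollifier (- x)) = (\<lambda>x. - pderivative j mollifier (- x))"
    using pderivative_affine(1)[OF smooth_differentiable[OF test_function_smooth[OF test_function_mollifier]], of j 1 0 "- 1"]
    by simp
  from fun_cong[OF this, of x] show ?thesis by (simp add: mollifier_even)
qed

text \<open>Mollifying the derivative of \<open>a\<close> gives \<open>a\<close> convolved with the derivative of the even
  mollifier, an odd kernel; moving this kernel across the inner product produces the sign.\<close>

lemma wder_integration_by_parts:
  assumes a: "wder [j] a a'" and b: "wder [j] b b'"
  shows "inner a' b = - inner a b'"
proof -
  let ?D = "pderivative j mollifier"
  have D: "integrable lborel ?D"
    by (intro test_function_integrable test_function_pderivative test_function_mollifier)
  have m: "moll s c' = (1 / s) *\<^sub>R conv s ?D c" if "wder [j] c c'" "s > 0" for c c' s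
    using wder_unique[OF wder_moll[OF that(1)] wder_conv_kernel[OF test_function_mollifier that(2)]] .
  have "inner (moll s a') b = - inner a (moll s b')" if "s > 0" for s
    using inner_conv_adjoint[OF D pderivative_mollifier_odd, of s a b]
    by (simp add: m[OF a that] m[OF b that])
  then have eq: "inner (moll (inverse (real (Suc n))) a') b = - inner a (moll (inverse (real (Suc n))) b')" for n
    by simp
  have "(\<lambda>n. inner (moll (inverse (real (Suc n))) a') b) \<longlonglongrightarrow> inner a' b"
    by (intro tendsto_intros moll_tendsto)
  moreover have "(\<lambda>n. - inner a (moll (inverse (real (Suc n))) b')) \<longlonglongrightarrow> - inner a b'"
    by (intro tendsto_intros moll_tendsto)
  ultimately show ?thesis unfolding eq using LIMSEQ_unique by blast
qed

section \<open>Cosine and sine transforms\<close>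

lemma lborel_integral_scale:
  fixes f :: "'a::euclidean_space \<Rightarrow> 'b::{banach, second_countable_topology}"
  assumes [measurable]: "f \<in> borel_measurable borel" and s: "s > 0"
  shows "(LINT x|lborel. f x) = s ^ DIM('a) *\<^sub>R (LINT x|lborel. f (s *\<^sub>R x))"
proof -
  have "(lborel :: 'a measure) = density (distr lborel borel (\<lambda>x. 0 + s *\<^sub>R x)) (\<lambda>_. \<bar>s\<bar> ^ DIM('a))"
    using s by (intro lborel_affine) simp
  then have "(LINT x|lborel. f x) = (LINT x|density (distr lborel borel (\<lambda>x::'a. s *\<^sub>R x)) (\<lambda>_. ennreal (s ^ DIM('a))). f x)"
    using s by (simp add: ennreal_power)
  also have "\<dots> = (LINT x|distr lborel borel (\<lambda>x::'a. s *\<^sub>R x). s ^ DIM('a) *\<^sub>R f x)"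
    using s by (subst integral_density) auto
  also have "\<dots> = (LINT x|lborel. s ^ DIM('a) *\<^sub>R f (s *\<^sub>R x))"
    by (subst integral_distr) auto
  finally show ?thesis by simp
qed

lemma lborel_nn_integral_scale:
  fixes f :: "'a::euclidean_space \<Rightarrow> ennreal"
  assumes [measurable]: "f \<in> borel_measurable borel" and s: "s > 0"
  shows "(\<integral>\<^sup>+ x. f x \<partial>lborel) = ennreal (s ^ DIM('a)) * (\<integral>\<^sup>+ x. f (s *\<^sub>R x) \<partial>lborel)"
proof -
  have "(lborel :: 'a measure) = density (distr lborel borel (\<lambda>x. 0 + s *\<^sub>R x)) (\<lambda>_. \<bar>s\<bar> ^ DIM('a))"
    using s by (intro lborel_affine) simp
  then have "(\<integral>\<^sup>+ x. f x \<partial>lborel) = (\<integral>\<^sup>+ x. f x \<partial>density (distr lborel borel (\<lambda>x::'a. s *\<^sub>R x)) (\<lambda>_. ennreal (s ^ DIM('a))))"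
    using s by (simp add: ennreal_power)
  also have "\<dots> = (\<integral>\<^sup>+ x. ennreal (s ^ DIM('a)) * f x \<partial>distr lborel borel (\<lambda>x::'a. s *\<^sub>R x))"
    by (subst nn_integral_density) auto
  also have "\<dots> = (\<integral>\<^sup>+ x. ennreal (s ^ DIM('a)) * f (s *\<^sub>R x) \<partial>lborel)"
    by (subst nn_integral_distr) auto
  finally show ?thesis by (simp add: nn_integral_cmult)
qed

lemma lborel_integral_product:
  fixes f :: "'a::euclidean_space \<Rightarrow> real \<Rightarrow> 'c::{real_normed_field, banach, second_countable_topology}"
  assumes f: "\<And>b. b \<in> Basis \<Longrightarrow> integrable lborel (f b)"
  shows "(LINT x|lborel. (\<Prod>b\<in>Basis. f b (x \<bullet> b))) = (\<Prod>b\<in>Basis. (LINT t|lborel. f b t))"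
    and "integrable lborel (\<lambda>x::'a. \<Prod>b\<in>Basis. f b (x \<bullet> b))"
proof -
  interpret product_sigma_finite "\<lambda>b::'a. lborel :: real measure" ..
  have fm [measurable]: "f b \<in> borel_measurable borel" if "b \<in> Basis" for b
    using f[OF that] by auto
  have [measurable]: "(\<lambda>x::'a. \<Prod>b\<in>Basis. f b (x \<bullet> b)) \<in> borel_measurable borel"
    by (intro borel_measurable_prod measurable_compose[OF _ fm]) auto
  have T [measurable]: "(\<lambda>w. \<Sum>b\<in>Basis. w b *\<^sub>R b) \<in> (\<Pi>\<^sub>M b\<in>(Basis::'a set). lborel) \<rightarrow>\<^sub>M borel"
    by measurable
  have eq: "(\<Prod>b\<in>Basis. f b ((\<Sum>b'\<in>Basis. w b' *\<^sub>R b') \<bullet> b)) = (\<Prod>b\<in>Basis. f b (w b))" for w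
    by (intro prod.cong refl) (simp add: inner_sum_left inner_Basis if_distrib cong: if_cong)
  have "(LINT x|lborel. (\<Prod>b\<in>Basis. f b (x \<bullet> b))) = (LINT w|(\<Pi>\<^sub>M b\<in>(Basis::'a set). lborel). (\<Prod>b\<in>Basis. f b (w b)))"
    by (subst lborel_eq, subst integral_distr) (auto simp: eq)
  also have "\<dots> = (\<Prod>b\<in>Basis. (LINT t|lborel. f b t))"
    using f by (intro product_integral_prod) auto
  finally show "(LINT x|lborel. (\<Prod>b\<in>Basis. f b (x \<bullet> b))) = (\<Prod>b\<in>Basis. (LINT t|lborel. f b t))" .
  have "integrable (\<Pi>\<^sub>M b\<in>(Basis::'a set). lborel) (\<lambda>w. \<Prod>b\<in>Basis. f b (w b))"
    using f by (intro product_integrable_prod) auto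
  then show "integrable lborel (\<lambda>x::'a. \<Prod>b\<in>Basis. f b (x \<bullet> b))"
    by (subst lborel_eq, subst integrable_distr_eq) (auto simp: eq)
qed

definition gaussian :: "'a::euclidean_space \<Rightarrow> real" where
  "gaussian x = (\<Prod>b\<in>Basis. std_normal_density (x \<bullet> b))"

lemma gaussian_nonneg: "gaussian x \<ge> 0"
  unfolding gaussian_def by (intro prod_nonneg) auto

lemma gaussian_integral: "integrable lborel (gaussian :: 'a::euclidean_space \<Rightarrow> real)" "(LINT x|lborel. gaussian (x :: 'a)) = 1"
  using lborel_integral_product[of "\<lambda>b::'a. std_normal_density"] by (auto simp: gaussian_def[abs_def])

lemma gaussian_measurable [measurable]: "gaussian \<in> borel_measurable borel"
  using gaussian_integral(1) by auto

text \<open>The factor \<open>(2 \<pi>)\<^sup>-\<^sup>d\<^sup>/\<^sup>2\<close> of Fourier inversion in dimension \<open>d\<close>.\<close>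

definition gauss_const :: "'a::euclidean_space itself \<Rightarrow> real" where
  "gauss_const _ = (1 / sqrt (2 * pi)) ^ DIM('a)"

lemma gaussian_eq: "gaussian (x :: 'a::euclidean_space) = gauss_const TYPE('a) * (\<Prod>b\<in>Basis. exp (- (x \<bullet> b)\<^sup>2 / 2))"
  unfolding gaussian_def gauss_const_def std_normal_density_def prod.distrib by simp

lemma gauss_const_pos: "gauss_const TYPE('a::euclidean_space) > 0"
  by (simp add: gauss_const_def)

lemma gaussian_le: "gaussian (x :: 'a::euclidean_space) \<le> gauss_const TYPE('a)"
proof -
  have "(\<Prod>b\<in>Basis. exp (- (x \<bullet> b)\<^sup>2 / 2)) \<le> 1" by (intro prod_le_1) auto
  then show ?thesis unfolding gaussian_eq using gauss_const_pos[where 'a = 'a] by (simp add: mult_left_le)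
qed

text \<open>The Gaussian is its own Fourier transform, coordinate by coordinate.\<close>

lemma gaussian_cos_integral:
  fixes z :: "'a::euclidean_space"
  shows "gauss_const TYPE('a) * (LINT \<xi>|lborel. gaussian \<xi> * cos (\<xi> \<bullet> z)) = gaussian z"
proof -
  have one: "(LINT t|lborel. complex_of_real (std_normal_density t) * cis (t * u)) = complex_of_real (exp (- u\<^sup>2 / 2))" for u
  proof -
    have "char std_normal_distribution u = (LINT t|lborel. std_normal_density t *\<^sub>R iexp (u * t))"
      unfolding char_def by (subst integral_density) auto
    then show ?thesis by (simp add: char_std_normal_distribution scaleR_conv_of_real cis_conv_exp mult_ac)
  qed
  have int: "integrable lborel (\<lambda>t. complex_of_real (std_normal_density t) * cis (t * u))" for u
  proof (rule Bochner_Integration.integrable_bound)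
    show "integrable lborel std_normal_density" by simp
    have [measurable]: "cis \<in> borel_measurable borel" by (intro borel_measurable_continuous_onI continuous_intros)
    show "(\<lambda>t. complex_of_real (std_normal_density t) * cis (t * u)) \<in> borel_measurable lborel" by measurable
  qed (auto simp: norm_mult)
  have prod: "(\<Prod>b\<in>Basis. complex_of_real (std_normal_density (\<xi> \<bullet> b)) * cis ((\<xi> \<bullet> b) * (z \<bullet> b))) = complex_of_real (gaussian \<xi>) * cis (\<xi> \<bullet> z)" for \<xi> :: 'a
  proof -
    have "(\<Prod>b\<in>(Basis::'a set). cis ((\<xi> \<bullet> b) * (z \<bullet> b))) = cis (\<Sum>b\<in>Basis. (\<xi> \<bullet> b) * (z \<bullet> b))"
      by (induction rule: finite_induct[OF finite_Basis]) (auto simp: cis_mult)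
    then show ?thesis by (simp add: prod.distrib gaussian_def euclidean_inner[of \<xi> z])
  qed
  have "(LINT \<xi>|lborel. complex_of_real (gaussian \<xi>) * cis (\<xi> \<bullet> z)) = (\<Prod>b\<in>Basis. complex_of_real (exp (- (z \<bullet> b)\<^sup>2 / 2)))"
    using lborel_integral_product(1)[of "\<lambda>b t. complex_of_real (std_normal_density t) * cis (t * (z \<bullet> b))"] int
    by (simp add: prod one)
  then have "Re (LINT \<xi>|lborel. complex_of_real (gaussian \<xi>) * cis (\<xi> \<bullet> z)) = (\<Prod>b\<in>Basis. exp (- (z \<bullet> b)\<^sup>2 / 2))"
    by (simp flip: of_real_prod)
  moreover have "integrable lborel (\<lambda>\<xi>. complex_of_real (gaussian \<xi>) * cis (\<xi> \<bullet> z))"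
    using lborel_integral_product(2)[of "\<lambda>b t. complex_of_real (std_normal_density t) * cis (t * (z \<bullet> b))"] int
    by (simp add: prod)
  from integral_Re[OF this] have "Re (LINT \<xi>|lborel. complex_of_real (gaussian \<xi>) * cis (\<xi> \<bullet> z)) = (LINT \<xi>|lborel. gaussian \<xi> * cos (\<xi> \<bullet> z))"
    by (simp add: cis.simps)
  ultimately show ?thesis by (simp add: gaussian_eq)
qed

text \<open>The real and the imaginary part (up to sign) of the Fourier transform, kept apart because the values lie
  in a real vector space.\<close>

definition cos_tr :: "('a::euclidean_space, 'b::euclidean_space) l2 \<Rightarrow> 'a \<Rightarrow> 'b" where
  "cos_tr a \<xi> = (LINT x|lborel. cos (\<xi> \<bullet> x) *\<^sub>R fn a x)"

definition sin_tr :: "('a::euclidean_space, 'b::euclidean_space) l2 \<Rightarrow> 'a \<Rightarrow> 'b" where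
  "sin_tr a \<xi> = (LINT x|lborel. sin (\<xi> \<bullet> x) *\<^sub>R fn a x)"

lemma cos_tr_measurable [measurable]: "cos_tr a \<in> borel_measurable borel"
  and sin_tr_measurable [measurable]: "sin_tr a \<in> borel_measurable borel"
  unfolding cos_tr_def[abs_def] sin_tr_def[abs_def] by measurable

lemma integrable_trig_scaleR:
  fixes f :: "'a::euclidean_space \<Rightarrow> 'b::euclidean_space"
  assumes "integrable lborel f" "h \<in> borel_measurable borel" "\<And>x. \<bar>h x\<bar> \<le> 1"
  shows "integrable lborel (\<lambda>x. h x *\<^sub>R f x)"
proof (rule Bochner_Integration.integrable_bound[OF assms(1)])
  show "AE x in lborel. norm (h x *\<^sub>R f x) \<le> norm (f x)"
    using assms(3) by (intro AE_I2) (simp add: mult_left_le_one_le)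
qed (use assms in auto)

lemma trig_integrable:
  fixes f :: "'a::euclidean_space \<Rightarrow> 'b::euclidean_space"
  assumes "integrable lborel f"
  shows "integrable lborel (\<lambda>x. cos (\<xi> \<bullet> x) *\<^sub>R f x)" "integrable lborel (\<lambda>x. sin (\<xi> \<bullet> x) *\<^sub>R f x)"
  using assms by (auto intro!: integrable_trig_scaleR)

text \<open>The real part of the inner product of the two Fourier transforms.\<close>

definition spectral :: "('a::euclidean_space, 'b::euclidean_space) l2 \<Rightarrow> ('a, 'b) l2 \<Rightarrow> 'a \<Rightarrow> real" where
  "spectral a b \<xi> = cos_tr a \<xi> \<bullet> cos_tr b \<xi> + sin_tr a \<xi> \<bullet> sin_tr b \<xi>"

lemma spectral_measurable [measurable]: "spectral a b \<in> borel_measurable borel"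
  unfolding spectral_def[abs_def] by measurable

lemma spectral_self_nonneg: "spectral a a \<xi> \<ge> 0"
  by (simp add: spectral_def)

lemma spectral_self: "spectral a a \<xi> = (norm (cos_tr a \<xi>))\<^sup>2 + (norm (sin_tr a \<xi>))\<^sup>2"
  by (simp add: spectral_def power2_norm_eq_inner)

lemma spectral_Cauchy_Schwarz: "\<bar>spectral a b \<xi>\<bar> \<le> sqrt (spectral a a \<xi>) * sqrt (spectral b b \<xi>)"
  using Cauchy_Schwarz_ineq2[of "(cos_tr a \<xi>, sin_tr a \<xi>)" "(cos_tr b \<xi>, sin_tr b \<xi>)"]
  by (simp add: spectral_def norm_eq_sqrt_inner inner_prod_def)

text \<open>Testing the pair of transforms against itself and moving the trigonometric factors inside.\<close>

lemma spectral_le_L1: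
  assumes a: "integrable lborel (fn a)"
  shows "sqrt (spectral a a \<xi>) \<le> (LINT x|lborel. norm (fn a x))"
proof -
  define N where "N = sqrt (spectral a a \<xi>)"
  have N0: "N \<ge> 0" by (simp add: N_def spectral_self_nonneg)
  have pt: "\<bar>(cos (\<xi> \<bullet> x) *\<^sub>R fn a x) \<bullet> cos_tr a \<xi> + (sin (\<xi> \<bullet> x) *\<^sub>R fn a x) \<bullet> sin_tr a \<xi>\<bar> \<le> N * norm (fn a x)" for x
  proof -
    have "\<bar>(cos (\<xi> \<bullet> x) *\<^sub>R fn a x, sin (\<xi> \<bullet> x) *\<^sub>R fn a x) \<bullet> (cos_tr a \<xi>, sin_tr a \<xi>)\<bar>
      \<le> norm (cos (\<xi> \<bullet> x) *\<^sub>R fn a x, sin (\<xi> \<bullet> x) *\<^sub>R fn a x) * norm (cos_tr a \<xi>, sin_tr a \<xi>)"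
      by (rule Cauchy_Schwarz_ineq2)
    also have "norm (cos_tr a \<xi>, sin_tr a \<xi>) = N"
      by (simp add: N_def spectral_self norm_Pair)
    also have "norm (cos (\<xi> \<bullet> x) *\<^sub>R fn a x, sin (\<xi> \<bullet> x) *\<^sub>R fn a x) = norm (fn a x)"
    proof -
      have "(cos (\<xi> \<bullet> x))\<^sup>2 * (norm (fn a x))\<^sup>2 + (sin (\<xi> \<bullet> x))\<^sup>2 * (norm (fn a x))\<^sup>2 = (norm (fn a x))\<^sup>2"
        by (simp flip: distrib_right)
      then show ?thesis by (simp add: norm_Pair power_mult_distrib)
    qed
    finally show ?thesis by (simp add: inner_prod_def mult.commute)
  qed
  have "N * N = cos_tr a \<xi> \<bullet> cos_tr a \<xi> + sin_tr a \<xi> \<bullet> sin_tr a \<xi>"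
    by (simp add: N_def spectral_self_nonneg) (simp add: spectral_def)
  also have "\<dots> = (LINT x|lborel. (cos (\<xi> \<bullet> x) *\<^sub>R fn a x) \<bullet> cos_tr a \<xi>) + (LINT x|lborel. (sin (\<xi> \<bullet> x) *\<^sub>R fn a x) \<bullet> sin_tr a \<xi>)"
    using trig_integrable[OF a, of \<xi>] by (simp only: integral_inner_left cos_tr_def[of a \<xi>] sin_tr_def[of a \<xi>])
  also have "\<dots> = (LINT x|lborel. (cos (\<xi> \<bullet> x) *\<^sub>R fn a x) \<bullet> cos_tr a \<xi> + (sin (\<xi> \<bullet> x) *\<^sub>R fn a x) \<bullet> sin_tr a \<xi>)"
    using trig_integrable[OF a, of \<xi>] by (intro Bochner_Integration.integral_add[symmetric] integrable_inner_left) auto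
  also have "\<dots> \<le> (LINT x|lborel. N * norm (fn a x))"
  proof (rule integral_mono)
    show "integrable lborel (\<lambda>x. (cos (\<xi> \<bullet> x) *\<^sub>R fn a x) \<bullet> cos_tr a \<xi> + (sin (\<xi> \<bullet> x) *\<^sub>R fn a x) \<bullet> sin_tr a \<xi>)"
      using trig_integrable[OF a, of \<xi>] by (intro Bochner_Integration.integrable_add integrable_inner_left) auto
    show "(cos (\<xi> \<bullet> x) *\<^sub>R fn a x) \<bullet> cos_tr a \<xi> + (sin (\<xi> \<bullet> x) *\<^sub>R fn a x) \<bullet> sin_tr a \<xi> \<le> N * norm (fn a x)" for x
      using pt[of x] by linarith
  qed (use a in auto)
  finally have "N * N \<le> N * (LINT x|lborel. norm (fn a x))" by simp
  then show ?thesis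
    using N0 by (cases "N = 0") (auto simp: N_def[symmetric])
qed

text \<open>The Wiener-Khinchin relation: the product of the transforms is the transform of the correlation.\<close>

lemma spectral_correlation:
  fixes a b :: "(real^'d, 'b::euclidean_space) l2"
  assumes a: "integrable lborel (fn a)" and b: "integrable lborel (fn b)"
  shows "integrable lborel (\<lambda>w. inner (shift w a) b)"
    and "spectral a b \<xi> = (LINT w|lborel. cos (\<xi> \<bullet> w) * inner (shift w a) b)"
proof -
  have G: "inner (shift w a) b = (LINT x|lborel. fn a (x - w) \<bullet> fn b x)" for w
    using inner_cls[OF sqi_shift[OF sqi_fn[of a], of w] sqi_fn[of b]] by (simp add: shift_def)
  have flip: "(LINT w|lborel. h (x - w)) = (LINT w|lborel. h w)" if "h \<in> borel_measurable borel" for h :: "real^'d \<Rightarrow> 'c::{banach, second_countable_topology}" and x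
    using lborel_integral_uminus[of "\<lambda>w. h (x + w)"] lborel_integral_translation[OF that, of x] that by simp
  have int_refl: "integrable lborel (\<lambda>w. h (x - w))" if "integrable lborel h" for h :: "real^'d \<Rightarrow> real" and x
  proof (rule integrableI_bounded)
    have [measurable]: "h \<in> borel_measurable borel" using that by auto
    show "(\<lambda>w. h (x - w)) \<in> borel_measurable lborel" by simp
    have "(\<integral>\<^sup>+ w. ennreal (norm (h (x - w))) \<partial>lborel) = (\<integral>\<^sup>+ w. ennreal (norm (h w)) \<partial>lborel)"
    proof -
      have rf: "(lborel :: (real^'d) measure) = distr lborel borel (\<lambda>w. x + (- 1) *\<^sub>R w)"
        using lborel_affine[of "- 1" x] by (simp add: density_1)
      show ?thesis by (subst (2) rf, subst nn_integral_distr) auto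
    qed
    then show "(\<integral>\<^sup>+ w. ennreal (norm (h (x - w))) \<partial>lborel) < \<infinity>"
      using that by (simp add: integrable_iff_bounded)
  qed
  have na: "integrable lborel (\<lambda>x. norm (fn a x))" and nb: "integrable lborel (\<lambda>x. norm (fn b x))" using a b by auto
  have pair: "integrable (lborel \<Otimes>\<^sub>M lborel) (\<lambda>(x, w). h w * (fn a (x - w) \<bullet> fn b x))" if [measurable]: "h \<in> borel_measurable borel" and h1: "\<And>w. \<bar>h w\<bar> \<le> 1" for h
  proof (rule lborel_pair.Fubini_integrable)
    show "(\<lambda>(x, w). h w * (fn a (x - w) \<bullet> fn b x)) \<in> borel_measurable (lborel \<Otimes>\<^sub>M lborel)"
      unfolding measurable_lborel1 by measurable
    have bd: "\<bar>h w * (fn a (x - w) \<bullet> fn b x)\<bar> \<le> norm (fn a (x - w)) * norm (fn b x)" for x w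
    proof -
      have "\<bar>h w\<bar> * \<bar>fn a (x - w) \<bullet> fn b x\<bar> \<le> 1 * (norm (fn a (x - w)) * norm (fn b x))"
        using h1 Cauchy_Schwarz_ineq2 by (intro mult_mono) auto
      then show ?thesis by (simp add: abs_mult)
    qed
    have i1: "integrable lborel (\<lambda>w. norm (fn a (x - w)) * norm (fn b x))" for x
      using int_refl[OF na, of x] by simp
    have i2: "integrable lborel (\<lambda>w. h w * (fn a (x - w) \<bullet> fn b x))" for x
      using bd by (intro Bochner_Integration.integrable_bound[OF i1[of x]]) (auto simp: abs_mult)
    then show "AE x in lborel. integrable lborel (\<lambda>w. case (x, w) of (x, w) \<Rightarrow> h w * (fn a (x - w) \<bullet> fn b x))" by simp
    show "integrable lborel (\<lambda>x. LINT w|lborel. norm (case (x, w) of (x, w) \<Rightarrow> h w * (fn a (x - w) \<bullet> fn b x)))"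
    proof (rule Bochner_Integration.integrable_bound)
      show "integrable lborel (\<lambda>x. (LINT w|lborel. norm (fn a w)) * norm (fn b x))" using nb by simp
      show "(\<lambda>x. LINT w|lborel. norm (case (x, w) of (x, w) \<Rightarrow> h w * (fn a (x - w) \<bullet> fn b x))) \<in> borel_measurable lborel"
        by measurable
      have "(LINT w|lborel. \<bar>h w * (fn a (x - w) \<bullet> fn b x)\<bar>) \<le> (LINT w|lborel. norm (fn a w)) * norm (fn b x)" for x
      proof -
        have "(LINT w|lborel. \<bar>h w * (fn a (x - w) \<bullet> fn b x)\<bar>) \<le> (LINT w|lborel. norm (fn a (x - w)) * norm (fn b x))"
          using i1[of x] i2[of x] bd by (intro integral_mono) auto
        then show ?thesis using flip[of "\<lambda>w. norm (fn a w)" x] by simp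
      qed
      then show "AE x in lborel. norm (LINT w|lborel. norm (case (x, w) of (x, w) \<Rightarrow> h w * (fn a (x - w) \<bullet> fn b x))) \<le> norm ((LINT w|lborel. norm (fn a w)) * norm (fn b x))"
        by (intro AE_I2) (auto simp: abs_mult)
    qed
  qed
  have sw: "(LINT w|lborel. LINT x|lborel. h w * (fn a (x - w) \<bullet> fn b x)) = (LINT x|lborel. LINT w|lborel. h w * (fn a (x - w) \<bullet> fn b x))" if "h \<in> borel_measurable borel" "\<And>w. \<bar>h w\<bar> \<le> 1" for h
    by (rule lborel_pair.Fubini_integral[OF pair[OF that]])
  show "integrable lborel (\<lambda>w. inner (shift w a) b)"
    using lborel_pair.integrable_snd[OF pair[of "\<lambda>_. 1"]] by (simp add: G)
  have "spectral a b \<xi> = (LINT x|lborel. (cos (\<xi> \<bullet> x) *\<^sub>R fn b x) \<bullet> cos_tr a \<xi>) + (LINT x|lborel. (sin (\<xi> \<bullet> x) *\<^sub>R fn b x) \<bullet> sin_tr a \<xi>)"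
    unfolding spectral_def inner_commute[of "cos_tr a \<xi>"] inner_commute[of "sin_tr a \<xi>"]
    using trig_integrable[OF b, of \<xi>] by (simp only: integral_inner_left cos_tr_def[of b \<xi>] sin_tr_def[of b \<xi>])
  also have "\<dots> = (LINT x|lborel. (cos (\<xi> \<bullet> x) *\<^sub>R fn b x) \<bullet> cos_tr a \<xi> + (sin (\<xi> \<bullet> x) *\<^sub>R fn b x) \<bullet> sin_tr a \<xi>)"
    using trig_integrable[OF b, of \<xi>] by (intro Bochner_Integration.integral_add[symmetric] integrable_inner_left) auto
  also have "\<dots> = (LINT x|lborel. LINT w|lborel. cos (\<xi> \<bullet> w) * (fn a (x - w) \<bullet> fn b x))"
  proof (intro Bochner_Integration.integral_cong refl)
    fix x
    have "(LINT w|lborel. cos (\<xi> \<bullet> w) * (fn a (x - w) \<bullet> fn b x)) = (LINT y|lborel. cos (\<xi> \<bullet> (x - y)) * (fn a y \<bullet> fn b x))"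
      using flip[of "\<lambda>y. cos (\<xi> \<bullet> (x - y)) * (fn a y \<bullet> fn b x)" x] by simp
    also have "\<dots> = (LINT y|lborel. (cos (\<xi> \<bullet> y) *\<^sub>R fn a y) \<bullet> (cos (\<xi> \<bullet> x) *\<^sub>R fn b x) + (sin (\<xi> \<bullet> y) *\<^sub>R fn a y) \<bullet> (sin (\<xi> \<bullet> x) *\<^sub>R fn b x))"
      by (intro Bochner_Integration.integral_cong refl) (simp add: inner_diff_right cos_diff algebra_simps)
    also have "\<dots> = (LINT y|lborel. (cos (\<xi> \<bullet> y) *\<^sub>R fn a y) \<bullet> (cos (\<xi> \<bullet> x) *\<^sub>R fn b x)) + (LINT y|lborel. (sin (\<xi> \<bullet> y) *\<^sub>R fn a y) \<bullet> (sin (\<xi> \<bullet> x) *\<^sub>R fn b x))"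
      using trig_integrable[OF a, of \<xi>] by (intro Bochner_Integration.integral_add integrable_inner_left) auto
    also have "\<dots> = cos_tr a \<xi> \<bullet> (cos (\<xi> \<bullet> x) *\<^sub>R fn b x) + sin_tr a \<xi> \<bullet> (sin (\<xi> \<bullet> x) *\<^sub>R fn b x)"
      using trig_integrable[OF a, of \<xi>] by (simp only: integral_inner_left cos_tr_def[of a \<xi>] sin_tr_def[of a \<xi>])
    finally show "(cos (\<xi> \<bullet> x) *\<^sub>R fn b x) \<bullet> cos_tr a \<xi> + (sin (\<xi> \<bullet> x) *\<^sub>R fn b x) \<bullet> sin_tr a \<xi> = (LINT w|lborel. cos (\<xi> \<bullet> w) * (fn a (x - w) \<bullet> fn b x))"
      by (simp only: inner_commute)
  qed
  also have "\<dots> = (LINT w|lborel. LINT x|lborel. cos (\<xi> \<bullet> w) * (fn a (x - w) \<bullet> fn b x))"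
    by (rule sw[symmetric]) auto
  finally show "spectral a b \<xi> = (LINT w|lborel. cos (\<xi> \<bullet> w) * inner (shift w a) b)" by (simp add: G)
qed

text \<open>Plancherel's identity, smoothed by a Gaussian of width \<open>s\<close>.\<close>

lemma gaussian_Plancherel:
  fixes a b :: "(real^'d, 'b::euclidean_space) l2"
  assumes a: "integrable lborel (fn a)" and b: "integrable lborel (fn b)" and s: "s > 0"
  shows "s ^ DIM(real^'d) * inner (conv s gaussian a) b
    = gauss_const TYPE(real^'d) * (LINT \<xi>|lborel. gaussian \<xi> * spectral a b ((1 / s) *\<^sub>R \<xi>))"
proof -
  define G where "G = (\<lambda>w. inner (shift w a) b)"
  have G: "integrable lborel G" unfolding G_def by (rule spectral_correlation(1)[OF a b])
  have [measurable]: "G \<in> borel_measurable borel" using G by auto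
  have "s ^ DIM(real^'d) * inner (conv s gaussian a) b = s ^ DIM(real^'d) *\<^sub>R (LINT z|lborel. gaussian ((1 / s) *\<^sub>R (s *\<^sub>R z)) * G (s *\<^sub>R z))"
    using s by (simp add: inner_conv[OF gaussian_integral(1)] G_def)
  also have "\<dots> = (LINT w|lborel. gaussian ((1 / s) *\<^sub>R w) * G w)"
    using s by (intro lborel_integral_scale[symmetric]) auto
  also have "\<dots> = (LINT w|lborel. LINT \<xi>|lborel. gauss_const TYPE(real^'d) * (G w * gaussian \<xi> * cos (\<xi> \<bullet> ((1 / s) *\<^sub>R w))))"
  proof (intro Bochner_Integration.integral_cong refl)
    fix w :: "real^'d"
    have "(LINT \<xi>|lborel. gauss_const TYPE(real^'d) * (G w * gaussian \<xi> * cos (\<xi> \<bullet> ((1 / s) *\<^sub>R w))))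
      = (gauss_const TYPE(real^'d) * (LINT \<xi>|lborel. gaussian \<xi> * cos (\<xi> \<bullet> ((1 / s) *\<^sub>R w)))) * G w"
      by (simp add: mult.assoc mult.left_commute)
    then show "gaussian ((1 / s) *\<^sub>R w) * G w = (LINT \<xi>|lborel. gauss_const TYPE(real^'d) * (G w * gaussian \<xi> * cos (\<xi> \<bullet> ((1 / s) *\<^sub>R w))))"
      unfolding gaussian_cos_integral by simp
  qed
  also have "\<dots> = gauss_const TYPE(real^'d) * (LINT w|lborel. LINT \<xi>|lborel. G w * gaussian \<xi> * cos (\<xi> \<bullet> ((1 / s) *\<^sub>R w)))"
    by simp
  also have "(LINT w|lborel. LINT \<xi>|lborel. G w * gaussian \<xi> * cos (\<xi> \<bullet> ((1 / s) *\<^sub>R w))) = (LINT \<xi>|lborel. LINT w|lborel. G w * gaussian \<xi> * cos (\<xi> \<bullet> ((1 / s) *\<^sub>R w)))"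
    by (rule lborel_pair.Fubini_integral[symmetric], rule integrable_product_bounded[OF G gaussian_integral(1), of _ 1]) auto
  also have "\<dots> = (LINT \<xi>|lborel. gaussian \<xi> * spectral a b ((1 / s) *\<^sub>R \<xi>))"
    by (intro Bochner_Integration.integral_cong refl) (simp add: spectral_correlation(2)[OF a b] G_def mult_ac)
  finally show ?thesis .
qed

lemma gaussian_spectral_integrable:
  fixes a b :: "(real^'d, 'b::euclidean_space) l2"
  assumes a: "integrable lborel (fn a)" and b: "integrable lborel (fn b)"
  shows "integrable lborel (\<lambda>\<xi>. gaussian \<xi> * spectral a b (r *\<^sub>R \<xi>))"
proof (rule Bochner_Integration.integrable_bound)
  let ?B = "(LINT x|lborel. norm (fn a x)) * (LINT x|lborel. norm (fn b x))"
  show "integrable lborel (\<lambda>\<xi>::real^'d. gaussian \<xi> * ?B)" using gaussian_integral(1) by auto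
  have "\<bar>spectral a b \<xi>\<bar> \<le> ?B" for \<xi>
  proof -
    have "\<bar>spectral a b \<xi>\<bar> \<le> sqrt (spectral a a \<xi>) * sqrt (spectral b b \<xi>)" by (rule spectral_Cauchy_Schwarz)
    also have "\<dots> \<le> ?B"
      using spectral_le_L1[OF a] spectral_le_L1[OF b] by (intro mult_mono) (auto simp: spectral_self_nonneg)
    finally show ?thesis .
  qed
  then have "\<bar>spectral a b \<xi>\<bar> \<le> \<bar>?B\<bar>" for \<xi> by (metis abs_ge_self order_trans)
  then show "AE \<xi> in lborel. norm (gaussian \<xi> * spectral a b (r *\<^sub>R \<xi>)) \<le> norm (gaussian \<xi> * ?B)"
    unfolding real_norm_def abs_mult[of "gaussian _"] by (intro AE_I2 mult_left_mono) auto
qed auto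

lemma norm_conv_gaussian_le:
  fixes a :: "(real^'d, 'b::euclidean_space) l2"
  shows "inner (conv s gaussian a) a \<le> (norm a)\<^sup>2"
proof -
  have "inner (conv s gaussian a) a \<le> (LINT z|lborel. gaussian (z :: real^'d) * (norm a)\<^sup>2)"
    unfolding inner_conv[OF gaussian_integral(1)]
  proof (rule integral_mono)
    show "integrable lborel (\<lambda>z. gaussian z * inner (shift (s *\<^sub>R z) a) a)"
      by (rule kernel_shift_integrable[OF gaussian_integral(1)])
    show "integrable lborel (\<lambda>z::real^'d. gaussian z * (norm a)\<^sup>2)" using gaussian_integral(1) by auto
    show "gaussian z * inner (shift (s *\<^sub>R z) a) a \<le> gaussian z * (norm a)\<^sup>2" for z
      using norm_cauchy_schwarz[of "shift (s *\<^sub>R z) a" a] gaussian_nonneg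
      by (intro mult_left_mono) (auto simp: power2_eq_square)
  qed
  then show ?thesis by (simp add: gaussian_integral)
qed

lemma conv_gaussian_tendsto:
  "(\<lambda>n. inner (conv (inverse (real (Suc n))) gaussian a) b) \<longlonglongrightarrow> inner a b"
  for a b :: "(real^'d, 'b::euclidean_space) l2"
  by (intro tendsto_intros conv_tendsto gaussian_integral gaussian_nonneg LIMSEQ_inverse_real_of_nat)

text \<open>Compare the two sides of the smoothed Plancherel identity and let the width tend to \<open>0\<close>.\<close>

lemma norm_le_if_spectral_le:
  fixes a :: "(real^'d, 'b::euclidean_space) l2" and b :: "(real^'d, 'c::euclidean_space) l2"
  assumes a: "integrable lborel (fn a)" and b: "integrable lborel (fn b)"
    and le: "\<And>\<xi>. spectral a a \<xi> \<le> spectral b b \<xi>"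
  shows "norm a \<le> norm b"
proof (rule power2_le_imp_le)
  have "inner (conv s gaussian a) a \<le> inner (conv s gaussian b) b" if s: "s > 0" for s
  proof -
    have "s ^ DIM(real^'d) * inner (conv s gaussian a) a \<le> s ^ DIM(real^'d) * inner (conv s gaussian b) b"
      unfolding gaussian_Plancherel[OF a a s] gaussian_Plancherel[OF b b s]
      using gauss_const_pos[where 'a = "real^'d"] le gaussian_nonneg
      by (intro mult_left_mono integral_mono gaussian_spectral_integrable a b) auto
    then show ?thesis using s by simp
  qed
  then have "inner a a \<le> inner b b"
    by (intro LIMSEQ_le[OF conv_gaussian_tendsto conv_gaussian_tendsto]) auto
  then show "(norm a)\<^sup>2 \<le> (norm b)\<^sup>2" by (simp add: power2_norm_eq_inner)
qed simp

text \<open>The hypothesis holds if the transform of \<open>a\<close> is that of \<open>g\<close> times a multiplier whose square is at most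
  \<open>J\<close>. Since the transform of \<open>b\<close> is bounded by the \<open>L\<^sup>1\<close> norm, the Cauchy-Schwarz inequality under the
  smoothed Plancherel integral separates \<open>J\<close> from the transform of \<open>g\<close>. Thus \<open>a\<close>, as a functional on
  integrable functions, is bounded by the norm of \<open>g\<close>.\<close>

lemma inner_le_L1_if_multiplier:
  fixes a b :: "(real^'d, 'b::euclidean_space) l2" and g :: "(real^'d, 'c::euclidean_space) l2"
  assumes a: "integrable lborel (fn a)" and b: "integrable lborel (fn b)" and g: "integrable lborel (fn g)"
    and J [measurable]: "J \<in> borel_measurable borel" and J0: "\<And>\<xi>. J \<xi> \<ge> 0"
    and A: "(\<integral>\<^sup>+ \<xi>. ennreal (J \<xi>) \<partial>lborel) \<le> ennreal A" and A0: "A \<ge> 0"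
    and le: "\<And>\<xi>. spectral a a \<xi> \<le> J \<xi> * spectral g g \<xi>"
  shows "\<bar>inner a b\<bar> \<le> gauss_const TYPE(real^'d) * sqrt A * norm g * (LINT x|lborel. norm (fn b x))"
proof -
  define C where "C = gauss_const TYPE(real^'d)"
  define L where "L = (LINT x|lborel. norm (fn b x))"
  define d where "d = DIM(real^'d)"
  have C: "C > 0" unfolding C_def by (rule gauss_const_pos)
  have L: "L \<ge> 0" by (simp add: L_def)
  have main: "\<bar>inner (conv s gaussian a) b\<bar> \<le> C * sqrt A * norm g * L" if s: "s > 0" for s
  proof -
    define p where "p = (\<lambda>\<xi>. sqrt (gaussian \<xi> * J ((1 / s) *\<^sub>R \<xi>)))"
    define q where "q = (\<lambda>\<xi>. sqrt (gaussian \<xi> * spectral g g ((1 / s) *\<^sub>R \<xi>)))"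
    have sc: "(\<integral>\<^sup>+ \<xi>. ennreal (J ((1 / s) *\<^sub>R \<xi>)) \<partial>lborel) \<le> ennreal (s ^ d * A)"
    proof -
      have "(\<integral>\<^sup>+ \<xi>. ennreal (J ((1 / s) *\<^sub>R \<xi>)) \<partial>lborel) = ennreal (s ^ d) * (\<integral>\<^sup>+ \<xi>. ennreal (J \<xi>) \<partial>lborel)"
        unfolding d_def using s by (subst lborel_nn_integral_scale[OF _ s]) auto
      also have "\<dots> \<le> ennreal (s ^ d) * ennreal A" by (rule mult_left_mono[OF A]) simp
      finally show ?thesis using s A0 by (simp add: ennreal_mult)
    qed
    have p2: "(\<integral>\<^sup>+ \<xi>. ennreal ((norm (p \<xi>))\<^sup>2) \<partial>lborel) \<le> ennreal (C * (s ^ d * A))"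
    proof -
      have "(\<integral>\<^sup>+ \<xi>. ennreal ((norm (p \<xi>))\<^sup>2) \<partial>lborel) \<le> (\<integral>\<^sup>+ \<xi>. ennreal C * ennreal (J ((1 / s) *\<^sub>R \<xi>)) \<partial>lborel)"
      proof (rule nn_integral_mono)
        fix \<xi> :: "real^'d"
        have "gaussian \<xi> * J ((1 / s) *\<^sub>R \<xi>) \<le> C * J ((1 / s) *\<^sub>R \<xi>)"
          using gaussian_le[of \<xi>] J0 by (intro mult_right_mono) (auto simp: C_def)
        then show "ennreal ((norm (p \<xi>))\<^sup>2) \<le> ennreal C * ennreal (J ((1 / s) *\<^sub>R \<xi>))"
          using C J0 gaussian_nonneg[of \<xi>] by (simp add: p_def ennreal_mult[symmetric] ennreal_leI)
      qed
      also have "\<dots> = ennreal C * (\<integral>\<^sup>+ \<xi>. ennreal (J ((1 / s) *\<^sub>R \<xi>)) \<partial>lborel)" by (rule nn_integral_cmult) simp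
      also have "\<dots> \<le> ennreal C * ennreal (s ^ d * A)" by (rule mult_left_mono[OF sc]) simp
      finally show ?thesis using C s A0 by (simp add: ennreal_mult)
    qed
    have p: "sqi p"
      unfolding sqi_def
    proof
      show "p \<in> borel_measurable borel" unfolding p_def by measurable
      then show "integrable lborel (\<lambda>\<xi>. (norm (p \<xi>))\<^sup>2)"
        using p2 by (intro integrableI_bounded) (auto simp: top_unique less_top[symmetric])
    qed
    have p_le: "(LINT \<xi>|lborel. (p \<xi>)\<^sup>2) \<le> C * (s ^ d * A)"
    proof -
      have "ennreal (LINT \<xi>|lborel. (p \<xi>)\<^sup>2) = (\<integral>\<^sup>+ \<xi>. ennreal ((norm (p \<xi>))\<^sup>2) \<partial>lborel)"
        using p by (subst nn_integral_eq_integral) (auto simp: sqi_def)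
      also note p2
      finally show ?thesis using C s A0 by (subst (asm) ennreal_le_iff) auto
    qed
    have q_sq: "(q \<xi>)\<^sup>2 = gaussian \<xi> * spectral g g ((1 / s) *\<^sub>R \<xi>)" for \<xi>
      by (simp add: q_def gaussian_nonneg spectral_self_nonneg)
    have q: "sqi q"
      unfolding sqi_def
    proof
      show "q \<in> borel_measurable borel" unfolding q_def by measurable
      show "integrable lborel (\<lambda>\<xi>. (norm (q \<xi>))\<^sup>2)"
        using gaussian_spectral_integrable[OF g g, of "1 / s"] by (simp add: q_sq)
    qed
    have q_le: "C * (LINT \<xi>|lborel. (q \<xi>)\<^sup>2) \<le> s ^ d * (norm g)\<^sup>2"
      unfolding q_sq C_def gaussian_Plancherel[OF g g s, symmetric] d_def
      using s norm_conv_gaussian_le by (intro mult_left_mono) auto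
    have pt: "\<bar>gaussian \<xi> * spectral a b ((1 / s) *\<^sub>R \<xi>)\<bar> \<le> L * (p \<xi> * q \<xi>)" for \<xi>
    proof -
      let ?z = "(1 / s) *\<^sub>R \<xi>"
      have "\<bar>spectral a b ?z\<bar> \<le> sqrt (spectral a a ?z) * sqrt (spectral b b ?z)" by (rule spectral_Cauchy_Schwarz)
      also have "\<dots> \<le> sqrt (J ?z * spectral g g ?z) * L"
        using le[of ?z] spectral_le_L1[OF b, of ?z] J0 by (intro mult_mono) (auto simp: L_def spectral_self_nonneg)
      finally have "gaussian \<xi> * \<bar>spectral a b ?z\<bar> \<le> gaussian \<xi> * (sqrt (J ?z * spectral g g ?z) * L)"
        by (rule mult_left_mono) (rule gaussian_nonneg)
      moreover have "p \<xi> * q \<xi> = gaussian \<xi> * sqrt (J ?z * spectral g g ?z)"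
        using gaussian_nonneg[of \<xi>] by (simp add: p_def q_def real_sqrt_mult)
      ultimately show ?thesis using gaussian_nonneg[of \<xi>] by (simp add: abs_mult mult_ac)
    qed
    have pq: "integrable lborel (\<lambda>\<xi>. p \<xi> * q \<xi>)" using sqi_inner_integrable[OF p q] by simp
    have "s ^ d * \<bar>inner (conv s gaussian a) b\<bar> = C * \<bar>LINT \<xi>|lborel. gaussian \<xi> * spectral a b ((1 / s) *\<^sub>R \<xi>)\<bar>"
    proof -
      have "\<bar>s ^ d * inner (conv s gaussian a) b\<bar> = \<bar>C * (LINT \<xi>|lborel. gaussian \<xi> * spectral a b ((1 / s) *\<^sub>R \<xi>))\<bar>"
        unfolding d_def C_def gaussian_Plancherel[OF a b s] ..
      then show ?thesis unfolding abs_mult using s C by simp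
    qed
    also have "\<dots> \<le> C * (LINT \<xi>|lborel. L * (p \<xi> * q \<xi>))"
    proof (rule mult_left_mono)
      show "\<bar>LINT \<xi>|lborel. gaussian \<xi> * spectral a b ((1 / s) *\<^sub>R \<xi>)\<bar> \<le> (LINT \<xi>|lborel. L * (p \<xi> * q \<xi>))"
        using pt pq gaussian_spectral_integrable[OF a b, of "1 / s"]
        by (intro order_trans[OF integral_abs_bound integral_mono]) auto
    qed (use C in simp)
    also have "\<dots> = C * L * (LINT \<xi>|lborel. p \<xi> * q \<xi>)" by simp
    also have "\<dots> \<le> C * L * (sqrt (LINT \<xi>|lborel. (p \<xi>)\<^sup>2) * sqrt (LINT \<xi>|lborel. (q \<xi>)\<^sup>2))"
      using integral_Cauchy_Schwarz[OF p q] C L by (intro mult_left_mono) auto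
    also have "\<dots> \<le> C * L * (sqrt (C * (s ^ d * A)) * sqrt (s ^ d * (norm g)\<^sup>2 / C))"
      using p_le q_le C L s A0 by (intro mult_left_mono mult_mono) (auto simp: field_simps)
    also have "sqrt (C * (s ^ d * A)) * sqrt (s ^ d * (norm g)\<^sup>2 / C) = s ^ d * (sqrt A * norm g)"
    proof -
      have "sqrt (C * (s ^ d * A)) * sqrt (s ^ d * (norm g)\<^sup>2 / C) = sqrt ((s ^ d)\<^sup>2 * (A * (norm g)\<^sup>2))"
        using C by (simp add: real_sqrt_mult[symmetric] power2_eq_square mult_ac)
      then show ?thesis using s by (simp add: real_sqrt_mult)
    qed
    finally have "s ^ d * \<bar>inner (conv s gaussian a) b\<bar> \<le> s ^ d * (C * sqrt A * norm g * L)" by (simp add: mult_ac)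
    then show ?thesis using s by simp
  qed
  have "(\<lambda>n. \<bar>inner (conv (inverse (real (Suc n))) gaussian a) b\<bar>) \<longlonglongrightarrow> \<bar>inner a b\<bar>"
    by (intro tendsto_rabs conv_gaussian_tendsto)
  then show ?thesis unfolding C_def[symmetric] L_def[symmetric]
    by (rule LIMSEQ_le_const2) (auto intro!: main)
qed

text \<open>In the plane, area is \<open>\<pi>\<close> times the length measured by the squared radius.\<close>

lemma nn_integral_radial_plane:
  fixes F :: "real \<Rightarrow> ennreal"
  assumes [measurable]: "F \<in> borel_measurable borel"
  shows "(\<integral>\<^sup>+ x. F ((norm (x :: real^2))\<^sup>2) \<partial>lborel) = ennreal pi * (\<integral>\<^sup>+ t. F t * indicator {0..} t \<partial>lborel)"
proof -
  define M where "M = distr (lborel :: (real^2) measure) borel (\<lambda>x. (norm x)\<^sup>2)"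
  define N where "N = density lborel (\<lambda>t::real. ennreal pi * indicator {0..} t)"
  have M_le: "emeasure M {..t} = (if t \<ge> 0 then ennreal (pi * t) else 0)" for t
  proof -
    have "emeasure M {..t} = emeasure (lborel :: (real^2) measure) {x. (norm x)\<^sup>2 \<le> t}"
      unfolding M_def by (subst emeasure_distr) (auto intro!: arg_cong[where f = "emeasure lborel"])
    also have "{x :: real^2. (norm x)\<^sup>2 \<le> t} = (if t \<ge> 0 then cball 0 (sqrt t) else {})"
    proof -
      have "t \<ge> 0 \<Longrightarrow> (norm x)\<^sup>2 \<le> t \<longleftrightarrow> norm x \<le> sqrt t" for x :: "real^2"
        using real_sqrt_le_iff[of "(norm x)\<^sup>2" t] by simp
      moreover have "\<not> t \<ge> 0 \<Longrightarrow> \<not> (norm x)\<^sup>2 \<le> t" for x :: "real^2"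
        using zero_le_power2[of "norm x"] by linarith
      ultimately show ?thesis by auto
    qed
    also have "emeasure lborel \<dots> = (if t \<ge> 0 then ennreal (pi * t) else 0)"
      by (simp add: emeasure_cball unit_ball_vol_2)
    finally show ?thesis .
  qed
  have N_le: "emeasure N {..t} = (if t \<ge> 0 then ennreal (pi * t) else 0)" for t
  proof -
    have "emeasure N {..t} = (\<integral>\<^sup>+ x. ennreal pi * indicator {0..t} x \<partial>lborel)"
      unfolding N_def by (subst emeasure_density) (auto intro!: nn_integral_cong simp: indicator_def)
    also have "\<dots> = ennreal pi * emeasure lborel {0..t}" by (simp add: nn_integral_cmult_indicator)
    finally show ?thesis by (simp add: ennreal_mult')
  qed
  have "M = N"
  proof (rule measure_eqI_generator_eq[where E = "range atMost" and \<Omega> = UNIV and A = "\<lambda>n. {..real n}"])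
    show "Int_stable (range (atMost :: real \<Rightarrow> real set))"
    proof (rule Int_stableI)
      fix a b :: "real set" assume "a \<in> range atMost" "b \<in> range atMost"
      then obtain s t where "a = {..s}" "b = {..t}" by auto
      then have "a \<inter> b = {..min s t}" by auto
      then show "a \<inter> b \<in> range atMost" by blast
    qed
    show "emeasure M X = emeasure N X" if "X \<in> range atMost" for X using that M_le N_le by auto
    have "sets borel = sigma_sets UNIV (range (atMost :: real \<Rightarrow> real set))"
      by (subst borel_eq_atMost) (simp add: sets_measure_of)
    then show "sets M = sigma_sets UNIV (range atMost)" "sets N = sigma_sets UNIV (range atMost)" by (auto simp: M_def N_def)
    show "(\<Union>n. {..real n}) = UNIV" by (auto intro: real_arch_simple)
    show "emeasure M {..real n} \<noteq> \<infinity>" for n by (simp add: M_le)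
  qed auto
  have "(\<integral>\<^sup>+ x. F ((norm (x :: real^2))\<^sup>2) \<partial>lborel) = (\<integral>\<^sup>+ t. F t \<partial>M)"
    unfolding M_def by (subst nn_integral_distr) auto
  also have "\<dots> = (\<integral>\<^sup>+ t. ennreal pi * (F t * indicator {0..} t) \<partial>lborel)"
    unfolding \<open>M = N\<close> N_def by (subst nn_integral_density) (auto simp: mult_ac)
  finally show ?thesis by (simp add: nn_integral_cmult)
qed

text \<open>In the variable \<open>t = |\<xi>|\<^sup>2\<close> the integrand is a multiple of a Cauchy density, whose mass on the whole line does
  not depend on its centre \<open>a\<close>.\<close>

lemma resolvent_symbol_integral:
  assumes \<eta>: "\<eta> > 0"
  shows "(\<integral>\<^sup>+ \<xi>. ennreal (1 / (((norm (\<xi> :: real^2))\<^sup>2 - a)\<^sup>2 + \<eta>\<^sup>2)) \<partial>lborel) \<le> ennreal (pi\<^sup>2 / \<eta>)"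
proof -
  let ?F = "\<lambda>t. arctan ((t - a) / \<eta>) / \<eta>"
  have pos: "(t - a)\<^sup>2 + \<eta>\<^sup>2 > 0" for t using \<eta> by (simp add: add_nonneg_pos)
  have D: "(?F has_real_derivative 1 / ((t - a)\<^sup>2 + \<eta>\<^sup>2)) (at t)" for t
  proof -
    have "inverse (1 + ((t - a) / \<eta>)\<^sup>2) * (1 / \<eta>) / \<eta> = 1 / ((t - a)\<^sup>2 + \<eta>\<^sup>2)"
    proof -
      have "1 + ((t - a) / \<eta>)\<^sup>2 = ((t - a)\<^sup>2 + \<eta>\<^sup>2) / \<eta>\<^sup>2"
        using \<eta> by (simp add: power_divide add_divide_distrib)
      then show ?thesis using \<eta> by (simp add: power2_eq_square)
    qed
    moreover have "(?F has_real_derivative inverse (1 + ((t - a) / \<eta>)\<^sup>2) * (1 / \<eta>) / \<eta>) (at t)"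
      using \<eta> by (auto intro!: derivative_eq_intros)
    ultimately show ?thesis by simp
  qed
  have "filterlim (\<lambda>t. (1 / \<eta>) * (- a + t)) at_top at_top"
    using \<eta> by (intro filterlim_tendsto_pos_mult_at_top[OF tendsto_const] filterlim_tendsto_add_at_top[OF tendsto_const] filterlim_ident) auto
  moreover have "(\<lambda>t. (1 / \<eta>) * (- a + t)) = (\<lambda>t. (t - a) / \<eta>)" by (auto simp: field_simps)
  ultimately have "filterlim (\<lambda>t. (t - a) / \<eta>) at_top at_top" by simp
  then have "((\<lambda>t. arctan ((t - a) / \<eta>)) \<longlongrightarrow> pi / 2) at_top"
    by (rule filterlim_compose[OF tendsto_arctan_at_top])
  then have lim: "(?F \<longlongrightarrow> pi / 2 / \<eta>) at_top" using \<eta> by (intro tendsto_divide tendsto_const) auto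
  have "(\<integral>\<^sup>+ t. ennreal (1 / ((t - a)\<^sup>2 + \<eta>\<^sup>2)) * indicator {0..} t \<partial>lborel) = pi / 2 / \<eta> - ?F 0"
    using lim D pos by (intro nn_integral_FTC_atLeast) (auto simp: less_imp_le)
  also have "\<dots> \<le> ennreal (pi / \<eta>)"
  proof (rule ennreal_leI)
    have "(pi / 2 - arctan ((0 - a) / \<eta>)) / \<eta> \<le> pi / \<eta>"
      using arctan_lbound[of "(0 - a) / \<eta>"] \<eta> by (intro divide_right_mono) auto
    then show "pi / 2 / \<eta> - arctan ((0 - a) / \<eta>) / \<eta> \<le> pi / \<eta>" by (simp only: diff_divide_distrib)
  qed
  finally have "ennreal pi * (\<integral>\<^sup>+ t. ennreal (1 / ((t - a)\<^sup>2 + \<eta>\<^sup>2)) * indicator {0..} t \<partial>lborel) \<le> ennreal pi * ennreal (pi / \<eta>)"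
    by (rule mult_left_mono) simp
  also have "\<dots> = ennreal (pi\<^sup>2 / \<eta>)" using \<eta> by (simp add: ennreal_mult[symmetric] power2_eq_square)
  finally show ?thesis
    by (subst nn_integral_radial_plane[where F = "\<lambda>t. ennreal (1 / ((t - a)\<^sup>2 + \<eta>\<^sup>2))"]) auto
qed

section \<open>Pointwise operations\<close>

definition pw :: "('b::euclidean_space \<Rightarrow> 'b) \<Rightarrow> ('a::euclidean_space, 'b) l2 \<Rightarrow> ('a, 'b) l2" where
  "pw A a = cls (\<lambda>x. A (fn a x))"

lemma fn_pw: "bounded_linear A \<Longrightarrow> AE x in lborel. fn (pw A a) x = A (fn a x)"
  unfolding pw_def by (rule fn_cls[OF sqi_linear[OF sqi_fn]])

lemma pw_add:
  assumes "bounded_linear A" shows "pw A (a + b) = pw A a + pw A b"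
proof -
  interpret A: bounded_linear A by fact
  show ?thesis
    by (rule l2_eqI) (use fn_pw[OF assms, of "a + b"] fn_add[of a b] fn_add[of "pw A a" "pw A b"]
      fn_pw[OF assms, of a] fn_pw[OF assms, of b] in \<open>eventually_elim, simp add: A.add\<close>)
qed

lemma pw_scaleR:
  assumes "bounded_linear A" shows "pw A (r *\<^sub>R a) = r *\<^sub>R pw A a"
proof -
  interpret A: bounded_linear A by fact
  show ?thesis
    by (rule l2_eqI) (use fn_pw[OF assms, of "r *\<^sub>R a"] fn_scaleR[of r a] fn_scaleR[of r "pw A a"]
      fn_pw[OF assms, of a] in \<open>eventually_elim, simp add: A.scaleR\<close>)
qed

lemma bounded_linear_pw:
  fixes A :: "'b::euclidean_space \<Rightarrow> 'b"
  assumes "bounded_linear A" shows "bounded_linear (pw A :: ('a::euclidean_space, 'b) l2 \<Rightarrow> _)"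
proof -
  obtain K where K: "K \<ge> 0" "\<And>v. norm (A v) \<le> norm v * K"
    using bounded_linear.nonneg_bounded[OF assms] by blast
  show ?thesis
  proof (rule bounded_linear_intro)
    fix a :: "('a, 'b) l2"
    show "norm (pw A a) \<le> norm a * K"
    proof (rule power2_le_imp_le)
      have "(norm (pw A a))\<^sup>2 = (LINT x|lborel. (norm (A (fn a x)))\<^sup>2)"
        unfolding pw_def by (rule norm_cls_sq[OF sqi_linear[OF sqi_fn assms]])
      also have "\<dots> \<le> (LINT x|lborel. (norm (fn a x))\<^sup>2 * K\<^sup>2)"
      proof (rule integral_mono)
        show "integrable lborel (\<lambda>x. (norm (A (fn a x)))\<^sup>2)"
          using sqi_linear[OF sqi_fn[of a] assms] by (simp add: sqi_def)
        show "(norm (A (fn a x)))\<^sup>2 \<le> (norm (fn a x))\<^sup>2 * K\<^sup>2" for x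
          using power_mono[OF K(2)[of "fn a x"], of 2] by (simp add: power_mult_distrib)
      qed simp
      finally show "(norm (pw A a))\<^sup>2 \<le> (norm a * K)\<^sup>2" by (simp add: norm_l2_sq power_mult_distrib)
    qed (use K in simp)
  qed (simp_all add: pw_add pw_scaleR assms)
qed

lemma inner_pw:
  assumes "bounded_linear A" "bounded_linear B" "\<And>v w. inner (A v) w = inner v (B w)"
  shows "inner (pw A a) b = inner a (pw B b)"
proof -
  have "inner (pw A a) b = (LINT x|lborel. A (fn a x) \<bullet> fn b x)"
    using inner_cls[OF sqi_linear[OF sqi_fn[of a] assms(1)] sqi_fn[of b]] by (simp add: pw_def)
  moreover have "inner a (pw B b) = (LINT x|lborel. fn a x \<bullet> B (fn b x))"
    unfolding pw_def by (rule inner_cls_right[OF sqi_linear[OF sqi_fn assms(2)]])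
  ultimately show ?thesis by (simp add: assms(3))
qed

lemma pw_cls:
  assumes "sqi f" "bounded_linear A" shows "pw A (cls f) = cls (\<lambda>x. A (f x))"
  unfolding pw_def by (rule cls_cong) (use fn_cls[OF assms(1)] in \<open>auto elim: eventually_mono\<close>)

lemma pw_shift:
  assumes "bounded_linear A" shows "pw A (shift z a) = shift z (pw A a)"
  unfolding shift_def[of z a] pw_def[of A a]
  by (simp add: pw_cls[OF sqi_shift[OF sqi_fn] assms] shift_cls[OF sqi_linear[OF sqi_fn assms]])

lemma pw_tf:
  fixes A :: "'b::euclidean_space \<Rightarrow> 'b" and \<phi> :: "real^'d \<Rightarrow> real"
  assumes "test_function \<phi>" "bounded_linear A" shows "pw A (tf \<phi> c) = tf \<phi> (A c)"
proof -
  interpret A: bounded_linear A by fact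
  show ?thesis
    unfolding tf_def by (simp add: pw_cls[OF test_function_integrable(2)[OF assms(1)] assms(2)] A.scaleR)
qed

lemma wder_pw:
  fixes A :: "'b::euclidean_space \<Rightarrow> 'b" and a :: "(real^'d, 'b) l2"
  assumes "wder js a b" "bounded_linear A" "bounded_linear B" "\<And>v w. inner (A v) w = inner v (B w)"
  shows "wder js (pw A a) (pw A b)"
  using assms(1) unfolding wder_def inner_pw[OF assms(2-4)]
  by (simp add: pw_tf[OF _ assms(3)] test_function_pderivatives)

lemma conv_pw:
  fixes a :: "(real^'d, 'b::euclidean_space) l2"
  assumes "integrable lborel k" "bounded_linear A" "bounded_linear B" "\<And>v w. inner (A v) w = inner v (B w)"
  shows "conv s k (pw A a) = pw A (conv s k a)"
proof (rule l2_inner_eqI)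
  fix b
  show "inner (conv s k (pw A a)) b = inner (pw A (conv s k a)) b"
    unfolding inner_pw[OF assms(2-4)] inner_conv[OF assms(1)] pw_shift[OF assms(2), symmetric] ..
qed

lemma conv_add:
  fixes a b :: "(real^'d, 'b::euclidean_space) l2"
  assumes "integrable lborel k" shows "conv s k (a + b) = conv s k a + conv s k b"
proof (rule l2_inner_eqI)
  fix c
  have "integrable lborel (\<lambda>z. k z * inner (shift (s *\<^sub>R z) a) c)" "integrable lborel (\<lambda>z. k z * inner (shift (s *\<^sub>R z) b) c)"
    by (rule kernel_shift_integrable[OF assms])+
  then show "inner (conv s k (a + b)) c = inner (conv s k a + conv s k b) c"
    by (simp add: inner_add_left inner_conv[OF assms] shift_add distrib_left)
qed

lemma conv_scaleR:
  fixes a :: "(real^'d, 'b::euclidean_space) l2"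
  assumes "integrable lborel k" shows "conv s k (r *\<^sub>R a) = r *\<^sub>R conv s k a"
proof (rule l2_inner_eqI)
  fix c
  show "inner (conv s k (r *\<^sub>R a)) c = inner (r *\<^sub>R conv s k a) c"
    by (simp add: inner_conv[OF assms] shift_scaleR mult.left_commute)
qed

definition mul :: "('a::euclidean_space \<Rightarrow> real) \<Rightarrow> ('a, 'b::euclidean_space) l2 \<Rightarrow> ('a, 'b) l2" where
  "mul \<theta> a = cls (\<lambda>x. \<theta> x *\<^sub>R fn a x)"

lemma sqi_mul:
  assumes "test_function \<theta>" "sqi f" shows "sqi (\<lambda>x. \<theta> x *\<^sub>R f x)"
proof -
  obtain B where "\<And>x. \<bar>\<theta> x\<bar> \<le> B" using test_function_bounded[OF assms(1)] by blast
  then show ?thesis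
    using assms by (intro sqi_bound[OF assms(2), of _ B]) (auto simp: sqi_def mult_right_mono test_function_measurable)
qed

lemma fn_mul: "test_function \<theta> \<Longrightarrow> AE x in lborel. fn (mul \<theta> a) x = \<theta> x *\<^sub>R fn a x"
  unfolding mul_def by (rule fn_cls[OF sqi_mul[OF _ sqi_fn]])

lemma mul_add:
  assumes "test_function \<theta>" shows "mul \<theta> (a + b) = mul \<theta> a + mul \<theta> b"
  by (rule l2_eqI) (use fn_mul[OF assms, of "a + b"] fn_mul[OF assms, of a] fn_mul[OF assms, of b] fn_add[of a b]
    fn_add[of "mul \<theta> a" "mul \<theta> b"] in \<open>eventually_elim, simp add: scaleR_add_right\<close>)

lemma mul_scaleR:
  assumes "test_function \<theta>" shows "mul \<theta> (r *\<^sub>R a) = r *\<^sub>R mul \<theta> a"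
  by (rule l2_eqI) (use fn_mul[OF assms, of "r *\<^sub>R a"] fn_mul[OF assms, of a] fn_scaleR[of r a]
    fn_scaleR[of r "mul \<theta> a"] in \<open>eventually_elim, simp\<close>)

lemma mul_pw:
  assumes "test_function \<theta>" "bounded_linear A" shows "mul \<theta> (pw A a) = pw A (mul \<theta> a)"
proof -
  interpret A: bounded_linear A by fact
  show ?thesis
    by (rule l2_eqI) (use fn_mul[OF assms(1), of "pw A a"] fn_mul[OF assms(1), of a] fn_pw[OF assms(2), of a] fn_pw[OF assms(2), of "mul \<theta> a"] in
      \<open>eventually_elim, simp add: A.scaleR\<close>)
qed

lemma inner_mul_tf:
  fixes a :: "(real^'d, 'b::euclidean_space) l2"
  assumes "test_function \<theta>" "test_function \<psi>"
  shows "inner (mul \<theta> a) (tf \<psi> c) = inner a (tf (\<lambda>x. \<theta> x * \<psi> x) c)"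
proof -
  have "inner (mul \<theta> a) (tf \<psi> c) = (LINT x|lborel. (\<theta> x *\<^sub>R fn a x) \<bullet> (\<psi> x *\<^sub>R c))"
    unfolding mul_def tf_def by (intro inner_cls sqi_mul sqi_fn test_function_integrable assms)
  then show ?thesis
    by (simp add: inner_tf test_function_mult test_function_smooth assms mult_ac)
qed

lemma wder_mul:
  fixes a :: "(real^'d, 'b::euclidean_space) l2"
  assumes "wder [j] a b" "test_function \<theta>"
  shows "wder [j] (mul \<theta> a) (mul \<theta> b + mul (pderivative j \<theta>) a)"
  unfolding wder_def
proof (intro allI impI)
  fix \<phi> :: "real^'d \<Rightarrow> real" and c :: 'b assume \<phi>: "test_function \<phi>"
  note smooth = test_function_smooth[OF \<phi>] test_function_smooth[OF assms(2)]
  have p: "pderivative j (\<lambda>x. \<theta> x * \<phi> x) = (\<lambda>x. \<theta> x * pderivative j \<phi> x + pderivative j \<theta> x * \<phi> x)"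
    by (intro pderivative_mult smooth_differentiable smooth)
  have t: "test_function (\<lambda>x. \<theta> x * pderivative j \<phi> x)" "test_function (\<lambda>x. pderivative j \<theta> x * \<phi> x)" "test_function (\<lambda>x. \<theta> x * \<phi> x)"
    by (rule test_function_mult[OF assms(2) smooth_pderivative[OF smooth(1)]]
      test_function_mult[OF test_function_pderivative[OF assms(2)] smooth(1)] test_function_mult[OF assms(2) smooth(1)])+
  have "inner a (tf (pderivatives [j] (\<lambda>x. \<theta> x * \<phi> x)) c) = (- 1) ^ length [j] * inner b (tf (\<lambda>x. \<theta> x * \<phi> x) c)"
    using assms(1) t(3) unfolding wder_def by blast
  then have "inner a (tf (pderivative j (\<lambda>x. \<theta> x * \<phi> x)) c) = - inner b (tf (\<lambda>x. \<theta> x * \<phi> x) c)" by simp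
  moreover have "tf (pderivative j (\<lambda>x. \<theta> x * \<phi> x)) c = tf (\<lambda>x. \<theta> x * pderivative j \<phi> x) c + tf (\<lambda>x. pderivative j \<theta> x * \<phi> x) c"
    unfolding p tf_def scaleR_add_left by (intro cls_add test_function_integrable t)
  ultimately show "inner (mul \<theta> a) (tf (pderivatives [j] \<phi>) c) = (- 1) ^ length [j] * inner (mul \<theta> b + mul (pderivative j \<theta>) a) (tf \<phi> c)"
    using assms(2) \<phi> by (simp add: inner_mul_tf test_function_pderivative inner_add_left inner_add_right)
qed

section \<open>The second order Sobolev space and the free operator\<close>

type_synonym field = "(real^2, complex^2) l2"

definition H :: "field set" where
  "H = {a. \<forall>js. length js \<le> 2 \<longrightarrow> (\<exists>b. wder js a b)}"

definition der :: "2 list \<Rightarrow> field \<Rightarrow> field" where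
  "der js a = (SOME b. wder js a b)"

lemma der_eqI: "wder js a b \<Longrightarrow> der js a = b"
  unfolding der_def by (rule some_equality) (auto intro: wder_unique)

lemma wder_der: "a \<in> H \<Longrightarrow> length js \<le> 2 \<Longrightarrow> wder js a (der js a)"
  unfolding H_def der_def by (blast intro: someI_ex)

lemma wder_der_der: "a \<in> H \<Longrightarrow> wder [j] (der [i] a) (der [i, j] a)"
  using wder_Cons_iff[OF wder_der[of a "[i]"]] wder_der[of a "[i, j]"] by simp

lemma list_length_le_2_cases:
  assumes "length js \<le> 2"
  obtains "js = []" | i where "js = [i]" | i j where "js = [i, j]"
proof (cases js)
  case (Cons i ks)
  show ?thesis
  proof (cases ks)
    case (Cons j ls)
    then show ?thesis using assms \<open>js = i # ks\<close> that(3) by simp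
  qed (use Cons that in auto)
qed (use that in auto)

lemma H_I:
  assumes "\<And>i. wder [i] a (g i)" "\<And>i j. wder [j] (g i) (h i j)"
  shows "a \<in> H" "der [i] a = g i" "der [i, j] a = h i j"
proof -
  have h: "wder [i, j] a (h i j)" for i j using wder_Cons_iff[OF assms(1)] assms(2) by blast
  show "a \<in> H"
    unfolding H_def
  proof (intro CollectI allI impI)
    fix js :: "2 list" assume "length js \<le> 2"
    then show "\<exists>b. wder js a b"
      by (cases rule: list_length_le_2_cases) (use wder_Nil assms(1) h in blast)+
  qed
  show "der [i] a = g i" "der [i, j] a = h i j" by (intro der_eqI assms h)+
qed

lemma H_add:
  assumes "a \<in> H" "b \<in> H"
  shows "a + b \<in> H" "der [i] (a + b) = der [i] a + der [i] b" "der [i, j] (a + b) = der [i, j] a + der [i, j] b"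
  using H_I[of "a + b" "\<lambda>i. der [i] a + der [i] b" "\<lambda>i j. der [i, j] a + der [i, j] b"]
    wder_add[OF wder_der[OF assms(1)] wder_der[OF assms(2)]] wder_add[OF wder_der_der[OF assms(1)] wder_der_der[OF assms(2)]]
  by auto

lemma H_scaleR:
  assumes "a \<in> H"
  shows "r *\<^sub>R a \<in> H" "der [i] (r *\<^sub>R a) = r *\<^sub>R der [i] a" "der [i, j] (r *\<^sub>R a) = r *\<^sub>R der [i, j] a"
  using H_I[of "r *\<^sub>R a" "\<lambda>i. r *\<^sub>R der [i] a" "\<lambda>i j. r *\<^sub>R der [i, j] a"]
    wder_scaleR[OF wder_der[OF assms]] wder_scaleR[OF wder_der_der[OF assms]]
  by auto

lemma H_pw:
  assumes "a \<in> H" "bounded_linear A" "bounded_linear B" "\<And>v w. inner (A v) w = inner v (B w)"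
  shows "pw A a \<in> H" "der [i] (pw A a) = pw A (der [i] a)" "der [i, j] (pw A a) = pw A (der [i, j] a)"
  using H_I[of "pw A a" "\<lambda>i. pw A (der [i] a)" "\<lambda>i j. pw A (der [i, j] a)"]
    wder_pw[OF wder_der[OF assms(1)] assms(2-4)] wder_pw[OF wder_der_der[OF assms(1)] assms(2-4)]
  by auto

lemma H_subspace: "subspace H"
proof -
  have "wder js 0 (0 :: field)" for js by (simp add: wder_def)
  then have "(0 :: field) \<in> H" by (auto simp: H_def)
  then show ?thesis by (auto simp: subspace_def H_add H_scaleR)
qed

lemma H_diff: "a \<in> H \<Longrightarrow> b \<in> H \<Longrightarrow> a - b \<in> H"
  by (rule subspace_diff[OF H_subspace])

text \<open>The Pauli matrices \<open>\<sigma>1\<close> and \<open>\<sigma>2\<close>, and multiplication by the imaginary unit.\<close>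

definition \<sigma>1 :: "complex^2 \<Rightarrow> complex^2" where "\<sigma>1 v = vector [v $ 2, v $ 1]"
definition \<sigma>2 :: "complex^2 \<Rightarrow> complex^2" where "\<sigma>2 v = vector [- \<i> * v $ 2, \<i> * v $ 1]"
definition im :: "complex^2 \<Rightarrow> complex^2" where "im v = \<i> *s v"

lemma vec2_eqI: "v $ 1 = w $ 1 \<Longrightarrow> v $ 2 = w $ 2 \<Longrightarrow> v = (w :: 'a^2)"
  by (simp add: vec_eq_iff forall_2)

lemma inner_vec2: "inner v w = inner (v $ 1) (w $ 1) + inner (v $ 2) (w $ 2)" for v w :: "complex^2"
  by (simp add: inner_vec_def sum_2)

lemma pauli_linear: "bounded_linear \<sigma>1" "bounded_linear \<sigma>2" "bounded_linear im" "bounded_linear (\<lambda>v. - im v)"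
proof -
  have "linear \<sigma>1" "linear \<sigma>2" "linear im" "linear (\<lambda>v. - im v)"
    by (auto intro!: linearI vec2_eqI simp: \<sigma>1_def \<sigma>2_def im_def algebra_simps)
  then show "bounded_linear \<sigma>1" "bounded_linear \<sigma>2" "bounded_linear im" "bounded_linear (\<lambda>v. - im v)"
    by (auto simp: linear_linear)
qed

lemma pauli_adjoint:
  "inner (\<sigma>1 v) w = inner v (\<sigma>1 w)" "inner (\<sigma>2 v) w = inner v (\<sigma>2 w)" "inner (im v) w = inner v (- im w)"
  by (auto simp: inner_vec2 \<sigma>1_def \<sigma>2_def im_def inner_complex_def)

lemma pauli_im: "\<sigma>1 (im v) = im (\<sigma>1 v)" "\<sigma>2 (im v) = im (\<sigma>2 v)"
  by (auto intro!: vec2_eqI simp: \<sigma>1_def \<sigma>2_def im_def)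

lemma norm_pauli: "(norm (p *\<^sub>R \<sigma>1 v + q *\<^sub>R \<sigma>2 v))\<^sup>2 = (p\<^sup>2 + q\<^sup>2) * (norm v)\<^sup>2"
  unfolding power2_norm_eq_inner
  by (simp add: inner_vec2 \<sigma>1_def \<sigma>2_def inner_complex_def) (simp add: algebra_simps power2_eq_square)

lemma norm_im: "norm (im v) = norm v"
  by (simp add: norm_eq_sqrt_inner inner_vec2 im_def inner_complex_def algebra_simps)

lemma inner_pw_pauli:
  "inner (pw \<sigma>1 a) b = inner a (pw \<sigma>1 b)" "inner (pw \<sigma>2 a) b = inner a (pw \<sigma>2 b)"
  by (intro inner_pw pauli_linear pauli_adjoint)+

lemma pw_uminus: "pw (\<lambda>v. - im v) a = - pw im a"
  by (rule l2_eqI) (use fn_pw[OF pauli_linear(4), of a] fn_pw[OF pauli_linear(3), of a] fn_uminus[of "pw im a"] in \<open>eventually_elim, simp\<close>)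

lemma inner_pw_im: "inner (pw im a) b = - inner a (pw im b)"
  using inner_pw[OF pauli_linear(3,4) pauli_adjoint(3), of a b] by (simp add: pw_uminus)

lemma inner_pw_im_self: "inner a (pw im a) = 0"
  using inner_pw_im[of a a] by (simp add: inner_commute)

lemma pw_im_im: "pw im (pw im a) = - a"
proof (rule l2_eqI)
  have im_im: "im (im v) = - v" for v by (auto intro!: vec2_eqI simp: im_def)
  show "AE x in lborel. fn (pw im (pw im a)) x = fn (- a) x"
    using fn_pw[OF pauli_linear(3), of a] fn_pw[OF pauli_linear(3), of "pw im a"] fn_uminus[of a]
    by eventually_elim (simp add: im_im)
qed

lemma norm_pw_im: "norm (pw im a) = norm a"
  unfolding norm_eq_sqrt_inner inner_pw_im pw_im_im by simp

lemma pw_pauli_im: "pw \<sigma>1 (pw im a) = pw im (pw \<sigma>1 a)" "pw \<sigma>2 (pw im a) = pw im (pw \<sigma>2 a)"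
proof -
  show "pw \<sigma>1 (pw im a) = pw im (pw \<sigma>1 a)"
    by (rule l2_eqI) (use fn_pw[OF pauli_linear(3), of a] fn_pw[OF pauli_linear(3), of "pw \<sigma>1 a"] fn_pw[OF pauli_linear(1), of a] fn_pw[OF pauli_linear(1), of "pw im a"] in \<open>eventually_elim, simp add: pauli_im\<close>)
  show "pw \<sigma>2 (pw im a) = pw im (pw \<sigma>2 a)"
    by (rule l2_eqI) (use fn_pw[OF pauli_linear(3), of a] fn_pw[OF pauli_linear(3), of "pw \<sigma>2 a"] fn_pw[OF pauli_linear(2), of a] fn_pw[OF pauli_linear(2), of "pw im a"] in \<open>eventually_elim, simp add: pauli_im\<close>)
qed

text \<open>This is \<open>D\<^sub>0\<close>: the entries \<open>4 \<partial>\<^sub>z\<^sub>b\<^sub>a\<^sub>r\<^sup>2\<close> and \<open>4 \<partial>\<^sub>z\<^sup>2\<close> expand to \<open>\<partial>\<^sub>1\<^sub>1 - \<partial>\<^sub>2\<^sub>2\<close> minus and plus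
  \<open>i (\<partial>\<^sub>1\<^sub>2 + \<partial>\<^sub>2\<^sub>1)\<close>.\<close>

definition free :: "field \<Rightarrow> field" where
  "free a = pw \<sigma>1 (der [1, 1] a - der [2, 2] a) + pw \<sigma>2 (der [1, 2] a + der [2, 1] a)"

lemmas pw_lin1 = bounded_linear_pw[OF pauli_linear(1)]
lemmas pw_lin2 = bounded_linear_pw[OF pauli_linear(2)]
lemmas pw_lin_im = bounded_linear_pw[OF pauli_linear(3)]

lemmas pw_linear_simps =
  linear_add[OF bounded_linear.linear[OF pw_lin1]] linear_diff[OF bounded_linear.linear[OF pw_lin1]] linear_cmul[OF bounded_linear.linear[OF pw_lin1]]
  linear_add[OF bounded_linear.linear[OF pw_lin2]] linear_diff[OF bounded_linear.linear[OF pw_lin2]] linear_cmul[OF bounded_linear.linear[OF pw_lin2]]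
  linear_add[OF bounded_linear.linear[OF pw_lin_im]] linear_diff[OF bounded_linear.linear[OF pw_lin_im]] linear_cmul[OF bounded_linear.linear[OF pw_lin_im]]

lemma free_add: "a \<in> H \<Longrightarrow> b \<in> H \<Longrightarrow> free (a + b) = free a + free b"
  by (simp add: free_def H_add pw_linear_simps algebra_simps)

lemma free_scaleR: "a \<in> H \<Longrightarrow> free (r *\<^sub>R a) = r *\<^sub>R free a"
  by (simp add: free_def H_scaleR pw_linear_simps algebra_simps)

lemma free_diff: "a \<in> H \<Longrightarrow> b \<in> H \<Longrightarrow> free (a - b) = free a - free b"
  using free_add[of a "- 1 *\<^sub>R b"] free_scaleR[of b "- 1"] H_scaleR(1)[of b "- 1"] by simp

lemma free_im: "a \<in> H \<Longrightarrow> free (pw im a) = pw im (free a)" and H_im: "a \<in> H \<Longrightarrow> pw im a \<in> H"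
  using H_pw[OF _ pauli_linear(3,4) pauli_adjoint(3)] by (auto simp: free_def pw_pauli_im pw_linear_simps)

lemma inner_der2:
  assumes "a \<in> H" "b \<in> H" shows "inner (der [i, j] a) b = inner a (der [j, i] b)"
proof -
  have "inner (der [i, j] a) b = - inner (der [i] a) (der [j] b)"
    using assms by (intro wder_integration_by_parts[OF wder_der_der wder_der]) auto
  also have "\<dots> = inner a (der [j, i] b)"
    using wder_integration_by_parts[OF wder_der[OF assms(1), of "[i]"] wder_der_der[OF assms(2), of i j]] by simp
  finally show ?thesis .
qed

lemma free_symmetric:
  assumes "a \<in> H" "b \<in> H" shows "inner (free a) b = inner a (free b)"
proof -
  have s1: "pw \<sigma>1 b \<in> H" "\<And>i j. der [i, j] (pw \<sigma>1 b) = pw \<sigma>1 (der [i, j] b)"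
    using H_pw[OF assms(2) pauli_linear(1,1) pauli_adjoint(1)] by auto
  have s2: "pw \<sigma>2 b \<in> H" "\<And>i j. der [i, j] (pw \<sigma>2 b) = pw \<sigma>2 (der [i, j] b)"
    using H_pw[OF assms(2) pauli_linear(2,2) pauli_adjoint(2)] by auto
  show ?thesis
    by (simp add: free_def inner_add_left inner_add_right inner_diff_left inner_diff_right inner_pw_pauli
        inner_der2[OF assms(1) s1(1)] inner_der2[OF assms(1) s2(1)] s1(2) s2(2) pw_linear_simps)
qed

lemma inner_free_im: "a \<in> H \<Longrightarrow> inner (free a) (pw im a) = 0"
  using free_symmetric[of a "pw im a"] inner_pw_im[of a "free a"] H_im[of a] free_im[of a] by (simp add: inner_commute)

text \<open>Integration by parts and the Cauchy-Schwarz inequality.\<close>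

lemma norm_der1_le:
  assumes "a \<in> H" shows "(norm (der [i] a))\<^sup>2 \<le> norm a * norm (der [i, i] a)"
proof -
  have "(norm (der [i] a))\<^sup>2 = - inner a (der [i, i] a)"
    using wder_integration_by_parts[OF wder_der[OF assms, of "[i]"] wder_der_der[OF assms, of i i]]
    by (simp add: power2_norm_eq_inner)
  also have "\<dots> \<le> norm a * norm (der [i, i] a)"
    using Cauchy_Schwarz_ineq2[of a "der [i, i] a"] by linarith
  finally show ?thesis .
qed

lemma H_moll:
  assumes "a \<in> H"
  shows "moll s a \<in> H" "free (moll s a) = moll s (free a)"
proof -
  have "wder [i] (moll s a) (moll s (der [i] a))" "wder [j] (moll s (der [i] a)) (moll s (der [i, j] a))" for i j
    using wder_moll[OF wder_der[OF assms]] wder_moll[OF wder_der_der[OF assms]] by auto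
  note * = H_I[OF this]
  show "moll s a \<in> H" by (rule *)
  have m: "moll s (x - y) = moll s x - moll s y" for x y :: field
    using conv_add[OF mollifier_integral(1), of s x "- 1 *\<^sub>R y"] conv_scaleR[OF mollifier_integral(1), of s "- 1" y] by simp
  show "free (moll s a) = moll s (free a)"
    unfolding free_def *(3) m[symmetric] conv_add[OF mollifier_integral(1)]
    unfolding conv_pw[OF mollifier_integral(1) pauli_linear(1,1) pauli_adjoint(1)] conv_pw[OF mollifier_integral(1) pauli_linear(2,2) pauli_adjoint(2)]
    unfolding conv_add[OF mollifier_integral(1)] ..
qed

lemma moll_in_H: "s > 0 \<Longrightarrow> moll s a \<in> H"
  using conv_wder_ex[OF test_function_mollifier] by (auto simp: H_def)

lemma H_mul:
  assumes "a \<in> H" "test_function \<theta>"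
  shows "mul \<theta> a \<in> H" "der [i] (mul \<theta> a) = mul \<theta> (der [i] a) + mul (pderivative i \<theta>) a"
    "der [i, j] (mul \<theta> a) = (mul \<theta> (der [i, j] a) + mul (pderivative j \<theta>) (der [i] a))
      + (mul (pderivative i \<theta>) (der [j] a) + mul (pderivative j (pderivative i \<theta>)) a)"
  using H_I[of "mul \<theta> a" "\<lambda>i. mul \<theta> (der [i] a) + mul (pderivative i \<theta>) a"
    "\<lambda>i j. (mul \<theta> (der [i, j] a) + mul (pderivative j \<theta>) (der [i] a)) + (mul (pderivative i \<theta>) (der [j] a) + mul (pderivative j (pderivative i \<theta>)) a)"]
    wder_mul[OF wder_der[OF assms(1)] assms(2)]
    wder_add[OF wder_mul[OF wder_der_der[OF assms(1)] assms(2)] wder_mul[OF wder_der[OF assms(1)] test_function_pderivative[OF assms(2)]]]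
  by auto

text \<open>The commutator of the free operator with a multiplication, of first order.\<close>

definition commutator :: "(real^2 \<Rightarrow> real) \<Rightarrow> field \<Rightarrow> field" where
  "commutator \<theta> a =
    pw \<sigma>1 (2 *\<^sub>R mul (pderivative 1 \<theta>) (der [1] a) + mul (pderivative 1 (pderivative 1 \<theta>)) a
      - 2 *\<^sub>R mul (pderivative 2 \<theta>) (der [2] a) - mul (pderivative 2 (pderivative 2 \<theta>)) a)
    + pw \<sigma>2 (2 *\<^sub>R mul (pderivative 1 \<theta>) (der [2] a) + 2 *\<^sub>R mul (pderivative 2 \<theta>) (der [1] a)
      + mul (pderivative 1 (pderivative 2 \<theta>)) a + mul (pderivative 2 (pderivative 1 \<theta>)) a)"

lemma free_mul:
  assumes "a \<in> H" "test_function \<theta>"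
  shows "free (mul \<theta> a) = mul \<theta> (free a) + commutator \<theta> a"
proof -
  have m: "mul \<theta> (x - y) = mul \<theta> x - mul \<theta> y" for x y :: field
    using mul_add[OF assms(2), of x "- 1 *\<^sub>R y"] mul_scaleR[OF assms(2), of "- 1" y] by simp
  show ?thesis
    by (simp add: free_def commutator_def H_mul[OF assms] mul_add[OF assms(2)] m mul_pw[OF assms(2)] pauli_linear
        pw_linear_simps scaleR_2)
qed

section \<open>Transforms of derivatives\<close>

text \<open>Dilating the mollifier makes the cutoffs tend to \<open>1\<close> while their derivatives tend to \<open>0\<close> uniformly.\<close>

definition cutoff :: "nat \<Rightarrow> real^'d \<Rightarrow> real" where
  "cutoff n x = mollifier (inverse (real (Suc n)) *\<^sub>R x) / mollifier (0 :: real^'d)"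

lemma mollifier_0_pos: "mollifier (0 :: real^'d) > 0"
proof -
  have "bump 1 (\<chi> i. - 1) (\<chi> i. 1) (0 :: real^'d) \<noteq> 0" by (subst bump_nonzero_iff) (auto simp: mem_box_cart)
  then show ?thesis
    using bump_integral_pos[where 'd = 'd] bump_nonneg[of 1 "\<chi> i. - 1" "\<chi> i. 1" "0 :: real^'d"] by (simp add: mollifier_def)
qed

lemma cutoff_affine:
  "cutoff n = (\<lambda>x. inverse (mollifier (0 :: real^'d)) * mollifier (0 + inverse (real (Suc n)) *\<^sub>R (x :: real^'d)))"
  by (rule ext) (simp add: cutoff_def divide_inverse mult.commute)

lemma test_function_cutoff: "test_function (cutoff n :: real^'d \<Rightarrow> real)"
  unfolding cutoff_affine by (intro test_function_cmult test_function_affine test_function_mollifier) simp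

lemma pderivative_cutoff:
  "pderivative j (cutoff n) = (\<lambda>x. inverse (real (Suc n)) * (inverse (mollifier (0 :: real^'d)) * pderivative j mollifier (inverse (real (Suc n)) *\<^sub>R (x :: real^'d))))"
  unfolding cutoff_affine
  by (subst pderivative_affine(1)) (auto intro: smooth_differentiable test_function_smooth test_function_mollifier)

lemma pderivative2_cutoff:
  "pderivative i (pderivative j (cutoff n)) = (\<lambda>x. (inverse (real (Suc n)))\<^sup>2 * (inverse (mollifier (0 :: real^'d)) * pderivative i (pderivative j mollifier) (inverse (real (Suc n)) *\<^sub>R (x :: real^'d))))"
proof -
  have e: "pderivative j (cutoff n) = (\<lambda>x. (inverse (real (Suc n)) * inverse (mollifier (0 :: real^'d))) * pderivative j mollifier (0 + inverse (real (Suc n)) *\<^sub>R (x :: real^'d)))"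
    unfolding pderivative_cutoff by (rule ext) simp
  show ?thesis
    unfolding e by (subst pderivative_affine(1))
      (auto intro: smooth_differentiable smooth_pderivative test_function_smooth test_function_mollifier simp: power2_eq_square mult_ac)
qed

lemma cutoff_bounds:
  obtains B where "B > 0" "\<And>n x. \<bar>cutoff n (x :: real^'d)\<bar> \<le> B"
    "\<And>n x j. \<bar>pderivative j (cutoff n) (x :: real^'d)\<bar> \<le> B * inverse (real (Suc n))"
    "\<And>n x i j. \<bar>pderivative i (pderivative j (cutoff n)) (x :: real^'d)\<bar> \<le> B * inverse (real (Suc n))"
proof -
  let ?c = "inverse (mollifier (0 :: real^'d))"
  have c: "?c > 0" using mollifier_0_pos by simp
  note t = test_function_mollifier[where 'd = 'd]
  obtain B0 where B0: "B0 > 0" "\<And>x. \<bar>mollifier (x :: real^'d)\<bar> \<le> B0" using test_function_bounded[OF t] by blast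
  have "\<exists>B. \<forall>x. \<bar>pderivative j mollifier (x :: real^'d)\<bar> \<le> B" for j
    using test_function_bounded[OF test_function_pderivative[OF t]] by metis
  then obtain B1 where B1: "\<And>j x. \<bar>pderivative j mollifier (x :: real^'d)\<bar> \<le> B1 j" by metis
  have "\<exists>B. \<forall>x. \<bar>pderivative i (pderivative j mollifier) (x :: real^'d)\<bar> \<le> B" for i j
    using test_function_bounded[OF test_function_pderivative[OF test_function_pderivative[OF t]]] by metis
  then obtain B2 where B2: "\<And>i j x. \<bar>pderivative i (pderivative j mollifier) (x :: real^'d)\<bar> \<le> B2 i j" by metis
  define B where "B = ?c * (B0 + (\<Sum>j\<in>UNIV. \<bar>B1 j\<bar>) + (\<Sum>i\<in>UNIV. \<Sum>j\<in>UNIV. \<bar>B2 i j\<bar>))"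
  have s0: "(\<Sum>j\<in>UNIV. \<bar>B1 j\<bar>) \<ge> 0" "(\<Sum>i\<in>UNIV. \<Sum>j\<in>UNIV. \<bar>B2 i j\<bar>) \<ge> 0" by (auto intro!: sum_nonneg)
  have s1: "\<bar>B1 j\<bar> \<le> (\<Sum>j\<in>UNIV. \<bar>B1 j\<bar>)" for j by (rule member_le_sum) auto
  have s2: "\<bar>B2 i j\<bar> \<le> (\<Sum>i\<in>UNIV. \<Sum>j\<in>UNIV. \<bar>B2 i j\<bar>)" for i j
  proof -
    have "\<bar>B2 i j\<bar> \<le> (\<Sum>j\<in>UNIV. \<bar>B2 i j\<bar>)" by (rule member_le_sum) auto
    also have "\<dots> \<le> (\<Sum>i\<in>UNIV. \<Sum>j\<in>UNIV. \<bar>B2 i j\<bar>)"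
      by (rule member_le_sum[where f = "\<lambda>i. \<Sum>j\<in>UNIV. \<bar>B2 i j\<bar>"]) (auto intro: sum_nonneg)
    finally show ?thesis .
  qed
  have le: "?c * \<bar>m\<bar> \<le> B" if "\<bar>m\<bar> \<le> B0 \<or> (\<exists>j. \<bar>m\<bar> \<le> B1 j) \<or> (\<exists>i j. \<bar>m\<bar> \<le> B2 i j)" for m
  proof -
    have "\<bar>m\<bar> \<le> B0 + (\<Sum>j\<in>UNIV. \<bar>B1 j\<bar>) + (\<Sum>i\<in>UNIV. \<Sum>j\<in>UNIV. \<bar>B2 i j\<bar>)"
      using that
    proof (elim disjE exE)
      fix j assume "\<bar>m\<bar> \<le> B1 j" then show ?thesis using s1[of j] s0 B0(1) by linarith
    next
      fix i j assume "\<bar>m\<bar> \<le> B2 i j" then show ?thesis using s2[of i j] s0 B0(1) by linarith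
    qed (use s0 in linarith)
    then show ?thesis unfolding B_def using c by (intro mult_left_mono) auto
  qed
  have r: "inverse (real (Suc n)) \<ge> 0" "inverse (real (Suc n)) \<le> 1" for n by (auto simp: field_simps)
  show ?thesis
  proof (rule that[of B])
    show "B > 0" unfolding B_def by (intro mult_pos_pos add_pos_nonneg c B0(1) s0)
    show "\<bar>cutoff n x\<bar> \<le> B" for n and x :: "real^'d"
    proof -
      have "\<bar>cutoff n x\<bar> = ?c * \<bar>mollifier (inverse (real (Suc n)) *\<^sub>R x)\<bar>"
        unfolding cutoff_affine abs_mult using c by simp
      also have "\<dots> \<le> B" by (rule le) (use B0 in blast)
      finally show ?thesis .
    qed
    show "\<bar>pderivative j (cutoff n) x\<bar> \<le> B * inverse (real (Suc n))" for n j and x :: "real^'d"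
    proof -
      have "\<bar>pderivative j (cutoff n) x\<bar> = inverse (real (Suc n)) * (?c * \<bar>pderivative j mollifier (inverse (real (Suc n)) *\<^sub>R x)\<bar>)"
        unfolding pderivative_cutoff abs_mult using c r[of n] by simp
      also have "\<dots> \<le> inverse (real (Suc n)) * B" using r B1 by (intro mult_left_mono le) blast+
      finally show ?thesis by (simp add: mult.commute)
    qed
    show "\<bar>pderivative i (pderivative j (cutoff n)) x\<bar> \<le> B * inverse (real (Suc n))" for n i j and x :: "real^'d"
    proof -
      have "\<bar>pderivative i (pderivative j (cutoff n)) x\<bar> = (inverse (real (Suc n)))\<^sup>2 * (?c * \<bar>pderivative i (pderivative j mollifier) (inverse (real (Suc n)) *\<^sub>R x)\<bar>)"
        unfolding pderivative2_cutoff abs_mult using c by simp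
      also have "\<dots> \<le> inverse (real (Suc n)) * B"
      proof (rule mult_mono)
        show "(inverse (real (Suc n)))\<^sup>2 \<le> inverse (real (Suc n))"
          using mult_left_mono[OF r(2)[of n] r(1)[of n]] by (simp add: power2_eq_square)
        show "?c * \<bar>pderivative i (pderivative j mollifier) (inverse (real (Suc n)) *\<^sub>R x)\<bar> \<le> B"
          using B2 by (intro le) blast
      qed (use c in auto)
      finally show ?thesis by (simp add: mult.commute)
    qed
  qed
qed

lemma cutoff_tendsto: "(\<lambda>n. cutoff n (x :: real^'d)) \<longlonglongrightarrow> 1"
proof -
  have "isCont mollifier (0 :: real^'d)"
    using smooth_differentiable[OF test_function_smooth[OF test_function_mollifier]] differentiable_imp_continuous_within by blast
  moreover have "(\<lambda>n. inverse (real (Suc n)) *\<^sub>R x) \<longlonglongrightarrow> 0"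
    using tendsto_scaleR[OF LIMSEQ_inverse_real_of_nat tendsto_const, of x] by simp
  ultimately have "(\<lambda>n. mollifier (inverse (real (Suc n)) *\<^sub>R x)) \<longlonglongrightarrow> mollifier (0 :: real^'d)"
    by (rule isCont_tendsto_compose)
  then have "(\<lambda>n. cutoff n x) \<longlonglongrightarrow> mollifier (0 :: real^'d) / mollifier (0 :: real^'d)"
    unfolding cutoff_def using mollifier_0_pos[where 'd = 'd] by (intro tendsto_intros) auto
  then show ?thesis using mollifier_0_pos[where 'd = 'd] by simp
qed

text \<open>Integrability of \<open>a\<close> and \<open>b\<close> allows test functions \<open>h\<close> that are merely bounded together with the derivative,
  such as trigonometric functions: multiply \<open>h\<close> by cutoffs.\<close>

lemma integral_by_parts_bounded:
  fixes a b :: "(real^'d, 'b::euclidean_space) l2"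
  assumes w: "wder [j] a b" and a: "integrable lborel (fn a)" and b: "integrable lborel (fn b)"
    and h: "smooth h" "\<And>x. \<bar>h x\<bar> \<le> 1" "\<And>x. \<bar>pderivative j h x\<bar> \<le> K"
  shows "(LINT x|lborel. pderivative j h x *\<^sub>R fn a x) = - (LINT x|lborel. h x *\<^sub>R fn b x)"
proof -
  obtain B where B: "B > 0" "\<And>n x. \<bar>cutoff n (x :: real^'d)\<bar> \<le> B"
    "\<And>n x j. \<bar>pderivative j (cutoff n) (x :: real^'d)\<bar> \<le> B * inverse (real (Suc n))"
    using cutoff_bounds[where 'd = 'd] by metis
  have m [measurable]: "h \<in> borel_measurable borel" "pderivative j h \<in> borel_measurable borel"
    "cutoff n \<in> borel_measurable borel" "pderivative j (cutoff n) \<in> borel_measurable borel" for n :: nat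
    using h(1) by (auto intro: smooth_measurable smooth_pderivative test_function_measurable test_function_pderivative test_function_cutoff)
  have K0: "K \<ge> 0" using h(3)[of 0] by linarith
  have ia: "integrable lborel (\<lambda>x. pderivative j h x *\<^sub>R fn a x)"
  proof (rule Bochner_Integration.integrable_bound[where f = "\<lambda>x. K * norm (fn a x)"])
    show "AE x in lborel. norm (pderivative j h x *\<^sub>R fn a x) \<le> norm (K * norm (fn a x))"
      using h(3) K0 by (intro AE_I2) (auto simp: abs_mult mult_right_mono)
  qed (use a in auto)
  have ib: "integrable lborel (\<lambda>x. h x *\<^sub>R fn b x)" using b h(2) by (intro integrable_trig_scaleR) auto
  show ?thesis
  proof (rule euclidean_eqI)
    fix c :: 'b assume c: "c \<in> Basis"
    let ?D = "\<lambda>n x. cutoff n x * pderivative j h x + pderivative j (cutoff n) x * h x"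
    have step: "(LINT x|lborel. ?D n x * (fn a x \<bullet> c)) = - (LINT x|lborel. (cutoff n x * h x) * (fn b x \<bullet> c))" for n
    proof -
      have t: "test_function (\<lambda>x. cutoff n x * h x)" by (rule test_function_mult[OF test_function_cutoff h(1)])
      have p: "pderivative j (\<lambda>x. cutoff n x * h x) = ?D n"
        by (intro pderivative_mult smooth_differentiable h(1) test_function_smooth test_function_cutoff)
      have "inner a (tf (pderivatives [j] (\<lambda>x. cutoff n x * h x)) c) = (- 1) ^ length [j] * inner b (tf (\<lambda>x. cutoff n x * h x) c)"
        using w t unfolding wder_def by blast
      then show ?thesis
        using test_function_pderivative[OF t, of j] by (simp add: inner_tf t p)
    qed
    have "(\<lambda>n. LINT x|lborel. ?D n x * (fn a x \<bullet> c)) \<longlonglongrightarrow> (LINT x|lborel. (1 * pderivative j h x + 0 * h x) * (fn a x \<bullet> c))"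
    proof (rule integral_dominated_convergence[where w = "\<lambda>x. (B * K + B) * norm (fn a x)"])
      show "AE x in lborel. (\<lambda>n. ?D n x * (fn a x \<bullet> c)) \<longlonglongrightarrow> (1 * pderivative j h x + 0 * h x) * (fn a x \<bullet> c)"
      proof (intro AE_I2 tendsto_mult tendsto_add tendsto_const cutoff_tendsto)
        fix x
        have "(\<lambda>n. B * inverse (real (Suc n))) \<longlonglongrightarrow> 0" using tendsto_mult[OF tendsto_const LIMSEQ_inverse_real_of_nat, of B] by simp
        then show "(\<lambda>n. pderivative j (cutoff n) x) \<longlonglongrightarrow> 0"
          by (rule Lim_null_comparison[rotated]) (use B(3) in simp)
      qed
      fix n
      have "\<bar>?D n x\<bar> \<le> B * K + B" for x
      proof -
        have "\<bar>cutoff n x * pderivative j h x\<bar> \<le> B * K" unfolding abs_mult using B h(3) by (intro mult_mono) auto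
        moreover have "\<bar>pderivative j (cutoff n) x * h x\<bar> \<le> B * 1" unfolding abs_mult
        proof (intro mult_mono)
          have "B * inverse (real (Suc n)) \<le> B * 1" using B(1) by (intro mult_left_mono) (auto simp: field_simps)
          then show "\<bar>pderivative j (cutoff n) x\<bar> \<le> B" using B(3)[of j n x] by simp
        qed (use h(2) B in auto)
        ultimately show ?thesis by linarith
      qed
      moreover have "\<bar>fn a x \<bullet> c\<bar> \<le> norm (fn a x)" for x using Basis_le_norm[OF c] .
      ultimately have "\<bar>?D n x * (fn a x \<bullet> c)\<bar> \<le> (B * K + B) * norm (fn a x)" for x
        unfolding abs_mult by (intro mult_mono) (use B K0 in auto)
      then show "AE x in lborel. norm (?D n x * (fn a x \<bullet> c)) \<le> (B * K + B) * norm (fn a x)" by simp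
    qed (use a in auto)
    moreover have "(\<lambda>n. - (LINT x|lborel. (cutoff n x * h x) * (fn b x \<bullet> c))) \<longlonglongrightarrow> - (LINT x|lborel. (1 * h x) * (fn b x \<bullet> c))"
    proof (intro tendsto_minus integral_dominated_convergence[where w = "\<lambda>x. (B * 1) * norm (fn b x)"])
      show "AE x in lborel. (\<lambda>n. cutoff n x * h x * (fn b x \<bullet> c)) \<longlonglongrightarrow> (1 * h x) * (fn b x \<bullet> c)"
        by (intro AE_I2 tendsto_mult tendsto_const cutoff_tendsto)
      fix n
      have "\<bar>cutoff n x * h x * (fn b x \<bullet> c)\<bar> \<le> (B * 1) * norm (fn b x)" for x
        unfolding abs_mult using B(1,2) h(2) Basis_le_norm[OF c] by (intro mult_mono) auto
      then show "AE x in lborel. norm (cutoff n x * h x * (fn b x \<bullet> c)) \<le> (B * 1) * norm (fn b x)" by simp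
    qed (use b in auto)
    ultimately have "(LINT x|lborel. (1 * pderivative j h x + 0 * h x) * (fn a x \<bullet> c)) = - (LINT x|lborel. (1 * h x) * (fn b x \<bullet> c))"
      unfolding step by (rule LIMSEQ_unique)
    then have "(LINT x|lborel. (pderivative j h x *\<^sub>R fn a x) \<bullet> c) = - (LINT x|lborel. (h x *\<^sub>R fn b x) \<bullet> c)" by simp
    then show "(LINT x|lborel. pderivative j h x *\<^sub>R fn a x) \<bullet> c = - (LINT x|lborel. h x *\<^sub>R fn b x) \<bullet> c"
      using integral_inner_left[of c lborel "\<lambda>x. pderivative j h x *\<^sub>R fn a x"] integral_inner_left[of c lborel "\<lambda>x. h x *\<^sub>R fn b x"] ia ib
      by (simp only: inner_minus_left)
  qed
qed

lemma transform_derivative: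
  fixes a b :: "(real^'d, 'b::euclidean_space) l2"
  assumes w: "wder [j] a b" and a: "integrable lborel (fn a)" and b: "integrable lborel (fn b)"
  shows "cos_tr b \<xi> = (\<xi> $ j) *\<^sub>R sin_tr a \<xi>" "sin_tr b \<xi> = - (\<xi> $ j) *\<^sub>R cos_tr a \<xi>"
proof -
  have sm: "smooth (\<lambda>x. p * cos (\<xi> \<bullet> x) + q * sin (\<xi> \<bullet> x))" for p q
    using smooth_real_ridge[OF smooth_real_trig[of p q], of \<xi> 0] by (simp add: inner_commute)
  have pd: "pderivative j (\<lambda>x. cos (\<xi> \<bullet> x)) = (\<lambda>x. - (\<xi> $ j) * sin (\<xi> \<bullet> x))" "pderivative j (\<lambda>x. sin (\<xi> \<bullet> x)) = (\<lambda>x. (\<xi> $ j) * cos (\<xi> \<bullet> x))"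
  proof -
    have "((\<lambda>x. cos (\<xi> \<bullet> x)) has_derivative (\<lambda>h. - (\<xi> \<bullet> h) * sin (\<xi> \<bullet> x))) (at x)" "((\<lambda>x. sin (\<xi> \<bullet> x)) has_derivative (\<lambda>h. (\<xi> \<bullet> h) * cos (\<xi> \<bullet> x))) (at x)" for x
      by (auto intro!: derivative_eq_intros)
    from pderivative_eqI[OF this(1)] pderivative_eqI[OF this(2)]
    show "pderivative j (\<lambda>x. cos (\<xi> \<bullet> x)) = (\<lambda>x. - (\<xi> $ j) * sin (\<xi> \<bullet> x))" "pderivative j (\<lambda>x. sin (\<xi> \<bullet> x)) = (\<lambda>x. (\<xi> $ j) * cos (\<xi> \<bullet> x))"
      by (auto simp: inner_axis)
  qed
  have bd: "\<bar>- (\<xi> $ j) * sin t\<bar> \<le> \<bar>\<xi> $ j\<bar>" "\<bar>(\<xi> $ j) * cos t\<bar> \<le> \<bar>\<xi> $ j\<bar>" for t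
    by (auto simp: abs_mult mult_left_le)
  have "(LINT x|lborel. pderivative j (\<lambda>x. cos (\<xi> \<bullet> x)) x *\<^sub>R fn a x) = - (LINT x|lborel. cos (\<xi> \<bullet> x) *\<^sub>R fn b x)"
    using sm[of 1 0] bd by (intro integral_by_parts_bounded[OF w a b, where K = "\<bar>\<xi> $ j\<bar>"]) (auto simp: pd)
  then show "cos_tr b \<xi> = (\<xi> $ j) *\<^sub>R sin_tr a \<xi>"
    by (simp add: pd cos_tr_def sin_tr_def scaleR_scaleR[symmetric] del: scaleR_scaleR)
  have "(LINT x|lborel. pderivative j (\<lambda>x. sin (\<xi> \<bullet> x)) x *\<^sub>R fn a x) = - (LINT x|lborel. sin (\<xi> \<bullet> x) *\<^sub>R fn b x)"
    using sm[of 0 1] bd by (intro integral_by_parts_bounded[OF w a b, where K = "\<bar>\<xi> $ j\<bar>"]) (auto simp: pd)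
  then show "sin_tr b \<xi> = - (\<xi> $ j) *\<^sub>R cos_tr a \<xi>"
    by (simp add: pd cos_tr_def sin_tr_def scaleR_scaleR[symmetric] del: scaleR_scaleR)
qed

section \<open>Approximation by functions of compact support\<close>

lemma mul_tendsto:
  fixes a :: "(real^'d, 'b::euclidean_space) l2"
  assumes t: "\<And>n. test_function (\<theta> n)" and B: "\<And>n x. \<bar>\<theta> n x\<bar> \<le> B" and lim: "\<And>x. (\<lambda>n. \<theta> n x) \<longlonglongrightarrow> c"
  shows "(\<lambda>n. mul (\<theta> n) a) \<longlonglongrightarrow> c *\<^sub>R a"
proof -
  have [measurable]: "\<theta> n \<in> borel_measurable borel" for n by (rule test_function_measurable[OF t])
  have n2: "(norm (mul (\<theta> n) a - c *\<^sub>R a))\<^sup>2 = (LINT x|lborel. (\<theta> n x - c)\<^sup>2 * (norm (fn a x))\<^sup>2)" for n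
  proof -
    have "AE x in lborel. (norm (fn (mul (\<theta> n) a - c *\<^sub>R a) x))\<^sup>2 = (\<theta> n x - c)\<^sup>2 * (norm (fn a x))\<^sup>2"
      using fn_diff[of "mul (\<theta> n) a" "c *\<^sub>R a"] fn_mul[OF t[of n], of a] fn_scaleR[of c a]
      by eventually_elim (simp add: power_mult_distrib flip: scaleR_left_diff_distrib)
    then show ?thesis unfolding norm_l2_sq by (intro integral_cong_AE) auto
  qed
  have "(\<lambda>n. LINT x|lborel. (\<theta> n x - c)\<^sup>2 * (norm (fn a x))\<^sup>2) \<longlonglongrightarrow> (LINT x|lborel. (c - c)\<^sup>2 * (norm (fn a x))\<^sup>2)"
  proof (rule integral_dominated_convergence[where w = "\<lambda>x. (B + \<bar>c\<bar>)\<^sup>2 * (norm (fn a x))\<^sup>2"])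
    show "AE x in lborel. (\<lambda>n. (\<theta> n x - c)\<^sup>2 * (norm (fn a x))\<^sup>2) \<longlonglongrightarrow> (c - c)\<^sup>2 * (norm (fn a x))\<^sup>2"
      by (intro AE_I2 tendsto_intros lim)
    fix n
    have "(\<theta> n x - c)\<^sup>2 \<le> (B + \<bar>c\<bar>)\<^sup>2" for x
      using B[of n x] by (intro power2_le_iff_abs_le[THEN iffD2]) auto
    then show "AE x in lborel. norm ((\<theta> n x - c)\<^sup>2 * (norm (fn a x))\<^sup>2) \<le> (B + \<bar>c\<bar>)\<^sup>2 * (norm (fn a x))\<^sup>2"
      by (intro AE_I2) (simp add: abs_mult mult_right_mono)
  qed auto
  then have "(\<lambda>n. (norm (mul (\<theta> n) a - c *\<^sub>R a))\<^sup>2) \<longlonglongrightarrow> 0" by (simp add: n2)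
  then have "(\<lambda>n. sqrt ((norm (mul (\<theta> n) a - c *\<^sub>R a))\<^sup>2)) \<longlonglongrightarrow> sqrt 0" by (rule tendsto_real_sqrt)
  then have "(\<lambda>n. norm (mul (\<theta> n) a - c *\<^sub>R a)) \<longlonglongrightarrow> 0" by simp
  then show ?thesis by (simp add: tendsto_norm_zero_iff LIM_zero_cancel)
qed

lemma mul_cutoff_tendsto:
  fixes a :: "(real^'d, 'b::euclidean_space) l2"
  shows "(\<lambda>n. mul (cutoff n) a) \<longlonglongrightarrow> a"
    "(\<lambda>n. mul (pderivative j (cutoff n)) a) \<longlonglongrightarrow> 0"
    "(\<lambda>n. mul (pderivative i (pderivative j (cutoff n))) a) \<longlonglongrightarrow> 0"
proof -
  obtain B where B: "B > 0" "\<And>n x. \<bar>cutoff n (x :: real^'d)\<bar> \<le> B"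
    "\<And>n x j. \<bar>pderivative j (cutoff n) (x :: real^'d)\<bar> \<le> B * inverse (real (Suc n))"
    "\<And>n x i j. \<bar>pderivative i (pderivative j (cutoff n)) (x :: real^'d)\<bar> \<le> B * inverse (real (Suc n))"
    using cutoff_bounds[where 'd = 'd] by metis
  have z: "(\<lambda>n. B * inverse (real (Suc n))) \<longlonglongrightarrow> 0" using tendsto_mult[OF tendsto_const LIMSEQ_inverse_real_of_nat, of B] by simp
  have BB: "B * inverse (real (Suc n)) \<le> B" for n
    using mult_left_mono[of "inverse (real (Suc n))" 1 B] B(1) by (simp add: field_simps)
  note t = test_function_cutoff test_function_pderivative[OF test_function_cutoff]
    test_function_pderivative[OF test_function_pderivative[OF test_function_cutoff]]
  have "(\<lambda>n. mul (cutoff n) a) \<longlonglongrightarrow> 1 *\<^sub>R a"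
    by (rule mul_tendsto[OF t(1) B(2) cutoff_tendsto])
  then show "(\<lambda>n. mul (cutoff n) a) \<longlonglongrightarrow> a" by simp
  have "(\<lambda>n. mul (pderivative j (cutoff n)) a) \<longlonglongrightarrow> 0 *\<^sub>R a"
  proof (rule mul_tendsto[OF t(2)])
    show "\<bar>pderivative j (cutoff n) x\<bar> \<le> B" for n x using B(3)[of j n x] BB[of n] by linarith
    show "(\<lambda>n. pderivative j (cutoff n) x) \<longlonglongrightarrow> 0" for x
      by (rule Lim_null_comparison[OF _ z]) (use B(3) in simp)
  qed
  then show "(\<lambda>n. mul (pderivative j (cutoff n)) a) \<longlonglongrightarrow> 0" by simp
  have "(\<lambda>n. mul (pderivative i (pderivative j (cutoff n))) a) \<longlonglongrightarrow> 0 *\<^sub>R a"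
  proof (rule mul_tendsto[OF t(3)])
    show "\<bar>pderivative i (pderivative j (cutoff n)) x\<bar> \<le> B" for n x using B(4)[of i j n x] BB[of n] by linarith
    show "(\<lambda>n. pderivative i (pderivative j (cutoff n)) x) \<longlonglongrightarrow> 0" for x
      by (rule Lim_null_comparison[OF _ z]) (use B(4) in simp)
  qed
  then show "(\<lambda>n. mul (pderivative i (pderivative j (cutoff n))) a) \<longlonglongrightarrow> 0" by simp
qed

lemma der2_cutoff_tendsto:
  assumes "a \<in> H" shows "(\<lambda>n. der [i, j] (mul (cutoff n) a)) \<longlonglongrightarrow> der [i, j] a"
proof -
  have "(\<lambda>n. (mul (cutoff n) (der [i, j] a) + mul (pderivative j (cutoff n)) (der [i] a))
      + (mul (pderivative i (cutoff n)) (der [j] a) + mul (pderivative j (pderivative i (cutoff n))) a))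
    \<longlonglongrightarrow> (der [i, j] a + 0) + (0 + 0)"
    by (intro tendsto_add mul_cutoff_tendsto)
  then show ?thesis by (simp add: H_mul[OF assms test_function_cutoff])
qed

lemma free_cutoff_tendsto:
  assumes "a \<in> H" shows "(\<lambda>n. free (mul (cutoff n) a)) \<longlonglongrightarrow> free a"
  unfolding free_def
  by (intro tendsto_add tendsto_diff bounded_linear.tendsto[OF pw_lin1] bounded_linear.tendsto[OF pw_lin2] der2_cutoff_tendsto assms)

lemma integrable_fn_cong:
  fixes a :: "('a::euclidean_space, 'b::euclidean_space) l2"
  assumes "AE x in lborel. fn a x = f x" "integrable lborel f"
  shows "integrable lborel (fn a)"
  by (rule integrable_cong_AE_imp[OF assms(2)]) (use assms(1) in \<open>auto elim: eventually_mono\<close>)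

lemma integrable_fn_mul:
  fixes a :: "(real^'d, 'b::euclidean_space) l2"
  assumes "test_function \<theta>" shows "integrable lborel (fn (mul \<theta> a))"
proof (rule integrable_fn_cong[OF fn_mul[OF assms]])
  show "integrable lborel (\<lambda>x. \<theta> x *\<^sub>R fn a x)"
    using test_function_integrable(2)[OF assms, of "1::real"] by (intro sqi_scaleR_integrable sqi_fn) simp
qed

lemma integrable_fn_add: "integrable lborel (fn a) \<Longrightarrow> integrable lborel (fn b) \<Longrightarrow> integrable lborel (fn (a + b))"
  by (rule integrable_fn_cong[OF fn_add]) auto

lemma integrable_fn_diff: "integrable lborel (fn a) \<Longrightarrow> integrable lborel (fn b) \<Longrightarrow> integrable lborel (fn (a - b))"
  by (rule integrable_fn_cong[OF fn_diff]) auto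

lemma integrable_fn_scaleR: "integrable lborel (fn a) \<Longrightarrow> integrable lborel (fn (r *\<^sub>R a))"
  by (rule integrable_fn_cong[OF fn_scaleR]) auto

lemma integrable_fn_pw: "bounded_linear A \<Longrightarrow> integrable lborel (fn a) \<Longrightarrow> integrable lborel (fn (pw A a))"
  by (rule integrable_fn_cong[OF fn_pw]) (auto intro: integrable_bounded_linear)

lemma integrable_fn_der_mul:
  assumes "a \<in> H" "test_function \<theta>"
  shows "integrable lborel (fn (der [i] (mul \<theta> a)))" "integrable lborel (fn (der [i, j] (mul \<theta> a)))"
    "integrable lborel (fn (free (mul \<theta> a)))"
proof -
  show "integrable lborel (fn (der [i] (mul \<theta> a)))"
    unfolding H_mul(2)[OF assms] by (intro integrable_fn_add integrable_fn_mul assms test_function_pderivative)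
  show d: "integrable lborel (fn (der [i, j] (mul \<theta> a)))" for i j
    unfolding H_mul(3)[OF assms] by (intro integrable_fn_add integrable_fn_mul assms test_function_pderivative)
  show "integrable lborel (fn (free (mul \<theta> a)))"
    unfolding free_def by (intro integrable_fn_add integrable_fn_diff integrable_fn_pw pauli_linear d)
qed

lemma transform_cong:
  fixes a :: "('a::euclidean_space, 'b::euclidean_space) l2"
  assumes "AE x in lborel. fn a x = f x" "f \<in> borel_measurable borel"
  shows "cos_tr a \<xi> = (LINT x|lborel. cos (\<xi> \<bullet> x) *\<^sub>R f x)" "sin_tr a \<xi> = (LINT x|lborel. sin (\<xi> \<bullet> x) *\<^sub>R f x)"
  unfolding cos_tr_def sin_tr_def using assms by (auto intro!: integral_cong_AE elim: eventually_mono)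

lemma transform_add:
  fixes a b :: "('a::euclidean_space, 'b::euclidean_space) l2"
  assumes "integrable lborel (fn a)" "integrable lborel (fn b)"
  shows "cos_tr (a + b) \<xi> = cos_tr a \<xi> + cos_tr b \<xi>" "sin_tr (a + b) \<xi> = sin_tr a \<xi> + sin_tr b \<xi>"
  using trig_integrable[OF assms(1), of \<xi>] trig_integrable[OF assms(2), of \<xi>]
  by (auto simp: transform_cong[OF fn_add] scaleR_add_right cos_tr_def[of a] cos_tr_def[of b] sin_tr_def[of a] sin_tr_def[of b])

lemma transform_scaleR:
  "cos_tr (r *\<^sub>R a) \<xi> = r *\<^sub>R cos_tr a \<xi>" "sin_tr (r *\<^sub>R a) \<xi> = r *\<^sub>R sin_tr a \<xi>"
proof -
  have m: "(\<lambda>x. r *\<^sub>R fn a x) \<in> borel_measurable borel" by measurable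
  show "cos_tr (r *\<^sub>R a) \<xi> = r *\<^sub>R cos_tr a \<xi>" "sin_tr (r *\<^sub>R a) \<xi> = r *\<^sub>R sin_tr a \<xi>"
    unfolding transform_cong[OF fn_scaleR m] cos_tr_def[of a] sin_tr_def[of a] scaleR_left_commute[of _ r] by (simp_all del: scaleR_scaleR)
qed

lemma transform_diff:
  fixes a b :: "('a::euclidean_space, 'b::euclidean_space) l2"
  assumes "integrable lborel (fn a)" "integrable lborel (fn b)"
  shows "cos_tr (a - b) \<xi> = cos_tr a \<xi> - cos_tr b \<xi>" "sin_tr (a - b) \<xi> = sin_tr a \<xi> - sin_tr b \<xi>"
  using transform_add[OF assms(1) integrable_fn_scaleR[OF assms(2), of "- 1"], of \<xi>] transform_scaleR[of "- 1" b \<xi>] by auto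

lemma transform_pw:
  fixes a :: "('a::euclidean_space, 'b::euclidean_space) l2"
  assumes "bounded_linear A" "integrable lborel (fn a)"
  shows "cos_tr (pw A a) \<xi> = A (cos_tr a \<xi>)" "sin_tr (pw A a) \<xi> = A (sin_tr a \<xi>)"
proof -
  interpret A: bounded_linear A by fact
  have [measurable]: "A \<in> borel_measurable borel"
    using assms(1) by (intro borel_measurable_continuous_onI linear_continuous_on)
  have "cos_tr (pw A a) \<xi> = (LINT x|lborel. A (cos (\<xi> \<bullet> x) *\<^sub>R fn a x))"
    by (subst transform_cong[OF fn_pw[OF assms(1)]]) (auto simp: A.scaleR)
  also have "\<dots> = A (cos_tr a \<xi>)"
    unfolding cos_tr_def by (rule integral_bounded_linear[OF assms(1)]) (rule trig_integrable[OF assms(2)])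
  finally show "cos_tr (pw A a) \<xi> = A (cos_tr a \<xi>)" .
  have "sin_tr (pw A a) \<xi> = (LINT x|lborel. A (sin (\<xi> \<bullet> x) *\<^sub>R fn a x))"
    by (subst transform_cong[OF fn_pw[OF assms(1)]]) (auto simp: A.scaleR)
  also have "\<dots> = A (sin_tr a \<xi>)"
    unfolding sin_tr_def by (rule integral_bounded_linear[OF assms(1)]) (rule trig_integrable[OF assms(2)])
  finally show "sin_tr (pw A a) \<xi> = A (sin_tr a \<xi>)" .
qed

definition symbol :: "real^2 \<Rightarrow> complex^2 \<Rightarrow> complex^2" where
  "symbol \<xi> v = - (((\<xi> $ 1)\<^sup>2 - (\<xi> $ 2)\<^sup>2) *\<^sub>R \<sigma>1 v + (2 * \<xi> $ 1 * \<xi> $ 2) *\<^sub>R \<sigma>2 v)"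

lemma norm_real2_sq: "(norm (\<xi> :: real^2))\<^sup>2 = (\<xi> $ 1)\<^sup>2 + (\<xi> $ 2)\<^sup>2"
  unfolding power2_norm_eq_inner by (simp add: inner_vec_def sum_2 power2_eq_square)

lemma norm_symbol: "(norm (symbol \<xi> v))\<^sup>2 = ((norm \<xi>)\<^sup>2)\<^sup>2 * (norm v)\<^sup>2"
proof -
  have "(norm (symbol \<xi> v))\<^sup>2 = (((\<xi> $ 1)\<^sup>2 - (\<xi> $ 2)\<^sup>2)\<^sup>2 + (2 * \<xi> $ 1 * \<xi> $ 2)\<^sup>2) * (norm v)\<^sup>2"
    unfolding symbol_def norm_minus_cancel by (rule norm_pauli)
  also have "((\<xi> $ 1)\<^sup>2 - (\<xi> $ 2)\<^sup>2)\<^sup>2 + (2 * \<xi> $ 1 * \<xi> $ 2)\<^sup>2 = ((norm \<xi>)\<^sup>2)\<^sup>2"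
    unfolding norm_real2_sq by (simp add: power2_eq_square algebra_simps)
  finally show ?thesis .
qed

lemma inner_symbol_im: "inner (symbol \<xi> v) (im v) = 0"
  by (simp add: symbol_def inner_vec2 \<sigma>1_def \<sigma>2_def im_def inner_complex_def algebra_simps)

text \<open>The eigenvalues of the symbol are \<open>\<plusminus>|\<xi>|\<^sup>2\<close>; the factor on the left is the square of the smaller of their
  distances from \<open>\<alpha> + i \<eta>\<close>.\<close>

lemma norm_symbol_shifted:
  "((\<bar>\<alpha>\<bar> - (norm \<xi>)\<^sup>2)\<^sup>2 + \<eta>\<^sup>2) * (norm v)\<^sup>2 \<le> (norm (symbol \<xi> v - \<alpha> *\<^sub>R v - \<eta> *\<^sub>R im v))\<^sup>2"
proof -
  have iv: "inner v (im v) = 0" by (simp add: inner_vec2 im_def inner_complex_def)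
  have e: "(norm (symbol \<xi> v - \<alpha> *\<^sub>R v - \<eta> *\<^sub>R im v))\<^sup>2
     = (norm (symbol \<xi> v))\<^sup>2 - 2 * \<alpha> * inner (symbol \<xi> v) v + \<alpha>\<^sup>2 * (norm v)\<^sup>2 + \<eta>\<^sup>2 * (norm (im v))\<^sup>2"
    unfolding power2_norm_eq_inner
    using iv inner_symbol_im[of \<xi> v]
    by (simp add: inner_diff_left inner_diff_right inner_commute power2_eq_square algebra_simps)
  have "\<bar>inner (symbol \<xi> v) v\<bar> \<le> norm (symbol \<xi> v) * norm v" by (rule Cauchy_Schwarz_ineq2)
  moreover have "norm (symbol \<xi> v) = (norm \<xi>)\<^sup>2 * norm v"
    by (rule power2_eq_imp_eq) (auto simp: norm_symbol power_mult_distrib)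
  ultimately have "\<bar>inner (symbol \<xi> v) v\<bar> \<le> (norm \<xi>)\<^sup>2 * (norm v)\<^sup>2" by (simp add: power2_eq_square mult_ac)
  then have "\<bar>\<alpha>\<bar> * \<bar>inner (symbol \<xi> v) v\<bar> \<le> \<bar>\<alpha>\<bar> * ((norm \<xi>)\<^sup>2 * (norm v)\<^sup>2)" by (rule mult_left_mono) simp
  then have "\<alpha> * inner (symbol \<xi> v) v \<le> \<bar>\<alpha>\<bar> * ((norm \<xi>)\<^sup>2 * (norm v)\<^sup>2)"
    using abs_ge_self[of "\<alpha> * inner (symbol \<xi> v) v"] by (simp add: abs_mult)
  moreover have "((\<bar>\<alpha>\<bar> - (norm \<xi>)\<^sup>2)\<^sup>2 + \<eta>\<^sup>2) * (norm v)\<^sup>2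
    = ((norm \<xi>)\<^sup>2)\<^sup>2 * (norm v)\<^sup>2 - 2 * (\<bar>\<alpha>\<bar> * ((norm \<xi>)\<^sup>2 * (norm v)\<^sup>2)) + \<alpha>\<^sup>2 * (norm v)\<^sup>2 + \<eta>\<^sup>2 * (norm v)\<^sup>2"
    by (simp add: power2_diff algebra_simps)
  ultimately show ?thesis unfolding e norm_symbol norm_im by linarith
qed

lemma transform_free:
  assumes a: "a \<in> H" "integrable lborel (fn a)" "\<And>i. integrable lborel (fn (der [i] a))" "\<And>i j. integrable lborel (fn (der [i, j] a))"
  shows "cos_tr (der [i, j] a) \<xi> = - (\<xi> $ i * \<xi> $ j) *\<^sub>R cos_tr a \<xi>" "sin_tr (der [i, j] a) \<xi> = - (\<xi> $ i * \<xi> $ j) *\<^sub>R sin_tr a \<xi>"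
    "cos_tr (free a) \<xi> = symbol \<xi> (cos_tr a \<xi>)" "sin_tr (free a) \<xi> = symbol \<xi> (sin_tr a \<xi>)"
proof -
  have d1: "cos_tr (der [i] a) \<xi> = (\<xi> $ i) *\<^sub>R sin_tr a \<xi>" "sin_tr (der [i] a) \<xi> = - (\<xi> $ i) *\<^sub>R cos_tr a \<xi>" for i
    using transform_derivative[OF wder_der[OF a(1), of "[i]"] a(2,3)] by auto
  show d2: "cos_tr (der [i, j] a) \<xi> = - (\<xi> $ i * \<xi> $ j) *\<^sub>R cos_tr a \<xi>" "sin_tr (der [i, j] a) \<xi> = - (\<xi> $ i * \<xi> $ j) *\<^sub>R sin_tr a \<xi>" for i j
    using transform_derivative[OF wder_der_der[OF a(1), where i = i and j = j] a(3)[of i] a(4)[of i j], of \<xi>] d1[of i] by (auto simp: mult.commute)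
  have symbol_eq: "\<sigma>1 (- (\<xi> $ 1 * \<xi> $ 1) *\<^sub>R v - - (\<xi> $ 2 * \<xi> $ 2) *\<^sub>R v)
    + \<sigma>2 (- (\<xi> $ 1 * \<xi> $ 2) *\<^sub>R v + - (\<xi> $ 2 * \<xi> $ 1) *\<^sub>R v) = symbol \<xi> v" for v
    by (intro vec2_eqI complex_eqI) (simp_all add: symbol_def \<sigma>1_def \<sigma>2_def power2_eq_square algebra_simps)
  note lin = transform_add transform_diff transform_pw pauli_linear integrable_fn_add integrable_fn_diff integrable_fn_pw a(4)
  have "cos_tr (free a) \<xi> = \<sigma>1 (cos_tr (der [1, 1] a) \<xi> - cos_tr (der [2, 2] a) \<xi>) + \<sigma>2 (cos_tr (der [1, 2] a) \<xi> + cos_tr (der [2, 1] a) \<xi>)"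
    unfolding free_def by (simp only: lin)
  then show "cos_tr (free a) \<xi> = symbol \<xi> (cos_tr a \<xi>)" unfolding d2 symbol_eq .
  have "sin_tr (free a) \<xi> = \<sigma>1 (sin_tr (der [1, 1] a) \<xi> - sin_tr (der [2, 2] a) \<xi>) + \<sigma>2 (sin_tr (der [1, 2] a) \<xi> + sin_tr (der [2, 1] a) \<xi>)"
    unfolding free_def by (simp only: lin)
  then show "sin_tr (free a) \<xi> = symbol \<xi> (sin_tr a \<xi>)" unfolding d2 symbol_eq .
qed

text \<open>Ellipticity: \<open>|\<xi>\<^sub>i \<xi>\<^sub>j|\<close> is at most \<open>|\<xi>|\<^sup>2\<close>, the factor by which the symbol of the free operator multiplies norms.\<close>

lemma norm_der2_le:
  assumes "a \<in> H" shows "norm (der [i, j] a) \<le> norm (free a)"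
proof -
  have "norm (der [i, j] (mul (cutoff n) a)) \<le> norm (free (mul (cutoff n) a))" for n
  proof (rule norm_le_if_spectral_le)
    note t = test_function_cutoff[where n = n and 'd = 2]
    let ?u = "mul (cutoff n) a"
    note tr = transform_free[OF H_mul(1)[OF assms t] integrable_fn_mul[OF t] integrable_fn_der_mul(1)[OF assms t] integrable_fn_der_mul(2)[OF assms t]]
    show "integrable lborel (fn (der [i, j] ?u))" "integrable lborel (fn (free ?u))"
      by (intro integrable_fn_der_mul assms t)+
    fix \<xi> :: "real^2"
    have "\<bar>\<xi> $ i * \<xi> $ j\<bar> \<le> (norm \<xi>)\<^sup>2"
      unfolding abs_mult power2_eq_square by (intro mult_mono component_le_norm_cart) auto
    then have "\<bar>\<xi> $ i * \<xi> $ j\<bar>\<^sup>2 \<le> ((norm \<xi>)\<^sup>2)\<^sup>2" by (rule power_mono) simp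
    then have "(\<xi> $ i * \<xi> $ j)\<^sup>2 * ((norm (cos_tr ?u \<xi>))\<^sup>2 + (norm (sin_tr ?u \<xi>))\<^sup>2) \<le> ((norm \<xi>)\<^sup>2)\<^sup>2 * ((norm (cos_tr ?u \<xi>))\<^sup>2 + (norm (sin_tr ?u \<xi>))\<^sup>2)"
      by (intro mult_right_mono) auto
    then show "spectral (der [i, j] ?u) (der [i, j] ?u) \<xi> \<le> spectral (free ?u) (free ?u) \<xi>"
      unfolding spectral_self tr norm_symbol by (simp add: power_mult_distrib distrib_left)
  qed
  then show ?thesis
    by (intro LIMSEQ_le[OF tendsto_norm[OF der2_cutoff_tendsto[OF assms]] tendsto_norm[OF free_cutoff_tendsto[OF assms]]]) auto
qed

section \<open>The pointwise resolvent estimate\<close>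

text \<open>The operator \<open>D\<^sub>0 - k\<close> for \<open>k = \<alpha> + i \<eta>\<close>.\<close>

definition shifted :: "real \<Rightarrow> real \<Rightarrow> field \<Rightarrow> field" where
  "shifted \<alpha> \<eta> u = free u - \<alpha> *\<^sub>R u - \<eta> *\<^sub>R pw im u"

lemma inner_shifted_im:
  assumes "u \<in> H" shows "inner (shifted \<alpha> \<eta> u) (pw im u) = - \<eta> * (norm u)\<^sup>2"
  using inner_free_im[OF assms] inner_pw_im_self[of u]
  by (simp add: shifted_def inner_diff_left power2_norm_eq_inner[of "pw im u", symmetric] dot_square_norm norm_pw_im)

lemma norm_le_shifted:
  assumes "u \<in> H" shows "\<bar>\<eta>\<bar> * norm u \<le> norm (shifted \<alpha> \<eta> u)"
proof -
  have "\<bar>\<eta>\<bar> * (norm u)\<^sup>2 \<le> norm (shifted \<alpha> \<eta> u) * norm u"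
    using Cauchy_Schwarz_ineq2[of "shifted \<alpha> \<eta> u" "pw im u"] by (simp add: inner_shifted_im[OF assms] norm_pw_im abs_mult)
  then show ?thesis by (cases "u = 0") (auto simp: power2_eq_square mult.assoc[symmetric])
qed

text \<open>The constant: in \<open>L\<^sup>2(d\<xi>)\<close> the resolvent symbol has squared norm at most \<open>\<pi>\<^sup>2/|\<eta>|\<close>, whatever
  the real part \<open>\<alpha>\<close>, and inversion of the transform contributes a factor \<open>1/(2\<pi>)\<close>.\<close>

lemma inner_le_shifted:
  assumes u: "u \<in> H" and \<eta>: "\<eta> \<noteq> 0" and b: "integrable lborel (fn b)"
  shows "\<bar>inner u b\<bar> \<le> norm (shifted \<alpha> \<eta> u) / (2 * sqrt \<bar>\<eta>\<bar>) * (LINT x|lborel. norm (fn b x))"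
proof -
  define J where "J = (\<lambda>\<xi> :: real^2. 1 / (((norm \<xi>)\<^sup>2 - \<bar>\<alpha>\<bar>)\<^sup>2 + \<bar>\<eta>\<bar>\<^sup>2))"
  have pos: "((norm \<xi>)\<^sup>2 - \<bar>\<alpha>\<bar>)\<^sup>2 + \<bar>\<eta>\<bar>\<^sup>2 > 0" for \<xi> :: "real^2" using \<eta> by (simp add: add_nonneg_pos)
  have J0: "J \<xi> \<ge> 0" for \<xi> unfolding J_def by (auto intro: less_imp_le pos)
  have main: "\<bar>inner (mul (cutoff n) u) b\<bar> \<le> gauss_const TYPE(real^2) * sqrt (pi\<^sup>2 / \<bar>\<eta>\<bar>) * norm (shifted \<alpha> \<eta> (mul (cutoff n) u)) * (LINT x|lborel. norm (fn b x))" for n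
  proof (rule inner_le_L1_if_multiplier[where J = J])
    note t = test_function_cutoff[where n = n and 'd = 2]
    let ?u = "mul (cutoff n) u"
    note tr = transform_free[OF H_mul(1)[OF u t] integrable_fn_mul[OF t] integrable_fn_der_mul(1)[OF u t] integrable_fn_der_mul(2)[OF u t]]
    note i = integrable_fn_mul[OF t, of u] integrable_fn_der_mul(3)[OF u t]
    show "integrable lborel (fn ?u)" "integrable lborel (fn b)" by fact+
    show "integrable lborel (fn (shifted \<alpha> \<eta> ?u))"
      unfolding shifted_def by (intro integrable_fn_diff integrable_fn_scaleR integrable_fn_pw pauli_linear i)
    show "J \<in> borel_measurable borel" unfolding J_def by measurable
    show "(\<integral>\<^sup>+ \<xi>. ennreal (J \<xi>) \<partial>lborel) \<le> ennreal (pi\<^sup>2 / \<bar>\<eta>\<bar>)"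
      unfolding J_def by (rule resolvent_symbol_integral) (use \<eta> in simp)
    fix \<xi> :: "real^2"
    have c: "cos_tr (shifted \<alpha> \<eta> ?u) \<xi> = symbol \<xi> (cos_tr ?u \<xi>) - \<alpha> *\<^sub>R cos_tr ?u \<xi> - \<eta> *\<^sub>R im (cos_tr ?u \<xi>)"
      and s: "sin_tr (shifted \<alpha> \<eta> ?u) \<xi> = symbol \<xi> (sin_tr ?u \<xi>) - \<alpha> *\<^sub>R sin_tr ?u \<xi> - \<eta> *\<^sub>R im (sin_tr ?u \<xi>)"
      unfolding shifted_def
      by (simp_all add: transform_diff transform_scaleR transform_pw pauli_linear integrable_fn_diff integrable_fn_scaleR integrable_fn_pw i tr)
    have le: "(((norm \<xi>)\<^sup>2 - \<bar>\<alpha>\<bar>)\<^sup>2 + \<bar>\<eta>\<bar>\<^sup>2) * (norm v)\<^sup>2 \<le> (norm (symbol \<xi> v - \<alpha> *\<^sub>R v - \<eta> *\<^sub>R im v))\<^sup>2" for v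
      using norm_symbol_shifted[of \<alpha> \<xi> \<eta> v] by (simp add: power2_commute)
    have "(((norm \<xi>)\<^sup>2 - \<bar>\<alpha>\<bar>)\<^sup>2 + \<bar>\<eta>\<bar>\<^sup>2) * spectral ?u ?u \<xi> \<le> spectral (shifted \<alpha> \<eta> ?u) (shifted \<alpha> \<eta> ?u) \<xi>"
      unfolding spectral_self c s distrib_left by (intro add_mono le)
    then show "spectral ?u ?u \<xi> \<le> J \<xi> * spectral (shifted \<alpha> \<eta> ?u) (shifted \<alpha> \<eta> ?u) \<xi>"
      unfolding J_def using pos[of \<xi>] by (simp add: pos_le_divide_eq mult.commute)
  qed (use J0 in auto)
  have "(\<lambda>n. shifted \<alpha> \<eta> (mul (cutoff n) u)) \<longlonglongrightarrow> shifted \<alpha> \<eta> u"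
    unfolding shifted_def
    by (intro tendsto_diff tendsto_scaleR tendsto_const free_cutoff_tendsto u mul_cutoff_tendsto bounded_linear.tendsto[OF pw_lin_im])
  then have "(\<lambda>n. gauss_const TYPE(real^2) * sqrt (pi\<^sup>2 / \<bar>\<eta>\<bar>) * norm (shifted \<alpha> \<eta> (mul (cutoff n) u)) * (LINT x|lborel. norm (fn b x)))
     \<longlonglongrightarrow> gauss_const TYPE(real^2) * sqrt (pi\<^sup>2 / \<bar>\<eta>\<bar>) * norm (shifted \<alpha> \<eta> u) * (LINT x|lborel. norm (fn b x))"
    by (intro tendsto_intros)
  moreover have "(\<lambda>n. \<bar>inner (mul (cutoff n) u) b\<bar>) \<longlonglongrightarrow> \<bar>inner u b\<bar>"
    by (intro tendsto_intros mul_cutoff_tendsto)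
  ultimately have "\<bar>inner u b\<bar> \<le> gauss_const TYPE(real^2) * sqrt (pi\<^sup>2 / \<bar>\<eta>\<bar>) * norm (shifted \<alpha> \<eta> u) * (LINT x|lborel. norm (fn b x))"
    using LIMSEQ_le main by blast
  also have "gauss_const TYPE(real^2) * sqrt (pi\<^sup>2 / \<bar>\<eta>\<bar>) * norm (shifted \<alpha> \<eta> u) = norm (shifted \<alpha> \<eta> u) / (2 * sqrt \<bar>\<eta>\<bar>)"
  proof -
    have "gauss_const TYPE(real^2) = 1 / (2 * pi)"
      by (simp add: gauss_const_def power2_eq_square)
    moreover have "sqrt (pi\<^sup>2 / \<bar>\<eta>\<bar>) = pi / sqrt \<bar>\<eta>\<bar>" by (simp add: real_sqrt_divide)
    ultimately show ?thesis by simp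
  qed
  finally show ?thesis .
qed

text \<open>Testing against the normalised field on a set where the bound fails.\<close>

lemma AE_norm_le_if_L1_functional:
  fixes u :: "(real^'d, 'b::euclidean_space) l2"
  assumes le: "\<And>b. integrable lborel (fn b) \<Longrightarrow> \<bar>inner u b\<bar> \<le> K * (LINT x|lborel. norm (fn b x))" and K: "K \<ge> 0"
  shows "AE x in lborel. norm (fn u x) \<le> K"
proof -
  have "AE x in lborel. \<not> (norm x \<le> real R \<and> norm (fn u x) > K)" for R :: nat
  proof -
    define E where "E = {x :: real^'d. norm x \<le> real R \<and> norm (fn u x) > K}"
    have E [measurable]: "E \<in> sets borel" unfolding E_def by measurable
    define f where "f = (\<lambda>x. indicator E x *\<^sub>R ((1 / norm (fn u x)) *\<^sub>R fn u x))"
    have [measurable]: "f \<in> borel_measurable borel" unfolding f_def by measurable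
    have nf: "norm (f x) = indicator E x" for x
      using K by (auto simp: f_def E_def indicator_def)
    have "sqi f"
      by (rule sqi_bound[OF sqi_indicator_cball[of "real R"], of _ 1]) (auto simp: nf E_def indicator_def)
    note fb = fn_cls[OF this]
    have fin: "emeasure lborel E < \<infinity>"
    proof -
      have "emeasure lborel E \<le> emeasure lborel (cball (0 :: real^'d) (real R))" by (rule emeasure_mono) (auto simp: E_def)
      also have "\<dots> < \<infinity>" by (rule emeasure_bounded_finite) simp
      finally show ?thesis .
    qed
    have iE: "integrable lborel (indicator E :: _ \<Rightarrow> real)" using fin by auto
    have fi: "integrable lborel f"
      by (rule Bochner_Integration.integrable_bound[OF iE]) (auto simp: nf)
    have "integrable lborel (fn (cls f))" by (rule integrable_fn_cong[OF fb fi])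
    from le[OF this] have "inner u (cls f) \<le> K * (LINT x|lborel. norm (fn (cls f) x))" by linarith
    moreover have "(LINT x|lborel. norm (fn (cls f) x)) = (LINT x|lborel. indicator E x)"
      using fb by (intro integral_cong_AE) (auto simp: nf elim: eventually_mono)
    moreover have "inner u (cls f) = (LINT x|lborel. indicator E x * norm (fn u x))"
    proof -
      have "fn u x \<bullet> f x = indicator E x * norm (fn u x)" for x
        by (simp add: f_def dot_square_norm power2_eq_square)
      then show ?thesis by (subst inner_cls_right[OF \<open>sqi f\<close>]) simp
    qed
    moreover have iu: "integrable lborel (\<lambda>x. indicator E x * norm (fn u x))"
    proof -
      have "sqi (indicator E :: _ \<Rightarrow> real)"
        by (rule sqi_bound[OF sqi_indicator_cball[of "real R"], of _ 1]) (auto simp: E_def indicator_def)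
      moreover have "sqi (\<lambda>x. norm (fn u x))" by (simp add: sqi_def)
      ultimately show ?thesis using sqi_inner_integrable by fastforce
    qed
    ultimately have "(LINT x|lborel. indicator E x * norm (fn u x) - K * indicator E x) \<le> 0" using iE by simp
    moreover have nn: "indicator E x * norm (fn u x) - K * indicator E x \<ge> (0 :: real)" for x by (auto simp: E_def indicator_def)
    ultimately have "(LINT x|lborel. indicator E x * norm (fn u x) - K * indicator E x) = 0"
      by (intro antisym integral_nonneg_AE AE_I2)
    then have "AE x in lborel. indicator E x * norm (fn u x) - K * indicator E x = 0"
      using iu iE nn by (subst (asm) integral_nonneg_eq_0_iff_AE) auto
    then show ?thesis by (rule eventually_mono) (auto simp: E_def indicator_def)
  qed
  then have "AE x in lborel. \<forall>R::nat. \<not> (norm x \<le> real R \<and> norm (fn u x) > K)" unfolding AE_all_countable by blast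
  then show ?thesis
  proof eventually_elim
    case (elim x)
    obtain R :: nat where "norm x \<le> real R" using real_arch_simple by blast
    then show ?case using elim by auto
  qed
qed

text \<open>A field that is bounded as a functional on integrable fields is bounded pointwise by the same constant.\<close>

lemma AE_norm_le_shifted:
  assumes "u \<in> H" "\<eta> \<noteq> 0"
  shows "AE x in lborel. (norm (fn u x))\<^sup>2 \<le> (norm (shifted \<alpha> \<eta> u))\<^sup>2 / (4 * \<bar>\<eta>\<bar>)"
proof -
  have "AE x in lborel. norm (fn u x) \<le> norm (shifted \<alpha> \<eta> u) / (2 * sqrt \<bar>\<eta>\<bar>)"
    by (rule AE_norm_le_if_L1_functional) (use inner_le_shifted[OF assms] in auto)
  then show ?thesis
  proof eventually_elim
    case (elim x)
    then have "(norm (fn u x))\<^sup>2 \<le> (norm (shifted \<alpha> \<eta> u) / (2 * sqrt \<bar>\<eta>\<bar>))\<^sup>2" by (rule power_mono) simp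
    then show ?case by (simp add: power_divide power_mult_distrib)
  qed
qed

section \<open>Limits in the Sobolev space\<close>

instance l2 :: (euclidean_space, euclidean_space) banach ..

lemma l2_AE_subsequence:
  fixes X :: "nat \<Rightarrow> ('a::euclidean_space, 'b::euclidean_space) l2"
  assumes "X \<longlonglongrightarrow> a"
  shows "\<exists>r. strict_mono r \<and> (AE x in lborel. (\<lambda>n. fn (X (r n)) x) \<longlonglongrightarrow> fn a x)"
proof -
  have "(\<lambda>n. (norm (X n - a))\<^sup>2) \<longlonglongrightarrow> 0\<^sup>2"
    using assms by (intro tendsto_power) (simp add: tendsto_norm_zero LIM_zero)
  then have "(\<lambda>n. LINT x|lborel. norm ((norm (fn (X n - a) x))\<^sup>2)) \<longlonglongrightarrow> 0"
    by (simp add: norm_l2_sq)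
  then obtain r where r: "strict_mono r" "AE x in lborel. (\<lambda>n. (norm (fn (X (r n) - a) x))\<^sup>2) \<longlonglongrightarrow> 0"
    using tendsto_L1_AE_subseq[of lborel "\<lambda>n x. (norm (fn (X n - a) x))\<^sup>2"] by auto
  have "AE x in lborel. \<forall>n. fn (X (r n) - a) x = fn (X (r n)) x - fn a x"
    unfolding AE_all_countable by (intro allI fn_diff)
  with r(2) have "AE x in lborel. (\<lambda>n. fn (X (r n)) x) \<longlonglongrightarrow> fn a x"
  proof eventually_elim
    case (elim x)
    have "(\<lambda>n. sqrt ((norm (fn (X (r n)) x - fn a x))\<^sup>2)) \<longlonglongrightarrow> sqrt 0"
      using elim by (intro tendsto_real_sqrt) simp
    then show ?case by (simp add: tendsto_norm_zero_iff LIM_zero_cancel)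
  qed
  then show ?thesis using r(1) by blast
qed

lemma H_diff_der:
  assumes "a \<in> H" "b \<in> H"
  shows "der [i] (a - b) = der [i] a - der [i] b" "der [i, j] (a - b) = der [i, j] a - der [i, j] b"
  using H_add[OF assms(1) H_scaleR(1)[OF assms(2), of "- 1"]] H_scaleR(2,3)[OF assms(2), where r = "- 1"] by auto

lemma norm_der1_le_sum:
  assumes "a \<in> H" shows "(norm (der [i] a))\<^sup>2 \<le> (norm a)\<^sup>2 + (norm (free a))\<^sup>2"
proof -
  have "(norm (der [i] a))\<^sup>2 \<le> norm a * norm (free a)"
    using norm_der1_le[OF assms, of i] norm_der2_le[OF assms, of i i] by (meson mult_left_mono norm_ge_zero order_trans)
  also have "\<dots> \<le> (norm a)\<^sup>2 + (norm (free a))\<^sup>2"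
    using sum_squares_bound[of "norm a" "norm (free a)"] mult_nonneg_nonneg[OF norm_ge_zero[of a] norm_ge_zero[of "free a"]] by linarith
  finally show ?thesis .
qed

lemma convergent_if_dominated:
  fixes Y :: "nat \<Rightarrow> 'h::{real_normed_vector, complete_space}"
  assumes A: "A \<longlonglongrightarrow> a" and B: "B \<longlonglongrightarrow> b"
    and le: "\<And>m n. (norm (Y m - Y n))\<^sup>2 \<le> (norm (A m - A n))\<^sup>2 + (norm (B m - B n))\<^sup>2"
  shows "convergent Y"
proof (rule Cauchy_convergent, rule CauchyI)
  fix e :: real assume e: "e > 0"
  obtain M where M: "\<And>m n. m \<ge> M \<Longrightarrow> n \<ge> M \<Longrightarrow> norm (A m - A n) < e / 2"
    using CauchyD[OF LIMSEQ_imp_Cauchy[OF A], of "e / 2"] e by auto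
  obtain N where N: "\<And>m n. m \<ge> N \<Longrightarrow> n \<ge> N \<Longrightarrow> norm (B m - B n) < e / 2"
    using CauchyD[OF LIMSEQ_imp_Cauchy[OF B], of "e / 2"] e by auto
  have "norm (Y m - Y n) < e" if "m \<ge> max M N" "n \<ge> max M N" for m n
  proof (rule power_less_imp_less_base)
    have "(norm (A m - A n))\<^sup>2 < (e / 2)\<^sup>2" using M[of m n] that by (intro power_strict_mono) auto
    moreover have "(norm (B m - B n))\<^sup>2 < (e / 2)\<^sup>2" using N[of m n] that by (intro power_strict_mono) auto
    moreover have "(e / 2)\<^sup>2 + (e / 2)\<^sup>2 \<le> e\<^sup>2" by (simp add: power_divide)
    ultimately show "(norm (Y m - Y n))\<^sup>2 < e\<^sup>2" using le[of m n] by linarith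
  qed (use e in simp)
  then show "\<exists>M. \<forall>m\<ge>M. \<forall>n\<ge>M. norm (Y m - Y n) < e" by blast
qed

lemma convergent_if_dominated1:
  fixes Y :: "nat \<Rightarrow> 'h::{real_normed_vector, complete_space}"
  assumes A: "A \<longlonglongrightarrow> a" and le: "\<And>m n. norm (Y m - Y n) \<le> norm (A m - A n)"
  shows "convergent Y"
proof (rule Cauchy_convergent, rule CauchyI)
  fix e :: real assume e: "e > 0"
  show "\<exists>M. \<forall>m\<ge>M. \<forall>n\<ge>M. norm (Y m - Y n) < e"
    using CauchyD[OF LIMSEQ_imp_Cauchy[OF A] e] le by (meson le_less_trans)
qed

text \<open>The graph norm of the free operator controls all derivatives up to second order, so that these converge
  together with \<open>X n\<close> and \<open>free (X n)\<close>.\<close>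

lemma free_closed:
  assumes X: "\<And>n. X n \<in> H" "X \<longlonglongrightarrow> u" "(\<lambda>n. free (X n)) \<longlonglongrightarrow> f"
  shows "u \<in> H" "free u = f"
proof -
  have "convergent (\<lambda>n. der [i] (X n))" for i
  proof (rule convergent_if_dominated[OF X(2,3)])
    show "(norm (der [i] (X m) - der [i] (X n)))\<^sup>2 \<le> (norm (X m - X n))\<^sup>2 + (norm (free (X m) - free (X n)))\<^sup>2" for m n
      using norm_der1_le_sum[OF H_diff[OF X(1) X(1)], of i m n] by (simp add: H_diff_der X(1) free_diff)
  qed
  then obtain g where g: "\<And>i. (\<lambda>n. der [i] (X n)) \<longlonglongrightarrow> g i" unfolding convergent_def by metis
  have "convergent (\<lambda>n. der [i, j] (X n))" for i j
  proof (rule convergent_if_dominated1[OF X(3)])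
    show "norm (der [i, j] (X m) - der [i, j] (X n)) \<le> norm (free (X m) - free (X n))" for m n
      using norm_der2_le[OF H_diff[OF X(1) X(1)], of i j m n] by (simp add: H_diff_der X(1) free_diff)
  qed
  then obtain h where h: "\<And>i j. (\<lambda>n. der [i, j] (X n)) \<longlonglongrightarrow> h i j" unfolding convergent_def by metis
  have "wder [i] u (g i)" for i
    by (rule wder_tendsto[OF _ X(2) g]) (simp add: wder_der X(1))
  moreover have "wder [j] (g i) (h i j)" for i j
    by (rule wder_tendsto[OF _ g h]) (rule wder_der_der[OF X(1)])
  ultimately have u: "u \<in> H" "\<And>i j. der [i, j] u = h i j"
    using H_I[of u g h] by blast+
  show "u \<in> H" by fact
  have "(\<lambda>n. free (X n)) \<longlonglongrightarrow> free u"
    unfolding free_def u(2)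
    by (intro tendsto_add tendsto_diff bounded_linear.tendsto[OF pw_lin1] bounded_linear.tendsto[OF pw_lin2] h)
  then show "free u = f" using X(3) LIMSEQ_unique by blast
qed

lemma wder_tf:
  fixes c :: "'b::euclidean_space" and \<phi> :: "real^'d \<Rightarrow> real"
  assumes \<phi>: "test_function \<phi>" shows "wder [j] (tf \<phi> c) (tf (pderivative j \<phi>) c)"
  unfolding wder_def
proof (intro allI impI)
  fix \<psi> :: "real^'d \<Rightarrow> real" and e :: 'b assume \<psi>: "test_function \<psi>"
  have i: "inner (tf p c) (tf q e) = (LINT x|lborel. q x * p x) * (c \<bullet> e)" if "test_function p" "test_function q" for p q :: "real^'d \<Rightarrow> real"
    unfolding tf_def by (subst inner_cls) (auto simp: test_function_integrable that mult.assoc[symmetric])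
  have "(LINT x|lborel. pderivative j \<psi> x * \<phi> x) = - (LINT x|lborel. \<psi> x * pderivative j \<phi> x)"
    using integral_by_parts[OF \<phi> test_function_smooth[OF \<psi>], of j] by (simp add: mult.commute)
  then show "inner (tf \<phi> c) (tf (pderivatives [j] \<psi>) e) = (- 1) ^ length [j] * inner (tf (pderivative j \<phi>) c) (tf \<psi> e)"
    using \<phi> \<psi> by (simp add: i test_function_pderivative)
qed

lemma tf_in_H: "test_function \<phi> \<Longrightarrow> tf \<phi> c \<in> H"
  by (rule H_I(1)[OF wder_tf wder_tf]) (auto intro: test_function_pderivative)

text \<open>Superpositions of countably many translates are the fields on which a perturbation with unbounded local
  norms would fail to be square integrable.\<close>

lemma summable_shifts:
  fixes a :: "(real^'d, 'b::euclidean_space) l2"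
  shows "summable (\<lambda>n. (1 / 2) ^ n *\<^sub>R shift (y n) a)"
  by (rule summable_norm_cancel) (auto intro!: summable_mult2 summable_geometric)

lemma shifts_in_H:
  assumes "a \<in> H" shows "(\<Sum>n. (1 / 2) ^ n *\<^sub>R shift (y n) a) \<in> H"
proof -
  have w: "wder js (\<Sum>n. (1 / 2) ^ n *\<^sub>R shift (y n) b) (\<Sum>n. (1 / 2) ^ n *\<^sub>R shift (y n) c)" if bc: "wder js b c" for js and b c :: field
  proof (rule wder_tendsto[OF _ summable_LIMSEQ[OF summable_shifts] summable_LIMSEQ[OF summable_shifts]])
    show "wder js (\<Sum>k<n. (1 / 2) ^ k *\<^sub>R shift (y k) b) (\<Sum>k<n. (1 / 2) ^ k *\<^sub>R shift (y k) c)" for n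
    proof (induction n)
      case 0
      show ?case by (simp add: wder_def)
    next
      case (Suc n)
      then show ?case by (simp add: wder_add wder_scaleR wder_shift bc)
    qed
  qed
  show ?thesis
    by (rule H_I(1)[OF w w]) (use wder_der[OF assms, of "[_]"] wder_der_der[OF assms] in auto)
qed

section \<open>Dissipative perturbations\<close>

lemma norm_matrix_vector_le:
  fixes A :: "complex^2^2" shows "norm (A *v v) \<le> norm A * norm v"
proof -
  have "norm ((A *v v) $ i) \<le> norm (A $ i) * norm v" for i
  proof -
    have "norm ((A *v v) $ i) \<le> (\<Sum>j\<in>UNIV. \<bar>norm (A $ i $ j)\<bar> * \<bar>norm (v $ j)\<bar>)"
      unfolding matrix_vector_mult_def by (auto intro!: order_trans[OF norm_sum] sum_mono simp: norm_mult)
    also have "\<dots> \<le> norm (A $ i) * norm v" unfolding norm_vec_def by (rule L2_set_mult_ineq)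
    finally show ?thesis .
  qed
  then have "norm (A *v v) \<le> L2_set (\<lambda>i. norm (A $ i) * norm v) UNIV"
    unfolding norm_vec_def[of "A *v v"] by (intro L2_set_mono) auto
  also have "\<dots> = norm A * norm v" unfolding norm_vec_def[of A] by (simp add: L2_set_left_distrib)
  finally show ?thesis .
qed

lemma bounded_bilinear_matrix_vector: "bounded_bilinear (\<lambda>A v. (A :: complex^2^2) *v (v :: complex^2))"
proof
  fix A B :: "complex^2^2" and v w :: "complex^2" and r :: real
  show "(A + B) *v v = A *v v + B *v v" by (rule matrix_vector_mult_add_rdistrib)
  show "A *v (v + w) = A *v v + A *v w" by (rule matrix_vector_right_distrib)
  show "(r *\<^sub>R A) *v v = r *\<^sub>R (A *v v)" "A *v (r *\<^sub>R v) = r *\<^sub>R (A *v v)"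
    by (auto simp: vec_eq_iff matrix_vector_mult_def scaleR_sum_right)
  show "\<exists>K. \<forall>(A :: complex^2^2) v. norm (A *v v) \<le> norm A * norm v * K"
    using norm_matrix_vector_le by (intro exI[of _ 1]) simp
qed

lemma matrix_vector_measurable [measurable (raw)]:
  fixes A :: "'a \<Rightarrow> complex^2^2" and v :: "'a \<Rightarrow> complex^2"
  assumes "A \<in> borel_measurable M" "v \<in> borel_measurable M"
  shows "(\<lambda>x. A x *v v x) \<in> borel_measurable M"
proof (rule borel_measurable_continuous_Pair[OF assms])
  show "continuous_on UNIV (\<lambda>x. (fst x :: complex^2^2) *v snd x)"
    by (intro bounded_bilinear.continuous_on[OF bounded_bilinear_matrix_vector] continuous_intros)
qed

text \<open>The perturbation is \<open>i W\<^sup>2\<close>. The norm of a matrix is the Hilbert-Schmidt norm, hence \<open>|W|\<^sup>2 = tr W\<^sup>2\<close> and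
  \<open>W_small\<close> is the smallness condition on the potential.\<close>

locale dissipative =
  fixes W :: "real^2 \<Rightarrow> complex^2^2"
  assumes W_measurable [measurable]: "W \<in> borel_measurable borel"
    and W_adjoint: "inner (W x *v v) w = inner v (W x *v w)"
    and W_integrable: "integrable lborel (\<lambda>x. (norm (W x))\<^sup>2)"
    and W_small: "(LINT x|lborel. (norm (W x))\<^sup>2) < 4"
    and W_maps: "u \<in> H \<Longrightarrow> sqi (\<lambda>x. W x *v (W x *v fn u x))"
begin

definition Wf :: "field \<Rightarrow> field" where "Wf u = cls (\<lambda>x. W x *v fn u x)"
definition Q :: "field \<Rightarrow> field" where "Q u = cls (\<lambda>x. W x *v (W x *v fn u x))"

abbreviation "N \<equiv> (LINT x|lborel. (norm (W x))\<^sup>2)"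

lemma N_nonneg: "N \<ge> 0" by simp

lemma Wf_bound:
  assumes "u \<in> H" "\<eta> \<noteq> 0"
  shows "AE x in lborel. (norm (W x *v fn u x))\<^sup>2 \<le> (norm (W x))\<^sup>2 * ((norm (shifted \<alpha> \<eta> u))\<^sup>2 / (4 * \<bar>\<eta>\<bar>))"
  using AE_norm_le_shifted[OF assms, of \<alpha>]
proof eventually_elim
  case (elim x)
  have "(norm (W x *v fn u x))\<^sup>2 \<le> (norm (W x) * norm (fn u x))\<^sup>2"
    by (intro power_mono norm_matrix_vector_le) simp
  also have "\<dots> \<le> (norm (W x))\<^sup>2 * ((norm (shifted \<alpha> \<eta> u))\<^sup>2 / (4 * \<bar>\<eta>\<bar>))"
    unfolding power_mult_distrib using elim by (intro mult_left_mono) auto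
  finally show ?case .
qed

lemma Wf_sqi:
  assumes "u \<in> H" shows "sqi (\<lambda>x. W x *v fn u x)"
  unfolding sqi_def
proof
  show "integrable lborel (\<lambda>x. (norm (W x *v fn u x))\<^sup>2)"
  proof (rule Bochner_Integration.integrable_bound)
    show "integrable lborel (\<lambda>x. (norm (W x))\<^sup>2 * ((norm (shifted 0 1 u))\<^sup>2 / (4 * \<bar>1\<bar>)))" using W_integrable by simp
    show "AE x in lborel. norm ((norm (W x *v fn u x))\<^sup>2) \<le> norm ((norm (W x))\<^sup>2 * ((norm (shifted 0 1 u))\<^sup>2 / (4 * \<bar>1\<bar>)))"
      using Wf_bound[OF assms, of 1 0] by auto
  qed measurable
qed measurable

text \<open>The pointwise resolvent estimate, integrated against \<open>|W|\<^sup>2\<close>.\<close>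

lemma norm_Wf_le:
  assumes "u \<in> H" "\<eta> \<noteq> 0"
  shows "(norm (Wf u))\<^sup>2 \<le> N / (4 * \<bar>\<eta>\<bar>) * (norm (shifted \<alpha> \<eta> u))\<^sup>2"
proof -
  have "(norm (Wf u))\<^sup>2 = (LINT x|lborel. (norm (W x *v fn u x))\<^sup>2)"
    unfolding Wf_def by (rule norm_cls_sq[OF Wf_sqi[OF assms(1)]])
  also have "\<dots> \<le> (LINT x|lborel. (norm (W x))\<^sup>2 * ((norm (shifted \<alpha> \<eta> u))\<^sup>2 / (4 * \<bar>\<eta>\<bar>)))"
    using Wf_bound[OF assms, of \<alpha>] Wf_sqi[OF assms(1)] W_integrable
    by (intro integral_mono_AE) (auto simp: sqi_def)
  finally show ?thesis by simp
qed

lemma inner_Q: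
  assumes "u \<in> H" "v \<in> H" shows "inner (Q u) v = inner (Wf u) (Wf v)"
proof -
  have "inner (Q u) v = (LINT x|lborel. (W x *v (W x *v fn u x)) \<bullet> fn v x)"
    using inner_cls[OF W_maps[OF assms(1)] sqi_fn[of v]] by (simp add: Q_def)
  moreover have "inner (Wf u) (Wf v) = (LINT x|lborel. (W x *v fn u x) \<bullet> (W x *v fn v x))"
    unfolding Wf_def by (rule inner_cls[OF Wf_sqi[OF assms(1)] Wf_sqi[OF assms(2)]])
  ultimately show ?thesis by (simp add: W_adjoint)
qed

lemma Q_add:
  assumes "u \<in> H" "v \<in> H" shows "Q (u + v) = Q u + Q v"
  unfolding Q_def cls_add[OF W_maps[OF assms(1)] W_maps[OF assms(2)], symmetric]
  by (rule cls_cong) (use fn_add[of u v] in \<open>eventually_elim, simp add: matrix_vector_right_distrib\<close>)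

lemma Q_scaleR:
  assumes "u \<in> H" shows "Q (r *\<^sub>R u) = r *\<^sub>R Q u"
  unfolding Q_def cls_scaleR[OF W_maps[OF assms], symmetric]
  by (rule cls_cong) (use fn_scaleR[of r u] in \<open>eventually_elim, simp add: bounded_bilinear.scaleR_right[OF bounded_bilinear_matrix_vector]\<close>)

text \<open>A gliding hump: were the local norms of \<open>W\<^sup>2\<close> unbounded, a superposition of translated bumps
  with geometrically decreasing weights would be mapped outside \<open>L\<^sup>2\<close>.\<close>

lemma local_bound_direction:
  assumes e: "norm e = 1"
  shows "\<exists>M\<ge>0. \<forall>y. (\<integral>\<^sup>+ x. ennreal ((norm (W x *v (W x *v e)))\<^sup>2 * (mollifier (x - y))\<^sup>2) \<partial>lborel) \<le> ennreal M"
proof (rule ccontr)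
  have [measurable]: "(mollifier :: real^2 \<Rightarrow> real) \<in> borel_measurable borel" by (rule test_function_measurable[OF test_function_mollifier])
  define I where "I = (\<lambda>y. \<integral>\<^sup>+ x. ennreal ((norm (W x *v (W x *v e)))\<^sup>2 * (mollifier (x - y))\<^sup>2) \<partial>lborel)"
  assume "\<not> ?thesis"
  then have neg: "\<exists>y. \<not> I y \<le> ennreal M" if "M \<ge> 0" for M
    unfolding I_def using that by blast
  \<comment> \<open>The hump at \<open>y n\<close> gets the amplitude \<open>(1/2)\<^sup>n\<close> and so contributes at least \<open>16\<^sup>n / 4\<^sup>n = 4\<^sup>n\<close> to the squared
    norm of the image.\<close>
  have "\<forall>n. \<exists>y. ennreal (16 ^ n) < I y"
  proof
    fix n :: nat
    have "(16 :: real) ^ n \<ge> 0" by simp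
    from neg[OF this] show "\<exists>y. ennreal (16 ^ n) < I y" by (simp only: not_le)
  qed
  from choice[OF this] obtain y0 where y0: "\<forall>n. ennreal (16 ^ n) < I (y0 n)" ..
  define y :: "nat \<Rightarrow> real^2" where "y = y0"
  have y: "(\<integral>\<^sup>+ x. ennreal ((norm (W x *v (W x *v e)))\<^sup>2 * (mollifier (x - y n))\<^sup>2) \<partial>lborel) > ennreal (16 ^ n)" for n
    using y0 unfolding y_def I_def by blast
  define a where "a = (\<lambda>k. (1 / 2) ^ k *\<^sub>R shift (y k) (tf mollifier e))"
  define u where "u = (\<Sum>k. a k)"
  have uH: "u \<in> H" unfolding u_def a_def by (rule shifts_in_H[OF tf_in_H[OF test_function_mollifier]])
  have lim: "(\<lambda>n. \<Sum>k<n. a k) \<longlonglongrightarrow> u" unfolding u_def a_def by (rule summable_LIMSEQ[OF summable_shifts])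
  obtain r where r: "strict_mono r" "AE x in lborel. (\<lambda>n. fn (\<Sum>k<r n. a k) x) \<longlonglongrightarrow> fn u x"
    using l2_AE_subsequence[OF lim] by blast
  define s where "s = (\<lambda>k x. (1 / 2) ^ k * mollifier (x - y k))"
  have s0: "s k x \<ge> 0" for k x by (simp add: s_def mollifier_nonneg)
  have "AE x in lborel. fn (a k) x = s k x *\<^sub>R e" for k
  proof -
    have "AE x in lborel. fn (tf (\<lambda>x. mollifier (x - y k)) e) x = mollifier (x - y k) *\<^sub>R e"
      unfolding tf_def by (intro fn_cls test_function_integrable test_function_shift test_function_mollifier)
    then show ?thesis
      unfolding a_def shift_tf[OF test_function_mollifier] using fn_scaleR[of "(1 / 2) ^ k" "tf (\<lambda>x. mollifier (x - y k)) e"]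
      by eventually_elim (simp add: s_def)
  qed
  then have 1: "AE x in lborel. \<forall>k. fn (a k) x = s k x *\<^sub>R e" unfolding AE_all_countable by blast
  have 2: "AE x in lborel. \<forall>n. fn ((\<Sum>k<n. a k) + a n) x = fn (\<Sum>k<n. a k) x + fn (a n) x"
    unfolding AE_all_countable by (intro allI fn_add)
  have main: "AE x in lborel. \<exists>c. fn u x = c *\<^sub>R e \<and> (\<forall>m. s m x \<le> c)"
    using r(2) 1 2 fn_zero[where 'a = "real^2" and 'b = "complex^2"]
  proof eventually_elim
    case (elim x)
    have sums: "fn (\<Sum>k<n. a k) x = (\<Sum>k<n. s k x) *\<^sub>R e" for n
      by (induction n) (use elim in \<open>auto simp: scaleR_add_left\<close>)
    have ee: "e \<bullet> e = 1" using e by (simp add: dot_square_norm)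
    define c where "c = fn u x \<bullet> e"
    have "(\<lambda>n. ((\<Sum>k<r n. s k x) *\<^sub>R e) \<bullet> e) \<longlonglongrightarrow> fn u x \<bullet> e"
      using elim(1) unfolding sums by (intro tendsto_inner tendsto_const)
    then have c: "(\<lambda>n. \<Sum>k<r n. s k x) \<longlonglongrightarrow> c" by (simp add: ee c_def)
    then have "(\<lambda>n. (\<Sum>k<r n. s k x) *\<^sub>R e) \<longlonglongrightarrow> c *\<^sub>R e" by (intro tendsto_intros)
    then have "fn u x = c *\<^sub>R e" using elim(1) unfolding sums by (rule LIMSEQ_unique[rotated])
    moreover have "s m x \<le> c" for m
    proof (rule LIMSEQ_le_const[OF c], intro exI[of _ "Suc m"] allI impI)
      fix n assume "Suc m \<le> n"
      then have "m < r n" using seq_suble[OF r(1), of n] by linarith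
      then show "s m x \<le> (\<Sum>k<r n. s k x)" by (intro member_le_sum) (auto simp: s0)
    qed
    ultimately show ?case by blast
  qed
  define F where "F = (LINT x|lborel. (norm (W x *v (W x *v fn u x)))\<^sup>2)"
  have Fe: "(\<integral>\<^sup>+ x. ennreal ((norm (W x *v (W x *v fn u x)))\<^sup>2) \<partial>lborel) = ennreal F"
    unfolding F_def using W_maps[OF uH] by (intro nn_integral_eq_integral) (auto simp: sqi_def)
  have "4 ^ m \<le> F" for m :: nat
  proof -
    have "ennreal (4 ^ m) = ennreal ((1 / 4) ^ m) * ennreal (16 ^ m)"
      by (simp add: ennreal_mult[symmetric] power_mult_distrib[symmetric])
    also have "\<dots> \<le> ennreal ((1 / 4) ^ m) * (\<integral>\<^sup>+ x. ennreal ((norm (W x *v (W x *v e)))\<^sup>2 * (mollifier (x - y m))\<^sup>2) \<partial>lborel)"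
      using y[of m] by (intro mult_left_mono) auto
    also have "\<dots> = (\<integral>\<^sup>+ x. ennreal ((1 / 4) ^ m) * ennreal ((norm (W x *v (W x *v e)))\<^sup>2 * (mollifier (x - y m))\<^sup>2) \<partial>lborel)"
      by (rule nn_integral_cmult[symmetric]) measurable
    also have "\<dots> \<le> (\<integral>\<^sup>+ x. ennreal ((norm (W x *v (W x *v fn u x)))\<^sup>2) \<partial>lborel)"
      using main
    proof (intro nn_integral_mono_AE, eventually_elim)
      case (elim x)
      then obtain c where c: "fn u x = c *\<^sub>R e" "s m x \<le> c" by blast
      have "(s m x)\<^sup>2 * (norm (W x *v (W x *v e)))\<^sup>2 \<le> c\<^sup>2 * (norm (W x *v (W x *v e)))\<^sup>2"
        using c(2) s0 by (intro mult_right_mono power_mono) auto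
      also have "\<dots> = (norm (W x *v (W x *v fn u x)))\<^sup>2"
        by (simp add: c(1) bounded_bilinear.scaleR_right[OF bounded_bilinear_matrix_vector] power_mult_distrib)
      finally have le: "(s m x)\<^sup>2 * (norm (W x *v (W x *v e)))\<^sup>2 \<le> (norm (W x *v (W x *v fn u x)))\<^sup>2" .
      have "(s m x)\<^sup>2 = (1 / 2 * (1 / 2)) ^ m * (mollifier (x - y m))\<^sup>2"
        unfolding s_def power_mult_distrib by (simp only: power2_eq_square power_mult_distrib)
      with le have "(1 / 4) ^ m * ((norm (W x *v (W x *v e)))\<^sup>2 * (mollifier (x - y m))\<^sup>2) \<le> (norm (W x *v (W x *v fn u x)))\<^sup>2"
        by (simp add: mult_ac)
      then show ?case by (subst ennreal_mult[symmetric]) (auto intro: ennreal_leI)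
    qed
    finally show ?thesis unfolding Fe by (subst (asm) ennreal_le_iff) (auto simp: F_def)
  qed
  moreover obtain m :: nat where "F < 4 ^ m" using real_arch_pow[of 4 F] by auto
  ultimately show False using not_le by blast
qed

text \<open>The squared Hilbert-Schmidt norm of \<open>W\<^sup>2\<close>, as a sum over the two directions to which the gliding hump argument
  applies.\<close>

definition g :: "real^2 \<Rightarrow> real" where
  "g x = (norm (W x *v (W x *v axis 1 1)))\<^sup>2 + (norm (W x *v (W x *v axis 2 1)))\<^sup>2"

lemma g_measurable [measurable]: "g \<in> borel_measurable borel"
  unfolding g_def[abs_def] by measurable

lemma g_nonneg: "g x \<ge> 0" by (simp add: g_def)

lemma norm_WW_le: "(norm (W x *v (W x *v v)))\<^sup>2 \<le> g x * (norm v)\<^sup>2"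
proof -
  let ?B = "W x ** W x"
  have col: "?B *v axis j 1 = (\<chi> i. ?B $ i $ j)" for j
    by (simp add: vec_eq_iff matrix_vector_mult_def axis_def if_distrib cong: if_cong)
  have nv: "(norm (w :: complex^2))\<^sup>2 = (norm (w $ 1))\<^sup>2 + (norm (w $ 2))\<^sup>2" for w
    by (simp add: norm_vec_def L2_set_def sum_2)
  have nm: "(norm (A :: complex^2^2))\<^sup>2 = (norm (A $ 1))\<^sup>2 + (norm (A $ 2))\<^sup>2" for A
    by (simp add: norm_vec_def[of A] L2_set_def sum_2)
  have "g x = (norm ?B)\<^sup>2"
    by (simp add: g_def matrix_vector_mul_assoc col nv nm)
  moreover have "(norm (?B *v v))\<^sup>2 \<le> (norm ?B * norm v)\<^sup>2" by (intro power_mono norm_matrix_vector_le) simp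
  ultimately show ?thesis by (simp add: matrix_vector_mul_assoc power_mult_distrib)
qed

lemma local_bound:
  obtains M where "M \<ge> 0" "\<And>y. (\<integral>\<^sup>+ x. ennreal (g x * (mollifier (x - y))\<^sup>2) \<partial>lborel) \<le> ennreal M"
proof -
  have [measurable]: "(mollifier :: real^2 \<Rightarrow> real) \<in> borel_measurable borel" by (rule test_function_measurable[OF test_function_mollifier])
  obtain M1 where M1: "M1 \<ge> 0" "\<And>y. (\<integral>\<^sup>+ x. ennreal ((norm (W x *v (W x *v axis 1 1)))\<^sup>2 * (mollifier (x - y))\<^sup>2) \<partial>lborel) \<le> ennreal M1"
    using local_bound_direction[of "axis 1 1"] by (auto simp: norm_axis_1)
  obtain M2 where M2: "M2 \<ge> 0" "\<And>y. (\<integral>\<^sup>+ x. ennreal ((norm (W x *v (W x *v axis 2 1)))\<^sup>2 * (mollifier (x - y))\<^sup>2) \<partial>lborel) \<le> ennreal M2"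
    using local_bound_direction[of "axis 2 1"] by (auto simp: norm_axis_1)
  have "(\<integral>\<^sup>+ x. ennreal (g x * (mollifier (x - y))\<^sup>2) \<partial>lborel) \<le> ennreal (M1 + M2)" for y
  proof -
    have "(\<integral>\<^sup>+ x. ennreal (g x * (mollifier (x - y))\<^sup>2) \<partial>lborel)
      = (\<integral>\<^sup>+ x. ennreal ((norm (W x *v (W x *v axis 1 1)))\<^sup>2 * (mollifier (x - y))\<^sup>2) \<partial>lborel)
        + (\<integral>\<^sup>+ x. ennreal ((norm (W x *v (W x *v axis 2 1)))\<^sup>2 * (mollifier (x - y))\<^sup>2) \<partial>lborel)"
      unfolding g_def distrib_right by (subst nn_integral_add[symmetric]) (auto simp: ennreal_plus[symmetric] simp del: ennreal_plus)
    also have "\<dots> \<le> ennreal M1 + ennreal M2" by (intro add_mono M1 M2)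
    finally show ?thesis using M1(1) M2(1) by simp
  qed
  then show ?thesis using that[of "M1 + M2"] M1(1) M2(1) by auto
qed

end

lemma nn_integral_reflect:
  fixes h :: "'a::euclidean_space \<Rightarrow> ennreal"
  assumes [measurable]: "h \<in> borel_measurable borel"
  shows "(\<integral>\<^sup>+ y. h (x - y) \<partial>lborel) = (\<integral>\<^sup>+ y. h y \<partial>lborel)"
proof -
  have rf: "(lborel :: 'a measure) = distr lborel borel (\<lambda>w. x + (- 1) *\<^sub>R w)"
    using lborel_affine[of "- 1" x] by (simp add: density_1)
  show ?thesis by (subst (2) rf, subst nn_integral_distr) auto
qed

definition mass :: "(real^'d \<Rightarrow> real) \<Rightarrow> real" where
  "mass \<psi> = (LINT x|lborel. (\<psi> x)\<^sup>2)"

lemma mass_nonneg: "mass \<psi> \<ge> 0" by (simp add: mass_def)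

text \<open>By Tonelli's theorem the localised norms average to the full norm as the localisation moves over the plane.\<close>

lemma norm_mul_shift:
  fixes c :: "(real^'d, 'b::euclidean_space) l2"
  assumes \<psi>: "test_function \<psi>"
  shows "ennreal ((norm (mul (\<lambda>x. \<psi> (x - y)) c))\<^sup>2) = (\<integral>\<^sup>+ x. ennreal ((\<psi> (x - y))\<^sup>2 * (norm (fn c x))\<^sup>2) \<partial>lborel)"
    and "(\<lambda>y. ennreal ((norm (mul (\<lambda>x. \<psi> (x - y)) c))\<^sup>2)) \<in> borel_measurable borel"
    and "(\<integral>\<^sup>+ y. ennreal ((norm (mul (\<lambda>x. \<psi> (x - y)) c))\<^sup>2) \<partial>lborel) = ennreal (mass \<psi> * (norm c)\<^sup>2)"
proof -
  have [measurable]: "\<psi> \<in> borel_measurable borel" by (rule test_function_measurable[OF \<psi>])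
  show eq: "ennreal ((norm (mul (\<lambda>x. \<psi> (x - y)) c))\<^sup>2) = (\<integral>\<^sup>+ x. ennreal ((\<psi> (x - y))\<^sup>2 * (norm (fn c x))\<^sup>2) \<partial>lborel)" for y
    unfolding nn_integral_fn_sq[symmetric] using fn_mul[OF test_function_shift[OF \<psi>, of y], of c]
    by (intro nn_integral_cong_AE) (auto simp: power_mult_distrib elim: eventually_mono)
  show "(\<lambda>y. ennreal ((norm (mul (\<lambda>x. \<psi> (x - y)) c))\<^sup>2)) \<in> borel_measurable borel"
    unfolding eq by measurable
  have sq: "integrable lborel (\<lambda>x. (\<psi> x)\<^sup>2)"
    using test_function_integrable(2)[OF \<psi>, of "1::real"] by (simp add: sqi_def)
  have "(\<integral>\<^sup>+ y. ennreal ((norm (mul (\<lambda>x. \<psi> (x - y)) c))\<^sup>2) \<partial>lborel) = (\<integral>\<^sup>+ x. \<integral>\<^sup>+ y. ennreal ((\<psi> (x - y))\<^sup>2 * (norm (fn c x))\<^sup>2) \<partial>lborel \<partial>lborel)"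
    unfolding eq by (rule lborel_pair.Fubini') measurable
  also have "\<dots> = (\<integral>\<^sup>+ x. ennreal (mass \<psi>) * ennreal ((norm (fn c x))\<^sup>2) \<partial>lborel)"
  proof (intro nn_integral_cong)
    fix x
    have "(\<integral>\<^sup>+ y. ennreal ((\<psi> (x - y))\<^sup>2 * (norm (fn c x))\<^sup>2) \<partial>lborel) = (\<integral>\<^sup>+ y. ennreal ((\<psi> (x - y))\<^sup>2) \<partial>lborel) * ennreal ((norm (fn c x))\<^sup>2)"
      by (subst nn_integral_multc[symmetric]) (auto simp: ennreal_mult)
    also have "(\<integral>\<^sup>+ y. ennreal ((\<psi> (x - y))\<^sup>2) \<partial>lborel) = (\<integral>\<^sup>+ y. ennreal ((\<psi> y)\<^sup>2) \<partial>lborel)"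
      by (rule nn_integral_reflect[where h = "\<lambda>y. ennreal ((\<psi> y)\<^sup>2)"]) measurable
    also have "\<dots> = ennreal (mass \<psi>)" unfolding mass_def using sq by (intro nn_integral_eq_integral) auto
    finally show "(\<integral>\<^sup>+ y. ennreal ((\<psi> (x - y))\<^sup>2 * (norm (fn c x))\<^sup>2) \<partial>lborel) = ennreal (mass \<psi>) * ennreal ((norm (fn c x))\<^sup>2)" .
  qed
  also have "\<dots> = ennreal (mass \<psi>) * ennreal ((norm c)\<^sup>2)"
    by (subst nn_integral_cmult) (auto simp: nn_integral_fn_sq)
  finally show "(\<integral>\<^sup>+ y. ennreal ((norm (mul (\<lambda>x. \<psi> (x - y)) c))\<^sup>2) \<partial>lborel) = ennreal (mass \<psi> * (norm c)\<^sup>2)"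
    by (simp add: ennreal_mult mass_nonneg)
qed

lemma norm_pw_pauli: "norm (pw \<sigma>1 a) = norm a" "norm (pw \<sigma>2 a) = norm a"
proof -
  have n: "norm (\<sigma>1 v) = norm v" "norm (\<sigma>2 v) = norm v" for v
    using norm_pauli[of 1 v 0] norm_pauli[of 0 v 1] by (auto intro: power2_eq_imp_eq)
  have "(norm (pw \<sigma>1 a))\<^sup>2 = (norm a)\<^sup>2" "(norm (pw \<sigma>2 a))\<^sup>2 = (norm a)\<^sup>2"
    unfolding pw_def norm_cls_sq[OF sqi_linear[OF sqi_fn pauli_linear(1)]] norm_cls_sq[OF sqi_linear[OF sqi_fn pauli_linear(2)]] n norm_l2_sq[of a]
    by auto
  then show "norm (pw \<sigma>1 a) = norm a" "norm (pw \<sigma>2 a) = norm a" by (auto intro: power2_eq_imp_eq)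
qed

text \<open>The finitely many kernels and fields that occur in the localised free operator.\<close>

definition kernels :: "(real^2 \<Rightarrow> real) set" where
  "kernels = insert mollifier (range (\<lambda>i. pderivative i mollifier) \<union> (\<lambda>(i, j). pderivative i (pderivative j mollifier)) ` UNIV)"

definition energy :: "field \<Rightarrow> real^2 \<Rightarrow> real" where
  "energy u y = (\<Sum>\<psi>\<in>kernels. \<Sum>c\<in>{u, free u, der [1] u, der [2] u}. (norm (mul (\<lambda>x. \<psi> (x - y)) c))\<^sup>2)"

lemma finite_kernels: "finite kernels" by (simp add: kernels_def)

lemma test_function_kernels: "\<psi> \<in> kernels \<Longrightarrow> test_function \<psi>"
  by (auto simp: kernels_def intro: test_function_mollifier test_function_pderivative)

lemma norm_mul_le_energy:
  assumes "\<psi> \<in> kernels" "c \<in> {u, free u, der [1] u, der [2] u}"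
  shows "norm (mul (\<lambda>x. \<psi> (x - y)) c) \<le> sqrt (energy u y)"
proof (rule real_le_rsqrt)
  have "(norm (mul (\<lambda>x. \<psi> (x - y)) c))\<^sup>2 \<le> (\<Sum>c\<in>{u, free u, der [1] u, der [2] u}. (norm (mul (\<lambda>x. \<psi> (x - y)) c))\<^sup>2)"
    by (rule member_le_sum[where f = "\<lambda>c. (norm (mul (\<lambda>x. \<psi> (x - y)) c))\<^sup>2"]) (use assms in auto)
  also have "\<dots> \<le> energy u y"
    unfolding energy_def
    by (rule member_le_sum[where f = "\<lambda>\<psi>. \<Sum>c\<in>{u, free u, der [1] u, der [2] u}. (norm (mul (\<lambda>x. \<psi> (x - y)) c))\<^sup>2"])
      (use assms finite_kernels in \<open>auto intro: sum_nonneg\<close>)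
  finally show "(norm (mul (\<lambda>x. \<psi> (x - y)) c))\<^sup>2 \<le> energy u y" .
qed

lemma energy_integral:
  assumes "u \<in> H"
  shows "(\<lambda>y. ennreal (energy u y)) \<in> borel_measurable borel"
    and "(\<integral>\<^sup>+ y. ennreal (energy u y) \<partial>lborel) \<le> ennreal ((\<Sum>\<psi>\<in>kernels. mass \<psi>) * (4 * ((norm u)\<^sup>2 + (norm (free u))\<^sup>2)))"
proof -
  let ?C = "{u, free u, der [1] u, der [2] u}"
  have e: "ennreal (energy u y) = (\<Sum>\<psi>\<in>kernels. \<Sum>c\<in>?C. ennreal ((norm (mul (\<lambda>x. \<psi> (x - y)) c))\<^sup>2))" for y
    unfolding energy_def by (simp only: sum_ennreal sum_nonneg zero_le_power2)
  show "(\<lambda>y. ennreal (energy u y)) \<in> borel_measurable borel"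
    unfolding e by (intro borel_measurable_sum norm_mul_shift(2) test_function_kernels)
  have le: "(norm c)\<^sup>2 \<le> (norm u)\<^sup>2 + (norm (free u))\<^sup>2" if "c \<in> ?C" for c
    using that norm_der1_le_sum[OF assms] by auto
  have "(\<integral>\<^sup>+ y. ennreal (energy u y) \<partial>lborel) = (\<Sum>\<psi>\<in>kernels. \<Sum>c\<in>?C. ennreal (mass \<psi> * (norm c)\<^sup>2))"
  proof -
    have m: "(\<lambda>y. ennreal ((norm (mul (\<lambda>x. \<psi> (x - y)) c))\<^sup>2)) \<in> borel_measurable lborel" if "\<psi> \<in> kernels" for \<psi> and c :: field
      using norm_mul_shift(2)[OF test_function_kernels[OF that]] by simp
    have "(\<integral>\<^sup>+ y. ennreal (energy u y) \<partial>lborel) = (\<Sum>\<psi>\<in>kernels. \<integral>\<^sup>+ y. (\<Sum>c\<in>?C. ennreal ((norm (mul (\<lambda>x. \<psi> (x - y)) c))\<^sup>2)) \<partial>lborel)"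
      unfolding e by (rule nn_integral_sum) (intro borel_measurable_sum m)
    also have "\<dots> = (\<Sum>\<psi>\<in>kernels. \<Sum>c\<in>?C. \<integral>\<^sup>+ y. ennreal ((norm (mul (\<lambda>x. \<psi> (x - y)) c))\<^sup>2) \<partial>lborel)"
      by (intro sum.cong refl nn_integral_sum m)
    also have "\<dots> = (\<Sum>\<psi>\<in>kernels. \<Sum>c\<in>?C. ennreal (mass \<psi> * (norm c)\<^sup>2))"
      by (intro sum.cong refl norm_mul_shift(3) test_function_kernels)
    finally show ?thesis .
  qed
  also have "\<dots> = ennreal (\<Sum>\<psi>\<in>kernels. \<Sum>c\<in>?C. mass \<psi> * (norm c)\<^sup>2)"
    by (simp only: sum_ennreal sum_nonneg mult_nonneg_nonneg mass_nonneg zero_le_power2)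
  also have "\<dots> \<le> ennreal ((\<Sum>\<psi>\<in>kernels. mass \<psi>) * (4 * ((norm u)\<^sup>2 + (norm (free u))\<^sup>2)))"
  proof (intro ennreal_leI)
    have "(\<Sum>c\<in>?C. (norm c)\<^sup>2) \<le> of_nat (card ?C) * ((norm u)\<^sup>2 + (norm (free u))\<^sup>2)"
      by (rule sum_bounded_above) (rule le)
    also have "\<dots> \<le> 4 * ((norm u)\<^sup>2 + (norm (free u))\<^sup>2)"
    proof (rule mult_right_mono)
      have "card ?C \<le> 4" by (simp add: card_insert_if)
      then show "of_nat (card ?C) \<le> (4 :: real)" by linarith
    qed simp
    finally have "(\<Sum>c\<in>?C. (norm c)\<^sup>2) \<le> 4 * ((norm u)\<^sup>2 + (norm (free u))\<^sup>2)" .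
    then show "(\<Sum>\<psi>\<in>kernels. \<Sum>c\<in>?C. mass \<psi> * (norm c)\<^sup>2) \<le> (\<Sum>\<psi>\<in>kernels. mass \<psi>) * (4 * ((norm u)\<^sup>2 + (norm (free u))\<^sup>2))"
      unfolding sum_distrib_left[symmetric] sum_distrib_right[symmetric]
      by (intro mult_left_mono sum_nonneg mass_nonneg)
  qed
  finally show "(\<integral>\<^sup>+ y. ennreal (energy u y) \<partial>lborel) \<le> ennreal ((\<Sum>\<psi>\<in>kernels. mass \<psi>) * (4 * ((norm u)\<^sup>2 + (norm (free u))\<^sup>2)))" .
qed

text \<open>The constant is \<open>13 = 1 + 6 + 6\<close>: the free operator inside the localisation, and a commutator with two Pauli
  components whose coefficients \<open>2, 2, 1, 1\<close> add up to \<open>6\<close>.\<close>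

lemma norm_free_localised:
  assumes "u \<in> H"
  shows "norm (free (mul (\<lambda>x. mollifier (x - y)) u)) \<le> 13 * sqrt (energy u y)"
proof -
  let ?\<theta> = "\<lambda>x :: real^2. mollifier (x - y)"
  note sm = test_function_smooth[OF test_function_mollifier]
  have t: "test_function ?\<theta>" by (rule test_function_shift[OF test_function_mollifier])
  have p1: "pderivative i ?\<theta> = (\<lambda>x. pderivative i mollifier (x - y))" for i by (rule pderivative_shift[OF sm])
  have p2: "pderivative i (pderivative j ?\<theta>) = (\<lambda>x. pderivative i (pderivative j mollifier) (x - y))" for i j
    unfolding p1 by (rule pderivative_shift[OF smooth_pderivative[OF sm]])
  have k0: "norm (mul ?\<theta> (free u)) \<le> sqrt (energy u y)"
    by (rule norm_mul_le_energy) (auto simp: kernels_def)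
  have k1: "norm (mul (pderivative i ?\<theta>) (der [j] u)) \<le> sqrt (energy u y)" for i j
    unfolding p1 by (rule norm_mul_le_energy) (use exhaust_2[of j] in \<open>auto simp: kernels_def\<close>)
  have k2: "norm (mul (pderivative i (pderivative j ?\<theta>)) u) \<le> sqrt (energy u y)" for i j
    unfolding p2 by (rule norm_mul_le_energy) (auto simp: kernels_def)
  have sum4: "norm (2 *\<^sub>R a + b - 2 *\<^sub>R c - d) \<le> 6 * E" "norm (2 *\<^sub>R a + 2 *\<^sub>R c + b + d) \<le> 6 * E"
    if "norm a \<le> E" "norm b \<le> E" "norm c \<le> E" "norm d \<le> E" for a b c d :: field and E
  proof -
    have "norm (2 *\<^sub>R a + b - 2 *\<^sub>R c - d) \<le> norm (2 *\<^sub>R a) + norm b + norm (2 *\<^sub>R c) + norm d"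
      using norm_triangle_ineq4[of "2 *\<^sub>R a + b - 2 *\<^sub>R c" d] norm_triangle_ineq4[of "2 *\<^sub>R a + b" "2 *\<^sub>R c"] norm_triangle_ineq[of "2 *\<^sub>R a" b] by linarith
    then show "norm (2 *\<^sub>R a + b - 2 *\<^sub>R c - d) \<le> 6 * E" using that by simp
    have "norm (2 *\<^sub>R a + 2 *\<^sub>R c + b + d) \<le> norm (2 *\<^sub>R a) + norm (2 *\<^sub>R c) + norm b + norm d"
      using norm_triangle_ineq[of "2 *\<^sub>R a + 2 *\<^sub>R c + b" d] norm_triangle_ineq[of "2 *\<^sub>R a + 2 *\<^sub>R c" b] norm_triangle_ineq[of "2 *\<^sub>R a" "2 *\<^sub>R c"] by linarith
    then show "norm (2 *\<^sub>R a + 2 *\<^sub>R c + b + d) \<le> 6 * E" using that by simp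
  qed
  have "norm (commutator ?\<theta> u) \<le> 6 * sqrt (energy u y) + 6 * sqrt (energy u y)"
    unfolding commutator_def
    by (rule order_trans[OF norm_triangle_ineq]) (unfold norm_pw_pauli, intro add_mono sum4 k1 k2)
  then show ?thesis
    unfolding free_mul[OF assms t] using k0 norm_triangle_ineq[of "mul ?\<theta> (free u)" "commutator ?\<theta> u"] by linarith
qed

context dissipative
begin

text \<open>Localise with a moving bump \<open>\<theta>\<close>, apply the pointwise estimate with a large imaginary part \<open>\<eta>\<close> to the
  localised field, and integrate over the position of the bump. Localisation enters with the weight
  \<open>\<theta>\<^sup>4\<close>: one factor \<open>\<theta>\<^sup>2\<close> goes with \<open>u\<close> into the pointwise estimate, the other with \<open>W\<^sup>2\<close> into the local
  bound.\<close>

lemma Q_relative_bound: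
  assumes \<epsilon>: "\<epsilon> > 0"
  shows "\<exists>C\<ge>0. \<forall>u\<in>H. (norm (Q u))\<^sup>2 \<le> \<epsilon> * (norm (free u))\<^sup>2 + C * (norm u)\<^sup>2"
proof -
  let ?\<theta> = "mollifier :: real^2 \<Rightarrow> real"
  note t = test_function_mollifier[where 'd = 2]
  have [measurable]: "?\<theta> \<in> borel_measurable borel" by (rule test_function_measurable[OF t])
  obtain M where M: "M \<ge> 0" "\<And>y. (\<integral>\<^sup>+ x. ennreal (g x * (?\<theta> (x - y))\<^sup>2) \<partial>lborel) \<le> ennreal M"
    using local_bound by blast
  define K where "K = (\<Sum>\<psi>\<in>kernels. mass \<psi>)"
  have K: "K \<ge> 0" unfolding K_def by (intro sum_nonneg mass_nonneg)
  have t2: "test_function (\<lambda>x. ?\<theta> x * ?\<theta> x)" by (rule test_function_mult[OF t test_function_smooth[OF t]])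
  define A where "A = mass (\<lambda>x. ?\<theta> x * ?\<theta> x)"
  have i4: "integrable lborel (\<lambda>x. (?\<theta> x * ?\<theta> x)\<^sup>2)"
    using test_function_integrable(2)[OF t2, of "1::real"] by (simp add: sqi_def)
  have A: "A > 0"
  proof -
    have "A \<noteq> 0"
    proof
      assume "A = 0"
      then have "AE x in lborel. (?\<theta> x * ?\<theta> x)\<^sup>2 = 0"
        unfolding A_def mass_def using i4 by (subst (asm) integral_nonneg_eq_0_iff_AE) auto
      then have "AE x in lborel. ?\<theta> x = 0" by (rule eventually_mono) simp
      then have "(LINT x|lborel. ?\<theta> x) = 0" by (rule integral_eq_zero_AE)
      then show False using mollifier_integral(2)[where 'd = 2] by simp
    qed
    then show ?thesis using mass_nonneg[of "\<lambda>x. ?\<theta> x * ?\<theta> x"] by (simp add: A_def)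
  qed
  \<comment> \<open>The coefficient of \<open>\<parallel>free u\<parallel>\<^sup>2\<close> comes out as \<open>M * 338 * K * 4 / (4 * \<eta> * A)\<close>, with \<open>338 = 2 * 13\<^sup>2\<close>; this \<open>\<eta>\<close>
    pushes it below \<open>\<epsilon>\<close>.\<close>
  define \<eta> where "\<eta> = M * 338 * K * 4 / (4 * A * \<epsilon>) + 1"
  have \<eta>: "\<eta> > 0" unfolding \<eta>_def using M(1) K A \<epsilon> by (intro add_nonneg_pos divide_nonneg_pos) auto
  define C where "C = M / (4 * \<eta> * A) * (338 * K * 4 + 2 * \<eta>\<^sup>2 * mass ?\<theta>)"
  have C: "C \<ge> 0" unfolding C_def using M(1) \<eta> A K mass_nonneg[of ?\<theta>] by (intro mult_nonneg_nonneg divide_nonneg_pos add_nonneg_nonneg) auto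
  have "(norm (Q u))\<^sup>2 \<le> \<epsilon> * (norm (free u))\<^sup>2 + C * (norm u)\<^sup>2" if u: "u \<in> H" for u
  proof -
    define B where "B = (\<lambda>y. (338 * energy u y + 2 * \<eta>\<^sup>2 * (norm (mul (\<lambda>x. ?\<theta> (x - y)) u))\<^sup>2) / (4 * \<eta>))"
    have en: "energy u y \<ge> 0" for y unfolding energy_def by (intro sum_nonneg) auto
    have point: "AE x in lborel. (?\<theta> (x - y))\<^sup>2 * (norm (fn u x))\<^sup>2 \<le> B y" for y
    proof -
      let ?v = "mul (\<lambda>x. ?\<theta> (x - y)) u"
      have ts: "test_function (\<lambda>x. ?\<theta> (x - y))" by (rule test_function_shift[OF t])
      have v: "?v \<in> H" by (rule H_mul(1)[OF u ts])
      have "norm (shifted 0 \<eta> ?v) \<le> norm (free ?v) + \<eta> * norm ?v"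
        using norm_triangle_ineq4[of "free ?v" "\<eta> *\<^sub>R pw im ?v"] \<eta> by (simp add: shifted_def norm_pw_im)
      then have "(norm (shifted 0 \<eta> ?v))\<^sup>2 \<le> (norm (free ?v) + \<eta> * norm ?v)\<^sup>2" by (rule power_mono) simp
      also have "\<dots> \<le> 2 * (norm (free ?v))\<^sup>2 + 2 * (\<eta> * norm ?v)\<^sup>2"
        using sum_squares_bound[of "norm (free ?v)" "\<eta> * norm ?v"] by (simp add: power2_sum)
      also have "(norm (free ?v))\<^sup>2 \<le> (13 * sqrt (energy u y))\<^sup>2" by (intro power_mono norm_free_localised[OF u]) simp
      finally have "(norm (shifted 0 \<eta> ?v))\<^sup>2 \<le> 338 * energy u y + 2 * \<eta>\<^sup>2 * (norm ?v)\<^sup>2"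
        using en[of y] by (simp add: power_mult_distrib)
      then have le: "(norm (shifted 0 \<eta> ?v))\<^sup>2 / (4 * \<bar>\<eta>\<bar>) \<le> B y"
        unfolding B_def using \<eta> by (simp add: divide_right_mono)
      have "AE x in lborel. (norm (fn ?v x))\<^sup>2 \<le> (norm (shifted 0 \<eta> ?v))\<^sup>2 / (4 * \<bar>\<eta>\<bar>)"
        using \<eta> by (intro AE_norm_le_shifted[OF v]) simp
      with fn_mul[OF ts, of u] show ?thesis
        by eventually_elim (use le in \<open>auto simp: power_mult_distrib\<close>)
    qed
    have B0: "B y \<ge> 0" for y unfolding B_def using en[of y] \<eta> by simp
    have loc: "(\<integral>\<^sup>+ x. ennreal (g x * (norm (fn u x))\<^sup>2 * (?\<theta> (x - y) * ?\<theta> (x - y))\<^sup>2) \<partial>lborel) \<le> ennreal M * ennreal (B y)" for y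
    proof -
      have "(\<integral>\<^sup>+ x. ennreal (g x * (norm (fn u x))\<^sup>2 * (?\<theta> (x - y) * ?\<theta> (x - y))\<^sup>2) \<partial>lborel)
        \<le> (\<integral>\<^sup>+ x. ennreal (g x * (?\<theta> (x - y))\<^sup>2) * ennreal (B y) \<partial>lborel)"
        using point[of y]
      proof (intro nn_integral_mono_AE, eventually_elim)
        case (elim x)
        have "g x * (norm (fn u x))\<^sup>2 * (?\<theta> (x - y) * ?\<theta> (x - y))\<^sup>2 = (g x * (?\<theta> (x - y))\<^sup>2) * ((?\<theta> (x - y))\<^sup>2 * (norm (fn u x))\<^sup>2)"
          by (simp add: power_mult_distrib mult_ac power2_eq_square)
        also have "\<dots> \<le> (g x * (?\<theta> (x - y))\<^sup>2) * B y" using elim g_nonneg by (intro mult_left_mono) auto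
        finally show ?case using g_nonneg B0 by (subst ennreal_mult[symmetric]) (auto intro: ennreal_leI)
      qed
      also have "\<dots> = (\<integral>\<^sup>+ x. ennreal (g x * (?\<theta> (x - y))\<^sup>2) \<partial>lborel) * ennreal (B y)"
        by (rule nn_integral_multc) measurable
      also have "\<dots> \<le> ennreal M * ennreal (B y)" by (intro mult_right_mono M) simp
      finally show ?thesis .
    qed
    have eB: "ennreal (B y) = ennreal (338 / (4 * \<eta>)) * ennreal (energy u y) + ennreal (2 * \<eta>\<^sup>2 / (4 * \<eta>)) * ennreal ((norm (mul (\<lambda>x. ?\<theta> (x - y)) u))\<^sup>2)" for y
      using en[of y] \<eta> unfolding B_def
      by (simp add: ennreal_mult[symmetric] ennreal_plus[symmetric] add_divide_distrib del: ennreal_plus)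
    define nf nu where "nf = (norm (free u))\<^sup>2" and "nu = (norm u)\<^sup>2"
    have intB: "(\<integral>\<^sup>+ y. ennreal (B y) \<partial>lborel) \<le> ennreal (338 / (4 * \<eta>) * (K * (4 * (nu + nf))) + 2 * \<eta>\<^sup>2 / (4 * \<eta>) * (mass ?\<theta> * nu))"
    proof -
      have "(\<integral>\<^sup>+ y. ennreal (B y) \<partial>lborel) = ennreal (338 / (4 * \<eta>)) * (\<integral>\<^sup>+ y. ennreal (energy u y) \<partial>lborel) + ennreal (2 * \<eta>\<^sup>2 / (4 * \<eta>)) * ennreal (mass ?\<theta> * nu)"
      proof -
        have m1: "(\<lambda>y. ennreal (energy u y)) \<in> borel_measurable lborel"
          and m2: "(\<lambda>y. ennreal ((norm (mul (\<lambda>x. ?\<theta> (x - y)) u))\<^sup>2)) \<in> borel_measurable lborel"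
          using energy_integral(1)[OF u] norm_mul_shift(2)[OF t, of u] by simp_all
        show ?thesis
          unfolding eB nu_def norm_mul_shift(3)[OF t, symmetric] nn_integral_cmult[OF m1, symmetric] nn_integral_cmult[OF m2, symmetric]
          using m1 m2 by (intro nn_integral_add borel_measurable_times_ennreal borel_measurable_const)
      qed
      also have "\<dots> \<le> ennreal (338 / (4 * \<eta>)) * ennreal (K * (4 * (nu + nf))) + ennreal (2 * \<eta>\<^sup>2 / (4 * \<eta>)) * ennreal (mass ?\<theta> * nu)"
        unfolding K_def nu_def nf_def by (intro add_mono mult_left_mono energy_integral(2)[OF u]) auto
      also have "\<dots> = ennreal (338 / (4 * \<eta>) * (K * (4 * (nu + nf))) + 2 * \<eta>\<^sup>2 / (4 * \<eta>) * (mass ?\<theta> * nu))"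
        using \<eta> K mass_nonneg[of ?\<theta>] by (simp add: ennreal_mult[symmetric] ennreal_plus[symmetric] nu_def nf_def del: ennreal_plus)
      finally show ?thesis .
    qed
    have "ennreal A * (\<integral>\<^sup>+ x. ennreal (g x * (norm (fn u x))\<^sup>2) \<partial>lborel)
      = (\<integral>\<^sup>+ x. \<integral>\<^sup>+ y. ennreal (g x * (norm (fn u x))\<^sup>2 * (?\<theta> (x - y) * ?\<theta> (x - y))\<^sup>2) \<partial>lborel \<partial>lborel)"
    proof (subst nn_integral_cmult[symmetric], measurable, intro nn_integral_cong)
      fix x
      have "(\<integral>\<^sup>+ y. ennreal (g x * (norm (fn u x))\<^sup>2 * (?\<theta> (x - y) * ?\<theta> (x - y))\<^sup>2) \<partial>lborel)
        = ennreal (g x * (norm (fn u x))\<^sup>2) * (\<integral>\<^sup>+ y. ennreal ((?\<theta> (x - y) * ?\<theta> (x - y))\<^sup>2) \<partial>lborel)"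
        using g_nonneg[of x] by (subst nn_integral_cmult[symmetric]) (auto simp: ennreal_mult)
      also have "(\<integral>\<^sup>+ y. ennreal ((?\<theta> (x - y) * ?\<theta> (x - y))\<^sup>2) \<partial>lborel) = (\<integral>\<^sup>+ y. ennreal ((?\<theta> y * ?\<theta> y)\<^sup>2) \<partial>lborel)"
        by (rule nn_integral_reflect[where h = "\<lambda>y. ennreal ((?\<theta> y * ?\<theta> y)\<^sup>2)"]) measurable
      also have "\<dots> = ennreal A" unfolding A_def mass_def using i4 by (intro nn_integral_eq_integral) auto
      finally show "ennreal A * ennreal (g x * (norm (fn u x))\<^sup>2) = (\<integral>\<^sup>+ y. ennreal (g x * (norm (fn u x))\<^sup>2 * (?\<theta> (x - y) * ?\<theta> (x - y))\<^sup>2) \<partial>lborel)"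
        by (simp add: mult.commute)
    qed
    also have "\<dots> = (\<integral>\<^sup>+ y. \<integral>\<^sup>+ x. ennreal (g x * (norm (fn u x))\<^sup>2 * (?\<theta> (x - y) * ?\<theta> (x - y))\<^sup>2) \<partial>lborel \<partial>lborel)"
      by (rule lborel_pair.Fubini') measurable
    also have "\<dots> \<le> (\<integral>\<^sup>+ y. ennreal M * ennreal (B y) \<partial>lborel)" by (intro nn_integral_mono loc)
    also have "\<dots> = ennreal M * (\<integral>\<^sup>+ y. ennreal (B y) \<partial>lborel)"
    proof (rule nn_integral_cmult)
      have comb: "(\<lambda>y. p * F y + q * G y) \<in> borel_measurable lborel"
        if [measurable]: "F \<in> borel_measurable borel" "G \<in> borel_measurable borel" for p q and F G :: "real^2 \<Rightarrow> ennreal"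
        by measurable
      show "(\<lambda>y. ennreal (B y)) \<in> borel_measurable lborel"
        unfolding eB by (rule comb[OF energy_integral(1)[OF u] norm_mul_shift(2)[OF t, of u]])
    qed
    also have "\<dots> \<le> ennreal M * ennreal (338 / (4 * \<eta>) * (K * (4 * (nu + nf))) + 2 * \<eta>\<^sup>2 / (4 * \<eta>) * (mass ?\<theta> * nu))"
      by (intro mult_left_mono intB) simp
    finally have fin: "ennreal A * (\<integral>\<^sup>+ x. ennreal (g x * (norm (fn u x))\<^sup>2) \<partial>lborel)
      \<le> ennreal M * ennreal (338 / (4 * \<eta>) * (K * (4 * (nu + nf))) + 2 * \<eta>\<^sup>2 / (4 * \<eta>) * (mass ?\<theta> * nu))" .
    have "ennreal ((norm (Q u))\<^sup>2) \<le> (\<integral>\<^sup>+ x. ennreal (g x * (norm (fn u x))\<^sup>2) \<partial>lborel)"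
      unfolding nn_integral_fn_sq[symmetric] Q_def using fn_cls[OF W_maps[OF u]]
    proof (intro nn_integral_mono_AE, eventually_elim)
      case (elim x)
      then show ?case using norm_WW_le[of x "fn u x"] by (simp add: ennreal_leI)
    qed
    then have "ennreal A * ennreal ((norm (Q u))\<^sup>2) \<le> ennreal A * (\<integral>\<^sup>+ x. ennreal (g x * (norm (fn u x))\<^sup>2) \<partial>lborel)"
      by (rule mult_left_mono) simp
    also note fin
    finally have "ennreal (A * (norm (Q u))\<^sup>2) \<le> ennreal (M * (338 / (4 * \<eta>) * (K * (4 * (nu + nf))) + 2 * \<eta>\<^sup>2 / (4 * \<eta>) * (mass ?\<theta> * nu)))"
      using A M(1) \<eta> K mass_nonneg[of ?\<theta>] by (simp add: ennreal_mult nu_def nf_def)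
    then have "A * (norm (Q u))\<^sup>2 \<le> M * (338 / (4 * \<eta>) * (K * (4 * (nu + nf))) + 2 * \<eta>\<^sup>2 / (4 * \<eta>) * (mass ?\<theta> * nu))"
      using A M(1) \<eta> K mass_nonneg[of ?\<theta>] by (subst (asm) ennreal_le_iff) (auto simp: nu_def nf_def)
    also have "\<dots> = A * ((M * 338 * K * 4 / (4 * \<eta> * A)) * nf + C * nu)"
      unfolding C_def using A \<eta> by (simp add: field_simps)
    finally have "(norm (Q u))\<^sup>2 \<le> (M * 338 * K * 4 / (4 * \<eta> * A)) * nf + C * nu" using A by simp
    also have "\<dots> \<le> \<epsilon> * nf + C * nu"
    proof (intro add_mono mult_right_mono order_refl)
      have "M * 338 * K * 4 / (4 * A * \<epsilon>) \<le> \<eta>" by (simp add: \<eta>_def)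
      then show "M * 338 * K * 4 / (4 * \<eta> * A) \<le> \<epsilon>" using A \<epsilon> \<eta> by (simp add: field_simps)
    qed (simp_all add: nf_def nu_def)
    finally show ?thesis by (simp add: nf_def nu_def)
  qed
  then show ?thesis using C by blast
qed

end

section \<open>Resolvents\<close>

lemma shifted_add: "u \<in> H \<Longrightarrow> v \<in> H \<Longrightarrow> shifted \<alpha> \<eta> (u + v) = shifted \<alpha> \<eta> u + shifted \<alpha> \<eta> v"
  by (simp add: shifted_def free_add pw_linear_simps algebra_simps)

lemma shifted_scaleR: "u \<in> H \<Longrightarrow> shifted \<alpha> \<eta> (r *\<^sub>R u) = r *\<^sub>R shifted \<alpha> \<eta> u"
  by (simp add: shifted_def free_scaleR pw_linear_simps algebra_simps)

lemma shifted_im: "u \<in> H \<Longrightarrow> shifted \<alpha> \<eta> (pw im u) = pw im (shifted \<alpha> \<eta> u)"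
  by (simp add: shifted_def free_im pw_linear_simps)

lemma shifted_adjoint:
  assumes "u \<in> H" "v \<in> H" shows "inner (shifted \<alpha> \<eta> u) v = inner u (shifted \<alpha> (- \<eta>) v)"
  by (simp add: shifted_def inner_diff_left inner_diff_right inner_add_right free_symmetric[OF assms] inner_pw_im)

lemma shifted_moll:
  assumes "u \<in> H" shows "shifted \<alpha> \<eta> (moll s u) = moll s (shifted \<alpha> \<eta> u)"
proof -
  have m: "moll s (x - y) = moll s x - moll s y" for x y :: field
    using conv_add[OF mollifier_integral(1), of s x "- 1 *\<^sub>R y"] conv_scaleR[OF mollifier_integral(1), of s "- 1" y] by simp
  show ?thesis
    by (simp add: shifted_def m H_moll[OF assms] conv_scaleR[OF mollifier_integral(1)] conv_pw[OF mollifier_integral(1) pauli_linear(3,4) pauli_adjoint(3)])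
qed

text \<open>If the images converge, the lower bound makes their preimages and the images of these under the free
  operator converge; the limit lies in the Sobolev space because the free operator is closed.\<close>

lemma closed_range:
  fixes T :: "field \<Rightarrow> field"
  assumes add: "\<And>u v. u \<in> H \<Longrightarrow> v \<in> H \<Longrightarrow> T (u + v) = T u + T v"
    and scale: "\<And>u r. u \<in> H \<Longrightarrow> T (r *\<^sub>R u) = r *\<^sub>R T u"
    and lower: "\<And>u. u \<in> H \<Longrightarrow> norm u + norm (free u) \<le> C * norm (T u)"
    and upper: "\<And>u. u \<in> H \<Longrightarrow> norm (T u) \<le> C' * (norm u + norm (free u))"
  shows "closed (T ` H)" "subspace (T ` H)"
proof -
  have diff: "T (u - v) = T u - T v" if "u \<in> H" "v \<in> H" for u v
    using add[OF that(1) H_scaleR(1)[OF that(2), of "- 1"]] scale[OF that(2), of "- 1"] by simp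
  show "subspace (T ` H)"
    unfolding subspace_def
  proof (intro conjI ballI allI)
    show "0 \<in> T ` H" using scale[OF subspace_0[OF H_subspace], of 0] subspace_0[OF H_subspace] by (auto intro: image_eqI[of _ _ 0])
    show "x + y \<in> T ` H" if "x \<in> T ` H" "y \<in> T ` H" for x y
      using that by (auto simp: add[symmetric] intro!: imageI H_add)
    show "c *\<^sub>R x \<in> T ` H" if "x \<in> T ` H" for c x
      using that by (auto simp: scale[symmetric] intro!: imageI H_scaleR)
  qed
  show "closed (T ` H)"
    unfolding closed_sequential_limits
  proof (intro allI impI, elim conjE)
    fix x l assume x: "\<forall>n. x n \<in> T ` H" and l: "x \<longlonglongrightarrow> l"
    have "\<forall>n. \<exists>u. u \<in> H \<and> x n = T u" using x by blast
    from choice[OF this] obtain u where u: "\<And>n. u n \<in> H" "\<And>n. x n = T (u n)" by blast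
    have X: "(\<lambda>n. C *\<^sub>R x n) \<longlonglongrightarrow> C *\<^sub>R l" using l by (intro tendsto_intros)
    have le: "norm (u m - u n) \<le> norm (C *\<^sub>R x m - C *\<^sub>R x n)" "norm (free (u m) - free (u n)) \<le> norm (C *\<^sub>R x m - C *\<^sub>R x n)" for m n
    proof -
      have "norm (u m - u n) + norm (free (u m) - free (u n)) \<le> C * norm (x m - x n)"
        using lower[OF H_diff[OF u(1) u(1)], of m n] by (simp add: free_diff u diff)
      also have "\<dots> \<le> norm (C *\<^sub>R x m - C *\<^sub>R x n)"
        unfolding scaleR_diff_right[symmetric] norm_scaleR by (intro mult_right_mono) auto
      finally show "norm (u m - u n) \<le> norm (C *\<^sub>R x m - C *\<^sub>R x n)" "norm (free (u m) - free (u n)) \<le> norm (C *\<^sub>R x m - C *\<^sub>R x n)"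
        using norm_ge_zero[of "u m - u n"] norm_ge_zero[of "free (u m) - free (u n)"] by linarith+
    qed
    have "convergent u"
      by (rule convergent_if_dominated1[OF X le(1)])
    then obtain v where v: "u \<longlonglongrightarrow> v" unfolding convergent_def by blast
    have "convergent (\<lambda>n. free (u n))"
      by (rule convergent_if_dominated1[OF X le(2)])
    then obtain f where f: "(\<lambda>n. free (u n)) \<longlonglongrightarrow> f" unfolding convergent_def by blast
    note vH = free_closed[OF u(1) v f]
    have "(\<lambda>n. C' * (norm (u n - v) + norm (free (u n) - free v))) \<longlonglongrightarrow> C' * (norm (v - v) + norm (f - free v))"
      by (intro tendsto_intros v f)
    then have z: "(\<lambda>n. C' * (norm (u n - v) + norm (free (u n) - free v))) \<longlonglongrightarrow> 0" by (simp add: vH(2))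
    have "(\<lambda>n. x n - T v) \<longlonglongrightarrow> 0"
    proof (rule Lim_null_comparison[OF _ z], intro always_eventually allI)
      fix n
      show "norm (x n - T v) \<le> C' * (norm (u n - v) + norm (free (u n) - free v))"
        using upper[OF H_diff[OF u(1) vH(1)], of n] by (simp add: u diff vH(1) free_diff)
    qed
    then have "x \<longlonglongrightarrow> T v" by (rule LIM_zero_cancel)
    then show "l \<in> T ` H" using LIMSEQ_unique[OF l] vH(1) by blast
  qed
qed

lemma norm_shifted_le: "u \<in> H \<Longrightarrow> norm (shifted \<alpha> \<eta> u) \<le> norm (free u) + (\<bar>\<alpha>\<bar> + \<bar>\<eta>\<bar>) * norm u"
  using norm_triangle_ineq4[of "free u - \<alpha> *\<^sub>R u" "\<eta> *\<^sub>R pw im u"] norm_triangle_ineq4[of "free u" "\<alpha> *\<^sub>R u"]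
  by (simp add: shifted_def norm_pw_im distrib_right)

lemma norm_free_le: "u \<in> H \<Longrightarrow> norm (free u) \<le> norm (shifted \<alpha> \<eta> u) + (\<bar>\<alpha>\<bar> + \<bar>\<eta>\<bar>) * norm u"
  using norm_triangle_ineq[of "shifted \<alpha> \<eta> u + \<alpha> *\<^sub>R u" "\<eta> *\<^sub>R pw im u"] norm_triangle_ineq[of "shifted \<alpha> \<eta> u" "\<alpha> *\<^sub>R u"]
  by (simp add: shifted_def norm_pw_im distrib_right)

text \<open>A vector orthogonal to the range solves the adjoint equation only in the weak sense, but its
  mollifications solve it in the Sobolev space, where symmetry of the free operator excludes them.\<close>

lemma shifted_surj:
  assumes \<eta>: "\<eta> \<noteq> 0" shows "shifted \<alpha> \<eta> ` H = UNIV"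
proof (rule closed_subspace_eq_UNIV)
  define K where "K = 1 / \<bar>\<eta>\<bar> + (1 + (\<bar>\<alpha>\<bar> + \<bar>\<eta>\<bar>) * (1 / \<bar>\<eta>\<bar>))"
  have low: "norm u + norm (free u) \<le> K * norm (shifted \<alpha> \<eta> u)" if "u \<in> H" for u
  proof -
    have n: "norm u \<le> 1 / \<bar>\<eta>\<bar> * norm (shifted \<alpha> \<eta> u)"
      using norm_le_shifted[OF that, of \<eta> \<alpha>] \<eta> by (simp add: field_simps)
    have "(\<bar>\<alpha>\<bar> + \<bar>\<eta>\<bar>) * norm u \<le> (\<bar>\<alpha>\<bar> + \<bar>\<eta>\<bar>) * (1 / \<bar>\<eta>\<bar> * norm (shifted \<alpha> \<eta> u))"
      by (rule mult_left_mono[OF n]) simp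
    then show ?thesis using n norm_free_le[OF that, of \<alpha> \<eta>] unfolding K_def distrib_right mult_1_left mult.assoc by linarith
  qed
  have up: "norm (shifted \<alpha> \<eta> u) \<le> (1 + (\<bar>\<alpha>\<bar> + \<bar>\<eta>\<bar>)) * (norm u + norm (free u))" if "u \<in> H" for u
  proof -
    have "norm (shifted \<alpha> \<eta> u) \<le> norm (free u) + (\<bar>\<alpha>\<bar> + \<bar>\<eta>\<bar>) * norm u" by (rule norm_shifted_le[OF that])
    also have "\<dots> \<le> (1 + (\<bar>\<alpha>\<bar> + \<bar>\<eta>\<bar>)) * (norm u + norm (free u))" by (simp add: algebra_simps)
    finally show ?thesis .
  qed
  show "closed (shifted \<alpha> \<eta> ` H)" "subspace (shifted \<alpha> \<eta> ` H)"
    by (rule closed_range[where C = K and C' = "1 + (\<bar>\<alpha>\<bar> + \<bar>\<eta>\<bar>)"]; fact shifted_add shifted_scaleR low up)+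
  fix z :: field assume z: "\<And>y. y \<in> shifted \<alpha> \<eta> ` H \<Longrightarrow> inner z y = 0"
  have "moll s z = 0" if "s > 0" for s
  proof -
    let ?v = "moll s z"
    have v: "?v \<in> H" by (rule moll_in_H[OF that])
    have "0 = inner z (shifted \<alpha> \<eta> (moll s (pw im ?v)))" using z H_moll(1)[OF H_im[OF v]] by simp
    also have "\<dots> = inner ?v (pw im (shifted \<alpha> \<eta> ?v))"
      by (simp add: shifted_moll[OF H_im[OF v]] shifted_im[OF v] inner_moll)
    also have "\<dots> = \<eta> * (norm ?v)\<^sup>2"
      using inner_shifted_im[OF v, of \<alpha> \<eta>] inner_pw_im[of ?v "shifted \<alpha> \<eta> ?v"] by (simp add: inner_commute)
    finally show ?thesis using \<eta> by simp
  qed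
  then have "(\<lambda>n. moll (inverse (real (Suc n))) z) = (\<lambda>n. 0)" by simp
  then show "z = 0" using moll_tendsto[of z] by (simp add: LIMSEQ_const_iff)
qed

text \<open>The bookkeeping for the a priori estimate: \<open>x\<close>, \<open>w\<close>, \<open>G\<close> are the norms of \<open>u\<close>, \<open>W u\<close> and of the
  right hand side. Inserting the dual bound into the energy bound gives a quadratic inequality for \<open>t w\<close> with
  leading coefficient \<open>1 - q\<close>, which limits \<open>t w\<close> to a multiple of \<open>G\<close> as long as \<open>q < 1\<close>.\<close>

lemma a_priori_arithmetic:
  fixes x w G t q \<eta> :: real
  assumes \<eta>: "\<eta> > 0" and q: "0 \<le> q" "q < 1" and t: "0 \<le> t" "t \<le> 1" and nn: "0 \<le> x" "0 \<le> w" "0 \<le> G"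
    and energy: "t * w\<^sup>2 \<le> \<eta> * x\<^sup>2 + G * x" and dual: "x \<le> G / \<eta> + t * sqrt (q / \<eta>) * w"
  shows "x \<le> (1 / \<eta> + sqrt (q / \<eta>) * (1 + (3 * sqrt (q / \<eta>) + 2 / \<eta>) / (1 - q))) * G"
proof -
  define r where "r = sqrt (q / \<eta>)"
  define p where "p = t * w"
  define X where "X = G / \<eta> + r * p"
  have r: "r \<ge> 0" "\<eta> * r\<^sup>2 = q" using \<eta> q by (auto simp: r_def)
  have p: "p \<ge> 0" using t nn by (simp add: p_def)
  have xX: "x \<le> X" using dual by (simp add: X_def r_def p_def mult_ac)
  have "p\<^sup>2 \<le> t * w\<^sup>2"
  proof -
    have "t * t \<le> 1 * t" using t by (intro mult_right_mono) auto
    then have "t * t * w\<^sup>2 \<le> t * w\<^sup>2" by (intro mult_right_mono) auto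
    then show ?thesis by (simp add: p_def power2_eq_square mult_ac)
  qed
  also note energy
  also have "\<eta> * x\<^sup>2 + G * x \<le> \<eta> * X\<^sup>2 + G * X"
    using xX nn \<eta> by (intro add_mono mult_left_mono power_mono) auto
  also have "\<dots> = 2 * G\<^sup>2 / \<eta> + 3 * r * (G * p) + q * p\<^sup>2"
  proof -
    have "\<eta> * X\<^sup>2 = G\<^sup>2 / \<eta> + 2 * r * (G * p) + (\<eta> * r\<^sup>2) * p\<^sup>2"
      unfolding X_def using \<eta> by (simp add: power2_eq_square field_simps)
    moreover have "G * X = G\<^sup>2 / \<eta> + r * (G * p)" unfolding X_def by (simp add: power2_eq_square algebra_simps)
    ultimately show ?thesis unfolding r(2) by simp
  qed
  finally have main: "(1 - q) * p\<^sup>2 \<le> 2 * G\<^sup>2 / \<eta> + 3 * r * (G * p)" by (simp add: algebra_simps)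
  define c where "c = (3 * r + 2 / \<eta>) / (1 - q)"
  have c0: "c \<ge> 0" unfolding c_def using r \<eta> q by simp
  have "p \<le> (1 + c) * G"
  proof (cases "p \<le> G")
    case True
    then show ?thesis using c0 nn by (simp add: distrib_right add_increasing2)
  next
    case False
    then have pos: "p > 0" using nn by linarith
    have "2 * G\<^sup>2 / \<eta> \<le> 2 * (G * p) / \<eta>"
      unfolding power2_eq_square using False nn \<eta> by (intro divide_right_mono mult_left_mono) auto
    with main have "(1 - q) * p\<^sup>2 \<le> (3 * r + 2 / \<eta>) * G * p" by (simp add: algebra_simps)
    then have "((1 - q) * p) * p \<le> ((3 * r + 2 / \<eta>) * G) * p" by (simp add: power2_eq_square mult.assoc)
    then have "(1 - q) * p \<le> (3 * r + 2 / \<eta>) * G" using pos by (rule mult_right_le_imp_le)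
    then have "p \<le> c * G" unfolding c_def using q by (simp add: field_simps)
    then show ?thesis using nn by (simp add: distrib_right)
  qed
  then have "r * p \<le> r * ((1 + c) * G)" using r by (intro mult_left_mono)
  then show ?thesis using xX unfolding X_def r_def[symmetric] c_def[symmetric] by (simp add: distrib_right mult.assoc)
qed

context dissipative
begin

text \<open>The path of operators \<open>D\<^sub>0 + t V - k\<close>, for \<open>k = \<alpha> + i \<eta>\<close>, from the free operator to the perturbed one.\<close>

definition T :: "real \<Rightarrow> real \<Rightarrow> real \<Rightarrow> field \<Rightarrow> field" where
  "T \<alpha> \<eta> t u = shifted \<alpha> \<eta> u + t *\<^sub>R pw im (Q u)"

lemma T_add: "u \<in> H \<Longrightarrow> v \<in> H \<Longrightarrow> T \<alpha> \<eta> t (u + v) = T \<alpha> \<eta> t u + T \<alpha> \<eta> t v"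
  by (simp add: T_def shifted_add Q_add pw_linear_simps algebra_simps)

lemma T_scaleR: "u \<in> H \<Longrightarrow> T \<alpha> \<eta> t (r *\<^sub>R u) = r *\<^sub>R T \<alpha> \<eta> t u"
  by (simp add: T_def shifted_scaleR Q_scaleR pw_linear_simps algebra_simps)

lemma inner_T_im:
  assumes "u \<in> H" shows "inner (T \<alpha> \<eta> t u) (pw im u) = - \<eta> * (norm u)\<^sup>2 + t * (norm (Wf u))\<^sup>2"
proof -
  have "inner (pw im (Q u)) (pw im u) = (norm (Wf u))\<^sup>2"
    using inner_Q[OF assms assms] by (simp add: inner_pw_im pw_im_im power2_norm_eq_inner)
  then show ?thesis by (simp add: T_def inner_add_left inner_shifted_im[OF assms])
qed

text \<open>The norm of \<open>u\<close> is computed by duality, writing \<open>u\<close> as an adjoint resolvent applied to some \<open>v\<close>;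
  the pointwise estimate for \<open>v\<close> then bounds the contribution of the perturbation by \<open>W u\<close>.\<close>

lemma dual_estimate:
  assumes u: "u \<in> H" and \<eta>: "\<eta> > 0" and t: "t \<ge> 0"
  shows "norm u \<le> norm (T \<alpha> \<eta> t u) / \<eta> + t * sqrt (N / 4 / \<eta>) * norm (Wf u)"
proof -
  obtain v where v: "v \<in> H" "shifted \<alpha> (- \<eta>) v = u" using shifted_surj[of "- \<eta>" \<alpha>] \<eta> by (metis UNIV_I imageE neg_equal_0_iff_equal less_irrefl)
  have vn: "norm v \<le> norm u / \<eta>" using norm_le_shifted[OF v(1), of "- \<eta>" \<alpha>] \<eta> by (simp add: v(2) field_simps)
  have wn: "norm (Wf (pw im v)) \<le> sqrt (N / 4 / \<eta>) * norm u"
  proof (rule power2_le_imp_le)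
    have "(norm (Wf (pw im v)))\<^sup>2 \<le> N / (4 * \<bar>- \<eta>\<bar>) * (norm (shifted \<alpha> (- \<eta>) (pw im v)))\<^sup>2"
      using \<eta> by (intro norm_Wf_le H_im v) simp
    also have "norm (shifted \<alpha> (- \<eta>) (pw im v)) = norm u" by (simp add: shifted_im[OF v(1)] v(2) norm_pw_im)
    finally show "(norm (Wf (pw im v)))\<^sup>2 \<le> (sqrt (N / 4 / \<eta>) * norm u)\<^sup>2"
      using \<eta> N_nonneg by (simp add: power_mult_distrib)
  qed (use \<eta> N_nonneg in simp)
  have "(norm u)\<^sup>2 = inner (shifted \<alpha> \<eta> u) v"
    by (simp add: shifted_adjoint[OF u v(1)] v(2) power2_norm_eq_inner)
  also have "\<dots> = inner (T \<alpha> \<eta> t u) v + t * inner (Wf u) (Wf (pw im v))"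
    by (simp add: T_def inner_add_left inner_pw_im inner_Q[OF u H_im[OF v(1)]])
  also have "\<dots> \<le> norm (T \<alpha> \<eta> t u) * norm v + t * (norm (Wf u) * norm (Wf (pw im v)))"
    using t by (intro add_mono mult_left_mono norm_cauchy_schwarz)
  also have "\<dots> \<le> norm (T \<alpha> \<eta> t u) * (norm u / \<eta>) + t * (norm (Wf u) * (sqrt (N / 4 / \<eta>) * norm u))"
    using t vn wn by (intro add_mono mult_left_mono) auto
  also have "\<dots> = (norm (T \<alpha> \<eta> t u) / \<eta> + t * sqrt (N / 4 / \<eta>) * norm (Wf u)) * norm u"
    by (simp add: algebra_simps)
  finally have "norm u * norm u \<le> (norm (T \<alpha> \<eta> t u) / \<eta> + t * sqrt (N / 4 / \<eta>) * norm (Wf u)) * norm u"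
    by (simp add: power2_eq_square)
  then show ?thesis
    using \<eta> t N_nonneg by (cases "u = 0") auto
qed

text \<open>For \<open>\<eta> < 0\<close> the two terms of \<open>inner_T_im\<close> have the same sign, so that each is bounded by the left hand side; for \<open>\<eta> > 0\<close> they
  compete, and the dual estimate decides.\<close>

lemma norm_le_T:
  assumes \<eta>: "\<eta> \<noteq> 0"
  shows "\<exists>C\<ge>0. \<forall>t\<in>{0..1}. \<forall>u\<in>H. norm u \<le> C * norm (T \<alpha> \<eta> t u)"
proof (cases "\<eta> > 0")
  case True
  let ?C = "1 / \<eta> + sqrt (N / 4 / \<eta>) * (1 + (3 * sqrt (N / 4 / \<eta>) + 2 / \<eta>) / (1 - N / 4))"
  have "norm u \<le> ?C * norm (T \<alpha> \<eta> t u)" if "t \<in> {0..1}" "u \<in> H" for t u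
  proof (rule a_priori_arithmetic[where w = "norm (Wf u)" and t = t])
    have "\<bar>inner (T \<alpha> \<eta> t u) (pw im u)\<bar> \<le> norm (T \<alpha> \<eta> t u) * norm u"
      using Cauchy_Schwarz_ineq2[of "T \<alpha> \<eta> t u" "pw im u"] by (simp add: norm_pw_im)
    then show "t * (norm (Wf u))\<^sup>2 \<le> \<eta> * (norm u)\<^sup>2 + norm (T \<alpha> \<eta> t u) * norm u"
      unfolding inner_T_im[OF that(2)] by linarith
    show "norm u \<le> norm (T \<alpha> \<eta> t u) / \<eta> + t * sqrt (N / 4 / \<eta>) * norm (Wf u)"
      using that True by (intro dual_estimate) auto
  qed (use that True W_small N_nonneg in auto)
  moreover have "?C \<ge> 0"
    using True W_small N_nonneg by (intro add_nonneg_nonneg mult_nonneg_nonneg divide_nonneg_nonneg) auto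
  ultimately show ?thesis by blast
next
  case False
  then have neg: "\<eta> < 0" using \<eta> by linarith
  have "norm u \<le> 1 / \<bar>\<eta>\<bar> * norm (T \<alpha> \<eta> t u)" if "t \<in> {0..1}" "u \<in> H" for t u
  proof -
    have "\<bar>inner (T \<alpha> \<eta> t u) (pw im u)\<bar> \<le> norm (T \<alpha> \<eta> t u) * norm u"
      using Cauchy_Schwarz_ineq2[of "T \<alpha> \<eta> t u" "pw im u"] by (simp add: norm_pw_im)
    moreover have "t * (norm (Wf u))\<^sup>2 \<ge> 0" using that by simp
    ultimately have "\<bar>\<eta>\<bar> * norm u * norm u \<le> norm (T \<alpha> \<eta> t u) * norm u"
      unfolding inner_T_im[OF that(2)] using neg by (simp add: power2_eq_square mult.assoc)
    then have "\<bar>\<eta>\<bar> * norm u \<le> norm (T \<alpha> \<eta> t u)" by (cases "u = 0") auto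
    then show ?thesis using neg by (simp add: field_simps)
  qed
  then show ?thesis by (intro exI[of _ "1 / \<bar>\<eta>\<bar>"]) auto
qed

lemma norm_Q_le:
  obtains D where "D \<ge> 0" "\<And>u. u \<in> H \<Longrightarrow> norm (Q u) \<le> 1 / 2 * norm (free u) + D * norm u"
proof -
  obtain C where C: "C \<ge> 0" "\<And>u. u \<in> H \<Longrightarrow> (norm (Q u))\<^sup>2 \<le> 1 / 4 * (norm (free u))\<^sup>2 + C * (norm u)\<^sup>2"
    using Q_relative_bound[of "1 / 4"] by auto
  have "norm (Q u) \<le> 1 / 2 * norm (free u) + sqrt C * norm u" if "u \<in> H" for u
  proof (rule power2_le_imp_le)
    have "1 / 4 * (norm (free u))\<^sup>2 + C * (norm u)\<^sup>2 \<le> (1 / 2 * norm (free u) + sqrt C * norm u)\<^sup>2"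
      using C(1) by (simp add: power2_sum power_mult_distrib power_divide)
    then show "(norm (Q u))\<^sup>2 \<le> (1 / 2 * norm (free u) + sqrt C * norm u)\<^sup>2" using C(2)[OF that] by linarith
  qed (use C in simp)
  then show ?thesis using that[of "sqrt C"] C(1) by auto
qed

lemma graph_norm_le_T:
  assumes \<eta>: "\<eta> \<noteq> 0"
  shows "\<exists>C\<ge>0. \<forall>t\<in>{0..1}. \<forall>u\<in>H. norm u + norm (free u) \<le> C * norm (T \<alpha> \<eta> t u) \<and> norm (Q u) \<le> C * norm (T \<alpha> \<eta> t u)"
proof -
  obtain C where C: "C \<ge> 0" "\<And>t u. t \<in> {0..1} \<Longrightarrow> u \<in> H \<Longrightarrow> norm u \<le> C * norm (T \<alpha> \<eta> t u)"
    using norm_le_T[OF assms, of \<alpha>] by blast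
  obtain D where D: "D \<ge> 0" "\<And>u. u \<in> H \<Longrightarrow> norm (Q u) \<le> 1 / 2 * norm (free u) + D * norm u"
    using norm_Q_le by blast
  define E where "E = \<bar>\<alpha>\<bar> + \<bar>\<eta>\<bar> + D"
  have E: "E \<ge> 0" using D(1) by (simp add: E_def)
  have "norm (free u) \<le> (2 + 2 * E * C) * norm (T \<alpha> \<eta> t u)" if "t \<in> {0..1}" "u \<in> H" for t u
  proof -
    have "norm (shifted \<alpha> \<eta> u) \<le> norm (T \<alpha> \<eta> t u) + norm (t *\<^sub>R pw im (Q u))"
      using norm_triangle_ineq4[of "T \<alpha> \<eta> t u" "t *\<^sub>R pw im (Q u)"] by (simp add: T_def)
    also have "norm (t *\<^sub>R pw im (Q u)) \<le> norm (Q u)" using that(1) by (simp add: norm_pw_im mult_left_le_one_le)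
    finally have "norm (free u) \<le> norm (T \<alpha> \<eta> t u) + norm (Q u) + (\<bar>\<alpha>\<bar> + \<bar>\<eta>\<bar>) * norm u"
      using norm_free_le[OF that(2), of \<alpha> \<eta>] by linarith
    moreover note D(2)[OF that(2)]
    moreover have "2 * (E * norm u) = 2 * ((\<bar>\<alpha>\<bar> + \<bar>\<eta>\<bar>) * norm u) + 2 * (D * norm u)"
      by (simp add: E_def algebra_simps)
    ultimately have "norm (free u) \<le> 2 * norm (T \<alpha> \<eta> t u) + 2 * (E * norm u)" by linarith
    also have "E * norm u \<le> E * (C * norm (T \<alpha> \<eta> t u))" by (rule mult_left_mono[OF C(2)[OF that] E])
    finally show ?thesis by (simp add: algebra_simps)
  qed
  note f = this
  define F where "F = 2 + 2 * E * C"
  have F: "F \<ge> 0" using E C(1) by (simp add: F_def)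
  have "norm u + norm (free u) \<le> ((C + F) + (F + D * C)) * norm (T \<alpha> \<eta> t u) \<and> norm (Q u) \<le> ((C + F) + (F + D * C)) * norm (T \<alpha> \<eta> t u)"
    if "t \<in> {0..1}" "u \<in> H" for t u
  proof -
    let ?G = "norm (T \<alpha> \<eta> t u)"
    have 1: "norm u \<le> C * ?G" "norm (free u) \<le> F * ?G" using C(2)[OF that] f[OF that] by (auto simp: F_def)
    have 2: "D * norm u \<le> D * (C * ?G)" by (rule mult_left_mono[OF 1(1) D(1)])
    have 3: "C * ?G \<ge> 0" "F * ?G \<ge> 0" "D * (C * ?G) \<ge> 0" using C(1) F D(1) by auto
    show ?thesis using 1 2 3 D(2)[OF that(2)] norm_ge_zero[of "free u"] unfolding distrib_right mult.assoc by linarith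
  qed
  then show ?thesis using C(1) F D(1) by (intro exI[of _ "(C + F) + (F + D * C)"]) auto
qed

text \<open>The method of continuity: since the a priori bound is uniform along the path \<open>t\<close>, surjectivity
  propagates from \<open>t = 0\<close> to \<open>t = 1\<close> in finitely many steps of fixed size.\<close>

lemma T_surj:
  assumes \<eta>: "\<eta> \<noteq> 0" shows "T \<alpha> \<eta> 1 ` H = UNIV"
proof -
  obtain C where C: "C \<ge> 0" "\<And>t u. t \<in> {0..1} \<Longrightarrow> u \<in> H \<Longrightarrow> norm u + norm (free u) \<le> C * norm (T \<alpha> \<eta> t u)"
    "\<And>t u. t \<in> {0..1} \<Longrightarrow> u \<in> H \<Longrightarrow> norm (Q u) \<le> C * norm (T \<alpha> \<eta> t u)"
    using graph_norm_le_T[OF assms, of \<alpha>] by blast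
  obtain D where D: "D \<ge> 0" "\<And>u. u \<in> H \<Longrightarrow> norm (Q u) \<le> 1 / 2 * norm (free u) + D * norm u"
    using norm_Q_le by blast
  define U where "U = 2 + (\<bar>\<alpha>\<bar> + \<bar>\<eta>\<bar>) + D"
  have up: "norm (T \<alpha> \<eta> t u) \<le> U * (norm u + norm (free u))" if "t \<in> {0..1}" "u \<in> H" for t u
  proof -
    have "norm (T \<alpha> \<eta> t u) \<le> norm (shifted \<alpha> \<eta> u) + norm (t *\<^sub>R pw im (Q u))" unfolding T_def by (rule norm_triangle_ineq)
    also have "norm (t *\<^sub>R pw im (Q u)) \<le> norm (Q u)" using that(1) by (simp add: norm_pw_im mult_left_le_one_le)
    finally have "norm (T \<alpha> \<eta> t u) \<le> 2 * norm (free u) + (\<bar>\<alpha>\<bar> + \<bar>\<eta>\<bar>) * norm u + D * norm u"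
      using norm_shifted_le[OF that(2), of \<alpha> \<eta>] D(2)[OF that(2)] norm_ge_zero[of "free u"] by linarith
    also have "\<dots> \<le> U * (norm u + norm (free u))"
      unfolding U_def using D(1) by (simp add: algebra_simps add_increasing add_increasing2)
    finally show ?thesis .
  qed
  have step: "T \<alpha> \<eta> s ` H = UNIV" if st: "T \<alpha> \<eta> t ` H = UNIV" "t \<in> {0..1}" "s \<in> {0..1}" "\<bar>s - t\<bar> * C < 1" for s t
  proof (rule closed_subspace_eq_UNIV)
    show "closed (T \<alpha> \<eta> s ` H)" "subspace (T \<alpha> \<eta> s ` H)"
      using T_add T_scaleR C(2)[OF st(3)] up[OF st(3)] closed_range[of "T \<alpha> \<eta> s" C U] by auto
    fix z :: field assume z: "\<And>y. y \<in> T \<alpha> \<eta> s ` H \<Longrightarrow> inner z y = 0"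
    obtain w where w: "w \<in> H" "z = T \<alpha> \<eta> t w" using st(1) by (metis UNIV_I imageE)
    have "T \<alpha> \<eta> s w = z + (s - t) *\<^sub>R pw im (Q w)" by (simp add: w(2) T_def algebra_simps)
    moreover have "inner z (T \<alpha> \<eta> s w) = 0" by (rule z[OF imageI[OF w(1)]])
    ultimately have "0 = (norm z)\<^sup>2 + (s - t) * inner z (pw im (Q w))"
      by (simp add: inner_add_right power2_norm_eq_inner)
    then have "(norm z)\<^sup>2 = - ((s - t) * inner z (pw im (Q w)))" by linarith
    also have "\<dots> \<le> \<bar>(s - t) * inner z (pw im (Q w))\<bar>" by linarith
    also have "\<dots> \<le> \<bar>s - t\<bar> * (norm z * norm (Q w))"
      unfolding abs_mult using Cauchy_Schwarz_ineq2[of z "pw im (Q w)"] by (intro mult_left_mono) (auto simp: norm_pw_im)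
    also have "\<dots> \<le> \<bar>s - t\<bar> * (norm z * (C * norm z))"
      using C(3)[OF st(2) w(1)] by (intro mult_left_mono) (auto simp: w(2))
    also have "\<dots> = (\<bar>s - t\<bar> * C) * (norm z)\<^sup>2" by (simp add: power2_eq_square)
    finally have "(norm z)\<^sup>2 \<le> (\<bar>s - t\<bar> * C) * (norm z)\<^sup>2" .
    then have "(1 - \<bar>s - t\<bar> * C) * (norm z)\<^sup>2 \<le> 0" by (simp add: algebra_simps)
    then have "(norm z)\<^sup>2 \<le> 0" using st(4) by (simp add: mult_le_0_iff)
    then show "z = 0" by simp
  qed
  obtain n :: nat where n: "C < real n" "n > 0"
    using reals_Archimedean2[of "max C 0"] by (metis max_less_iff_conj of_nat_0_less_iff)
  have "T \<alpha> \<eta> (real k / real n) ` H = UNIV" if "k \<le> n" for k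
    using that
  proof (induction k)
    case 0
    have "T \<alpha> \<eta> 0 = shifted \<alpha> \<eta>" by (rule ext) (simp add: T_def)
    then show ?case using shifted_surj[OF assms] by simp
  next
    case (Suc k)
    show ?case
    proof (rule step)
      show "T \<alpha> \<eta> (real k / real n) ` H = UNIV" using Suc by simp
      have "real (Suc k) / real n - real k / real n = 1 / real n" by (simp add: diff_divide_distrib[symmetric])
      then show "\<bar>real (Suc k) / real n - real k / real n\<bar> * C < 1" using n C(1) by (simp add: field_simps)
    qed (use Suc n in auto)
  qed
  from this[of n] show ?thesis using n by simp
qed

end

section \<open>The matrix absolute value\<close>

definition sesq :: "complex^'n \<Rightarrow> complex^'n \<Rightarrow> complex" where
  "sesq v w = (\<Sum>i\<in>UNIV. cnj (v $ i) * w $ i)"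

lemma sesq_add: "sesq (u + v) w = sesq u w + sesq v w" "sesq u (v + w) = sesq u v + sesq u w"
  by (auto simp: sesq_def algebra_simps sum.distrib)

lemma sesq_scale: "sesq (c *s v) w = cnj c * sesq v w" "sesq v (c *s w) = c * sesq v w"
  by (auto simp: sesq_def sum_distrib_left mult_ac)

lemma sesq_self: "sesq v v = complex_of_real ((norm v)\<^sup>2)"
proof -
  have "(norm v)\<^sup>2 = (\<Sum>i\<in>UNIV. (norm (v $ i))\<^sup>2)" by (simp add: norm_vec_def L2_set_def sum_nonneg)
  then show ?thesis by (simp add: sesq_def complex_norm_square mult.commute del: of_real_power)
qed

lemma sesq_adjoint: "sesq (A *v v) w = sesq v (mat_adj A *v w)"
proof -
  have "sesq (A *v v) w = (\<Sum>i\<in>UNIV. \<Sum>j\<in>UNIV. cnj (A $ i $ j) * cnj (v $ j) * w $ i)"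
    by (simp add: sesq_def matrix_vector_mult_def sum_distrib_right)
  also have "\<dots> = (\<Sum>j\<in>UNIV. \<Sum>i\<in>UNIV. cnj (A $ i $ j) * cnj (v $ j) * w $ i)" by (rule sum.swap)
  also have "\<dots> = sesq v (mat_adj A *v w)"
    by (simp add: sesq_def matrix_vector_mult_def mat_adj_def sum_distrib_left mult_ac)
  finally show ?thesis .
qed

lemma pos_semidef_sesq: "pos_semidef A \<longleftrightarrow> hermitian A \<and> (\<forall>v. 0 \<le> Re (sesq v (A *v v)))"
  by (simp add: pos_semidef_def sesq_def)

text \<open>A positive semidefinite form vanishes on \<open>y\<close> only if the matrix annihilates \<open>y\<close>:
  perturb \<open>y\<close> by a small multiple of its image.\<close>

lemma pos_semidef_null:
  assumes P: "pos_semidef P" and y: "Re (sesq y (P *v y)) = 0"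
  shows "P *v y = 0"
proof (rule ccontr)
  let ?z = "P *v y"
  assume z: "?z \<noteq> 0"
  have adj: "mat_adj P = P" using P by (simp add: pos_semidef_sesq hermitian_def)
  define c where "c = Re (sesq ?z (P *v ?z))"
  define n where "n = (norm ?z)\<^sup>2"
  have n: "n > 0" using z by (simp add: n_def)
  have c: "c \<ge> 0" using P by (simp add: c_def pos_semidef_sesq)
  have quad: "0 \<le> - 2 * t * n + t\<^sup>2 * c" for t :: real
  proof -
    let ?t = "complex_of_real t"
    have "sesq (y - ?t *s ?z) (P *v (y - ?t *s ?z)) = sesq y (P *v y) - ?t * sesq y (P *v ?z) - ?t * sesq ?z (P *v y) + ?t\<^sup>2 * sesq ?z (P *v ?z)"
    proof -
      have e: "y - ?t *s ?z = y + (- ?t) *s ?z" by (simp add: vec_eq_iff)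
      have Pe: "P *v (y - ?t *s ?z) = ?z + (- ?t) *s (P *v ?z)"
        unfolding e matrix_vector_right_distrib vector_scalar_commute ..
      show ?thesis
        unfolding Pe unfolding e sesq_add sesq_scale
        by (simp add: power2_eq_square algebra_simps)
    qed
    moreover have "sesq y (P *v ?z) = complex_of_real n" "sesq ?z (P *v y) = complex_of_real n"
      using sesq_adjoint[of P y ?z] by (simp_all add: adj sesq_self n_def)
    ultimately have "Re (sesq (y - ?t *s ?z) (P *v (y - ?t *s ?z))) = - 2 * t * n + t\<^sup>2 * c"
      using y by (simp add: c_def flip: of_real_power)
    then show ?thesis using P by (metis pos_semidef_sesq)
  qed
  have "0 \<le> - 2 * (n / (c + 1)) * n + (n / (c + 1))\<^sup>2 * c" by (rule quad)
  also have "(n / (c + 1))\<^sup>2 * c \<le> (n / (c + 1)) * n"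
  proof -
    have "(n / (c + 1)) * c \<le> n" using n c by (simp add: field_simps)
    then have "(n / (c + 1)) * ((n / (c + 1)) * c) \<le> (n / (c + 1)) * n" using n c by (intro mult_left_mono) auto
    then show ?thesis by (simp only: power2_eq_square mult.assoc)
  qed
  finally have "(n / (c + 1)) * n \<le> 0" by simp
  moreover have "(n / (c + 1)) * n > 0" using n c by (intro mult_pos_pos divide_pos_pos) auto
  ultimately show False by linarith
qed

lemma trace_sesq: "trace A = (\<Sum>j\<in>UNIV. sesq (axis j 1) (A *v axis j 1))"
  by (simp add: trace_def sesq_def matrix_vector_mult_def axis_def if_distrib[of cnj] if_distrib[of "\<lambda>x. x * _"] if_distrib[of "\<lambda>x. _ * x"] cong: if_cong)

text \<open>With \<open>X = P - Q\<close> one has \<open>(P + Q) X + X (P + Q) = 2 (P\<^sup>2 - Q\<^sup>2) = 0\<close>, so the positive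
  semidefinite matrices \<open>X P X\<close> and \<open>X Q X\<close> have total trace zero; hence \<open>P X = Q X = 0\<close> and \<open>X\<^sup>2 = 0\<close>.\<close>

lemma pos_semidef_sqrt_unique:
  fixes P Q :: "complex^'n^'n"
  assumes P: "pos_semidef P" and Q: "pos_semidef Q" and eq: "P ** P = Q ** Q"
  shows "P = Q"
proof -
  define X where "X = P - Q"
  have adj: "mat_adj P = P" "mat_adj Q = Q" using P Q by (auto simp: pos_semidef_sesq hermitian_def)
  have X: "mat_adj X = X" using adj by (simp add: X_def mat_adj_def vec_eq_iff)
  have mv: "X *v v = P *v v - Q *v v" for v by (simp add: X_def matrix_vector_mult_diff_rdistrib)
  have tr: "trace (X ** ((P + Q) ** X)) = 0"
  proof -
    have "trace (X ** ((P + Q) ** X)) = trace (((P + Q) ** X) ** X)" by (rule trace_mul_sym)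
    then have a: "trace (X ** ((P + Q) ** X)) = trace ((P + Q) ** X ** X)" by simp
    have b: "trace (X ** ((P + Q) ** X)) = trace (X ** (P + Q) ** X)" by (simp add: matrix_mul_assoc)
    have "(P + Q) ** X + X ** (P + Q) = 0"
    proof -
      have "(P + Q) ** X + X ** (P + Q) = (P ** P - Q ** Q) + (P ** P - Q ** Q)"
        by (simp add: X_def vec_eq_iff matrix_matrix_mult_def algebra_simps sum.distrib sum_subtractf)
      then show ?thesis using eq by simp
    qed
    then have "trace (((P + Q) ** X + X ** (P + Q)) ** X) = 0" by (simp add: trace_def matrix_matrix_mult_def)
    moreover have "((P + Q) ** X + X ** (P + Q)) ** X = (P + Q) ** X ** X + X ** (P + Q) ** X"
      by (simp add: vec_eq_iff matrix_matrix_mult_def[of _ X] distrib_right sum.distrib)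
    ultimately have "trace ((P + Q) ** X ** X) + trace (X ** (P + Q) ** X) = 0"
      by (simp add: trace_add)
    then show ?thesis using a b by simp
  qed
  let ?e = "\<lambda>j. axis j 1 :: complex^'n"
  have quadratic: "sesq (?e j) ((X ** ((P + Q) ** X)) *v ?e j) = sesq (X *v ?e j) (P *v (X *v ?e j)) + sesq (X *v ?e j) (Q *v (X *v ?e j))" for j
    unfolding matrix_vector_mul_assoc[symmetric] sesq_adjoint[of X] X
    by (simp add: matrix_vector_mult_add_rdistrib matrix_vector_right_distrib sesq_add)
  have nn: "0 \<le> Re (sesq v (P *v v))" "0 \<le> Re (sesq v (Q *v v))" for v
    using P Q by (auto simp: pos_semidef_sesq)
  have "(\<Sum>j\<in>UNIV. Re (sesq (X *v ?e j) (P *v (X *v ?e j))) + Re (sesq (X *v ?e j) (Q *v (X *v ?e j)))) = Re (trace (X ** ((P + Q) ** X)))"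
    unfolding trace_sesq quadratic by simp
  then have "(\<Sum>j\<in>UNIV. Re (sesq (X *v ?e j) (P *v (X *v ?e j))) + Re (sesq (X *v ?e j) (Q *v (X *v ?e j)))) = 0" using tr by simp
  then have z: "Re (sesq (X *v ?e j) (P *v (X *v ?e j))) + Re (sesq (X *v ?e j) (Q *v (X *v ?e j))) = 0" for j
    by (subst (asm) sum_nonneg_eq_0_iff) (auto intro: add_nonneg_nonneg nn)
  have "X *v ?e j = 0" for j
  proof -
    have "Re (sesq (X *v ?e j) (P *v (X *v ?e j))) = 0" "Re (sesq (X *v ?e j) (Q *v (X *v ?e j))) = 0"
      using z[of j] nn(1)[of "X *v ?e j"] nn(2)[of "X *v ?e j"] by linarith+
    then have "P *v (X *v ?e j) = 0" "Q *v (X *v ?e j) = 0" using pos_semidef_null P Q by blast+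
    then have "X *v (X *v ?e j) = 0" unfolding mv[of "X *v ?e j"] by simp
    then have "sesq (X *v ?e j) (X *v ?e j) = 0" unfolding sesq_adjoint[of X] X by (simp add: sesq_def)
    then show ?thesis by (simp add: sesq_self)
  qed
  then have "X $ i $ j = 0" for i j
  proof -
    have "(X *v ?e j) $ i = X $ i $ j"
      by (simp add: matrix_vector_mult_def axis_def if_distrib[of "\<lambda>x. _ * x"] cong: if_cong)
    then show ?thesis using \<open>\<And>j. X *v ?e j = 0\<close> by simp
  qed
  then have "X = 0" by (simp add: vec_eq_iff)
  then show ?thesis by (simp add: X_def)
qed

text \<open>Both \<open>W\<^sup>2\<close> and \<open>|V|\<close> are positive semidefinite square roots of \<open>V\<^sup>* V = W\<^sup>4\<close>.\<close>

lemma mat_abs_i_square: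
  fixes W :: "complex^'n^'n"
  assumes W: "hermitian W"
  shows "mat_abs (\<chi> i j. \<i> * (W ** W) $ i $ j) = W ** W"
  unfolding mat_abs_def
proof (rule the_equality)
  let ?V = "(\<chi> i j. \<i> * (W ** W) $ i $ j) :: complex^'n^'n"
  have adj: "mat_adj W = W" using W by (simp add: hermitian_def)
  have WW: "mat_adj (W ** W) = W ** W"
  proof -
    have "cnj (W $ i $ j) = W $ j $ i" for i j using adj by (simp add: mat_adj_def vec_eq_iff)
    then show ?thesis by (simp add: mat_adj_def vec_eq_iff matrix_matrix_mult_def mult.commute)
  qed
  have "sesq v ((W ** W) *v v) = sesq (W *v v) (W *v v)" for v
    unfolding matrix_vector_mul_assoc[symmetric] sesq_adjoint adj ..
  then have psd: "pos_semidef (W ** W)" using WW by (simp add: pos_semidef_sesq hermitian_def sesq_self)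
  have c: "cnj ((W ** W) $ i $ j) = (W ** W) $ j $ i" for i j using WW by (simp add: mat_adj_def vec_eq_iff)
  have sq: "(W ** W) ** (W ** W) = mat_adj ?V ** ?V"
    by (simp add: vec_eq_iff mat_adj_def matrix_matrix_mult_def[of "\<chi> i j. _ i j"] matrix_matrix_mult_def[of "W ** W"] c mult_ac)
  show "pos_semidef (W ** W) \<and> (W ** W) ** (W ** W) = mat_adj ?V ** ?V" using psd sq by blast
  show "P = W ** W" if "pos_semidef P \<and> P ** P = mat_adj ?V ** ?V" for P
    using that psd sq pos_semidef_sqrt_unique[of P "W ** W"] by simp
qed

lemma trace_square_hermitian:
  fixes W :: "complex^'n^'n"
  assumes "hermitian W" shows "Re (trace (W ** W)) = (norm W)\<^sup>2"
proof -
  have c: "W $ j $ i = cnj (W $ i $ j)" for i j using assms by (simp add: hermitian_def mat_adj_def vec_eq_iff)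
  have "trace (W ** W) = (\<Sum>i\<in>UNIV. \<Sum>j\<in>UNIV. W $ i $ j * cnj (W $ i $ j))"
    unfolding trace_def matrix_matrix_mult_def by (simp add: c[symmetric])
  also have "\<dots> = complex_of_real (\<Sum>i\<in>UNIV. \<Sum>j\<in>UNIV. (norm (W $ i $ j))\<^sup>2)"
    by (simp add: complex_norm_square del: of_real_power)
  also have "(\<Sum>i\<in>UNIV. \<Sum>j\<in>UNIV. (norm (W $ i $ j))\<^sup>2) = (norm W)\<^sup>2"
    by (simp add: norm_vec_def L2_set_def sum_nonneg)
  finally show ?thesis by simp
qed

section \<open>From classes of functions to functions\<close>

lemma AE_lebesgue_iff: "(AE x in lebesgue. P x) \<longleftrightarrow> (AE x in lborel. P x)"
  by (rule AE_completion_iff)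

lemma borel_representative:
  fixes f :: "'a::euclidean_space \<Rightarrow> 'b::euclidean_space"
  assumes "f \<in> borel_measurable lebesgue"
  shows "\<exists>h\<in>borel_measurable borel. AE x in lborel. f x = h x"
proof -
  have "\<exists>h\<in>borel_measurable lborel. AE x in lborel. f x \<bullet> b = h x" for b
    by (rule completion_ex_borel_measurable_real) (use assms in measurable)
  then obtain h where h: "\<And>b. h b \<in> borel_measurable lborel" "\<And>b. AE x in lborel. f x \<bullet> b = h b x" by metis
  have "AE x in lborel. \<forall>b\<in>Basis. f x \<bullet> b = h b x"
    by (subst AE_finite_all) (auto intro: h)
  then have "AE x in lborel. f x = (\<Sum>b\<in>Basis. h b x *\<^sub>R b)"
  proof (rule eventually_mono)
    fix x assume "\<forall>b\<in>Basis. f x \<bullet> b = h b x"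
    then have "(\<Sum>b\<in>Basis. (f x \<bullet> b) *\<^sub>R b) = (\<Sum>b\<in>Basis. h b x *\<^sub>R b)" by simp
    then show "f x = (\<Sum>b\<in>Basis. h b x *\<^sub>R b)" by (simp add: euclidean_representation)
  qed
  moreover have "h b \<in> borel_measurable borel" for b using h(1)[of b] by simp
  then have "(\<lambda>x. \<Sum>b\<in>Basis. h b x *\<^sub>R b) \<in> borel_measurable borel"
    by (intro borel_measurable_sum borel_measurable_scaleR borel_measurable_const)
  ultimately show ?thesis by (rule bexI)
qed

lemma borel_lebesgue: "f \<in> borel_measurable borel \<Longrightarrow> f \<in> borel_measurable lebesgue"
  by (rule measurable_completion) simp

lemma lebesgue_AE_borel:
  fixes f h :: "'a::euclidean_space \<Rightarrow> 'b::euclidean_space"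
  assumes "AE x in lborel. f x = h x" "h \<in> borel_measurable borel"
  shows "f \<in> borel_measurable lebesgue"
proof (rule borel_measurable_AE[OF borel_lebesgue[OF assms(2)]])
  show "AE x in lebesgue. h x = f x" unfolding AE_lebesgue_iff using assms(1) by (auto elim: eventually_mono)
qed

lemma lebesgue_integral_AE:
  fixes f h :: "'a::euclidean_space \<Rightarrow> 'b::euclidean_space"
  assumes "AE x in lborel. f x = h x" "h \<in> borel_measurable borel"
  shows "(LINT x|lebesgue. f x) = (LINT x|lborel. h x)" "integrable lebesgue f \<longleftrightarrow> integrable lborel h"
proof -
  note m = lebesgue_AE_borel[OF assms] borel_lebesgue[OF assms(2)]
  have ae: "AE x in lebesgue. f x = h x" using assms(1) by (simp add: AE_lebesgue_iff)
  have "(LINT x|lebesgue. f x) = (LINT x|lebesgue. h x)" by (rule integral_cong_AE[OF m ae])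
  also have "\<dots> = (LINT x|lborel. h x)" using assms(2) by (intro integral_completion) simp
  finally show "(LINT x|lebesgue. f x) = (LINT x|lborel. h x)" .
  have "integrable lebesgue f \<longleftrightarrow> integrable lebesgue h" by (rule integrable_cong_AE[OF m ae])
  also have "\<dots> \<longleftrightarrow> integrable lborel h" using assms(2) by (intro integrable_completion) simp
  finally show "integrable lebesgue f \<longleftrightarrow> integrable lborel h" .
qed

lemma L2_E:
  fixes f :: "real^'d \<Rightarrow> 'b::euclidean_space"
  assumes "f \<in> L2"
  obtains a where "AE x in lborel. f x = fn a x"
proof -
  have f: "f \<in> borel_measurable lebesgue" "integrable lebesgue (\<lambda>x. (norm (f x))\<^sup>2)" using assms by (auto simp: L2_def)
  obtain h where h: "h \<in> borel_measurable borel" "AE x in lborel. f x = h x" using borel_representative[OF f(1)] by blast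
  have "AE x in lborel. (norm (f x))\<^sup>2 = (norm (h x))\<^sup>2" using h(2) by (auto elim: eventually_mono)
  then have "sqi h" using lebesgue_integral_AE(2)[of "\<lambda>x. (norm (f x))\<^sup>2" "\<lambda>x. (norm (h x))\<^sup>2"] f(2) h(1) by (simp add: sqi_def)
  then have "AE x in lborel. fn (cls h) x = h x" by (rule fn_cls)
  with h(2) have "AE x in lborel. f x = fn (cls h) x" by eventually_elim simp
  then show ?thesis using that by blast
qed

lemma fn_in_L2: "fn a \<in> L2"
  using lebesgue_integral_AE(2)[of "\<lambda>x. (norm (fn a x))\<^sup>2" "\<lambda>x. (norm (fn a x))\<^sup>2"] borel_lebesgue[OF fn_measurable] by (simp add: L2_def)

lemma L2_norm_eq:
  assumes "AE x in lborel. f x = fn a x" shows "L2_norm f = norm a"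
proof -
  have "AE x in lborel. (norm (f x))\<^sup>2 = (norm (fn a x))\<^sup>2" using assms by (auto elim: eventually_mono)
  then have "(LINT x|lebesgue. (norm (f x))\<^sup>2) = (norm a)\<^sup>2"
    by (subst lebesgue_integral_AE(1)) (auto simp: norm_l2_sq)
  then show ?thesis by (simp add: L2_norm_def)
qed

lemma locally_integrable_measurable_bound:
  fixes u :: "real^'d \<Rightarrow> 'b::euclidean_space" and \<phi> :: "real^'d \<Rightarrow> real"
  assumes u: "locally_integrable u" and \<phi>: "test_function \<phi>"
  shows "integrable lebesgue (\<lambda>x. \<phi> x *\<^sub>R u x)"
proof -
  obtain R where R: "\<And>x. norm x > R \<Longrightarrow> \<phi> x = 0" using test_function_support[OF \<phi>] by metis
  obtain B where B: "\<And>x. \<bar>\<phi> x\<bar> \<le> B" "B > 0" using test_function_bounded[OF \<phi>] by metis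
  have i: "integrable lebesgue (\<lambda>x. indicator (cball 0 R) x *\<^sub>R u x)"
    using u compact_cball unfolding locally_integrable_def set_integrable_def by blast
  have e: "\<phi> x *\<^sub>R u x = \<phi> x *\<^sub>R (indicator (cball 0 R) x *\<^sub>R u x)" for x
    using R[of x] by (cases "norm x > R") auto
  have m: "\<phi> \<in> borel_measurable lebesgue" by (rule borel_lebesgue[OF test_function_measurable[OF \<phi>]])
  have "integrable lebesgue (\<lambda>x. \<phi> x *\<^sub>R (indicator (cball 0 R) x *\<^sub>R u x))"
  proof (rule Bochner_Integration.integrable_bound[where f = "\<lambda>x. B *\<^sub>R (indicator (cball 0 R) x *\<^sub>R u x)"])
    show "integrable lebesgue (\<lambda>x. B *\<^sub>R (indicator (cball 0 R) x *\<^sub>R u x))" by (rule integrable_scaleR_right) (rule i)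
    show "(\<lambda>x. \<phi> x *\<^sub>R (indicator (cball 0 R) x *\<^sub>R u x)) \<in> borel_measurable lebesgue"
      by (rule borel_measurable_scaleR[OF m borel_measurable_integrable[OF i]])
    show "AE x in lebesgue. norm (\<phi> x *\<^sub>R (indicator (cball 0 R) x *\<^sub>R u x)) \<le> norm (B *\<^sub>R (indicator (cball 0 R) x *\<^sub>R u x))"
    proof (rule AE_I2)
      fix x
      show "norm (\<phi> x *\<^sub>R (indicator (cball 0 R) x *\<^sub>R u x)) \<le> norm (B *\<^sub>R (indicator (cball 0 R) x *\<^sub>R u x))"
        unfolding norm_scaleR[of "\<phi> x"] norm_scaleR[of B] using B(1)[of x] B(2) by (intro mult_right_mono) auto
    qed
  qed
  then show ?thesis by (simp only: e[symmetric])
qed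

lemma locally_integrable_AE:
  fixes f :: "real^'d \<Rightarrow> 'b::euclidean_space"
  assumes "AE x in lborel. f x = fn a x" shows "locally_integrable f"
  unfolding locally_integrable_def set_integrable_def
proof (intro allI impI)
  fix K :: "(real^'d) set" assume K: "compact K"
  then have Kb: "K \<in> sets borel" by (simp add: compact_imp_closed)
  obtain R where R: "K \<subseteq> cball 0 R" using compact_imp_bounded[OF K] by (auto simp: bounded_iff subset_eq)
  have ae: "AE x in lborel. indicator K x *\<^sub>R f x = indicator K x *\<^sub>R fn a x" using assms by (auto elim: eventually_mono)
  have "integrable lborel (\<lambda>x. indicator K x *\<^sub>R (indicator (cball 0 R) x *\<^sub>R fn a x))"
    using Kb by (intro integrable_mult_indicator sqi_scaleR_integrable sqi_indicator_cball sqi_fn) simp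
  moreover have "(\<lambda>x. indicator K x *\<^sub>R (indicator (cball 0 R) x *\<^sub>R fn a x)) = (\<lambda>x. indicator K x *\<^sub>R fn a x)"
    using R by (auto simp: indicator_def fun_eq_iff)
  ultimately have "integrable lborel (\<lambda>x. indicator K x *\<^sub>R fn a x)" by (simp only:)
  then show "integrable lebesgue (\<lambda>x. indicator K x *\<^sub>R f x)"
    using lebesgue_integral_AE(2)[OF ae] Kb by simp
qed

lemma has_weak_derivative_iff:
  fixes u w :: "real^'d \<Rightarrow> 'b::euclidean_space"
  assumes u: "AE x in lborel. u x = fn a x" and w: "AE x in lborel. w x = fn b x"
  shows "has_weak_derivative js u w \<longleftrightarrow> wder js a b"
proof -
  have i: "integrable lborel (\<lambda>x. \<psi> x *\<^sub>R fn c x)" if "test_function \<psi>" for \<psi> and c :: "(real^'d, 'b) l2"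
    using test_function_integrable(2)[OF that, of "1 :: real"] by (intro sqi_scaleR_integrable sqi_fn) simp
  have eq: "(LINT x|lebesgue. \<psi> x *\<^sub>R f x) = (LINT x|lborel. \<psi> x *\<^sub>R fn c x)"
    if "test_function \<psi>" "AE x in lborel. f x = fn c x" for \<psi> and f :: "real^'d \<Rightarrow> 'b" and c
    using that by (intro lebesgue_integral_AE(1)) (auto intro: test_function_measurable elim: eventually_mono)
  have inn: "inner c (tf \<psi> e) = (LINT x|lborel. \<psi> x *\<^sub>R fn c x) \<bullet> e" if "test_function \<psi>" for \<psi> and c :: "(real^'d, 'b) l2" and e
    using integral_inner_left[of e lborel "\<lambda>x. \<psi> x *\<^sub>R fn c x"] i[OF that, of c] by (simp add: inner_tf[OF that])
  have "((LINT x|lebesgue. pderivatives js \<phi> x *\<^sub>R u x) = (- 1) ^ length js *\<^sub>R (LINT x|lebesgue. \<phi> x *\<^sub>R w x))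
    \<longleftrightarrow> (\<forall>e. inner a (tf (pderivatives js \<phi>) e) = (- 1) ^ length js * inner b (tf \<phi> e))" if \<phi>: "test_function \<phi>" for \<phi>
    unfolding eq[OF test_function_pderivatives[OF \<phi>] u] eq[OF \<phi> w] inn[OF test_function_pderivatives[OF \<phi>]] inn[OF \<phi>]
    by (simp only: inner_scaleR_left[symmetric] vector_eq_rdot)
  then show ?thesis
    unfolding has_weak_derivative_def wder_def using locally_integrable_AE[OF u] locally_integrable_AE[OF w] by blast
qed

lemma sobolev_2_E:
  assumes "u \<in> H2"
  obtains a where "a \<in> H" "AE x in lborel. u x = fn a x"
proof -
  have "u \<in> L2" using assms by (simp add: sobolev_def)
  then obtain a where a: "AE x in lborel. u x = fn a x" using L2_E by blast
  have "a \<in> H"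
    unfolding H_def
  proof (intro CollectI allI impI)
    fix js :: "2 list" assume "length js \<le> 2"
    then obtain w where w: "w \<in> L2" "has_weak_derivative js u w" using assms by (auto simp: sobolev_def)
    obtain b where b: "AE x in lborel. w x = fn b x" using L2_E[OF w(1)] by blast
    then show "\<exists>b. wder js a b" using has_weak_derivative_iff[OF a b] w(2) by blast
  qed
  then show ?thesis using that a by blast
qed

lemma fn_in_H2:
  assumes "a \<in> H" shows "fn a \<in> H2"
  unfolding sobolev_def
proof (intro CollectI conjI allI impI fn_in_L2)
  fix js :: "2 list" assume "length js \<le> 2"
  then obtain b where "wder js a b" using assms by (auto simp: H_def)
  then have "has_weak_derivative js (fn a) (fn b)" by (subst has_weak_derivative_iff[where a = a and b = b]) auto
  then show "\<exists>w\<in>L2. has_weak_derivative js (fn a) w" using fn_in_L2 by blast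
qed

text \<open>Uniqueness makes every representative of a weak derivative as good as the one chosen by
  \<open>weak_partial\<close>.\<close>

lemma has_weak_derivative_unique:
  fixes u v w :: "real^'d \<Rightarrow> 'b::euclidean_space"
  assumes "has_weak_derivative js u v" "has_weak_derivative js u w"
  shows "AE x in lborel. v x = w x"
proof -
  have l: "locally_integrable v" "locally_integrable w" using assms by (auto simp: has_weak_derivative_def)
  have vw: "(LINT x|lebesgue. \<phi> x *\<^sub>R (v x - w x)) = 0" if \<phi>: "test_function \<phi>" for \<phi>
  proof -
    have "(- 1) ^ length js *\<^sub>R (LINT x|lebesgue. \<phi> x *\<^sub>R v x) = (- 1) ^ length js *\<^sub>R (LINT x|lebesgue. \<phi> x *\<^sub>R w x)"
      using assms[unfolded has_weak_derivative_def, THEN conjunct2, THEN conjunct2, rule_format, OF \<phi>] by (simp only:)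
    then have "(LINT x|lebesgue. \<phi> x *\<^sub>R v x) = (LINT x|lebesgue. \<phi> x *\<^sub>R w x)" by simp
    then show ?thesis
      using locally_integrable_measurable_bound[OF l(1) \<phi>] locally_integrable_measurable_bound[OF l(2) \<phi>]
      by (simp add: scaleR_diff_right)
  qed
  have ball: "integrable lebesgue (\<lambda>x. indicator (cball 0 R) x *\<^sub>R (v x - w x))" for R
    using l compact_cball unfolding locally_integrable_def set_integrable_def scaleR_diff_right by (intro Bochner_Integration.integrable_diff) blast+
  have "(\<lambda>x. v x - w x) \<in> borel_measurable lebesgue"
  proof (rule borel_measurable_LIMSEQ_metric)
    show "(\<lambda>x. indicator (cball 0 (real n)) x *\<^sub>R (v x - w x)) \<in> borel_measurable lebesgue" for n
      by (rule borel_measurable_integrable[OF ball])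
    fix x :: "real^'d"
    obtain n :: nat where n: "norm x \<le> real n" using real_arch_simple by blast
    have "\<forall>\<^sub>F m in sequentially. indicator (cball 0 (real m)) x *\<^sub>R (v x - w x) = v x - w x"
      using eventually_ge_at_top[of n] by eventually_elim (use n in auto)
    then show "(\<lambda>m. indicator (cball 0 (real m)) x *\<^sub>R (v x - w x)) \<longlonglongrightarrow> v x - w x" by (rule tendsto_eventually)
  qed
  then obtain h where h: "h \<in> borel_measurable borel" "AE x in lborel. v x - w x = h x" using borel_representative by blast
  have "AE x in lborel. h x = 0"
  proof (rule AE_eq_0_if_test_functions)
    show "integrable lborel (\<lambda>x. indicator (cball 0 R) x *\<^sub>R h x)" for R
    proof (rule lebesgue_integral_AE(2)[THEN iffD1, OF _ _ ball[of R]])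
      show "AE x in lborel. indicator (cball 0 R) x *\<^sub>R (v x - w x) = indicator (cball 0 R) x *\<^sub>R h x" using h(2) by (auto elim: eventually_mono)
      show "(\<lambda>x. indicator (cball 0 R) x *\<^sub>R h x) \<in> borel_measurable borel"
        by (intro borel_measurable_scaleR borel_measurable_indicator h(1)) simp
    qed
    fix \<phi> :: "real^'d \<Rightarrow> real" assume \<phi>: "test_function \<phi>"
    have "(LINT x|lebesgue. \<phi> x *\<^sub>R (v x - w x)) = (LINT x|lborel. \<phi> x *\<^sub>R h x)"
    proof (rule lebesgue_integral_AE(1))
      show "AE x in lborel. \<phi> x *\<^sub>R (v x - w x) = \<phi> x *\<^sub>R h x" using h(2) by eventually_elim simp
      show "(\<lambda>x. \<phi> x *\<^sub>R h x) \<in> borel_measurable borel"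
        by (rule borel_measurable_scaleR[OF test_function_measurable[OF \<phi>] h(1)])
    qed
    then show "(LINT x|lborel. \<phi> x *\<^sub>R h x) = 0" using vw[OF \<phi>] by simp
  qed
  with h(2) show ?thesis by eventually_elim simp
qed

lemma weak_partial_works: "has_weak_derivative [j] u w \<Longrightarrow> has_weak_derivative [j] u (weak_partial j u)"
  unfolding weak_partial_def by (rule someI[where P = "has_weak_derivative [j] u"])

lemma weak_partial_AE: "has_weak_derivative [j] u w \<Longrightarrow> AE x in lborel. weak_partial j u x = w x"
  using has_weak_derivative_unique weak_partial_works by blast

lemma has_weak_derivative_linear:
  fixes u w :: "real^'d \<Rightarrow> 'b::euclidean_space" and A :: "'b \<Rightarrow> 'c::euclidean_space"
  assumes "has_weak_derivative js u w" "bounded_linear A"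
  shows "has_weak_derivative js (\<lambda>x. A (u x)) (\<lambda>x. A (w x))"
proof -
  interpret A: bounded_linear A by fact
  have l: "locally_integrable u" "locally_integrable w" using assms by (auto simp: has_weak_derivative_def)
  have lA: "locally_integrable (\<lambda>x. A (f x))" if "locally_integrable f" for f :: "real^'d \<Rightarrow> 'b"
    unfolding locally_integrable_def set_integrable_def
  proof (intro allI impI)
    fix K :: "(real^'d) set" assume "compact K"
    then have "integrable lebesgue (\<lambda>x. indicator K x *\<^sub>R f x)" using that by (simp add: locally_integrable_def set_integrable_def)
    from integrable_bounded_linear[OF assms(2) this] show "integrable lebesgue (\<lambda>x. indicator K x *\<^sub>R A (f x))" by (simp add: A.scaleR)
  qed
  have int: "(LINT x|lebesgue. \<phi> x *\<^sub>R A (f x)) = A (LINT x|lebesgue. \<phi> x *\<^sub>R f x)" if "locally_integrable f" "test_function \<phi>" for f and \<phi> :: "real^'d \<Rightarrow> real"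
    using integral_bounded_linear[OF assms(2) locally_integrable_measurable_bound[OF that]] by (simp add: A.scaleR)
  show ?thesis
    using assms(1) unfolding has_weak_derivative_def
    by (auto simp: lA int l test_function_pderivatives A.scaleR)
qed

lemma has_weak_derivative_add:
  fixes u w u' w' :: "real^'d \<Rightarrow> 'b::euclidean_space"
  assumes "has_weak_derivative js u w" "has_weak_derivative js u' w'"
  shows "has_weak_derivative js (\<lambda>x. u x + u' x) (\<lambda>x. w x + w' x)"
proof -
  have l: "locally_integrable u" "locally_integrable w" "locally_integrable u'" "locally_integrable w'" using assms by (auto simp: has_weak_derivative_def)
  have la: "locally_integrable (\<lambda>x. f x + h x)" if "locally_integrable f" "locally_integrable h" for f h :: "real^'d \<Rightarrow> 'b"
    using that unfolding locally_integrable_def set_integrable_def by (simp add: scaleR_add_right)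
  have int: "(LINT x|lebesgue. \<phi> x *\<^sub>R (f x + h x)) = (LINT x|lebesgue. \<phi> x *\<^sub>R f x) + (LINT x|lebesgue. \<phi> x *\<^sub>R h x)"
    if "locally_integrable f" "locally_integrable h" "test_function \<phi>" for f h and \<phi> :: "real^'d \<Rightarrow> real"
    using locally_integrable_measurable_bound[OF that(1,3)] locally_integrable_measurable_bound[OF that(2,3)] by (simp add: scaleR_add_right)
  show ?thesis
    unfolding has_weak_derivative_def
  proof (intro conjI allI impI la l)
    fix \<phi> :: "real^'d \<Rightarrow> real" assume \<phi>: "test_function \<phi>"
    show "(LINT x|lebesgue. pderivatives js \<phi> x *\<^sub>R (u x + u' x)) = (- 1) ^ length js *\<^sub>R (LINT x|lebesgue. \<phi> x *\<^sub>R (w x + w' x))"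
      unfolding int[OF l(1,3) test_function_pderivatives[OF \<phi>]] int[OF l(2,4) \<phi>]
      unfolding scaleR_add_right
      using assms \<phi> by (simp add: has_weak_derivative_def)
  qed
qed

lemma has_weak_derivative_Cons:
  fixes u v w :: "real^'d \<Rightarrow> 'b::euclidean_space"
  assumes "has_weak_derivative [i] u v" "has_weak_derivative [i, j] u w"
  shows "has_weak_derivative [j] v w"
  unfolding has_weak_derivative_def
proof (intro conjI allI impI)
  show "locally_integrable v" "locally_integrable w" using assms by (auto simp: has_weak_derivative_def)
  fix \<phi> :: "real^'d \<Rightarrow> real" assume \<phi>: "test_function \<phi>"
  have "(LINT x|lebesgue. pderivatives [i] (pderivative j \<phi>) x *\<^sub>R u x) = (- 1) ^ length [i] *\<^sub>R (LINT x|lebesgue. pderivative j \<phi> x *\<^sub>R v x)"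
    using assms(1) test_function_pderivative[OF \<phi>] unfolding has_weak_derivative_def by blast
  moreover have "(LINT x|lebesgue. pderivatives [i, j] \<phi> x *\<^sub>R u x) = (- 1) ^ length [i, j] *\<^sub>R (LINT x|lebesgue. \<phi> x *\<^sub>R w x)"
    using assms(2) \<phi> unfolding has_weak_derivative_def by blast
  ultimately have "- (LINT x|lebesgue. pderivative j \<phi> x *\<^sub>R v x) = (LINT x|lebesgue. \<phi> x *\<^sub>R w x)" by simp
  then show "(LINT x|lebesgue. pderivatives [j] \<phi> x *\<^sub>R v x) = (- 1) ^ length [j] *\<^sub>R (LINT x|lebesgue. \<phi> x *\<^sub>R w x)"
    by (simp add: minus_equation_iff[of "integral\<^sup>L lebesgue _"] eq_commute)
qed

text \<open>Both Wirtinger derivatives at once; applying one of them twice produces the second derivatives.\<close>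

definition wirtinger :: "complex \<Rightarrow> (real^2 \<Rightarrow> complex) \<Rightarrow> real^2 \<Rightarrow> complex" where
  "wirtinger c f = (\<lambda>x. 1 / 2 * (weak_partial 1 f x + c * weak_partial 2 f x))"

lemma d_zbar_wirtinger: "d_zbar = wirtinger (1 / \<i>)" and d_z_wirtinger: "d_z = wirtinger (- (1 / \<i>))"
  by (auto simp: d_zbar_def d_z_def wirtinger_def fun_eq_iff)

lemma wirtinger_twice:
  assumes 1: "\<And>i. has_weak_derivative [i] f (p i)" and 2: "\<And>i j. has_weak_derivative [i, j] f (q i j)"
  shows "AE x in lborel. 4 * wirtinger c (wirtinger c f) x = q 1 1 x + c * (q 1 2 x + q 2 1 x) + c\<^sup>2 * q 2 2 x"
proof -
  have w1: "has_weak_derivative [i] f (weak_partial i f)" for i by (rule weak_partial_works[OF 1])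
  have w2: "has_weak_derivative [j] (weak_partial i f) (q i j)" for i j by (rule has_weak_derivative_Cons[OF w1 2])
  have lin: "bounded_linear (\<lambda>z. d * z)" for d :: complex by (rule bounded_linear_mult_right)
  have w3: "has_weak_derivative [j] (wirtinger c f) (\<lambda>x. 1 / 2 * (q 1 j x + c * q 2 j x))" for j
    unfolding wirtinger_def
    by (rule has_weak_derivative_linear[OF has_weak_derivative_add[OF w2 has_weak_derivative_linear[OF w2 lin]] lin])
  have "AE x in lborel. weak_partial j (wirtinger c f) x = 1 / 2 * (q 1 j x + c * q 2 j x)" for j
    by (rule weak_partial_AE[OF w3])
  from this[of 1] this[of 2] show ?thesis
  proof eventually_elim
    case (elim x)
    have "4 * (1 / 2 * (1 / 2 * r + c * (1 / 2 * s))) = (4 * (1 / 2) * (1 / 2)) * (r + c * s)" for r s :: complex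
      by (simp only: distrib_left distrib_right mult_ac)
    then show ?case
      unfolding wirtinger_def[of c "wirtinger c f"] elim by (simp add: power2_eq_square algebra_simps)
  qed
qed

lemma D0_free:
  assumes a: "a \<in> H" and u: "AE x in lborel. u x = fn a x"
  shows "AE x in lborel. D0 u x = fn (free a) x"
proof -
  have nth: "bounded_linear (\<lambda>v :: complex^2. v $ k)" for k by (rule bounded_linear_vec_nth)
  have d: "has_weak_derivative js (\<lambda>x. u x $ k) (\<lambda>x. fn (der js a) x $ k)" if "length js \<le> 2" for js k
  proof (rule has_weak_derivative_linear[OF _ nth])
    show "has_weak_derivative js u (fn (der js a))"
      using has_weak_derivative_iff[OF u, of "fn (der js a)" "der js a" js] wder_der[OF a that] by simp
  qed
  have AEs: "AE x in lborel. 4 * wirtinger c (wirtinger c (\<lambda>y. u y $ k)) x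
    = fn (der [1, 1] a) x $ k + c * (fn (der [1, 2] a) x $ k + fn (der [2, 1] a) x $ k) + c\<^sup>2 * fn (der [2, 2] a) x $ k" for c k
    by (rule wirtinger_twice[where p = "\<lambda>i x. fn (der [i] a) x $ k" and q = "\<lambda>i j x. fn (der [i, j] a) x $ k"]) (auto intro: d)
  have "AE x in lborel. fn (free a) x = \<sigma>1 (fn (der [1, 1] a) x - fn (der [2, 2] a) x) + \<sigma>2 (fn (der [1, 2] a) x + fn (der [2, 1] a) x)"
    unfolding free_def
    using fn_add[of "pw \<sigma>1 (der [1, 1] a - der [2, 2] a)" "pw \<sigma>2 (der [1, 2] a + der [2, 1] a)"]
      fn_pw[OF pauli_linear(1), of "der [1, 1] a - der [2, 2] a"] fn_pw[OF pauli_linear(2), of "der [1, 2] a + der [2, 1] a"]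
      fn_diff[of "der [1, 1] a" "der [2, 2] a"] fn_add[of "der [1, 2] a" "der [2, 1] a"]
    by eventually_elim simp
  then show ?thesis
    using AEs[of "1 / \<i>" 2] AEs[of "- (1 / \<i>)" 1]
  proof eventually_elim
    case (elim x)
    show ?case
      unfolding elim(1) D0_def d_zbar_wirtinger d_z_wirtinger elim(2,3)
      by (rule vec2_eqI) (simp_all add: \<sigma>1_def \<sigma>2_def power2_eq_square algebra_simps)
  qed
qed

lemma mat_adj_bounded_linear: "bounded_linear (mat_adj :: complex^2^2 \<Rightarrow> complex^2^2)"
proof -
  have "linear (mat_adj :: complex^2^2 \<Rightarrow> complex^2^2)"
    by (intro linearI) (auto simp: mat_adj_def vec_eq_iff)
  then show ?thesis by (simp add: linear_linear)
qed

text \<open>The real inner product is the real part of the Hermitian one.\<close>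

lemma hermitian_real_symmetric:
  fixes A :: "complex^2^2"
  assumes "hermitian A" shows "inner (A *v v) w = inner v (A *v w)"
proof -
  have "inner x y = Re (sesq x y)" for x y :: "complex^2"
    by (simp add: inner_vec2 sesq_def sum_2 inner_complex_def)
  then show ?thesis using assms by (simp add: sesq_adjoint hermitian_def)
qed

section \<open>The spectrum\<close>

theorem corollary3p1:
  fixes W V :: "real^2 \<Rightarrow> complex^2^2"
  assumes W_measurable: "W \<in> borel_measurable lebesgue"
    and W_hermitian: "\<And>x. hermitian (W x)"
    and V_eq: "\<And>x. V x = (\<chi> i j. \<i> * (W x ** W x) $ i $ j)"
    and V_maps: "\<And>u. u \<in> H2 \<Longrightarrow> (\<lambda>x. V x *v u x) \<in> L2"
    and V_integrable: "integrable lebesgue (\<lambda>x. Re (trace (mat_abs (V x))))"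
    and V_small: "1 / 4 * (LINT x|lebesgue. Re (trace (mat_abs (V x)))) < 1"
  shows "(\<forall>k. is_eigenvalue H2 (perturbed_D V) k \<longrightarrow> k \<in> \<real>) \<and>
         spectrum H2 (perturbed_D V) \<subseteq> \<real>"
proof -
  obtain h where h [measurable]: "h \<in> borel_measurable borel" and hW: "AE x in lborel. W x = h x"
    using borel_representative[OF W_measurable] by blast
  \<comment> \<open>The Borel representative \<open>h\<close> is Hermitian only almost everywhere; its Hermitian part is so everywhere.\<close>
  define W1 where "W1 = (\<lambda>x. (1 / 2) *\<^sub>R (h x + mat_adj (h x)))"
  have [measurable]: "(mat_adj :: complex^2^2 \<Rightarrow> _) \<in> borel_measurable borel"
    by (intro borel_measurable_continuous_onI linear_continuous_on mat_adj_bounded_linear)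
  have W1_meas: "W1 \<in> borel_measurable borel" unfolding W1_def by measurable
  have W1_herm: "hermitian (W1 x)" for x
    by (auto simp: W1_def hermitian_def mat_adj_def vec_eq_iff)
  have WW1: "AE x in lborel. W x = W1 x"
    using hW
  proof (rule eventually_mono)
    fix x assume "W x = h x"
    moreover have "mat_adj (W x) = W x" using W_hermitian by (simp add: hermitian_def)
    ultimately show "W x = W1 x" unfolding W1_def by (metis scaleR_half_double)
  qed
  have trV: "Re (trace (mat_abs (V x))) = (norm (W x))\<^sup>2" for x
    unfolding V_eq mat_abs_i_square[OF W_hermitian] by (rule trace_square_hermitian[OF W_hermitian])
  have ae: "AE x in lborel. (norm (W x))\<^sup>2 = (norm (W1 x))\<^sup>2" using WW1 by (auto elim: eventually_mono)
  have Vv: "V x *v v = im (W x *v (W x *v v))" for x v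
  proof -
    have "V x *v v = \<i> *s ((W x ** W x) *v v)"
      by (simp add: V_eq vec_eq_iff matrix_vector_mult_def sum_distrib_left mult.assoc)
    then show ?thesis by (simp add: im_def matrix_vector_mul_assoc)
  qed
  interpret dissipative W1
  proof
    show "W1 \<in> borel_measurable borel" by (rule W1_meas)
    show "inner (W1 x *v v) w = inner v (W1 x *v w)" for x v w by (rule hermitian_real_symmetric[OF W1_herm])
    show "integrable lborel (\<lambda>x. (norm (W1 x))\<^sup>2)"
      using V_integrable lebesgue_integral_AE(2)[OF ae] W1_meas by (simp add: trV)
    show "(LINT x|lborel. (norm (W1 x))\<^sup>2) < 4"
      using V_small lebesgue_integral_AE(1)[OF ae] W1_meas by (simp add: trV)
    fix u assume u: "u \<in> H"
    have m: "(\<lambda>x. W1 x *v (W1 x *v fn u x)) \<in> borel_measurable borel"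
      by (intro matrix_vector_measurable W1_meas fn_measurable)
    have "AE x in lborel. (norm (V x *v fn u x))\<^sup>2 = (norm (W1 x *v (W1 x *v fn u x)))\<^sup>2"
      using WW1 by (rule eventually_mono) (simp add: Vv norm_im)
    note lebesgue_integral_AE(2)[OF this]
    moreover have "integrable lebesgue (\<lambda>x. (norm (V x *v fn u x))\<^sup>2)"
      using V_maps[OF fn_in_H2[OF u]] by (simp add: L2_def)
    ultimately have "integrable lborel (\<lambda>x. (norm (W1 x *v (W1 x *v fn u x)))\<^sup>2)" using m by simp
    then show "sqi (\<lambda>x. W1 x *v (W1 x *v fn u x))" using m by (simp add: sqi_def)
  qed
  have op: "AE x in lborel. perturbed_D V u x - k *s u x = fn (T (Re k) (Im k) 1 a) x"
    if a: "a \<in> H" and u: "AE x in lborel. u x = fn a x" for a u k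
  proof -
    have Ta: "T (Re k) (Im k) 1 a = free a - Re k *\<^sub>R a - Im k *\<^sub>R pw im a + pw im (Q a)"
      by (simp add: T_def shifted_def)
    have "AE x in lborel. fn (T (Re k) (Im k) 1 a) x = fn (free a) x - Re k *\<^sub>R fn a x - Im k *\<^sub>R im (fn a x) + im (W1 x *v (W1 x *v fn a x))"
      unfolding Ta
      using fn_add[of "free a - Re k *\<^sub>R a - Im k *\<^sub>R pw im a" "pw im (Q a)"] fn_diff[of "free a - Re k *\<^sub>R a" "Im k *\<^sub>R pw im a"]
        fn_diff[of "free a" "Re k *\<^sub>R a"] fn_scaleR[of "Re k" a] fn_scaleR[of "Im k" "pw im a"] fn_pw[OF pauli_linear(3), of a]
        fn_pw[OF pauli_linear(3), of "Q a"] fn_cls[OF W_maps[OF a], folded Q_def]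
      by eventually_elim simp
    with D0_free[OF a u] u WW1 show ?thesis
    proof eventually_elim
      case (elim x)
      have "k *s v = Re k *\<^sub>R v + Im k *\<^sub>R im v" for v :: "complex^2"
        by (intro vec2_eqI complex_eqI) (simp_all add: im_def)
      then show ?case unfolding perturbed_D_def using elim by (simp add: Vv)
    qed
  qed
  have res: "k \<in> resolvent_set H2 (perturbed_D V)" if k: "k \<notin> \<real>" for k
  proof -
    have \<eta>: "Im k \<noteq> 0" using k by (auto simp: complex_is_Real_iff)
    obtain C where C: "C \<ge> 0" "\<And>u. u \<in> H \<Longrightarrow> norm u \<le> C * norm (T (Re k) (Im k) 1 u)"
      using norm_le_T[OF \<eta>, of "Re k"] by auto
    have "AE x in lebesgue. u x = 0" if u: "u \<in> H2" "AE x in lebesgue. perturbed_D V u x = k *s u x" for u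
    proof -
      obtain a where a: "a \<in> H" "AE x in lborel. u x = fn a x" using sobolev_2_E[OF u(1)] by blast
      have "AE x in lborel. fn (T (Re k) (Im k) 1 a) x = fn 0 x"
        using op[OF a, of k] u(2)[unfolded AE_lebesgue_iff] fn_zero[where 'a = "real^2" and 'b = "complex^2"] by eventually_elim simp
      then have "T (Re k) (Im k) 1 a = 0" by (rule l2_eqI)
      then have "a = 0" using C(2)[OF a(1)] by simp
      then have "AE x in lborel. u x = 0"
        using a(2) fn_zero[where 'a = "real^2" and 'b = "complex^2"] by (auto elim: eventually_elim2)
      then show ?thesis by (simp add: AE_lebesgue_iff)
    qed
    moreover have "\<exists>u\<in>H2. AE x in lebesgue. perturbed_D V u x - k *s u x = f x" if f: "f \<in> L2" for f
    proof -
      obtain b where b: "AE x in lborel. f x = fn b x" using L2_E[OF f] by blast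
      obtain a where a: "a \<in> H" "b = T (Re k) (Im k) 1 a" using T_surj[OF \<eta>, of "Re k"] by blast
      have "AE x in lborel. perturbed_D V (fn a) x - k *s fn a x = fn b x" using op[OF a(1), of "fn a" k] a(2) by simp
      with b have "AE x in lborel. perturbed_D V (fn a) x - k *s fn a x = f x" by eventually_elim simp
      then show ?thesis using fn_in_H2[OF a(1)] by (auto simp: AE_lebesgue_iff)
    qed
    moreover have "L2_norm u \<le> C * L2_norm (\<lambda>x. perturbed_D V u x - k *s u x)" if u: "u \<in> H2" for u
    proof -
      obtain a where a: "a \<in> H" "AE x in lborel. u x = fn a x" using sobolev_2_E[OF u] by blast
      show ?thesis unfolding L2_norm_eq[OF a(2)] L2_norm_eq[OF op[OF a]] by (rule C(2)[OF a(1)])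
    qed
    ultimately show ?thesis unfolding resolvent_set_def by blast
  qed
  then have "spectrum H2 (perturbed_D V) \<subseteq> \<real>" unfolding spectrum_def by blast
  moreover have "k \<in> \<real>" if "is_eigenvalue H2 (perturbed_D V) k" for k
  proof (rule ccontr)
    assume "k \<notin> \<real>"
    then show False using res[of k] that unfolding resolvent_set_def is_eigenvalue_def by blast
  qed
  ultimately show ?thesis by blast
qed

end
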